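(* Let $m\ge3$, let $\mathfrak g_s=\mathfrak{so}(m)$ with the second short grading, and let $\mathfrak r=W\otimes V$, where $V$ is the standard $\mathfrak g_s$-module and $W$ is a finite-dimensional vector space on which $\mathfrak g_s$ acts trivially. Let $\mathcal S_{\frac12}$ be the category associated with $\mathfrak g=\mathfrak g_s\ltimes\mathfrak r$, $\mathfrak r$ being an abelian ideal. (a) If $m=2n$, then $\mathcal S_{\frac12}$ is equivalent to the category of (finite-dimensional) $\mathbb Z_2$-graded $\Lambda(W)$-modules. (b) If $m=2n+1$, then $\mathcal S_{\frac12}$ is equivalent to the category of (finite-dimensional) $\Lambda(W)$-modules.
   Context: $\mathbf k$ is an algebraically closed field of characteristic zero; all modules are finite-dimensional. A short subalgebra of a Lie algebra $\mathfrak g$ is a subalgebra isomorphic to $\mathfrak{sl}_2$ spanned by $e,h,f$ with $[e,f]=h$, $[h,e]=-e$, $[h,f]=f$ such that $\mathrm{ad}\,h$ is diagonalizable on $\mathfrak g$ with eigenvalues in $\{-1,0,1\}$. The second short grading on $\mathfrak{so}(m)$ is the one (coming from the Jordan algebra of a non-degenerate bilinear form) for which $h$ acts on the standard $m$-dimensional module $V$ with eigenvalues $1,0,-1$ of multiplicities $1,m-2,1$; $\alpha\subset\mathfrak{so}(m)$ is the corresponding short subalgebra. The simple $\mathfrak g_s$-modules on which $h$ has eigenvalues $\pm\frac12$ are then the spinor modules. $\hat{\mathfrak g}$ is the universal central extension of $\mathfrak g$. $\mathcal S_{\frac12}$ is the category of finite-dimensional $\hat{\mathfrak g}$-modules whose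 restriction to $\alpha$ is a direct sum of two-dimensional simple $\mathfrak{sl}_2$-modules. $\Lambda(W)$ is the exterior algebra; $\mathbb Z_2$-graded modules are taken with $W$ odd and degree-preserving morphisms. *)

theory Defs
  imports
    "Jordan_Normal_Form.VS_Connect"
    "HOL-Algebra.QuotRing"
begin

section \<open>Categories and equivalence of categories\<close>

text \<open>Hom-sets need not be disjoint: identities and composition are indexed by the objects involved,
  and \<open>Comp C X Y Z g f\<close> is the composite of \<open>f : X \<rightarrow> Y\<close> and \<open>g : Y \<rightarrow> Z\<close>.\<close>

record ('o, 'm) category =
  Ob :: "'o set"
  Hom :: "'o \<Rightarrow> 'o \<Rightarrow> 'm set"
  Ident :: "'o \<Rightarrow> 'm"
  Comp :: "'o \<Rightarrow> 'o \<Rightarrow> 'o \<Rightarrow> 'm \<Rightarrow> 'm \<Rightarrow> 'm"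

definition is_category :: "('o, 'm) category \<Rightarrow> bool" where
  "is_category C \<longleftrightarrow>
     (\<forall>X\<in>Ob C. Ident C X \<in> Hom C X X) \<and>
     (\<forall>X\<in>Ob C. \<forall>Y\<in>Ob C. \<forall>Z\<in>Ob C. \<forall>f\<in>Hom C X Y. \<forall>g\<in>Hom C Y Z. Comp C X Y Z g f \<in> Hom C X Z) \<and>
     (\<forall>X\<in>Ob C. \<forall>Y\<in>Ob C. \<forall>f\<in>Hom C X Y.
        Comp C X X Y f (Ident C X) = f \<and> Comp C X Y Y (Ident C Y) f = f) \<and>
     (\<forall>X\<in>Ob C. \<forall>Y\<in>Ob C. \<forall>Z\<in>Ob C. \<forall>T\<in>Ob C. \<forall>f\<in>Hom C X Y. \<forall>g\<in>Hom C Y Z. \<forall>h\<in>Hom C Z T.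
        Comp C X Z T h (Comp C X Y Z g f) = Comp C X Y T (Comp C Y Z T h g) f)"

definition is_iso :: "('o, 'm) category \<Rightarrow> 'o \<Rightarrow> 'o \<Rightarrow> 'm \<Rightarrow> bool" where
  "is_iso C X Y f \<longleftrightarrow> f \<in> Hom C X Y \<and>
     (\<exists>g\<in>Hom C Y X. Comp C X Y X g f = Ident C X \<and> Comp C Y X Y f g = Ident C Y)"

type_synonym ('o, 'm, 'p, 'n) functor_data = "('o \<Rightarrow> 'p) \<times> ('o \<Rightarrow> 'o \<Rightarrow> 'm \<Rightarrow> 'n)"

definition is_functor ::
  "('o, 'm) category \<Rightarrow> ('p, 'n) category \<Rightarrow> ('o, 'm, 'p, 'n) functor_data \<Rightarrow> bool" where
  "is_functor C D F \<longleftrightarrow>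
     (\<forall>X\<in>Ob C. fst F X \<in> Ob D) \<and>
     (\<forall>X\<in>Ob C. \<forall>Y\<in>Ob C. \<forall>f\<in>Hom C X Y. snd F X Y f \<in> Hom D (fst F X) (fst F Y)) \<and>
     (\<forall>X\<in>Ob C. snd F X X (Ident C X) = Ident D (fst F X)) \<and>
     (\<forall>X\<in>Ob C. \<forall>Y\<in>Ob C. \<forall>Z\<in>Ob C. \<forall>f\<in>Hom C X Y. \<forall>g\<in>Hom C Y Z.
        snd F X Z (Comp C X Y Z g f) =
        Comp D (fst F X) (fst F Y) (fst F Z) (snd F Y Z g) (snd F X Y f))"

definition id_functor :: "('o, 'm, 'o, 'm) functor_data" where
  "id_functor = (\<lambda>X. X, \<lambda>X Y f. f)"

definition comp_functor ::
  "('p, 'n, 'q, 'l) functor_data \<Rightarrow> ('o, 'm, 'p, 'n) functor_data \<Rightarrow> ('o, 'm, 'q, 'l) functor_data" where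
  "comp_functor G F = (\<lambda>X. fst G (fst F X), \<lambda>X Y f. snd G (fst F X) (fst F Y) (snd F X Y f))"

definition naturally_isomorphic ::
  "('o, 'm) category \<Rightarrow> ('p, 'n) category \<Rightarrow>
   ('o, 'm, 'p, 'n) functor_data \<Rightarrow> ('o, 'm, 'p, 'n) functor_data \<Rightarrow> bool" where
  "naturally_isomorphic C D F G \<longleftrightarrow>
     (\<exists>\<eta>. (\<forall>X\<in>Ob C. is_iso D (fst F X) (fst G X) (\<eta> X)) \<and>
          (\<forall>X\<in>Ob C. \<forall>Y\<in>Ob C. \<forall>f\<in>Hom C X Y.
             Comp D (fst F X) (fst F Y) (fst G Y) (\<eta> Y) (snd F X Y f) =
             Comp D (fst F X) (fst G X) (fst G Y) (snd G X Y f) (\<eta> X)))"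

definition equivalent_categories :: "('o, 'm) category \<Rightarrow> ('p, 'n) category \<Rightarrow> bool" where
  "equivalent_categories C D \<longleftrightarrow> is_category C \<and> is_category D \<and>
     (\<exists>F G. is_functor C D F \<and> is_functor D C G \<and>
            naturally_isomorphic C C (comp_functor G F) id_functor \<and>
            naturally_isomorphic D D (comp_functor F G) id_functor)"


section \<open>Vector spaces and Lie algebras\<close>

text \<open>The ground field is a type \<open>'k\<close>; \<open>class_ring\<close> is this field as a ring record. Vector spaces are
  \<^const>\<open>vectorspace\<close> records over \<open>class_ring\<close>; the fields \<open>mult\<close> and \<open>one\<close> are used only when the record is an associative algebra.\<close>

definition fd_vectorspace :: "('k::field, 'v, 'x) module_scheme \<Rightarrow> bool" where
  "fd_vectorspace V \<longleftrightarrow> vectorspace class_ring V \<and> vectorspace.fin_dim class_ring V"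

definition bilinear_map ::
  "('k::field, 'u, 'x) module_scheme \<Rightarrow> ('k, 'v, 'y) module_scheme \<Rightarrow> ('k, 'w, 'z) module_scheme \<Rightarrow>
   ('u \<Rightarrow> 'v \<Rightarrow> 'w) \<Rightarrow> bool" where
  "bilinear_map U V W b \<longleftrightarrow>
     (\<forall>u\<in>carrier U. linear_map class_ring V W (b u)) \<and>
     (\<forall>v\<in>carrier V. linear_map class_ring U W (\<lambda>u. b u v))"

record ('k, 'l) lie = "('k, 'l) module" +
  bracket :: "'l \<Rightarrow> 'l \<Rightarrow> 'l" (\<open>[_,_]\<index>\<close>)

definition lie_algebra :: "('k::field, 'l, 'x) lie_scheme \<Rightarrow> bool" where
  "lie_algebra L \<longleftrightarrow> vectorspace class_ring L \<and> bilinear_map L L L (bracket L) \<and>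
     (\<forall>x\<in>carrier L. bracket L x x = \<zero>\<^bsub>L\<^esub>) \<and>
     (\<forall>x\<in>carrier L. \<forall>y\<in>carrier L. \<forall>z\<in>carrier L.
        bracket L x (bracket L y z) \<oplus>\<^bsub>L\<^esub> bracket L y (bracket L z x) \<oplus>\<^bsub>L\<^esub> bracket L z (bracket L x y)
        = \<zero>\<^bsub>L\<^esub>)"

definition lie_hom ::
  "('k::field, 'l, 'x) lie_scheme \<Rightarrow> ('k, 'n, 'y) lie_scheme \<Rightarrow> ('l \<Rightarrow> 'n) \<Rightarrow> bool" where
  "lie_hom L N \<phi> \<longleftrightarrow> linear_map class_ring L N \<phi> \<and>
     (\<forall>x\<in>carrier L. \<forall>y\<in>carrier L. \<phi> (bracket L x y) = bracket N (\<phi> x) (\<phi> y))"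

definition central_extension ::
  "('k::field, 'e) lie \<Rightarrow> ('e \<Rightarrow> 'l) \<Rightarrow> ('k, 'l) lie \<Rightarrow> bool" where
  "central_extension E \<pi> L \<longleftrightarrow> lie_algebra E \<and> lie_algebra L \<and> lie_hom E L \<pi> \<and>
     \<pi> ` carrier E = carrier L \<and>
     (\<forall>x\<in>carrier E. \<pi> x = \<zero>\<^bsub>L\<^esub> \<longrightarrow> (\<forall>y\<in>carrier E. bracket E x y = \<zero>\<^bsub>E\<^esub>))"

text \<open>The competitors \<open>E'\<close> range over all Lie algebras whose elements are of the same type \<open>'e\<close>. If \<open>L\<close>
  is nonzero, perfect and finite-dimensional over an infinite field, then \<open>'e\<close> is at least as large
  as the field, so a copy of the true (finite-dimensional) universal central extension lives on
  \<open>'e\<close> and is among the competitors. Hence the predicate determines \<open>E\<close> up to isomorphism over \<open>L\<close>.\<close>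

definition universal_central_extension ::
  "('k::field, 'e) lie \<Rightarrow> ('e \<Rightarrow> 'l) \<Rightarrow> ('k, 'l) lie \<Rightarrow> bool" where
  "universal_central_extension E \<pi> L \<longleftrightarrow> central_extension E \<pi> L \<and>
     (\<forall>(E' :: ('k, 'e) lie) \<pi>'. central_extension E' \<pi>' L \<longrightarrow>
        (\<exists>!\<phi>. \<phi> \<in> extensional (carrier E) \<and> lie_hom E E' \<phi> \<and> (\<forall>x\<in>carrier E. \<pi>' (\<phi> x) = \<pi> x)))"

definition sl2_relations :: "('k::field, 'l, 'x) lie_scheme \<Rightarrow> 'l \<Rightarrow> 'l \<Rightarrow> 'l \<Rightarrow> bool" where
  "sl2_relations L e h f \<longleftrightarrow> e \<in> carrier L \<and> h \<in> carrier L \<and> f \<in> carrier L \<and>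
     bracket L e f = h \<and> bracket L h e = \<ominus>\<^bsub>L\<^esub> e \<and> bracket L h f = f"

definition short_triple :: "('k::field, 'l, 'x) lie_scheme \<Rightarrow> 'l \<Rightarrow> 'l \<Rightarrow> 'l \<Rightarrow> bool" where
  "short_triple L e h f \<longleftrightarrow> sl2_relations L e h f \<and>
     (\<forall>a b c. a \<odot>\<^bsub>L\<^esub> e \<oplus>\<^bsub>L\<^esub> b \<odot>\<^bsub>L\<^esub> h \<oplus>\<^bsub>L\<^esub> c \<odot>\<^bsub>L\<^esub> f = \<zero>\<^bsub>L\<^esub> \<longrightarrow> a = 0 \<and> b = 0 \<and> c = 0) \<and>
     (\<forall>x\<in>carrier L. \<exists>x1\<in>carrier L. \<exists>x2\<in>carrier L. \<exists>x3\<in>carrier L.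
        x = x1 \<oplus>\<^bsub>L\<^esub> x2 \<oplus>\<^bsub>L\<^esub> x3 \<and>
        bracket L h x1 = \<ominus>\<^bsub>L\<^esub> x1 \<and> bracket L h x2 = \<zero>\<^bsub>L\<^esub> \<and> bracket L h x3 = x3)"


section \<open>The Lie algebra \<open>so(m) \<ltimes> (W \<otimes> V)\<close>\<close>

text \<open>\<open>so(m)\<close> is the Lie algebra of the standard symmetric bilinear form on \<open>V = k^m\<close>
  (all non-degenerate ones are equivalent over an algebraically closed field of characteristic 0).\<close>

definition so_lie :: "nat \<Rightarrow> ('k::field, 'k mat) lie" where
  "so_lie m = module.extend
     ((module_mat TYPE('k) m m)\<lparr>carrier := {A \<in> carrier_mat m m. transpose_mat A = - A}\<rparr>)
     (lie.fields (\<lambda>A B. A * B - B * A))"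

definition second_short_triple :: "nat \<Rightarrow> 'k::field mat \<Rightarrow> 'k mat \<Rightarrow> 'k mat \<Rightarrow> bool" where
  "second_short_triple m e h f \<longleftrightarrow> short_triple (so_lie m) e h f \<and>
     similar_mat h (mat_diag m (\<lambda>i. if i = 0 then 1 else if i = 1 then - 1 else 0))"

text \<open>As \<open>V = k^m\<close>, the tensor product \<open>W \<otimes> V\<close> is \<open>W^m\<close>, with pure tensors \<open>w \<otimes> v = (v\<^sub>i w)\<^sub>i\<close>.\<close>

definition tensor_std :: "nat \<Rightarrow> ('k::field, 'w) module \<Rightarrow> ('k, nat \<Rightarrow> 'w) module" where
  "tensor_std m W =
     \<lparr>carrier = {..<m} \<rightarrow>\<^sub>E carrier W,
      mult = (\<lambda>x y. \<lambda>i\<in>{..<m}. \<zero>\<^bsub>W\<^esub>), one = (\<lambda>i\<in>{..<m}. \<zero>\<^bsub>W\<^esub>),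
      zero = (\<lambda>i\<in>{..<m}. \<zero>\<^bsub>W\<^esub>),
      add = (\<lambda>x y. \<lambda>i\<in>{..<m}. x i \<oplus>\<^bsub>W\<^esub> y i),
      smult = (\<lambda>c x. \<lambda>i\<in>{..<m}. c \<odot>\<^bsub>W\<^esub> x i)\<rparr>"

definition pure_tensor :: "nat \<Rightarrow> ('k::field, 'w) module \<Rightarrow> 'w \<Rightarrow> 'k vec \<Rightarrow> nat \<Rightarrow> 'w" where
  "pure_tensor m W w v = (\<lambda>i\<in>{..<m}. (v $ i) \<odot>\<^bsub>W\<^esub> w)"

definition tensor_std_act ::
  "nat \<Rightarrow> ('k::field, 'w) module \<Rightarrow> 'k mat \<Rightarrow> (nat \<Rightarrow> 'w) \<Rightarrow> nat \<Rightarrow> 'w" where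
  "tensor_std_act m W A x = (\<lambda>i\<in>{..<m}. \<Oplus>\<^bsub>W\<^esub>j\<in>{..<m}. (A $$ (i, j)) \<odot>\<^bsub>W\<^esub> x j)"

lemma tensor_std_act_pure_tensor:
  fixes W :: "('k::field, 'w) module"
  assumes "vectorspace class_ring W" "A \<in> carrier_mat m m" "v \<in> carrier_vec m" "w \<in> carrier W"
  shows "tensor_std_act m W A (pure_tensor m W w v) = pure_tensor m W w (A *\<^sub>v v)"
proof -
  interpret vectorspace class_ring W by fact
  have "(\<Oplus>\<^bsub>W\<^esub>j\<in>S. (f j) \<odot>\<^bsub>W\<^esub> w) = sum f S \<odot>\<^bsub>W\<^esub> w" if "finite S" for f and S :: "nat set"
    using that \<open>w \<in> _\<close> smult_l_null smult_l_distr by (induction S) auto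
  then have *: "(\<Oplus>\<^bsub>W\<^esub>j\<in>{..<m}. (A $$ (i, j) * v $ j) \<odot>\<^bsub>W\<^esub> w) = (\<Sum>j<m. A $$ (i, j) * v $ j) \<odot>\<^bsub>W\<^esub> w" for i
    by simp
  have "(\<Oplus>\<^bsub>W\<^esub>j\<in>{..<m}. (A $$ (i, j)) \<odot>\<^bsub>W\<^esub> pure_tensor m W w v j) = (A *\<^sub>v v) $ i \<odot>\<^bsub>W\<^esub> w" if "i < m" for i
  proof -
    have "(\<Oplus>\<^bsub>W\<^esub>j\<in>{..<m}. (A $$ (i, j)) \<odot>\<^bsub>W\<^esub> pure_tensor m W w v j) =
          (\<Oplus>\<^bsub>W\<^esub>j\<in>{..<m}. (A $$ (i, j) * v $ j) \<odot>\<^bsub>W\<^esub> w)"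
      using \<open>w \<in> _\<close> by (intro finsum_cong') (use smult_assoc1 in \<open>auto simp: pure_tensor_def\<close>)
    also have "\<dots> = (A *\<^sub>v v) $ i \<odot>\<^bsub>W\<^esub> w"
      unfolding * using assms that by (simp add: scalar_prod_def lessThan_atLeast0)
    finally show ?thesis .
  qed
  then show ?thesis
    unfolding tensor_std_act_def by (subst (2) pure_tensor_def) (auto intro!: restrict_ext)
qed

definition semidirect ::
  "('k::field, 'l) lie \<Rightarrow> ('k, 'r) module \<Rightarrow> ('l \<Rightarrow> 'r \<Rightarrow> 'r) \<Rightarrow> ('k, 'l \<times> 'r) lie" where
  "semidirect L R \<rho> = module.extend (direct_sum L R)
     (lie.fields (\<lambda>(a, x) (b, y). (bracket L a b, \<rho> a y \<ominus>\<^bsub>R\<^esub> \<rho> b x)))"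

definition so_semidirect :: "nat \<Rightarrow> ('k::field, 'w) module \<Rightarrow> ('k, 'k mat \<times> (nat \<Rightarrow> 'w)) lie" where
  "so_semidirect m W = semidirect (so_lie m) (tensor_std m W) (tensor_std_act m W)"


section \<open>Categories of finite-dimensional modules\<close>

text \<open>A module is a vector space record together with an action; its elements are taken from an
  arbitrary type \<open>'v\<close>.\<close>

record ('k, 'a, 'v) rep = "('k, 'v) module" +
  act :: "'a \<Rightarrow> 'v \<Rightarrow> 'v"

definition rep_hom ::
  "'a set \<Rightarrow> ('k::field, 'a, 'v, 'x) rep_scheme \<Rightarrow> ('k, 'a, 'v, 'x) rep_scheme \<Rightarrow> ('v \<Rightarrow> 'v) set" where
  "rep_hom A M N = {\<phi> \<in> extensional (carrier M). linear_map class_ring M N \<phi> \<and>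
     (\<forall>a\<in>A. \<forall>x\<in>carrier M. \<phi> (act M a x) = act N a (\<phi> x))}"

definition lie_module :: "('k::field, 'l) lie \<Rightarrow> ('k, 'l, 'v) rep \<Rightarrow> bool" where
  "lie_module L M \<longleftrightarrow> fd_vectorspace M \<and> bilinear_map L M M (act M) \<and>
     (\<forall>a\<in>carrier L. \<forall>b\<in>carrier L. \<forall>x\<in>carrier M.
        act M (bracket L a b) x = act M a (act M b x) \<ominus>\<^bsub>M\<^esub> act M b (act M a x))"

definition invariant_subspace :: "'a set \<Rightarrow> ('k::field, 'a, 'v) rep \<Rightarrow> 'v set \<Rightarrow> bool" where
  "invariant_subspace A M U \<longleftrightarrow> VectorSpace.subspace class_ring U M \<and> (\<forall>a\<in>A. \<forall>x\<in>U. act M a x \<in> U)"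

definition simple_subspace :: "'a set \<Rightarrow> ('k::field, 'a, 'v) rep \<Rightarrow> 'v set \<Rightarrow> bool" where
  "simple_subspace A M U \<longleftrightarrow> invariant_subspace A M U \<and> U \<noteq> {\<zero>\<^bsub>M\<^esub>} \<and>
     (\<forall>U'. invariant_subspace A M U' \<and> U' \<subseteq> U \<longrightarrow> U' = {\<zero>\<^bsub>M\<^esub>} \<or> U' = U)"

definition sum_of_simple_planes :: "'a set \<Rightarrow> ('k::field, 'a, 'v) rep \<Rightarrow> bool" where
  "sum_of_simple_planes A M \<longleftrightarrow> (\<exists>(n::nat) U.
     (\<forall>i<n. simple_subspace A M (U i) \<and> vectorspace.dim class_ring (M\<lparr>carrier := U i\<rparr>) = 2) \<and>
     (\<forall>x\<in>carrier M. \<exists>!u. u \<in> Pi\<^sub>E {..<n} U \<and> x = (\<Oplus>\<^bsub>M\<^esub>i\<in>{..<n}. u i)))"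

text \<open>Here \<open>\<pi> : E \<rightarrow> L\<close> is the universal central extension, and \<open>e, h, f\<close> span \<open>\<alpha> \<subseteq> L\<close>. As the
  kernel of \<open>\<pi>\<close> is central, \<open>\<alpha>\<close> has a unique lift to a subalgebra of \<open>E\<close> isomorphic to \<open>\<alpha>\<close>
  (spanned by \<open>e', h', f'\<close>); this is how an \<open>E\<close>-module is restricted to \<open>\<alpha>\<close>.\<close>

definition S_half ::
  "('k::field, 'e) lie \<Rightarrow> ('e \<Rightarrow> 'l) \<Rightarrow> 'l \<Rightarrow> 'l \<Rightarrow> 'l \<Rightarrow> (('k, 'e, 'v) rep, 'v \<Rightarrow> 'v) category" where
  "S_half E \<pi> e h f =
     \<lparr>Ob = {M. lie_module E M \<and>
              (\<exists>e' h' f'. sl2_relations E e' h' f' \<and> \<pi> e' = e \<and> \<pi> h' = h \<and> \<pi> f' = f \<and>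
                 sum_of_simple_planes {e', h', f'} M)},
      Hom = rep_hom (carrier E),
      Ident = (\<lambda>M. \<lambda>x\<in>carrier M. x),
      Comp = (\<lambda>M N P \<psi> \<phi>. compose (carrier M) \<psi> \<phi>)\<rparr>"


section \<open>The exterior algebra and its modules\<close>

text \<open>The free associative unital algebra on a set \<open>X\<close>: finitely supported functions on the words
  in \<open>X\<close>, with concatenation of words extended bilinearly.\<close>

definition free_alg :: "'w set \<Rightarrow> ('k::field, 'w list \<Rightarrow> 'k) module" where
  "free_alg X =
     \<lparr>carrier = {p. finite {u. p u \<noteq> 0} \<and> {u. p u \<noteq> 0} \<subseteq> lists X},
      mult = (\<lambda>p q u. \<Sum>i\<le>length u. p (take i u) * q (drop i u)),
      one = (\<lambda>u. if u = [] then 1 else 0),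
      zero = (\<lambda>u. 0),
      add = (\<lambda>p q u. p u + q u),
      smult = (\<lambda>c p u. c * p u)\<rparr>"

definition letter :: "'w \<Rightarrow> 'w list \<Rightarrow> 'k::field" where
  "letter w = (\<lambda>u. if u = [w] then 1 else 0)"

text \<open>\<open>\<Lambda>(W)\<close> is \<open>T(W) / (w \<otimes> w)\<close>. Imposing linearity of \<^const>\<open>letter\<close> on the free algebra on the set
  \<open>W\<close> gives the tensor algebra \<open>T(W)\<close>; both families of relations are imposed at once.\<close>

definition ext_relations :: "('k::field, 'w) module \<Rightarrow> ('w list \<Rightarrow> 'k) set" where
  "ext_relations W =
     {\<lambda>u. letter (w \<oplus>\<^bsub>W\<^esub> w') u - letter w u - letter w' u | w w'. w \<in> carrier W \<and> w' \<in> carrier W} \<union>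
     {\<lambda>u. letter (c \<odot>\<^bsub>W\<^esub> w) u - c * letter w u | c w. w \<in> carrier W} \<union>
     {letter w \<otimes>\<^bsub>free_alg (carrier W)\<^esub> letter w | w. w \<in> carrier W}"

definition ext_ideal :: "('k::field, 'w) module \<Rightarrow> ('w list \<Rightarrow> 'k) set" where
  "ext_ideal W = Idl\<^bsub>free_alg (carrier W)\<^esub> (ext_relations W)"

definition ext_alg :: "('k::field, 'w) module \<Rightarrow> ('k, ('w list \<Rightarrow> 'k) set) module" where
  "ext_alg W = ring.extend (free_alg (carrier W) Quot ext_ideal W)
     (module.fields (\<lambda>c. rcoset_mult (free_alg (carrier W)) (ext_ideal W)
        (ext_ideal W +>\<^bsub>free_alg (carrier W)\<^esub> (c \<odot>\<^bsub>free_alg (carrier W)\<^esub> \<one>\<^bsub>free_alg (carrier W)\<^esub>))))"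

text \<open>The \<open>\<int>\<^sub>2\<close>-grading of \<open>\<Lambda>(W)\<close> for which \<open>W\<close> is odd: the classes of the linear combinations
  of words whose length has the given parity.\<close>

definition ext_part :: "('k::field, 'w) module \<Rightarrow> nat \<Rightarrow> ('w list \<Rightarrow> 'k) set set" where
  "ext_part W i = {ext_ideal W +>\<^bsub>free_alg (carrier W)\<^esub> p | p.
     p \<in> carrier (free_alg (carrier W)) \<and> (\<forall>u. p u \<noteq> 0 \<longrightarrow> length u mod 2 = i mod 2)}"

definition alg_module ::
  "('k::field, 'a) module \<Rightarrow> ('k, 'a, 'v, 'x) rep_scheme \<Rightarrow> bool" where
  "alg_module A M \<longleftrightarrow> fd_vectorspace M \<and> bilinear_map A M M (act M) \<and>
     (\<forall>x\<in>carrier M. act M \<one>\<^bsub>A\<^esub> x = x) \<and>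
     (\<forall>a\<in>carrier A. \<forall>b\<in>carrier A. \<forall>x\<in>carrier M. act M (a \<otimes>\<^bsub>A\<^esub> b) x = act M a (act M b x))"

definition ext_modules :: "('k::field, 'w) module \<Rightarrow>
    (('k, ('w list \<Rightarrow> 'k) set, 'v) rep, 'v \<Rightarrow> 'v) category" where
  "ext_modules W =
     \<lparr>Ob = {M. alg_module (ext_alg W) M},
      Hom = rep_hom (carrier (ext_alg W)),
      Ident = (\<lambda>M. \<lambda>x\<in>carrier M. x),
      Comp = (\<lambda>M N P \<psi> \<phi>. compose (carrier M) \<psi> \<phi>)\<rparr>"

text \<open>Only the values of \<open>part\<close> at the degrees \<open>0\<close> and \<open>1\<close> matter.\<close>

record ('k, 'a, 'v) graded_rep = "('k, 'a, 'v) rep" +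
  part :: "nat \<Rightarrow> 'v set"

definition graded_ext_module ::
  "('k::field, 'w) module \<Rightarrow> ('k, ('w list \<Rightarrow> 'k) set, 'v) graded_rep \<Rightarrow> bool" where
  "graded_ext_module W M \<longleftrightarrow> alg_module (ext_alg W) M \<and>
     VectorSpace.subspace class_ring (part M 0) M \<and> VectorSpace.subspace class_ring (part M 1) M \<and>
     (\<forall>x\<in>carrier M. \<exists>!p. p \<in> part M 0 \<times> part M 1 \<and> x = fst p \<oplus>\<^bsub>M\<^esub> snd p) \<and>
     (\<forall>i<2. \<forall>j<2. \<forall>a\<in>ext_part W i. \<forall>x\<in>part M j. act M a x \<in> part M ((i + j) mod 2))"

definition graded_ext_modules :: "('k::field, 'w) module \<Rightarrow>
    (('k, ('w list \<Rightarrow> 'k) set, 'v) graded_rep, 'v \<Rightarrow> 'v) category" where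
  "graded_ext_modules W =
     \<lparr>Ob = {M. graded_ext_module W M},
      Hom = (\<lambda>M N. {\<phi> \<in> rep_hom (carrier (ext_alg W)) M N. \<forall>i<2. \<phi> ` part M i \<subseteq> part N i}),
      Ident = (\<lambda>M. \<lambda>x\<in>carrier M. x),
      Comp = (\<lambda>M N P \<psi> \<phi>. compose (carrier M) \<psi> \<phi>)\<rparr>"

end

theory Submission
 imports Defs "HOL-Library.Function_Algebras"
begin

text \<open>
 Let \<open>C\<^sub>r\<close> be the category of finite-dimensional spaces with pairwise anticommuting operators \<open>c\<^sub>i\<close> (\<open>i < r\<close>) and \<open>c\<^sub>w\<close>,
 linear in \<open>w\<close>, such that \<open>c\<^sub>i\<^sup>2 = - 1\<close> and \<open>c\<^sub>w\<^sup>2 = 0\<close>. An orthogonal change of basis brings the short triple into a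
 standard form. On an object of \<open>S\<close> the lifted triple satisfies \<open>e\<^sup>2 = f\<^sup>2 = 0\<close> and \<open>ef + fe = - 1/2\<close>; by double
 commutators, twice the canonical lifts of \<open>E\<^sub>0\<^sub>j\<close> and \<open>w \<otimes> b\<^sub>0\<close> then satisfy the Clifford relations. Conversely a Clifford
 module carries the spin action up to central operators, which is an action of a central extension, hence of the universal one.
 So \<open>S\<close> is equivalent to \<open>C\<^sub>r\<close> with \<open>r = m - 1\<close>. Passing to the kernel of \<open>c\<^sub>r + i c\<close>, where \<open>c\<close> is the next generator, lowers \<open>r\<close> by 2,
 and \<open>C\<^sub>0\<close>, \<open>C\<^sub>1\<close> are the \<open>\<Lambda>(W)\<close>-modules and the graded ones, with parity operator \<open>- i c\<^sub>0\<close>.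
\<close>

text \<open>The rank is m - 1 because so(m) embeds in the even Clifford algebra of V, which is
  generated by the products of b_0 with the other basis vectors, and these are the elements 2 E_0j.
  Together with the w tensor b_0 they span an odd part P of L with L = P + [P,P] and [P,[P,P]]
  inside P, so double brackets carry all the information. The kernel of the universal extension is
  never computed: being central, it lets a bracket in G depend only on images in L. It may act
  nontrivially, since [w tensor b_0, w' tensor b_0] = 0 in L while c_w and c_w' merely anticommute;
  this is why the way back leads through an extension by central operators. Two obstacles are
  set-theoretic. All modules have their elements in one type \<open>'v\<close>, so a direct sum must
  be re-encoded in the carrier of its summand; and universality is given only against Lie algebras
  on \<open>'e\<close>. Both are met by the same fact: a nonzero space over a field of
  characteristic 0 is infinite, hence equinumerous with its square.\<close>

section \<open>Criteria for equivalence of categories\<close>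

lemma is_categoryD:
 assumes "is_category C"
 shows "X \<in> Ob C ==> Ident C X \<in> Hom C X X"
  and "[|X \<in> Ob C; Y \<in> Ob C; Z \<in> Ob C; f \<in> Hom C X Y; g \<in> Hom C Y Z|] ==> Comp C X Y Z g f \<in> Hom C X Z"
  and "[|X \<in> Ob C; Y \<in> Ob C; f \<in> Hom C X Y|] ==> Comp C X X Y f (Ident C X) = f"
  and "[|X \<in> Ob C; Y \<in> Ob C; f \<in> Hom C X Y|] ==> Comp C X Y Y (Ident C Y) f = f"
  and "[|X \<in> Ob C; Y \<in> Ob C; Z \<in> Ob C; T \<in> Ob C; f \<in> Hom C X Y; g \<in> Hom C Y Z; h \<in> Hom C Z T|] ==>
   Comp C X Z T h (Comp C X Y Z g f) = Comp C X Y T (Comp C Y Z T h g) f"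
 using assms by (auto simp: is_category_def)

lemma is_functorD:
 assumes "is_functor C D F"
 shows "X \<in> Ob C ==> fst F X \<in> Ob D"
  and "[|X \<in> Ob C; Y \<in> Ob C; f \<in> Hom C X Y|] ==> snd F X Y f \<in> Hom D (fst F X) (fst F Y)"
  and "X \<in> Ob C ==> snd F X X (Ident C X) = Ident D (fst F X)"
  and "[|X \<in> Ob C; Y \<in> Ob C; Z \<in> Ob C; f \<in> Hom C X Y; g \<in> Hom C Y Z|] ==>
   snd F X Z (Comp C X Y Z g f) = Comp D (fst F X) (fst F Y) (fst F Z) (snd F Y Z g) (snd F X Y f)"
 using assms by (auto simp: is_functor_def)

lemma is_isoE:
 assumes "is_iso C X Y f"
 obtains g where "f \<in> Hom C X Y" "g \<in> Hom C Y X" "Comp C X Y X g f = Ident C X" "Comp C Y X Y f g = Ident C Y"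
 using assms by (auto simp: is_iso_def)

lemma is_iso_comp:
 assumes C: "is_category C" and ob: "X \<in> Ob C" "Y \<in> Ob C" "Z \<in> Ob C"
  and f: "is_iso C X Y f" and g: "is_iso C Y Z g"
 shows "is_iso C X Z (Comp C X Y Z g f)"
proof -
 note cat = is_categoryD[OF C]
 obtain f' where f': "f \<in> Hom C X Y" "f' \<in> Hom C Y X" "Comp C X Y X f' f = Ident C X" "Comp C Y X Y f f' = Ident C Y"
  using f by (rule is_isoE)
 obtain g' where g': "g \<in> Hom C Y Z" "g' \<in> Hom C Z Y" "Comp C Y Z Y g' g = Ident C Y" "Comp C Z Y Z g g' = Ident C Z"
  using g by (rule is_isoE)
 let ?h = "Comp C X Y Z g f" and ?h' = "Comp C Z Y X f' g'"
 have h: "?h \<in> Hom C X Z" "?h' \<in> Hom C Z X" using cat(2) ob f' g' by blast+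
 have "Comp C X Z X ?h' ?h = Comp C X Y X (Comp C Y Z X ?h' g) f"
  using cat(5)[of X Y Z X f g ?h'] ob f' g' h by blast
 also have "Comp C Y Z X ?h' g = Comp C Y Y X f' (Comp C Y Z Y g' g)"
  using cat(5)[of Y Z Y X g g' f'] ob f' g' h by metis
 also have "\<dots> = f'" using g' cat(3) ob f' by metis
 finally have 1: "Comp C X Z X ?h' ?h = Ident C X" using f' by metis
 have "Comp C Z X Z ?h ?h' = Comp C Z Y Z (Comp C Y X Z ?h f') g'"
  using cat(5)[of Z Y X Z g' f' ?h] ob f' g' h by blast
 also have "Comp C Y X Z ?h f' = Comp C Y Y Z g (Comp C Y X Y f f')"
  using cat(5)[of Y X Y Z f' f g] ob f' g' h by metis
 also have "\<dots> = g" using f' cat(3) ob g' by metis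
 finally have 2: "Comp C Z X Z ?h ?h' = Ident C Z" using g' by metis
 show ?thesis using h 1 2 by (auto simp: is_iso_def)
qed

lemma is_iso_functor:
 assumes "is_functor C D F" "X \<in> Ob C" "Y \<in> Ob C" "is_iso C X Y f"
 shows "is_iso D (fst F X) (fst F Y) (snd F X Y f)"
proof -
 note F = is_functorD[OF assms(1)]
 obtain g where g: "f \<in> Hom C X Y" "g \<in> Hom C Y X" "Comp C X Y X g f = Ident C X" "Comp C Y X Y f g = Ident C Y"
  using assms(4) by (rule is_isoE)
 show ?thesis
  unfolding is_iso_def using F(2)[OF _ _ g(1)] F(2)[OF _ _ g(2)] F(4)[OF _ _ _ g(1,2)] F(4)[OF _ _ _ g(2,1)] g F(3) assms(2,3)
  by metis
qed

lemma is_functor_comp: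
 assumes "is_functor C D F" "is_functor D E G"
 shows "is_functor C E (comp_functor G F)"
 using is_functorD[OF assms(1)] is_functorD[OF assms(2)]
 by (simp add: is_functor_def comp_functor_def)

lemma naturally_isomorphic_idE:
 assumes "naturally_isomorphic C C (comp_functor G F) id_functor"
 obtains \<eta> where "\<And>X. X \<in> Ob C ==> is_iso C (fst G (fst F X)) X (\<eta> X)"
  "\<And>X Y f. X \<in> Ob C ==> Y \<in> Ob C ==> f \<in> Hom C X Y ==>
   Comp C (fst G (fst F X)) (fst G (fst F Y)) Y (\<eta> Y) (snd G (fst F X) (fst F Y) (snd F X Y f)) =
   Comp C (fst G (fst F X)) X Y f (\<eta> X)"
 using assms unfolding naturally_isomorphic_def comp_functor_def id_functor_def fst_conv snd_conv
 by (elim exE conjE) (rule that, blast+)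

text \<open>The isomorphism at X is \<open>\<eta> X\<close> after the image under G of \<theta> at F
  X. Only one of the two triangles of an equivalence is treated; transitivity uses the lemma a
  second time with the two functors of each pair exchanged.\<close>

lemma naturally_isomorphic_comp_id:
 assumes C: "is_category C" and F: "is_functor C D F" "is_functor D C G"
  and H: "is_functor D E H" "is_functor E D K"
  and 1: "naturally_isomorphic C C (comp_functor G F) id_functor"
  and 2: "naturally_isomorphic D D (comp_functor K H) id_functor"
 shows "naturally_isomorphic C C (comp_functor (comp_functor G K) (comp_functor H F)) id_functor"
proof -
 note cat = is_categoryD[OF C]
 note F1 = is_functorD[OF F(1)] and G1 = is_functorD[OF F(2)]
 note H1 = is_functorD[OF H(1)] and K1 = is_functorD[OF H(2)]
 obtain \<eta> where \<eta>: "\<And>X. X \<in> Ob C ==> is_iso C (fst G (fst F X)) X (\<eta> X)"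
  "\<And>X Y f. X \<in> Ob C ==> Y \<in> Ob C ==> f \<in> Hom C X Y ==>
   Comp C (fst G (fst F X)) (fst G (fst F Y)) Y (\<eta> Y) (snd G (fst F X) (fst F Y) (snd F X Y f)) =
   Comp C (fst G (fst F X)) X Y f (\<eta> X)"
  using 1 by (rule naturally_isomorphic_idE) (rule that)
 obtain \<theta> where \<theta>: "\<And>X. X \<in> Ob D ==> is_iso D (fst K (fst H X)) X (\<theta> X)"
  "\<And>X Y f. X \<in> Ob D ==> Y \<in> Ob D ==> f \<in> Hom D X Y ==>
   Comp D (fst K (fst H X)) (fst K (fst H Y)) Y (\<theta> Y) (snd K (fst H X) (fst H Y) (snd H X Y f)) =
   Comp D (fst K (fst H X)) X Y f (\<theta> X)"
  using 2 by (rule naturally_isomorphic_idE) (rule that)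
 \<comment> \<open>The whiskering of \<theta> with F on the right and G on the left, from GKHF to
   GF.\<close>
 define \<zeta> where "\<zeta> X = snd G (fst K (fst H (fst F X))) (fst F X) (\<theta> (fst F X))" for X
 let ?T = "\<lambda>X. fst G (fst K (fst H (fst F X)))" and ?U = "\<lambda>X. fst G (fst F X)"
 define \<xi> where "\<xi> X = Comp C (?T X) (?U X) X (\<eta> X) (\<zeta> X)" for X
 have ob: "?T X \<in> Ob C" "?U X \<in> Ob C" if "X \<in> Ob C" for X using that F1 G1 H1 K1 by auto
 have \<zeta>iso: "is_iso C (?T X) (?U X) (\<zeta> X)" if "X \<in> Ob C" for X
  unfolding \<zeta>_def using that F1 G1 H1 K1 \<theta>(1) by (intro is_iso_functor[OF F(2)]) auto
 have \<xi>iso: "is_iso C (?T X) X (\<xi> X)" if "X \<in> Ob C" for X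
  unfolding \<xi>_def using that ob \<zeta>iso \<eta>(1) by (intro is_iso_comp[OF C]) auto
 have nat: "Comp C (?T X) (?T Y) Y (\<xi> Y)
    (snd G (fst K (fst H (fst F X))) (fst K (fst H (fst F Y)))
     (snd K (fst H (fst F X)) (fst H (fst F Y)) (snd H (fst F X) (fst F Y) (snd F X Y f)))) =
   Comp C (?T X) X Y f (\<xi> X)" (is "Comp C _ _ _ _ ?GKHFf = _")
  if X: "X \<in> Ob C" and Y: "Y \<in> Ob C" and f: "f \<in> Hom C X Y" for X Y f
 proof -
  let ?g = "snd F X Y f"
  let ?KHg = "snd K (fst H (fst F X)) (fst H (fst F Y)) (snd H (fst F X) (fst F Y) ?g)"
  let ?GFf = "snd G (fst F X) (fst F Y) ?g"
  have a: "fst F X \<in> Ob D" "fst F Y \<in> Ob D" using F1(1) X Y by auto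
  have b: "fst K (fst H (fst F X)) \<in> Ob D" "fst K (fst H (fst F Y)) \<in> Ob D" using a H1(1) K1(1) by auto
  have g: "?g \<in> Hom D (fst F X) (fst F Y)" by (rule F1(2)[OF X Y f])
  have KHg: "?KHg \<in> Hom D (fst K (fst H (fst F X))) (fst K (fst H (fst F Y)))"
   by (rule K1(2)[OF H1(1)[OF a(1)] H1(1)[OF a(2)] H1(2)[OF a g]])
  have homs: "?GKHFf \<in> Hom C (?T X) (?T Y)" "?GFf \<in> Hom C (?U X) (?U Y)"
   by (rule G1(2)[OF b KHg] G1(2)[OF a g])+
  have hm: "\<zeta> X \<in> Hom C (?T X) (?U X)" "\<zeta> Y \<in> Hom C (?T Y) (?U Y)" "\<eta> X \<in> Hom C (?U X) X" "\<eta> Y \<in> Hom C (?U Y) Y"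
   using \<zeta>iso \<eta>(1) X Y by (auto simp: is_iso_def)
  have \<theta>hom: "\<theta> (fst F X) \<in> Hom D (fst K (fst H (fst F X))) (fst F X)" "\<theta> (fst F Y) \<in> Hom D (fst K (fst H (fst F Y))) (fst F Y)"
   using \<theta>(1) F1(1) X Y by (auto simp: is_iso_def)
  \<comment> \<open>Naturality of \<zeta> is the image under G of the naturality square of \<theta>
    at the morphism F f.\<close>
  have key: "Comp C (?T X) (?T Y) (?U Y) (\<zeta> Y) ?GKHFf = Comp C (?T X) (?U X) (?U Y) ?GFf (\<zeta> X)"
  proof -
   show ?thesis
    by (simp only: \<zeta>_def G1(4)[OF b(1) b(2) a(2) KHg \<theta>hom(2), symmetric]
      G1(4)[OF b(1) a(1) a(2) \<theta>hom(1) g, symmetric] \<theta>(2)[OF a g])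
  qed
  have "Comp C (?T X) (?T Y) Y (\<xi> Y) ?GKHFf = Comp C (?T X) (?U Y) Y (\<eta> Y) (Comp C (?T X) (?T Y) (?U Y) (\<zeta> Y) ?GKHFf)"
   unfolding \<xi>_def using cat(5)[OF ob(1)[OF X] ob(1)[OF Y] ob(2)[OF Y] Y homs(1) hm(2) hm(4)] by metis
  also have "\<dots> = Comp C (?T X) (?U X) Y (Comp C (?U X) (?U Y) Y (\<eta> Y) ?GFf) (\<zeta> X)"
   unfolding key using cat(5)[OF ob(1)[OF X] ob(2)[OF X] ob(2)[OF Y] Y hm(1) homs(2) hm(4)] by metis
  also have "\<dots> = Comp C (?T X) X Y f (\<xi> X)"
   unfolding \<xi>_def \<eta>(2)[OF X Y f] using cat(5)[OF ob(1)[OF X] ob(2)[OF X] X Y hm(1) hm(3) f] by metis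
  finally show ?thesis .
 qed
 show ?thesis
  unfolding naturally_isomorphic_def comp_functor_def id_functor_def
  using \<xi>iso nat by (intro exI[of _ \<xi>]) auto
qed

lemma equivalent_categories_trans:
 assumes "equivalent_categories C D" "equivalent_categories D E"
 shows "equivalent_categories C E"
proof -
 obtain F G where F: "is_category C" "is_category D" "is_functor C D F" "is_functor D C G"
  "naturally_isomorphic C C (comp_functor G F) id_functor" "naturally_isomorphic D D (comp_functor F G) id_functor"
  using assms(1) by (auto simp: equivalent_categories_def)
 obtain H K where H: "is_category E" "is_functor D E H" "is_functor E D K"
  "naturally_isomorphic D D (comp_functor K H) id_functor" "naturally_isomorphic E E (comp_functor H K) id_functor"
  using assms(2) by (auto simp: equivalent_categories_def)
 show ?thesis
  unfolding equivalent_categories_def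
  by (intro conjI exI[of _ "comp_functor H F"] exI[of _ "comp_functor G K"] F(1) H(1) is_functor_comp[OF F(3) H(2)] is_functor_comp[OF H(3) F(4)]
    naturally_isomorphic_comp_id[OF F(1) F(3,4) H(2,3) F(5) H(4)]
    naturally_isomorphic_comp_id[OF H(1) H(3,2) F(4,3) H(5) F(6)])
qed

text \<open>The quasi-inverse chooses for each Z an object \<open>g Z\<close> and an isomorphism
  \<open>e Z\<close> from its image to Z. A morphism of D is conjugated by these isomorphisms and
  then pulled back along the bijection of hom-sets.\<close>

lemma equivalent_categories_if_fully_faithful:
 assumes C: "is_category C" and D: "is_category D" and F: "is_functor C D F"
  and ff: "\<And>X Y. X \<in> Ob C ==> Y \<in> Ob C ==> bij_betw (snd F X Y) (Hom C X Y) (Hom D (fst F X) (fst F Y))"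
  and es: "\<And>Z. Z \<in> Ob D ==> \<exists>X\<in>Ob C. \<exists>f. is_iso D (fst F X) Z f"
 shows "equivalent_categories C D"
proof -
 note cC = is_categoryD[OF C] and cD = is_categoryD[OF D] and F1 = is_functorD[OF F]
 define g where "g Z = (SOME X. X \<in> Ob C \<and> (\<exists>f. is_iso D (fst F X) Z f))" for Z
 have g: "g Z \<in> Ob C \<and> (\<exists>f. is_iso D (fst F (g Z)) Z f)" if "Z \<in> Ob D" for Z
  unfolding g_def by (rule someI_ex) (use es[OF that] in blast)
 have "\<forall>Z\<in>Ob D. \<exists>e e'. e \<in> Hom D (fst F (g Z)) Z \<and> e' \<in> Hom D Z (fst F (g Z)) \<and>
  Comp D (fst F (g Z)) Z (fst F (g Z)) e' e = Ident D (fst F (g Z)) \<and> Comp D Z (fst F (g Z)) Z e e' = Ident D Z"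
  using g unfolding is_iso_def by blast
 then obtain e e' where e: "\<And>Z. Z \<in> Ob D ==> e Z \<in> Hom D (fst F (g Z)) Z"
  "\<And>Z. Z \<in> Ob D ==> e' Z \<in> Hom D Z (fst F (g Z))"
  "\<And>Z. Z \<in> Ob D ==> Comp D (fst F (g Z)) Z (fst F (g Z)) (e' Z) (e Z) = Ident D (fst F (g Z))"
  "\<And>Z. Z \<in> Ob D ==> Comp D Z (fst F (g Z)) Z (e Z) (e' Z) = Ident D Z" by metis
 let ?inv = "\<lambda>X Y. inv_into (Hom C X Y) (snd F X Y)"
 have inv: "?inv X Y k \<in> Hom C X Y" "snd F X Y (?inv X Y k) = k"
  if "X \<in> Ob C" "Y \<in> Ob C" "k \<in> Hom D (fst F X) (fst F Y)" for X Y k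
  using ff[OF that(1,2)] that(3) by (auto simp: bij_betw_def inv_into_into f_inv_into_f)
 have inj: "k = k'" if "X \<in> Ob C" "Y \<in> Ob C" "k \<in> Hom C X Y" "k' \<in> Hom C X Y" "snd F X Y k = snd F X Y k'" for X Y k k'
  using ff[OF that(1,2)] that(3-5) by (auto simp: bij_betw_def inj_on_def)
 let ?F = "fst F"
 \<comment> \<open>The conjugate of k by the chosen isomorphisms; the quasi-inverse must send k to
   the preimage of this morphism under F.\<close>
 define t where "t Z Z' k = Comp D (?F (g Z)) Z' (?F (g Z')) (e' Z') (Comp D (?F (g Z)) Z Z' k (e Z))" for Z Z' k
 have t: "t Z Z' k \<in> Hom D (?F (g Z)) (?F (g Z'))" if "Z \<in> Ob D" "Z' \<in> Ob D" "k \<in> Hom D Z Z'" for Z Z' k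
  unfolding t_def using that e g F1(1) cD(2) by metis
 have et: "Comp D (?F (g Z)) (?F (g Z')) Z' (e Z') (t Z Z' k) = Comp D (?F (g Z)) Z Z' k (e Z)"
  if "Z \<in> Ob D" "Z' \<in> Ob D" "k \<in> Hom D Z Z'" for Z Z' k
 proof -
  have ob: "?F (g Z) \<in> Ob D" "?F (g Z') \<in> Ob D" using that g F1(1) by auto
  have ke: "Comp D (?F (g Z)) Z Z' k (e Z) \<in> Hom D (?F (g Z)) Z'" using cD(2) ob that e(1) by blast
  show ?thesis unfolding t_def
   using cD(5)[OF ob(1) that(2) ob(2) that(2) ke e(2)[OF that(2)] e(1)[OF that(2)]] e(4)[OF that(2)] cD(4)[OF ob(1) that(2) ke] by metis
 qed
 \<comment> \<open>Since \<open>e Z'\<close> is invertible, a morphism fitting into the naturality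
   square of e is the conjugate. The functor laws of the quasi-inverse are therefore checked after
   composition with e only.\<close>
 have t_uniq: "t Z Z' k = k'" if "Z \<in> Ob D" "Z' \<in> Ob D" "k \<in> Hom D Z Z'" "k' \<in> Hom D (?F (g Z)) (?F (g Z'))"
  "Comp D (?F (g Z)) (?F (g Z')) Z' (e Z') k' = Comp D (?F (g Z)) Z Z' k (e Z)" for Z Z' k k'
 proof -
  have ob: "?F (g Z) \<in> Ob D" "?F (g Z') \<in> Ob D" using that g F1(1) by auto
  show ?thesis unfolding t_def that(5)[symmetric]
   using cD(5)[OF ob(1) ob(2) that(2) ob(2) that(4) e(1)[OF that(2)] e(2)[OF that(2)]] e(3)[OF that(2)] cD(4)[OF ob that(4)] by metis
 qed
 define G where "G = (g, \<lambda>Z Z' k. ?inv (g Z) (g Z') (t Z Z' k))"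
 have G: "is_functor D C G"
  unfolding is_functor_def
 proof (intro conjI ballI)
  fix Z assume Z: "Z \<in> Ob D"
  show "fst G Z \<in> Ob C" using g Z by (simp add: G_def)
  have "t Z Z (Ident D Z) = Ident D (?F (g Z))"
  proof (rule t_uniq[OF Z Z cD(1)[OF Z]])
   have ob: "?F (g Z) \<in> Ob D" using g[OF Z] F1(1) by blast
   show "Ident D (?F (g Z)) \<in> Hom D (?F (g Z)) (?F (g Z))" by (rule cD(1)[OF ob])
   show "Comp D (?F (g Z)) (?F (g Z)) Z (e Z) (Ident D (?F (g Z))) = Comp D (?F (g Z)) Z Z (Ident D Z) (e Z)"
    using cD(3)[OF ob Z e(1)[OF Z]] cD(4)[OF ob Z e(1)[OF Z]] by simp
  qed
  moreover have "?inv (g Z) (g Z) (t Z Z (Ident D Z)) = Ident C (g Z)"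
   if *: "t Z Z (Ident D Z) = Ident D (?F (g Z))"
  proof -
   have gZ: "g Z \<in> Ob C" using g[OF Z] by blast
   note i = inv[OF gZ gZ t[OF Z Z cD(1)[OF Z]]]
   show ?thesis by (rule inj[OF gZ gZ i(1) cC(1)[OF gZ]]) (use i(2) * F1(3)[OF gZ] in simp)
  qed
  ultimately show "snd G Z Z (Ident D Z) = Ident C (fst G Z)" by (simp add: G_def)
  fix Z' assume Z': "Z' \<in> Ob D"
  show "snd G Z Z' k \<in> Hom C (fst G Z) (fst G Z')" if k: "k \<in> Hom D Z Z'" for k
   using inv(1)[OF _ _ t[OF Z Z' k]] g Z Z' unfolding G_def by auto
  fix Z'' k k' assume Z'': "Z'' \<in> Ob D" and k: "k \<in> Hom D Z Z'" and k': "k' \<in> Hom D Z' Z''"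
  have ob: "?F (g Z) \<in> Ob D" "?F (g Z') \<in> Ob D" "?F (g Z'') \<in> Ob D" using Z Z' Z'' g F1(1) by auto
  have obg: "g Z \<in> Ob C" "g Z' \<in> Ob C" "g Z'' \<in> Ob C" using Z Z' Z'' g by auto
  have tt: "Comp D (?F (g Z)) (?F (g Z')) (?F (g Z'')) (t Z' Z'' k') (t Z Z' k) \<in> Hom D (?F (g Z)) (?F (g Z''))"
   using cD(2) ob t k k' Z Z' Z'' by blast
  have k'k: "Comp D Z Z' Z'' k' k \<in> Hom D Z Z''" using cD(2) Z Z' Z'' k k' by blast
  have "t Z Z'' (Comp D Z Z' Z'' k' k) = Comp D (?F (g Z)) (?F (g Z')) (?F (g Z'')) (t Z' Z'' k') (t Z Z' k)"
  proof (rule t_uniq[OF Z Z'' k'k tt])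
   have "Comp D (?F (g Z)) (?F (g Z'')) Z'' (e Z'') (Comp D (?F (g Z)) (?F (g Z')) (?F (g Z'')) (t Z' Z'' k') (t Z Z' k)) =
    Comp D (?F (g Z)) (?F (g Z')) Z'' (Comp D (?F (g Z')) Z' Z'' k' (e Z')) (t Z Z' k)"
    using cD(5)[OF ob Z'' t[OF Z Z' k] t[OF Z' Z'' k'] e(1)[OF Z'']] et[OF Z' Z'' k'] by metis
   also have "\<dots> = Comp D (?F (g Z)) Z' Z'' k' (Comp D (?F (g Z)) Z Z' k (e Z))"
    using cD(5)[OF ob(1,2) Z' Z'' t[OF Z Z' k] e(1)[OF Z'] k'] et[OF Z Z' k] by metis
   also have "\<dots> = Comp D (?F (g Z)) Z Z'' (Comp D Z Z' Z'' k' k) (e Z)"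
    using cD(5)[OF ob(1) Z Z' Z'' e(1)[OF Z] k k'] by metis
   finally show "Comp D (?F (g Z)) (?F (g Z'')) Z'' (e Z'') (Comp D (?F (g Z)) (?F (g Z')) (?F (g Z'')) (t Z' Z'' k') (t Z Z' k)) = \<dots>" .
  qed
  moreover have "?inv (g Z) (g Z'') (Comp D (?F (g Z)) (?F (g Z')) (?F (g Z'')) (t Z' Z'' k') (t Z Z' k)) =
   Comp C (g Z) (g Z') (g Z'') (?inv (g Z') (g Z'') (t Z' Z'' k')) (?inv (g Z) (g Z') (t Z Z' k))"
  proof -
   note i1 = inv[OF obg(1,2) t[OF Z Z' k]] and i2 = inv[OF obg(2,3) t[OF Z' Z'' k']] and i3 = inv[OF obg(1,3) tt]
   show ?thesis
    by (rule inj[OF obg(1,3) i3(1) cC(2)[OF obg i1(1) i2(1)]])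
     (use i1 i2 i3 F1(4)[OF obg i1(1) i2(1)] in simp)
  qed
  ultimately show "snd G Z Z'' (Comp D Z Z' Z'' k' k) = Comp C (fst G Z) (fst G Z') (fst G Z'') (snd G Z' Z'' k') (snd G Z Z' k)"
   by (simp add: G_def)
 qed
 have FG: "naturally_isomorphic D D (comp_functor F G) id_functor"
  unfolding naturally_isomorphic_def
 proof (rule exI[of _ e], intro conjI ballI)
  fix Z assume Z: "Z \<in> Ob D"
  show "is_iso D (fst (comp_functor F G) Z) (fst id_functor Z) (e Z)"
   using e[OF Z] by (auto simp: is_iso_def G_def comp_functor_def id_functor_def intro!: bexI[of _ "e' Z"])
  fix Z' k assume Z': "Z' \<in> Ob D" and k: "k \<in> Hom D Z Z'"
  show "Comp D (fst (comp_functor F G) Z) (fst (comp_functor F G) Z') (fst id_functor Z') (e Z') (snd (comp_functor F G) Z Z' k) =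
   Comp D (fst (comp_functor F G) Z) (fst id_functor Z) (fst id_functor Z') (snd id_functor Z Z' k) (e Z)"
   using et[OF Z Z' k] inv(2)[OF _ _ t[OF Z Z' k]] g Z Z' unfolding G_def comp_functor_def id_functor_def by simp
 qed
 \<comment> \<open>The preimage of \<open>e (?F X)\<close> under F. It is invertible, and natural in
   X, because F is injective on hom-sets and the corresponding equations hold in D.\<close>
 define \<eta> where "\<eta> X = ?inv (g (?F X)) X (e (?F X))" for X
 have ob: "?F X \<in> Ob D" "g (?F X) \<in> Ob C" "?F (g (?F X)) \<in> Ob D" if "X \<in> Ob C" for X
  using that g F1(1) by auto
 have \<eta>: "\<eta> X \<in> Hom C (g (?F X)) X" "snd F (g (?F X)) X (\<eta> X) = e (?F X)" if "X \<in> Ob C" for X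
  unfolding \<eta>_def using inv that ob e(1) by auto
 have GF: "naturally_isomorphic C C (comp_functor G F) id_functor"
  unfolding naturally_isomorphic_def
 proof (rule exI[of _ \<eta>], intro conjI ballI)
  fix X assume X: "X \<in> Ob C"
  let ?i = "?inv X (g (?F X)) (e' (?F X))"
  have i: "?i \<in> Hom C X (g (?F X))" "snd F X (g (?F X)) ?i = e' (?F X)"
   using inv X ob[OF X] e(2) by auto
  have "Comp C (g (?F X)) X (g (?F X)) ?i (\<eta> X) = Ident C (g (?F X))"
   using X ob[OF X] i \<eta>[OF X] cC(1,2) e(3) by (intro inj[of "g (?F X)" "g (?F X)"]) (auto simp: F1(3,4))
  moreover have "Comp C X (g (?F X)) X (\<eta> X) ?i = Ident C X"
   using X ob[OF X] i \<eta>[OF X] cC(1,2) e(4) by (intro inj[of X X]) (auto simp: F1(3,4))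
  ultimately show "is_iso C (fst (comp_functor G F) X) (fst id_functor X) (\<eta> X)"
   using i(1) \<eta>(1)[OF X] unfolding is_iso_def G_def comp_functor_def id_functor_def by auto
  fix Y k assume Y: "Y \<in> Ob C" and k: "k \<in> Hom C X Y"
  have Fk: "snd F X Y k \<in> Hom D (?F X) (?F Y)" using F1(2) X Y k by blast
  note tk = t[OF ob(1)[OF X] ob(1)[OF Y] Fk]
  have "Comp C (g (?F X)) (g (?F Y)) Y (\<eta> Y) (?inv (g (?F X)) (g (?F Y)) (t (?F X) (?F Y) (snd F X Y k))) =
   Comp C (g (?F X)) X Y k (\<eta> X)"
   using X Y k ob[OF X] ob[OF Y] \<eta>[OF X] \<eta>[OF Y] inv[OF _ _ tk] et[OF _ _ Fk] cC(2)
   by (intro inj[of "g (?F X)" Y]) (auto simp: F1(4))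
  thus "Comp C (fst (comp_functor G F) X) (fst (comp_functor G F) Y) (fst id_functor Y) (\<eta> Y) (snd (comp_functor G F) X Y k) =
   Comp C (fst (comp_functor G F) X) (fst id_functor X) (fst id_functor Y) (snd id_functor X Y k) (\<eta> X)"
   unfolding G_def comp_functor_def id_functor_def by simp
 qed
 show ?thesis unfolding equivalent_categories_def using C D F G FG GF by blast
qed

text \<open>For categories whose objects carry two kinds of structure on the same underlying space:
  related objects admit the same maps as morphisms, so the functor chooses a related object and
  leaves morphisms alone. This spares constructing a quasi-inverse in every application.\<close>

lemma equivalent_categories_if_related:
 fixes C :: "('o, 'm) category" and D :: "('p, 'm) category"
 assumes C: "is_category C" and D: "is_category D"
  and lr: "\<And>X. X \<in> Ob C ==> \<exists>Y\<in>Ob D. R X Y" and rl: "\<And>Y. Y \<in> Ob D ==> \<exists>X\<in>Ob C. R X Y"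
  and hom: "\<And>X Y X' Y'. [|X \<in> Ob C; Y \<in> Ob D; X' \<in> Ob C; Y' \<in> Ob D; R X Y; R X' Y'|] ==> Hom C X X' = Hom D Y Y'"
  and ident: "\<And>X Y. [|X \<in> Ob C; Y \<in> Ob D; R X Y|] ==> Ident C X = Ident D Y"
  and comp: "\<And>X Y X' Y' X'' Y''. [|X \<in> Ob C; Y \<in> Ob D; R X Y|] ==> Comp C X X' X'' = Comp D Y Y' Y''"
 shows "equivalent_categories C D"
proof -
 define F where "F X = (SOME Y. Y \<in> Ob D \<and> R X Y)" for X
 have F: "F X \<in> Ob D" "R X (F X)" if "X \<in> Ob C" for X
  using someI_ex[of "\<lambda>Y. Y \<in> Ob D \<and> R X Y"] lr[OF that] unfolding F_def by blast+
 show ?thesis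
 proof (rule equivalent_categories_if_fully_faithful[OF C D, of "(F, \<lambda>X Y f. f)"])
  show "is_functor C D (F, \<lambda>X Y f. f)"
   unfolding is_functor_def fst_conv snd_conv
  proof (intro conjI ballI)
   fix X assume X: "X \<in> Ob C"
   show "F X \<in> Ob D" using F(1)[OF X] .
   show "Ident C X = Ident D (F X)" by (rule ident[OF X F(1)[OF X] F(2)[OF X]])
   fix Y f assume Y: "Y \<in> Ob C" and f: "f \<in> Hom C X Y"
   show "f \<in> Hom D (F X) (F Y)" using hom[OF X F(1)[OF X] Y F(1)[OF Y] F(2)[OF X] F(2)[OF Y]] f by simp
   fix Z g
   show "Comp C X Y Z g f = Comp D (F X) (F Y) (F Z) g f" using comp[OF X F(1)[OF X] F(2)[OF X]] by metis
  qed
  show "bij_betw (snd (F, \<lambda>X Y f. f) X Y) (Hom C X Y) (Hom D (fst (F, \<lambda>X Y f. f) X) (fst (F, \<lambda>X Y f. f) Y))"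
   if "X \<in> Ob C" "Y \<in> Ob C" for X Y
   using hom[OF that(1) F(1)[OF that(1)] that(2) F(1)[OF that(2)]] F(2) that by (simp add: bij_betw_def)
  fix Z assume Z: "Z \<in> Ob D"
  obtain X where X: "X \<in> Ob C" "R X Z" using rl Z by blast
  note c = is_categoryD[OF C] and d = is_categoryD[OF D] 
  have h: "Hom D (F X) Z = Hom C X X" "Hom D Z (F X) = Hom C X X" using hom X Z F by metis+
  have "Comp D (F X) Z (F X) = Comp C X X X" "Comp D Z (F X) Z = Comp C X X X" using comp X Z F by metis+
  \<comment> \<open>Both F X and Z are related to X, so their hom-sets and compositions in D are
    those of X with itself in C, and the identity of X serves in both directions.\<close>
  hence "is_iso D (F X) Z (Ident C X)"
   unfolding is_iso_def h using c(1,3) X ident Z F by metis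
  thus "\<exists>X\<in>Ob C. \<exists>f. is_iso D (fst (F, \<lambda>X Y f. f) X) Z f" using X by auto
 qed
qed

subsection \<open>Linear maps\<close>

abbreviation vsp :: "('k::field, 'v, 'x) module_scheme => bool" where
 "vsp M \<equiv> vectorspace class_ring M"

abbreviation lmap :: "('k::field, 'u, 'x) module_scheme => ('k, 'v, 'y) module_scheme => ('u => 'v) => bool" where
 "lmap M N f \<equiv> linear_map class_ring M N f"

lemma fdD:
 assumes "fd_vectorspace M"
 shows "vsp M" "module class_ring M" "abelian_group M"
proof -
 interpret vectorspace class_ring M using assms by (simp add: fd_vectorspace_def)
 show "vsp M" "module class_ring M" "abelian_group M" by unfold_locales
qed

lemma lmapI:
 fixes M :: "('k::field, 'u, 'x) module_scheme" and N :: "('k, 'v, 'y) module_scheme"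
 assumes "vsp M" "vsp N"
  and "\<And>x. x \<in> carrier M ==> f x \<in> carrier N"
  and "\<And>x y. [|x \<in> carrier M; y \<in> carrier M|] ==> f (x \<oplus>\<^bsub>M\<^esub> y) = f x \<oplus>\<^bsub>N\<^esub> f y"
  and "\<And>c x. x \<in> carrier M ==> f (c \<odot>\<^bsub>M\<^esub> x) = c \<odot>\<^bsub>N\<^esub> f x"
 shows "lmap M N f"
proof -
 interpret M: vectorspace class_ring M by fact
 interpret N: vectorspace class_ring N by fact
 have "f \<in> LinearCombinations.module_hom class_ring M N"
  unfolding LinearCombinations.module_hom_def using assms(3-5) by simp
 hence "mod_hom class_ring M N f"
  by (intro mod_hom.intro M.module_axioms N.module_axioms mod_hom_axioms.intro)
 thus ?thesis
  by (intro linear_map.intro assms(1,2))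
qed

lemma lmapD:
 fixes M (structure)
 assumes "lmap M N f"
 shows "vsp M" "vsp N"
  and "x \<in> carrier M ==> f x \<in> carrier N"
  and "[|x \<in> carrier M; y \<in> carrier M|] ==> f (x \<oplus> y) = f x \<oplus>\<^bsub>N\<^esub> f y"
  and "x \<in> carrier M ==> f (c \<odot> x) = c \<odot>\<^bsub>N\<^esub> f x"
  and "f \<zero> = \<zero>\<^bsub>N\<^esub>"
  and "x \<in> carrier M ==> f (\<ominus> x) = \<ominus>\<^bsub>N\<^esub> f x"
  and "[|x \<in> carrier M; y \<in> carrier M|] ==> f (x \<ominus> y) = f x \<ominus>\<^bsub>N\<^esub> f y"
proof -
 interpret linear_map class_ring M N f by fact
 show "vsp M" "vsp N" by unfold_locales
 show "x \<in> carrier M ==> f x \<in> carrier N"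
  "[|x \<in> carrier M; y \<in> carrier M|] ==> f (x \<oplus> y) = f x \<oplus>\<^bsub>N\<^esub> f y"
  "x \<in> carrier M ==> f (c \<odot> x) = c \<odot>\<^bsub>N\<^esub> f x"
  "f \<zero> = \<zero>\<^bsub>N\<^esub>"
  "x \<in> carrier M ==> f (\<ominus> x) = \<ominus>\<^bsub>N\<^esub> f x"
  "[|x \<in> carrier M; y \<in> carrier M|] ==> f (x \<ominus> y) = f x \<ominus>\<^bsub>N\<^esub> f y"
  by (auto simp: T_add T_smult)
qed

lemma lmap_comp:
 assumes "lmap M N f" "lmap N K g"
 shows "lmap M K (\<lambda>x. g (f x))"
 using lmapD[OF assms(1)] lmapD[OF assms(2)] by (intro lmapI) auto

lemma lmap_cong:
 assumes "lmap M N f" "\<And>x. x \<in> carrier M ==> f x = g x"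
 shows "lmap M N g"
proof -
 interpret M: vectorspace class_ring M using lmapD[OF assms(1)] by blast
 show ?thesis
  using lmapD[OF assms(1)]
  by (intro lmapI) (auto simp: assms(2)[symmetric])
qed

lemma lmap_add:
 assumes "lmap M N f" "lmap M N g"
 shows "lmap M N (\<lambda>x. f x \<oplus>\<^bsub>N\<^esub> g x)"
proof -
 interpret N: vectorspace class_ring N using lmapD[OF assms(1)] by blast
 show ?thesis
  using lmapD[OF assms(1)] lmapD[OF assms(2)]
  by (intro lmapI) (auto simp: N.a_ac N.smult_r_distr)
qed

lemma lmap_smult:
 fixes N (structure)
 assumes "lmap M N f"
 shows "lmap M N (\<lambda>x. c \<odot> f x)"
proof -
 interpret N: vectorspace class_ring N using lmapD[OF assms(1)] by blast
 have "c \<odot> (d \<odot> x) = d \<odot> (c \<odot> x)" if "x \<in> carrier N" for d x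
  using N.smult_assoc1[of c d x] N.smult_assoc1[of d c x] that by (metis UNIV_I mult.commute partial_object.select_convs(1) monoid.select_convs(1))
 thus ?thesis
  using lmapD[OF assms(1)]
  by (intro lmapI) (auto simp: N.smult_r_distr)
qed

lemma lmap_id:
 "vsp M ==> lmap M M (\<lambda>x. x)"
 by (intro lmapI) auto

lemma lmap_zero:
 assumes "vsp M" "vsp N"
 shows "lmap M N (\<lambda>x. \<zero>\<^bsub>N\<^esub>)"
proof -
 interpret N: vectorspace class_ring N by fact
 show ?thesis using assms by (intro lmapI) (auto simp: N.smult_r_null)
qed

lemma fd_vectorspace_surj:
 assumes "lmap M N f" "fd_vectorspace M" "f ` carrier M = carrier N"
 shows "fd_vectorspace N"
proof -
 interpret linear_map class_ring M N f by fact
 have "V.fin_dim" using assms(2) by (simp add: fd_vectorspace_def)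
 thus ?thesis
  using surj_fin_dim[OF _ assms(3)] W.vectorspace_axioms by (simp add: fd_vectorspace_def)
qed

subsection \<open>The ring of linear operators on a function space\<close>

text \<open>Via coordinates extended by 0, the operators on all modules with elements in a fixed type live in one ring.\<close>

typedef (overloaded) ('b, 'k) endo =
 "{T :: ('b => 'k::field) => 'b => 'k. (\<forall>x y. T (x + y) = T x + T y) \<and> (\<forall>c x. T (\<lambda>v. c * x v) = (\<lambda>v. c * T x v))}"
 morphisms app Endo
 by (rule exI[of _ id]) auto

setup_lifting type_definition_endo

lemma app_add: "app T (x + y) = app T x + app T y"
 and app_smult: "app T (\<lambda>v. c * x v) = (\<lambda>v. c * app T x v)"
 using app[of T] by auto

lemma endo_eqI: "(\<And>x. app S x = app T x) ==> S = T"
 by (simp add: app_inject[symmetric] fun_eq_iff)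

instantiation endo :: (type, field) ring_1
begin

lift_definition zero_endo :: "('a, 'b) endo" is "\<lambda>x. 0" by auto
lift_definition one_endo :: "('a, 'b) endo" is "\<lambda>x. x" by auto
lift_definition plus_endo :: "('a, 'b) endo => ('a, 'b) endo => ('a, 'b) endo" is "\<lambda>S T x. S x + T x"
 by (auto simp: fun_eq_iff algebra_simps)
lift_definition uminus_endo :: "('a, 'b) endo => ('a, 'b) endo" is "\<lambda>S x. - S x"
 by (auto simp: fun_eq_iff algebra_simps)
lift_definition minus_endo :: "('a, 'b) endo => ('a, 'b) endo => ('a, 'b) endo" is "\<lambda>S T x. S x - T x"
 by (auto simp: fun_eq_iff algebra_simps)
lift_definition times_endo :: "('a, 'b) endo => ('a, 'b) endo => ('a, 'b) endo" is "\<lambda>S T x. S (T x)"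
 by auto

instance
proof
 show "(0 :: ('a, 'b) endo) \<noteq> 1"
 proof transfer
  show "(\<lambda>x. 0 :: 'a => 'b) \<noteq> (\<lambda>x. x)"
  proof
   assume "(\<lambda>x. 0 :: 'a => 'b) = (\<lambda>x. x)"
   from fun_cong[OF fun_cong[OF this, of "\<lambda>_. 1"]] show False by simp
  qed
 qed
qed (transfer; auto simp: fun_eq_iff algebra_simps)+

end

text \<open>The class \<open>ring_1\<close> offers no scalar multiplication; a scalar c is
  represented by the central element \<open>sc c\<close>, which turns linear identities between
  operators into ring identities.\<close>

lift_definition sc :: "'k::field => ('b, 'k) endo" is "\<lambda>c x v. c * x v"
 by (auto simp: fun_eq_iff algebra_simps)

lemma app_simps [simp]:
 "app 0 x = 0" "app 1 x = x" "app (S + T) x = app S x + app T x" "app (- S) x = - app S x"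
 "app (S - T) x = app S x - app T x" "app (S * T) x = app S (app T x)" "app (sc c) x = (\<lambda>v. c * x v)"
 by (transfer; simp)+

lemma sc_simps [simp]: "sc 0 = 0" "sc 1 = 1" "sc (- a) = - sc a"
 by (transfer; auto simp: fun_eq_iff)+

lemma sc_add: "sc (a + b) = sc a + sc b" and sc_diff: "sc (a - b) = sc a - sc b"
 and sc_mult: "sc (a * b) = sc a * sc b" and sc_commute: "T * sc c = sc c * T"
 by (rule endo_eqI, simp add: fun_eq_iff algebra_simps app_smult)+

lemma sc_numeral [simp]: "sc (numeral n) = numeral n"
 by (induction n) (simp_all only: numeral.simps sc_add sc_simps)

lemma sc_left_commute: "T * (sc c * S) = sc c * (T * S)"
 by (metis mult.assoc sc_commute)

lemma sc_sum: "sc (sum f A) = (\<Sum>a\<in>A. sc (f a))"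
 by (induction A rule: infinite_finite_induct) (auto simp: sc_add)

lemma sc_cancel:
 assumes "a \<noteq> 0" "sc a * S = sc a * T"
 shows "S = T"
proof -
 have "sc (inverse a) * (sc a * S) = sc (inverse a) * (sc a * T)" using assms(2) by simp
 hence "sc (inverse a * a) * S = sc (inverse a * a) * T" by (simp only: mult.assoc[symmetric] sc_mult)
 thus ?thesis using assms(1) by simp
qed

subsection \<open>Coordinates\<close>

definition coord_basis :: "('k::field, 'v, 'x) module_scheme => 'v set" where
 "coord_basis M = (SOME B. finite B \<and> vectorspace.basis class_ring M B)"

definition iota :: "('k::field, 'v, 'x) module_scheme => ('v => 'k) => 'v" where
 "iota M \<phi> = (\<Oplus>\<^bsub>M\<^esub>b\<in>coord_basis M. \<phi> b \<odot>\<^bsub>M\<^esub> b)"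

text \<open>Requiring the coordinates to vanish off the basis makes them unique. Thus
  \<open>kappa M\<close> is a linear section of \<open>iota M\<close>, and \<open>kappa M\<close>
  after \<open>iota M\<close> cuts a function down to the basis.\<close>

definition kappa :: "('k::field, 'v, 'x) module_scheme => 'v => 'v => 'k" where
 "kappa M x = (SOME \<phi>. (\<forall>b. b \<notin> coord_basis M \<longrightarrow> \<phi> b = 0) \<and> iota M \<phi> = x)"

context
 fixes M :: "('k::field, 'v, 'x) module_scheme" (structure)
 assumes fd: "fd_vectorspace M"
begin

interpretation vectorspace class_ring M using fd by (simp add: fd_vectorspace_def)

lemma coord_basis: "finite (coord_basis M)" "basis (coord_basis M)"
proof -
 have "\<exists>B. finite B \<and> basis B" using finite_basis_exists fd by (simp add: fd_vectorspace_def)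
 from someI_ex[OF this] show "finite (coord_basis M)" "basis (coord_basis M)"
  by (simp_all add: coord_basis_def)
qed

lemma coord_basis_subset: "coord_basis M \<subseteq> carrier M"
 using coord_basis(2) by (simp add: basis_def)

lemma coord_basis_smult: "b \<in> coord_basis M ==> c \<odot> b \<in> carrier M"
 using coord_basis_subset by auto

lemma iota_closed: "iota M \<phi> \<in> carrier M"
 unfolding iota_def using coord_basis_subset by (auto intro!: finsum_closed)

lemma iota_cong: "(\<And>b. b \<in> coord_basis M ==> \<phi> b = \<psi> b) ==> iota M \<phi> = iota M \<psi>"
 unfolding iota_def using coord_basis_smult by (intro finsum_cong') auto

lemma iota_add: "iota M (\<phi> + \<psi>) = iota M \<phi> \<oplus> iota M \<psi>"
proof -
 have "iota M (\<phi> + \<psi>) = (\<Oplus>b\<in>coord_basis M. \<phi> b \<odot> b \<oplus> \<psi> b \<odot> b)"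
  unfolding iota_def using coord_basis_subset smult_l_distr coord_basis_smult
  by (intro finsum_cong') auto
 thus ?thesis
  unfolding iota_def using coord_basis_smult by (simp add: finsum_addf Pi_iff)
qed

lemma iota_smult: "iota M (\<lambda>v. c * \<phi> v) = c \<odot> iota M \<phi>"
proof -
 have "iota M (\<lambda>v. c * \<phi> v) = (\<Oplus>b\<in>coord_basis M. c \<odot> (\<phi> b \<odot> b))"
  unfolding iota_def using coord_basis_subset smult_assoc1 coord_basis_smult
  by (intro finsum_cong') auto
 thus ?thesis
  unfolding iota_def using coord_basis_smult coord_basis(1)
  by (simp add: finsum_smult[symmetric] Pi_iff)
qed

lemma iota_ex1: 
 assumes "x \<in> carrier M"
 shows "\<exists>!\<phi>. (\<forall>b. b \<notin> coord_basis M \<longrightarrow> \<phi> b = 0) \<and> iota M \<phi> = x"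
proof -
 have "\<exists>!a. a \<in> coord_basis M \<rightarrow>\<^sub>E UNIV \<and> lincomb a (coord_basis M) = x"
  using basis_criterion[OF coord_basis(1) coord_basis_subset] coord_basis(2) assms by simp
 hence ex: "\<exists>!a. a \<in> coord_basis M \<rightarrow>\<^sub>E UNIV \<and> iota M a = x" by (simp add: lincomb_def iota_def)
 show ?thesis
 proof (rule ex_ex1I)
  obtain a where "iota M a = x" using ex by blast
  thus "\<exists>\<phi>. (\<forall>b. b \<notin> coord_basis M \<longrightarrow> \<phi> b = 0) \<and> iota M \<phi> = x"
   by (intro exI[of _ "\<lambda>b. if b \<in> coord_basis M then a b else 0"]) (auto intro: iota_cong)
  fix \<phi> \<psi>
  assume *: "(\<forall>b. b \<notin> coord_basis M \<longrightarrow> \<phi> b = 0) \<and> iota M \<phi> = x" "(\<forall>b. b \<notin> coord_basis M \<longrightarrow> \<psi> b = 0) \<and> iota M \<psi> = x"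
  have "restrict \<phi> (coord_basis M) = restrict \<psi> (coord_basis M)"
   using ex * iota_cong[of "restrict \<phi> (coord_basis M)" \<phi>] iota_cong[of "restrict \<psi> (coord_basis M)" \<psi>]
   by auto
  thus "\<phi> = \<psi>" using * by (metis restrict_apply' ext)
 qed
qed

lemma iota_kappa: "x \<in> carrier M ==> iota M (kappa M x) = x"
 and kappa_outside: "[|x \<in> carrier M; b \<notin> coord_basis M|] ==> kappa M x b = 0"
 using someI_ex[OF ex1_implies_ex[OF iota_ex1], of x] by (simp_all add: kappa_def)

lemma kappa_eqI: "(\<And>b. b \<notin> coord_basis M ==> \<phi> b = 0) ==> iota M \<phi> = x ==> kappa M x = \<phi>"
 using iota_ex1[of x] iota_kappa[of x] kappa_outside[of x] iota_closed[of \<phi>] by blast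

lemma kappa_add: "[|x \<in> carrier M; y \<in> carrier M|] ==> kappa M (x \<oplus> y) = kappa M x + kappa M y"
 by (rule kappa_eqI) (auto simp: kappa_outside iota_add iota_kappa)

lemma kappa_smult: "x \<in> carrier M ==> kappa M (c \<odot> x) = (\<lambda>v. c * kappa M x v)"
 by (rule kappa_eqI) (auto simp: kappa_outside iota_smult iota_kappa)

lemma kappa_zero: "kappa M \<zero> = 0"
proof (rule kappa_eqI)
 show "iota M 0 = \<zero>"
  using iota_smult[of 0 0] smult_l_null[OF iota_closed[of 0]] by (simp add: zero_fun_def)
qed simp

end

text \<open>A linear map in coordinates, precomposed with \<open>iota M\<close> so that it is
  defined on every function on \<open>'v\<close>. Composition of maps becomes the product of one
  ring, whatever the carriers are.\<close>

definition Op :: "('k::field, 'v, 'x) module_scheme => ('k, 'v, 'y) module_scheme => ('v => 'v) => ('v, 'k) endo" where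
 "Op M N f = Endo (\<lambda>\<phi>. kappa N (f (iota M \<phi>)))"

text \<open>The idempotent that restricts functions to the chosen basis of M. It takes the place of
  the unit for the operators on M, which is why it stands on the right of all Clifford relations
  below.\<close>

abbreviation Pr :: "('k::field, 'v, 'x) module_scheme => ('v, 'k) endo" where
 "Pr M \<equiv> Op M M (\<lambda>x. x)"

definition De :: "('k::field, 'v, 'x) module_scheme => ('k, 'v, 'y) module_scheme => ('v, 'k) endo => 'v => 'v" where
 "De M N T x = iota N (app T (kappa M x))"

lemma app_Op:
 assumes "fd_vectorspace M" "fd_vectorspace N" "lmap M N f"
 shows "app (Op M N f) \<phi> = kappa N (f (iota M \<phi>))"
proof -
 note l = lmapD[OF assms(3)]
 have "(\<lambda>\<phi>. kappa N (f (iota M \<phi>))) \<in> {T. (\<forall>x y. T (x + y) = T x + T y) \<and> (\<forall>c x. T (\<lambda>v. c * x v) = (\<lambda>v. c * T x v))}"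
  using assms by (auto simp: iota_add iota_smult iota_closed l kappa_add kappa_smult)
 thus ?thesis unfolding Op_def by (simp add: Endo_inverse)
qed

lemma De_Op:
 assumes "fd_vectorspace M" "fd_vectorspace N" "lmap M N f" "x \<in> carrier M"
 shows "De M N (Op M N f) x = f x"
 using assms lmapD(3)[OF assms(3)] by (simp add: De_def app_Op iota_kappa)

lemma Op_mult:
 assumes "fd_vectorspace M" "fd_vectorspace N" "fd_vectorspace K"
  and "lmap M N f" "lmap N K g"
 shows "Op N K g * Op M N f = Op M K (\<lambda>x. g (f x))"
 using assms lmapD(3)[OF assms(4)]
 by (intro endo_eqI) (simp add: app_Op lmap_comp[OF assms(4,5)] iota_kappa iota_closed)

lemma Op_add:
 assumes "fd_vectorspace M" "fd_vectorspace N" "lmap M N f" "lmap M N g"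
 shows "Op M N (\<lambda>x. f x \<oplus>\<^bsub>N\<^esub> g x) = Op M N f + Op M N g"
 using assms lmapD(3)[OF assms(3)] lmapD(3)[OF assms(4)]
 by (intro endo_eqI) (simp add: app_Op lmap_add kappa_add iota_closed)

lemma Op_smult:
 assumes "fd_vectorspace M" "fd_vectorspace N" "lmap M N f"
 shows "Op M N (\<lambda>x. c \<odot>\<^bsub>N\<^esub> f x) = sc c * Op M N f"
 using assms lmapD(3)[OF assms(3)]
 by (intro endo_eqI) (simp add: app_Op lmap_smult kappa_smult iota_closed)

lemma Op_zero:
 assumes "fd_vectorspace M" "fd_vectorspace N"
 shows "Op M N (\<lambda>x. \<zero>\<^bsub>N\<^esub>) = 0"
 using assms by (intro endo_eqI) (simp add: app_Op lmap_zero fdD kappa_zero)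

lemma vectorspace_minus_smult:
 assumes "vsp M" "x \<in> carrier M"
 shows "\<ominus>\<^bsub>M\<^esub> x = (- 1) \<odot>\<^bsub>M\<^esub> x"
proof -
 interpret vectorspace class_ring M by fact
 show ?thesis using smult_minus_1[OF assms(2)] by (simp add: class_ring_simps)
qed

lemma Op_cong:
 assumes "fd_vectorspace M" "\<And>x. x \<in> carrier M ==> f x = g x"
 shows "Op M N f = Op M N g"
 unfolding Op_def using assms iota_closed by metis

lemma Op_diff:
 fixes N (structure)
 assumes "fd_vectorspace M" "fd_vectorspace N" "lmap M N f" "lmap M N g"
 shows "Op M N (\<lambda>x. f x \<ominus> g x) = Op M N f - Op M N g"
proof -
 have "Op M N (\<lambda>x. f x \<ominus> g x) = Op M N (\<lambda>x. f x \<oplus> (- 1) \<odot> g x)"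
  using assms lmapD[OF assms(4)] by (intro Op_cong) (simp_all add: a_minus_def vectorspace_minus_smult)
 thus ?thesis using assms by (simp add: Op_add Op_smult lmap_smult)
qed

lemma Op_eqD:
 assumes "fd_vectorspace M" "fd_vectorspace N" "lmap M N f" "lmap M N g"
  and "Op M N f = Op M N g" "x \<in> carrier M"
 shows "f x = g x"
 using De_Op[OF assms(1-3,6)] De_Op[OF assms(1,2,4,6)] assms(5) by simp

lemma Pr_Op: 
 assumes "fd_vectorspace M" "fd_vectorspace N" "lmap M N f"
 shows "Pr N * Op M N f = Op M N f" "Op M N f * Pr M = Op M N f"
 using assms by (simp_all add: Op_mult lmap_id fdD)

lemma De_linear:
 assumes "fd_vectorspace M" "fd_vectorspace N"
 shows "lmap M N (De M N T)"
 using assms unfolding De_def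
 by (intro lmapI) (auto simp: fdD iota_closed kappa_add kappa_smult app_add app_smult iota_add iota_smult)

lemma De_add:
 assumes "fd_vectorspace M" "fd_vectorspace N"
 shows "De M N (S + T) x = De M N S x \<oplus>\<^bsub>N\<^esub> De M N T x"
 using assms by (simp add: De_def iota_add)

lemma De_smult:
 assumes "fd_vectorspace M" "fd_vectorspace N"
 shows "De M N (sc c * T) x = c \<odot>\<^bsub>N\<^esub> De M N T x"
 using assms by (simp add: De_def iota_smult)

subsection \<open>Categories of representations\<close>

definition act_closed :: "'a set => ('k, 'a, 'v, 'x) rep_scheme => bool" where
 "act_closed A M \<longleftrightarrow> (\<forall>a\<in>A. \<forall>x\<in>carrier M. act M a x \<in> carrier M)"

lemma rep_homD:
 assumes "\<phi> \<in> rep_hom A M N"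
 shows "\<phi> \<in> extensional (carrier M)" "lmap M N \<phi>"
  "[|a \<in> A; x \<in> carrier M|] ==> \<phi> (act M a x) = act N a (\<phi> x)"
  "x \<in> carrier M ==> \<phi> x \<in> carrier N"
 using assms lmapD(3)[of M N \<phi>] by (auto simp: rep_hom_def)

lemma rep_homI:
 assumes "lmap M N \<phi>" "act_closed A M"
  "\<And>a x. [|a \<in> A; x \<in> carrier M|] ==> \<phi> (act M a x) = act N a (\<phi> x)"
 shows "restrict \<phi> (carrier M) \<in> rep_hom A M N"
 using assms by (auto simp: rep_hom_def act_closed_def intro!: lmap_cong[of M N \<phi>])

lemma rep_hom_id:
 assumes "vsp M" "act_closed A M"
 shows "(\<lambda>x\<in>carrier M. x) \<in> rep_hom A M M"
 using assms by (intro rep_homI lmap_id) auto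

lemma rep_hom_compose:
 assumes "\<phi> \<in> rep_hom A M N" "\<psi> \<in> rep_hom A N K" "act_closed A M"
 shows "compose (carrier M) \<psi> \<phi> \<in> rep_hom A M K"
 unfolding compose_def using assms
 by (intro rep_homI lmap_comp[of M N \<phi> K \<psi>]) (auto simp: rep_homD)

text \<open>The predicate Q is a side condition on morphisms. It is trivial for Lie, Clifford and
  ungraded exterior modules, and preservation of parity for graded ones.\<close>

lemma is_category_reps:
 assumes "\<And>M. M \<in> Obs ==> vsp M \<and> act_closed A M"
  and "\<And>M. M \<in> Obs ==> Q M M (\<lambda>x\<in>carrier M. x)"
  and "\<And>M N K \<phi> \<psi>. [|M \<in> Obs; N \<in> Obs; K \<in> Obs; \<phi> \<in> rep_hom A M N; \<psi> \<in> rep_hom A N K; Q M N \<phi>; Q N K \<psi>|] ==>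
   Q M K (compose (carrier M) \<psi> \<phi>)"
 shows "is_category \<lparr>Ob = Obs, Hom = (\<lambda>M N. {\<phi> \<in> rep_hom A M N. Q M N \<phi>}),
   Ident = (\<lambda>M. \<lambda>x\<in>carrier M. x), Comp = (\<lambda>M N P \<psi> \<phi>. compose (carrier M) \<psi> \<phi>)\<rparr>"
 unfolding is_category_def category.simps
proof (intro conjI ballI)
 fix M assume M: "M \<in> Obs"
 show "(\<lambda>x\<in>carrier M. x) \<in> {\<phi> \<in> rep_hom A M M. Q M M \<phi>}"
  using assms(1,2)[OF M] rep_hom_id by blast
 fix N assume N: "N \<in> Obs"
 show "compose (carrier M) \<phi> (\<lambda>x\<in>carrier M. x) = \<phi>" "compose (carrier M) (\<lambda>x\<in>carrier N. x) \<phi> = \<phi>"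
  if "\<phi> \<in> {\<phi> \<in> rep_hom A M N. Q M N \<phi>}" for \<phi>
  using that rep_homD[of \<phi> A M N] by (auto simp: fun_eq_iff compose_def extensional_def)
 fix K assume K: "K \<in> Obs"
 fix \<phi> \<psi> assume h: "\<phi> \<in> {\<phi> \<in> rep_hom A M N. Q M N \<phi>}" "\<psi> \<in> {\<phi> \<in> rep_hom A N K. Q N K \<phi>}"
 show "compose (carrier M) \<psi> \<phi> \<in> {\<phi> \<in> rep_hom A M K. Q M K \<phi>}"
  using h assms(1)[OF M] rep_hom_compose[of \<phi> A M N \<psi> K] assms(3)[OF M N K] by blast
 fix L \<chi> assume "L \<in> Obs" "\<chi> \<in> {\<phi> \<in> rep_hom A K L. Q K L \<phi>}"
 show "compose (carrier M) \<chi> (compose (carrier M) \<psi> \<phi>) = compose (carrier M) (compose (carrier N) \<chi> \<psi>) \<phi>"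
  using h(1) rep_homD(4)[of \<phi> A M N] by (auto simp: fun_eq_iff compose_def)
qed

lemma rep_hom_inverse:
 assumes \<phi>: "\<phi> \<in> rep_hom A M N" and bij: "bij_betw \<phi> (carrier M) (carrier N)" and c: "act_closed A M" "act_closed A N"
 defines "\<psi> \<equiv> restrict (inv_into (carrier M) \<phi>) (carrier N)"
 shows "\<psi> \<in> rep_hom A N M" "compose (carrier M) \<psi> \<phi> = (\<lambda>x\<in>carrier M. x)" "compose (carrier N) \<phi> \<psi> = (\<lambda>x\<in>carrier N. x)"
proof -
 note h = rep_homD[OF \<phi>] and l = lmapD[OF rep_homD(2)[OF \<phi>]]
 interpret M: vectorspace class_ring M by (rule l(1))
 let ?i = "inv_into (carrier M) \<phi>"
 have i: "?i y \<in> carrier M" "\<phi> (?i y) = y" if "y \<in> carrier N" for y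
  using bij that by (auto simp: bij_betw_def inv_into_into f_inv_into_f)
 have j: "?i (\<phi> x) = x" if "x \<in> carrier M" for x
  using bij that by (auto simp: bij_betw_def)
 have e: "?i y = x" if "\<phi> x = y" "x \<in> carrier M" for x y using that j by auto
 show "\<psi> \<in> rep_hom A N M" unfolding \<psi>_def
  using i h(3) c l
  by (intro rep_homI lmapI) (auto simp: act_closed_def intro!: e)
 show "compose (carrier M) \<psi> \<phi> = (\<lambda>x\<in>carrier M. x)" "compose (carrier N) \<phi> \<psi> = (\<lambda>x\<in>carrier N. x)"
  using i j l(3) by (auto simp: compose_def \<psi>_def fun_eq_iff)
qed

subsection \<open>Transport of structure\<close>

definition transport :: "('v => 'u) => ('k, 'v, 'x) module_scheme => ('k, 'u) module" where
 "transport j M = (let i = inv_into (carrier M) j in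
  \<lparr>carrier = j ` carrier M, mult = (\<lambda>x y. j \<zero>\<^bsub>M\<^esub>), one = j \<zero>\<^bsub>M\<^esub>, zero = j \<zero>\<^bsub>M\<^esub>,
   add = (\<lambda>x y. j (i x \<oplus>\<^bsub>M\<^esub> i y)), smult = (\<lambda>c x. j (c \<odot>\<^bsub>M\<^esub> i x))\<rparr>)"

lemma transport_simps [simp]:
 "carrier (transport j M) = j ` carrier M" "\<zero>\<^bsub>transport j M\<^esub> = j \<zero>\<^bsub>M\<^esub>"
 "x \<oplus>\<^bsub>transport j M\<^esub> y = j (inv_into (carrier M) j x \<oplus>\<^bsub>M\<^esub> inv_into (carrier M) j y)"
 "c \<odot>\<^bsub>transport j M\<^esub> x = j (c \<odot>\<^bsub>M\<^esub> inv_into (carrier M) j x)"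
 by (simp_all add: transport_def Let_def)

lemma vspI:
 fixes V :: "('k::field, 'v, 'x) module_scheme"
 assumes "\<zero>\<^bsub>V\<^esub> \<in> carrier V" "\<And>v w. [|v \<in> carrier V; w \<in> carrier V|] ==> v \<oplus>\<^bsub>V\<^esub> w \<in> carrier V"
  "\<And>c v. v \<in> carrier V ==> c \<odot>\<^bsub>V\<^esub> v \<in> carrier V"
  "\<And>v w. [|v \<in> carrier V; w \<in> carrier V|] ==> v \<oplus>\<^bsub>V\<^esub> w = w \<oplus>\<^bsub>V\<^esub> v"
  "\<And>v w x. [|v \<in> carrier V; w \<in> carrier V; x \<in> carrier V|] ==> (v \<oplus>\<^bsub>V\<^esub> w) \<oplus>\<^bsub>V\<^esub> x = v \<oplus>\<^bsub>V\<^esub> (w \<oplus>\<^bsub>V\<^esub> x)"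
  "\<And>v. v \<in> carrier V ==> v \<oplus>\<^bsub>V\<^esub> \<zero>\<^bsub>V\<^esub> = v"
  "\<And>v. v \<in> carrier V ==> v \<oplus>\<^bsub>V\<^esub> (- 1) \<odot>\<^bsub>V\<^esub> v = \<zero>\<^bsub>V\<^esub>"
  "\<And>a b v. v \<in> carrier V ==> (a * b) \<odot>\<^bsub>V\<^esub> v = a \<odot>\<^bsub>V\<^esub> (b \<odot>\<^bsub>V\<^esub> v)"
  "\<And>v. v \<in> carrier V ==> 1 \<odot>\<^bsub>V\<^esub> v = v"
  "\<And>a b v. v \<in> carrier V ==> (a + b) \<odot>\<^bsub>V\<^esub> v = a \<odot>\<^bsub>V\<^esub> v \<oplus>\<^bsub>V\<^esub> b \<odot>\<^bsub>V\<^esub> v"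
  "\<And>a v w. [|v \<in> carrier V; w \<in> carrier V|] ==> a \<odot>\<^bsub>V\<^esub> (v \<oplus>\<^bsub>V\<^esub> w) = a \<odot>\<^bsub>V\<^esub> v \<oplus>\<^bsub>V\<^esub> a \<odot>\<^bsub>V\<^esub> w"
 shows "vsp V"
proof (rule vs_criteria)
 show "\<forall>v\<in>carrier V. \<exists>neg_v\<in>carrier V. v \<oplus>\<^bsub>V\<^esub> neg_v = \<zero>\<^bsub>V\<^esub>" using assms(3,7) by blast
qed (use assms class_field in auto)

lemma vsp_simps:
 fixes V (structure)
 assumes "vsp V"
 shows "\<zero> \<in> carrier V" "\<And>v w. [|v \<in> carrier V; w \<in> carrier V|] ==> v \<oplus> w \<in> carrier V"
  "\<And>c v. v \<in> carrier V ==> c \<odot> v \<in> carrier V"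
  "\<And>v w. [|v \<in> carrier V; w \<in> carrier V|] ==> v \<oplus> w = w \<oplus> v"
  "\<And>v w x. [|v \<in> carrier V; w \<in> carrier V; x \<in> carrier V|] ==> (v \<oplus> w) \<oplus> x = v \<oplus> (w \<oplus> x)"
  "\<And>v. v \<in> carrier V ==> v \<oplus> \<zero> = v" "\<And>v. v \<in> carrier V ==> \<zero> \<oplus> v = v"
  "\<And>v. v \<in> carrier V ==> v \<oplus> (- 1) \<odot> v = \<zero>"
  "\<And>a b v. v \<in> carrier V ==> a \<odot> (b \<odot> v) = (a * b) \<odot> v"
  "\<And>v. v \<in> carrier V ==> 1 \<odot> v = v" "\<And>v. v \<in> carrier V ==> 0 \<odot> v = \<zero>" "\<And>c. c \<odot> \<zero> = \<zero>"
  "\<And>a b v. v \<in> carrier V ==> a \<odot> v \<oplus> b \<odot> v = (a + b) \<odot> v"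
  "\<And>a v w. [|v \<in> carrier V; w \<in> carrier V|] ==> a \<odot> (v \<oplus> w) = a \<odot> v \<oplus> a \<odot> w"
  "\<And>v. v \<in> carrier V ==> \<ominus> v = (- 1) \<odot> v"
  "\<And>v w. [|v \<in> carrier V; w \<in> carrier V|] ==> v \<ominus> w = v \<oplus> (- 1) \<odot> w"
proof -
 interpret vectorspace class_ring V by fact
 have ag: "abelian_monoid V" by unfold_locales
 show g: "\<And>v. v \<in> carrier V ==> \<ominus> v = (- 1) \<odot> v" using vectorspace_minus_smult[OF assms] by blast
 show "\<And>v w. [|v \<in> carrier V; w \<in> carrier V|] ==> v \<ominus> w = v \<oplus> (- 1) \<odot> w"
  by (simp add: a_minus_def g)
 show "\<And>v. v \<in> carrier V ==> v \<oplus> (- 1) \<odot> v = \<zero>" using r_neg by (simp add: g)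
 show "\<And>a b v. v \<in> carrier V ==> a \<odot> (b \<odot> v) = (a * b) \<odot> v" using smult_assoc1 by simp
 show "\<And>v. v \<in> carrier V ==> 0 \<odot> v = \<zero>" using smult_l_null by simp
 show "\<And>c. c \<odot> \<zero> = \<zero>" using smult_r_null by simp
 show "\<And>v. v \<in> carrier V ==> 1 \<odot> v = v" using smult_one by simp
 show "\<And>a b v. v \<in> carrier V ==> a \<odot> v \<oplus> b \<odot> v = (a + b) \<odot> v" using smult_l_distr by simp
 show "\<And>a v w. [|v \<in> carrier V; w \<in> carrier V|] ==> a \<odot> (v \<oplus> w) = a \<odot> v \<oplus> a \<odot> w" using smult_r_distr by simp
 show "\<And>v w. [|v \<in> carrier V; w \<in> carrier V|] ==> v \<oplus> w = w \<oplus> v" by (rule abelian_monoid.a_comm[OF ag])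
 show "\<And>v w x. [|v \<in> carrier V; w \<in> carrier V; x \<in> carrier V|] ==> (v \<oplus> w) \<oplus> x = v \<oplus> (w \<oplus> x)"
  by (rule abelian_monoid.a_assoc[OF ag])
 show "\<zero> \<in> carrier V" "\<And>v w. [|v \<in> carrier V; w \<in> carrier V|] ==> v \<oplus> w \<in> carrier V"
  "\<And>c v. v \<in> carrier V ==> c \<odot> v \<in> carrier V"
  "\<And>v. v \<in> carrier V ==> v \<oplus> \<zero> = v" "\<And>v. v \<in> carrier V ==> \<zero> \<oplus> v = v"
  by auto
qed

lemma vsp_transport:
 assumes V: "vsp M" and j: "inj_on j (carrier M)"
 shows "vsp (transport j M)"
  and "lmap M (transport j M) j"
  and "lmap (transport j M) M (inv_into (carrier M) j)"
proof -
 interpret M: vectorspace class_ring M by (rule V)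
 note v = vsp_simps[OF V]
 show vt: "vsp (transport j M)"
  by (rule vspI) (use j in \<open>auto simp: v(1-3,5-) intro!: arg_cong[of _ _ j] v(4)\<close>)
 show "lmap M (transport j M) j" "lmap (transport j M) M (inv_into (carrier M) j)"
  using j by (auto intro!: lmapI V vt)
qed

lemma fd_transport: "[|fd_vectorspace M; inj_on j (carrier M)|] ==> fd_vectorspace (transport j M)"
 by (rule fd_vectorspace_surj[OF vsp_transport(2)]) (auto simp: fdD)

lemma vsp_subset:
 assumes V: "vsp M" and S: "S \<subseteq> carrier M" "\<zero>\<^bsub>M\<^esub> \<in> S"
  "\<And>x y. x \<in> S ==> y \<in> S ==> x \<oplus>\<^bsub>M\<^esub> y \<in> S" "\<And>c x. x \<in> S ==> c \<odot>\<^bsub>M\<^esub> x \<in> S"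
 shows "vsp (M\<lparr>carrier := S\<rparr>)"
proof -
 note v = vsp_simps[OF V]
 have "x \<in> carrier M" if "x \<in> S" for x using that S by auto
 thus ?thesis
  by (intro vspI) (auto simp: S(2-4) v(6-) intro: v(4) v(5))
qed

lemma vsp_infinite:
 fixes M :: "('k::field_char_0, 'v, 'x) module_scheme" (structure)
 assumes V: "vsp M" and x: "x \<in> carrier M" "x \<noteq> \<zero>"
 shows "inj (\<lambda>c. c \<odot> x)" "infinite (carrier M)"
proof -
 note v = vsp_simps[OF V]
 show inj: "inj (\<lambda>c. c \<odot> x)"
 proof (rule injI, rule ccontr)
  fix c d assume *: "c \<odot> x = d \<odot> x" "c \<noteq> d"
  have "(c + - d) \<odot> x = c \<odot> x \<oplus> (- d) \<odot> x" using x v(13) by simp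
  also have "\<dots> = \<zero>" unfolding *(1) using x by (simp add: v)
  finally have "inverse (c + - d) \<odot> ((c + - d) \<odot> x) = \<zero>" by (simp add: v)
  thus False using x * by (simp add: v)
 qed
 have "range (\<lambda>c. c \<odot> x) \<subseteq> carrier M" using x v by auto
 moreover have "infinite (range (\<lambda>c. c \<odot> x))"
  using inj infinite_UNIV_char_0 finite_imageD by blast
 ultimately show "infinite (carrier M)" using infinite_super by blast
qed

text \<open>A nonzero carrier contains the multiples of one vector, hence is infinite, and an
  infinite set is equinumerous with its square. Such a bijection encodes a direct sum of two copies
  of a module in its own carrier, and finite lists of elements of G in G.\<close>

lemma vsp_square_bij:
 fixes M :: "('k::field_char_0, 'v, 'x) module_scheme"
 assumes V: "vsp M"
 shows "\<exists>b. bij_betw b (carrier M \<times> carrier M) (carrier M)"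
proof (cases "carrier M = {\<zero>\<^bsub>M\<^esub>}")
 case True
 thus ?thesis by (intro exI[of _ "\<lambda>_. \<zero>\<^bsub>M\<^esub>"]) (auto simp: bij_betw_def)
next
 case False
 then obtain x where "x \<in> carrier M" "x \<noteq> \<zero>\<^bsub>M\<^esub>" using vsp_simps(1)[OF V] by blast
 hence "infinite (carrier M)" by (rule vsp_infinite(2)[OF V])
 thus ?thesis using card_of_Times_same_infinite[of "carrier M"] by (simp add: card_of_ordIso)
qed

subsection \<open>Clifford modules\<close>

text \<open>\<open>Inl i\<close> stands for the Clifford generator \<open>c\<^sub>i\<close>, and \<open>Inr w\<close> for \<open>c\<^sub>w\<close>.\<close>

definition gens :: "nat => ('k::field, 'w) module => (nat + 'w) set" where
 "gens r W = Inl ` {..<r} \<union> Inr ` carrier W"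

text \<open>A degenerate symmetric form: orthonormal on the generators \<open>Inl i\<close>, with
  all of W in its radical. Its Clifford algebra is that of rank r, tensored in the graded sense with
  the exterior algebra of W.\<close>

fun cform :: "nat + 'w => nat + 'w => 'k::field" where
 "cform (Inl i) (Inl j) = (if i = j then 1 else 0)"
| "cform _ _ = 0"

definition cliff_module :: "nat => ('k::field, 'w) module => ('k, nat + 'w, 'v) rep => bool" where
 "cliff_module r W M \<longleftrightarrow> fd_vectorspace M \<and> (\<forall>a\<in>gens r W. lmap M M (act M a)) \<and>
  (\<forall>w\<in>carrier W. \<forall>w'\<in>carrier W. \<forall>x\<in>carrier M.
    act M (Inr (w \<oplus>\<^bsub>W\<^esub> w')) x = act M (Inr w) x \<oplus>\<^bsub>M\<^esub> act M (Inr w') x) \<and>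
  (\<forall>c. \<forall>w\<in>carrier W. \<forall>x\<in>carrier M. act M (Inr (c \<odot>\<^bsub>W\<^esub> w)) x = c \<odot>\<^bsub>M\<^esub> act M (Inr w) x) \<and>
  (\<forall>a\<in>gens r W. \<forall>b\<in>gens r W. \<forall>x\<in>carrier M.
    act M a (act M b x) \<oplus>\<^bsub>M\<^esub> act M b (act M a x) = (- 2 * cform a b) \<odot>\<^bsub>M\<^esub> x)"

definition cliff_modules :: "nat => ('k::field, 'w) module => (('k, nat + 'w, 'v) rep, 'v => 'v) category" where
 "cliff_modules r W =
  \<lparr>Ob = {M. cliff_module r W M},
   Hom = rep_hom (gens r W),
   Ident = (\<lambda>M. \<lambda>x\<in>carrier M. x),
   Comp = (\<lambda>M N P \<psi> \<phi>. compose (carrier M) \<psi> \<phi>)\<rparr>"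

lemma cliffD:
 fixes M (structure)
 assumes "cliff_module r W M"
 shows "fd_vectorspace M" "vsp M" "a \<in> gens r W ==> lmap M M (act M a)" "act_closed (gens r W) M"
  "[|w \<in> carrier W; w' \<in> carrier W; x \<in> carrier M|] ==>
    act M (Inr (w \<oplus>\<^bsub>W\<^esub> w')) x = act M (Inr w) x \<oplus> act M (Inr w') x"
  "[|w \<in> carrier W; x \<in> carrier M|] ==> act M (Inr (c \<odot>\<^bsub>W\<^esub> w)) x = c \<odot> act M (Inr w) x"
  "[|a \<in> gens r W; b \<in> gens r W; x \<in> carrier M|] ==>
    act M a (act M b x) \<oplus> act M b (act M a x) = (- 2 * cform a b) \<odot> x"
 using assms fdD[of M] lmapD(3)[of M M]
 unfolding cliff_module_def act_closed_def by blast+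

lemma is_category_cliff: "is_category (cliff_modules r W)"
proof -
 have "vsp M \<and> act_closed (gens r W) M" if "M \<in> {M. cliff_module r W M}" for M
  using cliffD(2,4) that by blast
 from is_category_reps[where Obs = "{M. cliff_module r W M}" and Q = "\<lambda>_ _ _. True", OF this] show ?thesis by (simp add: cliff_modules_def)
qed

abbreviation cop :: "('k::field, 'a, 'v, 'x) rep_scheme => 'a => ('v, 'k) endo" where
 "cop M a \<equiv> Op M M (act M a)"

text \<open>The axioms of a Clifford module as identities of operators, where they can be multiplied
  and rearranged by the ring laws. The scalar on the right becomes a multiple of the
  projection.\<close>

lemma cop_simps:
 fixes W (structure)
 assumes M: "cliff_module r W M"
 shows "a \<in> gens r W ==> Pr M * cop M a = cop M a" "a \<in> gens r W ==> cop M a * Pr M = cop M a"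
  "Pr M * Pr M = Pr M"
  "[|a \<in> gens r W; b \<in> gens r W|] ==> cop M a * cop M b + cop M b * cop M a = sc (- 2 * cform a b) * Pr M"
  "[|w \<in> carrier W; w' \<in> carrier W|] ==> cop M (Inr (w \<oplus> w')) = cop M (Inr w) + cop M (Inr w')"
  "w \<in> carrier W ==> cop M (Inr (c \<odot> w)) = sc c * cop M (Inr w)"
proof -
 note m = cliffD[OF M]
 have g: "w \<in> carrier W ==> Inr w \<in> gens r W" for w by (auto simp: gens_def)
 show "a \<in> gens r W ==> Pr M * cop M a = cop M a" "a \<in> gens r W ==> cop M a * Pr M = cop M a"
  using Pr_Op[OF m(1,1)] m(3) by blast+
 show "Pr M * Pr M = Pr M" using Pr_Op[OF m(1,1)] lmap_id[OF m(2)] by blast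
 show "cop M a * cop M b + cop M b * cop M a = sc (- 2 * cform a b) * Pr M" if "a \<in> gens r W" "b \<in> gens r W"
 proof -
  have "sc (- 2 * cform a b) * Pr M = Op M M (\<lambda>x. (- 2 * cform a b) \<odot>\<^bsub>M\<^esub> x)"
   using Op_smult[OF m(1,1) lmap_id[OF m(2)]] by simp
  also have "\<dots> = Op M M (\<lambda>x. act M a (act M b x) \<oplus>\<^bsub>M\<^esub> act M b (act M a x))"
   using m(7) that by (intro Op_cong[OF m(1)]) simp
  also have "\<dots> = Op M M (\<lambda>x. act M a (act M b x)) + Op M M (\<lambda>x. act M b (act M a x))"
   by (rule Op_add[OF m(1,1) lmap_comp[OF m(3)[OF that(2)] m(3)[OF that(1)]]
      lmap_comp[OF m(3)[OF that(1)] m(3)[OF that(2)]]])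
  also have "\<dots> = cop M a * cop M b + cop M b * cop M a"
   by (simp only: Op_mult[OF m(1,1,1) m(3)[OF that(2)] m(3)[OF that(1)]] Op_mult[OF m(1,1,1) m(3)[OF that(1)] m(3)[OF that(2)]])
  finally show ?thesis by (rule sym)
 qed
 show "cop M (Inr (w \<oplus> w')) = cop M (Inr w) + cop M (Inr w')" if "w \<in> carrier W" "w' \<in> carrier W"
  using that m g by (subst Op_add[symmetric]) (auto intro!: Op_cong)
 show "cop M (Inr (c \<odot> w)) = sc c * cop M (Inr w)" if "w \<in> carrier W"
  using that m g by (subst Op_smult[symmetric]) (auto intro!: Op_cong)
qed

definition img :: "'k::alg_closed_field" where
 "img = (SOME i. i * i = - 1)"

lemma img_sq: "img * img = (- 1 :: 'k::alg_closed_field)"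
proof -
 obtain y :: 'k where "y ^ 2 = - 1" using nth_root_exists[of 2 "- 1"] by auto
 thus ?thesis unfolding img_def by (intro someI[of "\<lambda>i. i * i = - 1" y]) (simp add: power2_eq_square)
qed

lemma img_nz: "img \<noteq> (0 :: 'k::alg_closed_field)"
 using img_sq[where ?'k = 'k] by auto

lemma De_De:
 assumes "fd_vectorspace M" "fd_vectorspace N" "fd_vectorspace K"
 shows "De N K S (De M N T x) = De M K (S * Pr N * T) x"
 using assms by (simp add: De_def app_Op lmap_id fdD)

lemma cop_square:
 fixes W :: "('k::field_char_0, 'w) module"
 assumes "cliff_module r W M" "i < r"
 shows "cop M (Inl i) * cop M (Inl i) = - Pr M"
proof (rule sc_cancel[of 2])
 have "Inl i \<in> gens r W" using assms(2) by (auto simp: gens_def)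
 from cop_simps(4)[OF assms(1) this this]
 show "sc 2 * (cop M (Inl i) * cop M (Inl i)) = sc 2 * (- Pr M)" by (simp add: mult_2)
qed simp

lemma cop_anticommute:
 assumes "cliff_module r W M" "a \<in> gens r W" "b \<in> gens r W" "cform a b = (0 :: 'k::field)"
 shows "cop M b * cop M a = - (cop M a * (cop M b :: ('v, 'k) endo))"
 using cop_simps(4)[OF assms(1-3)] assms(4) by (simp add: eq_neg_iff_add_eq_0 add.commute)

lemma De_cop:
 assumes "cliff_module r W M" "a \<in> gens r W" "x \<in> carrier M"
 shows "De M M (cop M a) x = act M a x"
 using De_Op[of M M] cliffD[OF assms(1)] assms(2,3) by blast

subsection \<open>Splitting off a hyperbolic plane\<close>

text \<open>The operators \<open>psip\<close> and \<open>psim\<close> belong to the isotropic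
  vectors of the plane spanned by the last two generators. As both generators square to -1, the two
  operators square to 0 and their anticommutator is 2 * (-1) + 2 * (-1) = -4.\<close>

definition psip :: "nat => ('k::alg_closed_field, nat + 'w, 'v) rep => ('v, 'k) endo" where
 "psip r M = cop M (Inl r) + sc img * cop M (Inl (Suc r))"

definition psim :: "nat => ('k::alg_closed_field, nat + 'w, 'v) rep => ('v, 'k) endo" where
 "psim r M = cop M (Inl r) - sc img * cop M (Inl (Suc r))"

text \<open>The vacuum vectors of a Fock space, with \<open>psip\<close> as the annihilation
  operator. The action is left unchanged, because the first r generators and W anticommute with
  \<open>psip\<close> and so preserve its kernel.\<close>

definition vac :: "nat => ('k::alg_closed_field, nat + 'w, 'v) rep => ('k, nat + 'w, 'v) rep" where
 "vac r M = M\<lparr>carrier := {x \<in> carrier M. De M M (psip r M) x = \<zero>\<^bsub>M\<^esub>}\<rparr>"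

context
 fixes r :: nat and W :: "('k::{alg_closed_field, field_char_0}, 'w) module" and M :: "('k, nat + 'w, 'v) rep" (structure)
 assumes M: "cliff_module (Suc (Suc r)) W M"
begin

lemma gens_Suc: "Inl r \<in> gens (Suc (Suc r)) W" "Inl (Suc r) \<in> gens (Suc (Suc r)) W"
 "a \<in> gens r W ==> a \<in> gens (Suc (Suc r)) W"
 "a \<in> gens r W ==> cform a (Inl r) = 0" "a \<in> gens r W ==> cform a (Inl (Suc r)) = 0"
 by (auto simp: gens_def)

lemma psi_simps:
 shows "psip r M * psip r M = 0" "psim r M * psim r M = 0"
  "psip r M * psim r M + psim r M * psip r M = sc (- 4) * Pr M"
  "psip r M * Pr M = psip r M" "psim r M * Pr M = psim r M" "Pr M * psip r M = psip r M" "Pr M * psim r M = psim r M"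
  "a \<in> gens r W ==> psip r M * cop M a = - (cop M a * psip r M)"
  "a \<in> gens r W ==> psim r M * cop M a = - (cop M a * psim r M)"
proof -
 define p q s P where "p = cop M (Inl r)" and "q = cop M (Inl (Suc r))" and "s = (sc img :: ('v, 'k) endo)" and "P = Pr M"
 have pq: "p * p = - P" "q * q = - P" "q * p = - (p * q)"
  using cop_square[OF M] cop_anticommute[OF M gens_Suc(1,2)] by (simp_all add: p_def q_def P_def)
 have four: "4 * P = P + (P + (P + P))"
  by (simp only: numeral.simps distrib_right mult_1 add.assoc)
 have ss: "s * (s * U) = - U" for U
  unfolding s_def by (simp only: mult.assoc[symmetric] sc_mult[symmetric] img_sq) simp
 have sp: "p * (s * U) = s * (p * U)" "q * (s * U) = s * (q * U)" for U
  unfolding s_def by (simp_all only: sc_left_commute)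
 have def': "psip r M = p + s * q" "psim r M = p - s * q"
  by (simp_all add: psip_def psim_def p_def q_def s_def)
 show "psip r M * psip r M = 0" "psim r M * psim r M = 0"
  "psip r M * psim r M + psim r M * psip r M = sc (- 4) * Pr M"
  unfolding def' P_def[symmetric]
  by (simp_all add: algebra_simps pq sp ss mult.assoc four)
 have P: "p * P = p" "q * P = q" "P * p = p" "P * q = q" "P * (s * U) = s * (P * U)" for U
  using cop_simps(1,2)[OF M] gens_Suc(1,2) sc_left_commute[of P img U]
  by (simp_all add: p_def q_def P_def s_def)
 show "psip r M * Pr M = psip r M" "psim r M * Pr M = psim r M" "Pr M * psip r M = psip r M" "Pr M * psim r M = psim r M"
  unfolding def' P_def[symmetric] by (simp_all add: algebra_simps P mult.assoc)
 assume a: "a \<in> gens r W"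
 define A where "A = cop M a"
 have A: "p * A = - (A * p)" "q * A = - (A * q)"
  using cop_anticommute[OF M gens_Suc(3)[OF a] gens_Suc(1) gens_Suc(4)[OF a]]
   cop_anticommute[OF M gens_Suc(3)[OF a] gens_Suc(2) gens_Suc(5)[OF a]] by (simp_all add: A_def p_def q_def)
 have sA: "A * (s * U) = s * (A * U)" for U unfolding s_def by (simp only: sc_left_commute)
 show "psip r M * cop M a = - (cop M a * psip r M)" "psim r M * cop M a = - (cop M a * psim r M)"
  unfolding def' A_def[symmetric] by (simp_all add: algebra_simps A sA mult.assoc)
qed

abbreviation (input) "ps \<equiv> De M M (psip r M)"
abbreviation (input) "qs \<equiv> De M M (psim r M)"

text \<open>The operator identities read back on vectors through \<open>De\<close>, together with
  the formulas expressing the last two generators by \<open>psip\<close> and \<open>psim\<close> and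
  conversely.\<close>

lemma psi_elem:
 shows "lmap M M ps" "lmap M M qs"
  "x \<in> carrier M ==> ps (ps x) = \<zero>" "x \<in> carrier M ==> qs (qs x) = \<zero>"
  "x \<in> carrier M ==> ps (qs x) \<oplus> qs (ps x) = (- 4) \<odot> x"
  "x \<in> carrier M ==> ps (qs (ps x)) = (- 4) \<odot> ps x"
  "x \<in> carrier M ==> qs (ps (qs x)) = (- 4) \<odot> qs x"
  "[|a \<in> gens r W; x \<in> carrier M|] ==> ps (act M a x) = (- 1) \<odot> act M a (ps x)"
  "[|a \<in> gens r W; x \<in> carrier M|] ==> qs (act M a x) = (- 1) \<odot> act M a (qs x)"
  "x \<in> carrier M ==> act M (Inl r) x = (1 / 2) \<odot> (ps x \<oplus> qs x)"
  "x \<in> carrier M ==> act M (Inl (Suc r)) x = (- img / 2) \<odot> (ps x \<oplus> (- 1) \<odot> qs x)"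
  "x \<in> carrier M ==> ps x = act M (Inl r) x \<oplus> img \<odot> act M (Inl (Suc r)) x"
  "x \<in> carrier M ==> qs x = act M (Inl r) x \<oplus> (- img) \<odot> act M (Inl (Suc r)) x"
proof -
 note m = cliffD[OF M] and s = psi_simps
 note dd = De_De[OF m(1,1,1)] and da = De_add[OF m(1,1), symmetric] and ds = De_smult[OF m(1,1), symmetric]
 have de: "act M b x = De M M (cop M b) x" if "b \<in> gens (Suc (Suc r)) W" "x \<in> carrier M" for b x
  using De_cop[OF M that] by simp
 have d1: "x = De M M (Pr M) x" if "x \<in> carrier M" for x
  using De_Op[OF m(1,1) lmap_id[OF m(2)] that] by simp
 show "lmap M M ps" "lmap M M qs" using De_linear m(1) by blast+
 have z: "De M M 0 x = \<zero>" for x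
  using iota_smult[OF m(1), of 0 0] vsp_simps(11)[OF m(2) iota_closed[OF m(1)], of 0] by (simp add: De_def zero_fun_def)
 have p3: "psip r M * (psim r M * psip r M) = sc (- 4) * psip r M" "psim r M * (psip r M * psim r M) = sc (- 4) * psim r M"
  using arg_cong[OF s(3), of "\<lambda>T. T * psip r M"] arg_cong[OF s(3), of "\<lambda>T. T * psim r M"] s(1,2)
  by (simp_all add: distrib_right mult.assoc s(6,7))
 assume x: "x \<in> carrier M"
 show "ps (ps x) = \<zero>" "qs (qs x) = \<zero>" by (simp_all add: dd s z)
 show "ps (qs x) \<oplus> qs (ps x) = (- 4) \<odot> x" 
  by (subst (3) d1[OF x]) (simp only: dd da ds s)
 show "ps (qs (ps x)) = (- 4) \<odot> ps x" "qs (ps (qs x)) = (- 4) \<odot> qs x"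
  by (simp_all only: dd ds s p3)
 show "ps (act M a x) = (- 1) \<odot> act M a (ps x)" "qs (act M a x) = (- 1) \<odot> act M a (qs x)" if a: "a \<in> gens r W"
 proof -
  have px: "ps x \<in> carrier M" "qs x \<in> carrier M"
   using lmapD(3)[OF De_linear[OF m(1,1)] x] by blast+
  show "ps (act M a x) = (- 1) \<odot> act M a (ps x)" "qs (act M a x) = (- 1) \<odot> act M a (qs x)"
   unfolding de[OF gens_Suc(3)[OF a] x] de[OF gens_Suc(3)[OF a] px(1)] de[OF gens_Suc(3)[OF a] px(2)]
   by (simp_all add: dd ds s a cop_simps(2)[OF M gens_Suc(3)[OF a]])
 qed
 have h: "sc (1 / 2) * (T + T) = (T :: ('v, 'k) endo)" for T
  by (simp only: mult_2[symmetric] sc_numeral[symmetric] mult.assoc[symmetric] sc_mult[symmetric]) simp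
 have "sc (1 / 2) * (psip r M + psim r M) = cop M (Inl r)"
  using h[of "cop M (Inl r)"] by (simp add: psip_def psim_def)
 thus "act M (Inl r) x = (1 / 2) \<odot> (ps x \<oplus> qs x)"
  unfolding de[OF gens_Suc(1) x] by (simp only: da ds)
 have "sc (- img / 2) * (psip r M + sc (- 1) * psim r M) = sc (- img) * (sc (1 / 2) * (sc img * cop M (Inl (Suc r)) + sc img * cop M (Inl (Suc r))))"
  by (simp add: psip_def psim_def sc_mult[symmetric] mult.assoc[symmetric])
 also have "\<dots> = cop M (Inl (Suc r))"
  unfolding h by (simp only: mult.assoc[symmetric] sc_mult[symmetric]) (simp add: img_sq)
 finally show "act M (Inl (Suc r)) x = (- img / 2) \<odot> (ps x \<oplus> (- 1) \<odot> qs x)"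
  unfolding de[OF gens_Suc(2) x] by (simp only: da ds)
 show "ps x = act M (Inl r) x \<oplus> img \<odot> act M (Inl (Suc r)) x"
  "qs x = act M (Inl r) x \<oplus> (- img) \<odot> act M (Inl (Suc r)) x"
  unfolding de[OF gens_Suc(1) x] de[OF gens_Suc(2) x] by (simp_all add: da ds psip_def psim_def)
qed

lemma vac_simps:
 "carrier (vac r M) = {x \<in> carrier M. ps x = \<zero>}" "add (vac r M) = add M" "smult (vac r M) = smult M"
 "zero (vac r M) = zero M" "act (vac r M) = act M"
 by (simp_all add: vac_def)

lemma vac_closed: "x \<in> carrier M ==> ps x \<in> carrier (vac r M)"
 using psi_elem(3) lmapD(3)[OF psi_elem(1)] by (simp add: vac_simps)

text \<open>The relations are inherited from M; the point is finite dimension, obtained by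
  exhibiting the kernel of \<open>psip\<close> as a linear image of M.\<close>

lemma cliff_module_vac: "cliff_module r W (vac r M)"
proof -
 note m = cliffD[OF M] and p = lmapD[OF psi_elem(1)] and q = lmapD[OF psi_elem(2)]
 note v = vsp_simps[OF m(2)]
 have vv: "vsp (vac r M)"
  unfolding vac_def by (rule vsp_subset[OF m(2)]) (auto simp: v p)
 \<comment> \<open>The values are killed by ps because its square is 0; on the kernel of ps this map
   is multiplication by -4, so it is onto.\<close>
 have l: "lmap M (vac r M) (\<lambda>x. ps (qs x))"
  by (rule lmapI[OF m(2) vv]) (auto simp: vac_simps p(3-5) q(3-5) psi_elem(3))
 have fd: "fd_vectorspace (vac r M)"
 proof (rule fd_vectorspace_surj[OF l m(1)])
  have "x \<in> (\<lambda>x. ps (qs x)) ` carrier M" if x: "x \<in> carrier (vac r M)" for x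
  proof -
   have xM: "x \<in> carrier M" "ps x = \<zero>" using x by (auto simp: vac_simps)
   have "ps (qs x) = (- 4) \<odot> x" using psi_elem(5)[OF xM(1)] xM q(6) p(3) q(3) by (simp add: v)
   hence "x = ps (qs ((- 1 / 4) \<odot> x))" using xM p q by (simp add: v)
   thus ?thesis using xM v by blast
  qed
  thus "(\<lambda>x. ps (qs x)) ` carrier M = carrier (vac r M)"
   using lmapD(3)[OF l] by blast
 qed
 have lact: "lmap (vac r M) (vac r M) (act (vac r M) a)" if a: "a \<in> gens r W" for a
 proof (rule lmapI[OF vv vv])
  note am = lmapD[OF m(3)[OF gens_Suc(3)[OF a]]]
  show "act (vac r M) a x \<in> carrier (vac r M)" if "x \<in> carrier (vac r M)" for x
   using that am psi_elem(8)[OF a] by (auto simp: vac_simps v)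
 qed (use lmapD[OF m(3)[OF gens_Suc(3)[OF a]]] in \<open>auto simp: vac_simps\<close>)
 show ?thesis
  unfolding cliff_module_def using fd lact m(5-7) gens_Suc(3) by (auto simp: vac_simps)
qed

end

lemma rep_hom_psi:
 fixes W :: "('k::{alg_closed_field, field_char_0}, 'w) module"
 assumes M: "cliff_module (Suc (Suc r)) W M" and N: "cliff_module (Suc (Suc r)) W N"
  and \<phi>: "\<phi> \<in> rep_hom (gens (Suc (Suc r)) W) M N" and x: "x \<in> carrier M"
 shows "\<phi> (De M M (psip r M) x) = De N N (psip r N) (\<phi> x)" "\<phi> (De M M (psim r M) x) = De N N (psim r N) (\<phi> x)"
proof -
 note h = rep_homD[OF \<phi>] and l = lmapD[OF rep_homD(2)[OF \<phi>]]
 have g: "Inl r \<in> gens (Suc (Suc r)) W" "Inl (Suc r) \<in> gens (Suc (Suc r)) W" by (auto simp: gens_def)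
 have c: "act M (Inl r) x \<in> carrier M" "act M (Inl (Suc r)) x \<in> carrier M"
  using cliffD(4)[OF M] g x by (auto simp: act_closed_def)
 note v = vsp_simps[OF cliffD(2)[OF M]]
 show "\<phi> (De M M (psip r M) x) = De N N (psip r N) (\<phi> x)" "\<phi> (De M M (psim r M) x) = De N N (psim r N) (\<phi> x)"
  unfolding psi_elem(12,13)[OF M x] psi_elem(12,13)[OF N h(4)[OF x]]
  using c v by (simp_all add: l h(3)[OF g(1) x] h(3)[OF g(2) x])
qed

lemma is_iso_cliffI:
 assumes "cliff_module r W M" "cliff_module r W N" "\<phi> \<in> rep_hom (gens r W) M N" "bij_betw \<phi> (carrier M) (carrier N)"
 shows "is_iso (cliff_modules r W) M N \<phi>"
 using assms rep_hom_inverse[OF assms(3,4) cliffD(4)[OF assms(1)] cliffD(4)[OF assms(2)]]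
 unfolding is_iso_def cliff_modules_def by auto

lemma gens_cases:
 assumes "a \<in> gens (Suc (Suc r)) W"
 obtains "a \<in> gens r W" | "a = Inl r" | "a = Inl (Suc r)"
 using assms by (auto simp: gens_def less_Suc_eq)

text \<open>The anticommutator -4 splits M into the vacuum space and its image under
  \<open>psim\<close>. A morphism commutes with \<open>psim\<close>, so it is determined by its
  restriction to the vacuum, and every morphism of vacuum spaces extends.\<close>

lemma vac_fully_faithful:
 fixes W :: "('k::{alg_closed_field, field_char_0}, 'w) module"
 assumes M: "cliff_module (Suc (Suc r)) W M" and N: "cliff_module (Suc (Suc r)) W N"
 shows "bij_betw (\<lambda>\<phi>. restrict \<phi> (carrier (vac r M))) (rep_hom (gens (Suc (Suc r)) W) M N)
  (rep_hom (gens r W) (vac r M) (vac r N))"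
proof -
 let ?A = "gens (Suc (Suc r)) W"
 note m = cliffD[OF M] and n = cliffD[OF N]
 note vm = vsp_simps[OF m(2)] and vn = vsp_simps[OF n(2)]
 note pm = lmapD[OF psi_elem(1)[OF M]] and qm = lmapD[OF psi_elem(2)[OF M]]
 note pn = lmapD[OF psi_elem(1)[OF N]] and qn = lmapD[OF psi_elem(2)[OF N]]
 note M' = cliff_module_vac[OF M] and N' = cliff_module_vac[OF N]
 have vac_sub: "x \<in> carrier M" if "x \<in> carrier (vac r M)" for x using that by (auto simp: vac_simps[OF M])
 have into: "restrict \<phi> (carrier (vac r M)) \<in> rep_hom (gens r W) (vac r M) (vac r N)" if \<phi>: "\<phi> \<in> rep_hom ?A M N" for \<phi>
 proof (rule rep_homI)
  note h = rep_homD[OF \<phi>] and l = lmapD[OF rep_homD(2)[OF \<phi>]]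
  show "lmap (vac r M) (vac r N) \<phi>"
   by (rule lmapI[OF cliffD(2)[OF M'] cliffD(2)[OF N']])
    (use rep_hom_psi(1)[OF M N \<phi>] l in \<open>auto simp: vac_simps[OF M] vac_simps[OF N]\<close>, metis)
  show "act_closed (gens r W) (vac r M)" by (rule cliffD(4)[OF M'])
  show "\<phi> (act (vac r M) a x) = act (vac r N) a (\<phi> x)" if "a \<in> gens r W" "x \<in> carrier (vac r M)" for a x
   using h(3)[OF gens_Suc(3)[OF M that(1)] vac_sub[OF that(2)]] by (simp add: vac_simps[OF M] vac_simps[OF N])
 qed
 have split: "x = (- 1 / 4) \<odot>\<^bsub>M\<^esub> (De M M (psip r M) (De M M (psim r M) x) \<oplus>\<^bsub>M\<^esub> De M M (psim r M) (De M M (psip r M) x))"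
  if "x \<in> carrier M" for x
  using that by (simp add: psi_elem(5)[OF M] vm)
 have inj: "inj_on (\<lambda>\<phi>. restrict \<phi> (carrier (vac r M))) (rep_hom ?A M N)"
 proof (rule inj_onI)
  fix \<phi> \<phi>'
  assume h: "\<phi> \<in> rep_hom ?A M N" "\<phi>' \<in> rep_hom ?A M N" "restrict \<phi> (carrier (vac r M)) = restrict \<phi>' (carrier (vac r M))"
  have eq: "\<phi> x = \<phi>' x" if "x \<in> carrier (vac r M)" for x using fun_cong[OF h(3), of x] that by simp
  have "\<phi> x = \<phi>' x" if x: "x \<in> carrier M" for x
  proof -
   have 1: "\<chi> x = (- 1 / 4) \<odot>\<^bsub>N\<^esub> (\<chi> (De M M (psip r M) (De M M (psim r M) x)) \<oplus>\<^bsub>N\<^esub> De N N (psim r N) (\<chi> (De M M (psip r M) x)))"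
    if c: "\<chi> \<in> rep_hom ?A M N" for \<chi>
    using lmapD[OF rep_homD(2)[OF c]] x pm(3) qm(3) rep_hom_psi(2)[OF M N c]
    by (subst split[OF x]) (simp add: vm vn qn)
   show ?thesis
    unfolding 1[OF h(1)] 1[OF h(2)] using vac_closed[OF M] x qm(3) by (simp add: eq)
  qed
  thus "\<phi> = \<phi>'" using rep_homD(1)[OF h(1)] rep_homD(1)[OF h(2)] by (auto intro: extensionalityI)
 qed
 have surj: "\<exists>\<phi>\<in>rep_hom ?A M N. restrict \<phi> (carrier (vac r M)) = \<chi>" if \<chi>: "\<chi> \<in> rep_hom (gens r W) (vac r M) (vac r N)" for \<chi>
 proof -
  note h = rep_homD[OF \<chi>] and l = lmapD[OF rep_homD(2)[OF \<chi>]]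
  define p p' q q' where "p = De M M (psip r M)" and "p' = De N N (psip r N)" and "q = De M M (psim r M)" and "q' = De N N (psim r N)"
  note pq = p_def[symmetric] p'_def[symmetric] q_def[symmetric] q'_def[symmetric]
  note em = psi_elem[OF M, unfolded pq] and en = psi_elem[OF N, unfolded pq]
  note pm = lmapD[OF em(1)] and qm = lmapD[OF em(2)]
  note pn = lmapD[OF en(1)] and qn = lmapD[OF en(2)]
  \<comment> \<open>The extension forced by the splitting x = -1/4 (p q x + q p x): the first
    summand is a vacuum vector and is sent by \<chi>, the second is q applied to the vacuum vector p
    x.\<close>
  define \<Phi> where "\<Phi> x = (- 1 / 4) \<odot>\<^bsub>N\<^esub> (\<chi> (p (q x)) \<oplus>\<^bsub>N\<^esub> q' (\<chi> (p x)))" for x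
  have pv: "p x \<in> carrier (vac r M)" if "x \<in> carrier M" for x using vac_closed[OF M that] by (simp add: p_def)
  have \<chi>N: "\<chi> x \<in> carrier N" "p' (\<chi> x) = \<zero>\<^bsub>N\<^esub>" if "x \<in> carrier (vac r M)" for x
   using h(4)[OF that] by (auto simp: vac_simps[OF N] pq)
  have \<chi>l: "\<chi> (c \<odot>\<^bsub>M\<^esub> x) = c \<odot>\<^bsub>N\<^esub> \<chi> x" if "x \<in> carrier (vac r M)" for x c
   using l(5) that by (simp_all add: vac_simps[OF N] vac_simps[OF M])
  have \<chi>0: "\<chi> \<zero>\<^bsub>M\<^esub> = \<zero>\<^bsub>N\<^esub>" using l(6) by (simp add: vac_simps[OF N] vac_simps[OF M])
  have \<chi>a: "\<chi> (act M a x) = act N a (\<chi> x)" if "a \<in> gens r W" "x \<in> carrier (vac r M)" for a x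
   using h(3)[OF that] by (simp add: vac_simps[OF N] vac_simps[OF M])
  have lp: "lmap M (vac r M) p"
   by (rule lmapI[OF m(2) cliffD(2)[OF M']]) (simp_all add: pv pm vac_simps(2,3)[OF M])
  have li: "lmap (vac r N) N (\<lambda>x. x)"
   by (rule lmapI[OF cliffD(2)[OF N'] n(2)]) (auto simp: vac_simps[OF N])
  have l1: "lmap M N (\<lambda>x. \<chi> (p x))"
   using lmap_comp[OF lmap_comp[OF lp h(2)] li] .
  have l\<Phi>: "lmap M N \<Phi>" unfolding \<Phi>_def
   by (rule lmap_smult[OF lmap_add[OF lmap_comp[OF em(2) l1] lmap_comp[OF l1 en(2)]]])
  note L = lmapD[OF l\<Phi>]
  have \<Phi>p: "\<Phi> (p x) = \<chi> (p x)" if "x \<in> carrier M" for x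
   using that pm(3) qm(3) \<chi>N pv unfolding \<Phi>_def by (simp add: em(3-9) \<chi>l \<chi>0 qn vn)
  have \<Phi>q: "\<Phi> (q x) = (- 1 / 4) \<odot>\<^bsub>N\<^esub> q' (\<chi> (p (q x)))" if "x \<in> carrier M" for x
   using that pm qm(3) \<chi>N pv qn unfolding \<Phi>_def by (simp add: em(3-9) \<chi>0 vn)
  have p'q': "p' (q' y) = (- 4) \<odot>\<^bsub>N\<^esub> y" if "y \<in> carrier N" "p' y = \<zero>\<^bsub>N\<^esub>" for y
   using en(5)[OF that(1)] that qn pn by (simp add: vn)
  have cp: "\<Phi> (p x) = p' (\<Phi> x)" if "x \<in> carrier M" for x
   unfolding \<Phi>p[OF that] unfolding \<Phi>_def using that pm(3) qm(3) \<chi>N pv qn(3) by (simp add: pn p'q' vn)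
  have cq: "\<Phi> (q x) = q' (\<Phi> x)" if "x \<in> carrier M" for x
   unfolding \<Phi>q[OF that] unfolding \<Phi>_def using that pm(3) qm(3) \<chi>N pv qn(3) by (simp add: qn en(3-9) vn)
  have ca: "\<Phi> (act M a x) = act N a (\<Phi> x)" if a: "a \<in> gens r W" and x: "x \<in> carrier M" for a x
  proof -
   note am = lmapD[OF m(3)[OF gens_Suc(3)[OF M a]]] and an = lmapD[OF n(3)[OF gens_Suc(3)[OF M a]]]
   have 1: "p (q (act M a x)) = act M a (p (q x))"
    using x a am qm(3) pm by (simp add: em(3-9) vm)
   have 2: "p (act M a x) = (- 1) \<odot>\<^bsub>M\<^esub> act M a (p x)" using x a by (simp add: em(3-9))
   have 3: "\<chi> ((- 1) \<odot>\<^bsub>M\<^esub> act M a (p x)) = (- 1) \<odot>\<^bsub>N\<^esub> act N a (\<chi> (p x))"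
    using \<chi>l[of "act M a (p x)"] \<chi>a[OF a pv[OF x]] cliffD(4)[OF M'] pv[OF x] a
    by (auto simp: act_closed_def vac_simps[OF M])
   show ?thesis unfolding \<Phi>_def 1 2 3 \<chi>a[OF a pv[OF qm(3)[OF x]]]
    using \<chi>N(1)[OF pv[OF x]] \<chi>N(1)[OF pv[OF qm(3)[OF x]]] an(3) qn a by (simp add: en(3-9) an vn)
  qed
  have "restrict \<Phi> (carrier M) \<in> rep_hom ?A M N"
  proof (rule rep_homI[OF l\<Phi> m(4)])
   fix a x assume a: "a \<in> ?A" and x: "x \<in> carrier M"
   show "\<Phi> (act M a x) = act N a (\<Phi> x)"
    using a
   proof (cases rule: gens_cases)
    case 1
    thus ?thesis using ca x by blast
   next
    case 2
    show ?thesis unfolding 2 em(10)[OF x] en(10)[OF L(3)[OF x]] using x pm(3) qm(3) vm(2,3) by (simp add: L cp cq)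
   next
    case 3
    show ?thesis unfolding 3 em(11)[OF x] en(11)[OF L(3)[OF x]] using x pm(3) qm(3) vm(2,3) by (simp add: L cp cq)
   qed
  qed
  moreover have "restrict (restrict \<Phi> (carrier M)) (carrier (vac r M)) = \<chi>"
  proof (rule extensionalityI[OF _ h(1)])
   fix x assume x: "x \<in> carrier (vac r M)"
   have xM: "x \<in> carrier M" "p x = \<zero>\<^bsub>M\<^esub>" using x by (auto simp: vac_simps[OF M] pq)
   have "p (q x) = (- 4) \<odot>\<^bsub>M\<^esub> x" using em(5)[OF xM(1)] xM qm pm by (simp add: vm)
   hence "\<Phi> x = \<chi> x"
    unfolding \<Phi>_def using xM \<chi>l[OF x] \<chi>0 \<chi>N(1)[OF x] qn by (simp add: vn)
   thus "restrict (restrict \<Phi> (carrier M)) (carrier (vac r M)) x = \<chi> x" using x xM by simp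
  qed (simp add: extensional_def)
  ultimately show ?thesis by blast
 qed
 show ?thesis unfolding bij_betw_def using inj into surj by (force simp: image_iff)
qed

text \<open>Z tensored with the two-dimensional spinor module. In blocks, generator r is (0 1; -1
  0), generator r + 1 is i (0 1; 1 0), and the remaining ones are twisted by diag(-1, 1) so that
  they anticommute with these two. The injection j encodes pairs as elements of the carrier
  type.\<close>

definition double :: "nat => ('k::alg_closed_field, nat + 'w, 'v) rep => ('v \<times> 'v => 'v) => ('k, nat + 'w, 'v) rep" where
 "double r Z j = module.extend (transport j (direct_sum Z Z)) (rep.fields
  (\<lambda>a u. let (x, y) = inv_into (carrier Z \<times> carrier Z) j u in
   j (if a = Inl r then (y, (- 1) \<odot>\<^bsub>Z\<^esub> x) else if a = Inl (Suc r) then (img \<odot>\<^bsub>Z\<^esub> y, img \<odot>\<^bsub>Z\<^esub> x)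
     else ((- 1) \<odot>\<^bsub>Z\<^esub> act Z a x, act Z a y))))"

lemma vsp_direct_sum: "vsp M ==> vsp N ==> vsp (direct_sum M N)"
 by (rule direct_sum_is_vs)

lemma direct_sum_simps [simp]:
 "carrier (direct_sum M N) = carrier M \<times> carrier N" "\<zero>\<^bsub>direct_sum M N\<^esub> = (\<zero>\<^bsub>M\<^esub>, \<zero>\<^bsub>N\<^esub>)"
 "x \<oplus>\<^bsub>direct_sum M N\<^esub> y = (fst x \<oplus>\<^bsub>M\<^esub> fst y, snd x \<oplus>\<^bsub>N\<^esub> snd y)"
 "c \<odot>\<^bsub>direct_sum M N\<^esub> x = (c \<odot>\<^bsub>M\<^esub> fst x, c \<odot>\<^bsub>N\<^esub> snd x)"
 by (simp_all add: direct_sum_def)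

lemma fd_direct_sum:
 fixes N (structure) and M :: "('k::field, 'u, 'x) module_scheme"
 assumes M: "fd_vectorspace M" and N: "fd_vectorspace N"
 shows "fd_vectorspace (direct_sum M N)"
proof -
 let ?D = "direct_sum M N"
 note vm = vsp_simps[OF fdD(1)[OF M]] and vn = vsp_simps[OF fdD(1)[OF N]]
 interpret M: vectorspace class_ring M using fdD(1)[OF M] .
 interpret N: vectorspace class_ring N using fdD(1)[OF N] .
 interpret D: vectorspace class_ring ?D using vsp_direct_sum[OF fdD(1)[OF M] fdD(1)[OF N]] .
 obtain A where A: "finite A" "A \<subseteq> carrier M" "M.span A = carrier M"
  using M by (auto simp: fd_vectorspace_def M.fin_dim_def)
 obtain B where B: "finite B" "B \<subseteq> carrier N" "N.span B = carrier N"
  using N by (auto simp: fd_vectorspace_def N.fin_dim_def)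
 let ?S = "(\<lambda>a. (a, \<zero>)) ` A \<union> (\<lambda>b. (\<zero>\<^bsub>M\<^esub>, b)) ` B"
 have S: "finite ?S" "?S \<subseteq> carrier ?D" using A B by auto
 note sub = D.span_is_submodule[OF S(2)]
 have T: "D.span ?S \<subseteq> carrier ?D" by (rule D.span_is_subset2[OF S(2)])
 have own: "?S \<subseteq> D.span ?S" by (rule D.in_own_span[OF S(2)])
 have sadd: "x \<oplus>\<^bsub>?D\<^esub> y \<in> D.span ?S" if "x \<in> D.span ?S" "y \<in> D.span ?S" for x y
  using submodule.m_closed[OF sub that] .
 have ssm: "c \<odot>\<^bsub>?D\<^esub> x \<in> D.span ?S" if "x \<in> D.span ?S" for c x
  using submodule.smult_closed[OF sub _ that, of c] by simp
 have szero: "\<zero>\<^bsub>?D\<^esub> \<in> D.span ?S" using submodule.zero_closed[OF sub] .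
 have l: "(M.lincomb c F, \<zero>) \<in> D.span ?S" if "finite F" "F \<subseteq> A" for c F
  using that
 proof (induction F)
  case empty
  thus ?case using szero by (simp add: M.lincomb_def)
 next
  case (insert a F)
  have Fc: "F \<subseteq> carrier M" "a \<in> carrier M" using insert A by auto
  have "M.lincomb c (insert a F) = c a \<odot>\<^bsub>M\<^esub> a \<oplus>\<^bsub>M\<^esub> M.lincomb c F"
   using insert Fc unfolding M.lincomb_def by (subst M.finsum_insert) auto
  moreover have "(a, \<zero>) \<in> D.span ?S" using own insert by auto
  ultimately show ?case
   using sadd[OF ssm[of "(a, \<zero>)" "c a"] insert.IH] insert by (simp add: vn)
 qed
 have r: "(\<zero>\<^bsub>M\<^esub>, N.lincomb c F) \<in> D.span ?S" if "finite F" "F \<subseteq> B" for c F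
  using that
 proof (induction F)
  case empty
  thus ?case using szero by (simp add: N.lincomb_def)
 next
  case (insert a F)
  have Fc: "F \<subseteq> carrier N" "a \<in> carrier N" using insert B by auto
  have "N.lincomb c (insert a F) = c a \<odot> a \<oplus> N.lincomb c F"
   using insert Fc unfolding N.lincomb_def by (subst N.finsum_insert) auto
  moreover have "(\<zero>\<^bsub>M\<^esub>, a) \<in> D.span ?S" using own insert by auto
  ultimately show ?case
   using sadd[OF ssm[of "(\<zero>\<^bsub>M\<^esub>, a)" "c a"] insert.IH] insert by (simp add: vm)
 qed
 have "carrier ?D \<subseteq> D.span ?S"
 proof
  fix z assume z: "z \<in> carrier ?D"
  have fz: "fst z \<in> M.span A" "snd z \<in> N.span B" using z A(3) B(3) by auto
  obtain c F where F: "finite F" "F \<subseteq> A" "fst z = M.lincomb c F"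
   using fz(1) unfolding M.span_def by blast
  obtain d G where G: "finite G" "G \<subseteq> B" "snd z = N.lincomb d G"
   using fz(2) unfolding N.span_def by blast
  have "z = (fst z, \<zero>) \<oplus>\<^bsub>?D\<^esub> (\<zero>\<^bsub>M\<^esub>, snd z)" using z by (auto simp: vm vn)
  thus "z \<in> D.span ?S" using sadd[OF l[OF F(1,2), of c] r[OF G(1,2), of d]] F(3) G(3) by simp
 qed
 hence "D.span ?S = carrier ?D" using T by blast
 hence "D.fin_dim" unfolding D.fin_dim_def using S by blast
 thus ?thesis using D.vectorspace_axioms by (simp add: fd_vectorspace_def)
qed

text \<open>In the blocks of \<open>double\<close> the operator \<open>psip\<close> sends (x, y) to
  (0, -2 x). Its kernel is the second copy of Z, on which the generators of rank r act without the
  sign twist, so taking the second component gives the isomorphism to Z.\<close>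

lemma double_essentially_surjective:
 fixes W :: "('k::{alg_closed_field, field_char_0}, 'w) module" and Z :: "('k, nat + 'w, 'v) rep" (structure)
 assumes Z: "cliff_module r W Z" and j: "bij_betw j (carrier Z \<times> carrier Z) (carrier Z)"
 shows "cliff_module (Suc (Suc r)) W (double r Z j)"
  and "\<exists>\<phi>. is_iso (cliff_modules r W) (vac r (double r Z j)) Z \<phi>"
proof -
 let ?D = "double r Z j" and ?i = "inv_into (carrier Z \<times> carrier Z) j"
 note z = cliffD[OF Z] and v = vsp_simps[OF cliffD(2)[OF Z]]
 have inj: "inj_on j (carrier (direct_sum Z Z))" using j by (simp add: bij_betw_def)
 have ij: "?i (j (x, y)) = (x, y)" if "x \<in> carrier Z" "y \<in> carrier Z" for x y
  using that inj by (simp add: inv_into_f_f)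
 have D: "carrier ?D = j ` (carrier Z \<times> carrier Z)" "\<zero>\<^bsub>?D\<^esub> = j (\<zero>, \<zero>)"
  "\<And>x y x' y'. [|x \<in> carrier Z; y \<in> carrier Z; x' \<in> carrier Z; y' \<in> carrier Z|] ==>
   j (x, y) \<oplus>\<^bsub>?D\<^esub> j (x', y') = j (x \<oplus> x', y \<oplus> y')"
  "\<And>c x y. [|x \<in> carrier Z; y \<in> carrier Z|] ==> c \<odot>\<^bsub>?D\<^esub> j (x, y) = j (c \<odot> x, c \<odot> y)"
  by (simp_all add: double_def module.extend_def rep.fields_def transport_def Let_def ij)
 have act: "act ?D a (j (x, y)) = j (if a = Inl r then (y, (- 1) \<odot> x) else if a = Inl (Suc r) then (img \<odot> y, img \<odot> x)
     else ((- 1) \<odot> act Z a x, act Z a y))" if "x \<in> carrier Z" "y \<in> carrier Z" for a x y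
  using that by (simp add: double_def module.extend_def rep.fields_def ij)
 have inD: "j (x, y) \<in> carrier ?D \<longleftrightarrow> x \<in> carrier Z \<and> y \<in> carrier Z" if "x \<in> carrier Z" "y \<in> carrier Z" for x y
  using that by (auto simp: D)
 have memD: "P u" if "\<And>x y. x \<in> carrier Z ==> y \<in> carrier Z ==> P (j (x, y))" "u \<in> carrier ?D" for P u
  using that by (auto simp: D)
 have fdT: "fd_vectorspace (transport j (direct_sum Z Z))" by (rule fd_transport[OF fd_direct_sum[OF z(1,1)] inj])
 have vD: "vsp ?D"
  by (rule vspI) (auto simp: D v(1-3,5-) intro!: arg_cong[of _ _ j] v(4))
 have fd: "fd_vectorspace ?D"
  by (rule fd_vectorspace_surj[OF lmapI[OF fdD(1)[OF fdT] vD] fdT, of "\<lambda>x. x"])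
   (auto simp: double_def module.extend_def rep.fields_def)
 have la: "lmap Z Z (act Z a)" if "a \<in> gens (Suc (Suc r)) W" "a \<noteq> Inl r" "a \<noteq> Inl (Suc r)" for a
  using that z(3) by (elim gens_cases) auto
 have lD: "lmap ?D ?D (act ?D a)" if a: "a \<in> gens (Suc (Suc r)) W" for a
 proof (cases "a = Inl r \<or> a = Inl (Suc r)")
  case True
  thus ?thesis
   by (intro lmapI[OF vD vD]) (auto simp: D act v mult.commute)
 next
  case False
  note l = lmapD[OF la[OF a]]
  show ?thesis
   using False by (intro lmapI[OF vD vD]) (auto simp: D act v l mult.commute)
 qed
 have rel: "act ?D a (act ?D b u) \<oplus>\<^bsub>?D\<^esub> act ?D b (act ?D a u) = (- 2 * cform a b) \<odot>\<^bsub>?D\<^esub> u"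
  if a: "a \<in> gens (Suc (Suc r)) W" and b: "b \<in> gens (Suc (Suc r)) W" and u: "u \<in> carrier ?D" for a b u
  using u
 proof (rule memD[rotated])
  fix x y assume xy: "x \<in> carrier Z" "y \<in> carrier Z"
  have rz: "a \<noteq> Inl r ==> a \<noteq> Inl (Suc r) ==> b \<noteq> Inl r ==> b \<noteq> Inl (Suc r) ==> t \<in> carrier Z ==>
    act Z a (act Z b t) \<oplus> act Z b (act Z a t) = (- 2 * cform a b) \<odot> t" for t
   using a b z(7) by (elim gens_cases) auto
  have ca: "a \<noteq> Inl r ==> a \<noteq> Inl (Suc r) ==> cform a (Inl r) = (0 :: 'k) \<and> cform a (Inl (Suc r)) = (0 :: 'k)"
   by (cases a) auto
  have cb: "b \<noteq> Inl r ==> b \<noteq> Inl (Suc r) ==> cform (Inl r) b = (0 :: 'k) \<and> cform (Inl (Suc r)) b = (0 :: 'k)"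
   by (cases b) auto
  note la' = lmapD[OF la[OF a]] and lb' = lmapD[OF la[OF b]]
  show "act ?D a (act ?D b (j (x, y))) \<oplus>\<^bsub>?D\<^esub> act ?D b (act ?D a (j (x, y))) = (- 2 * cform a b) \<odot>\<^bsub>?D\<^esub> j (x, y)"
   using xy
   by (cases "a = Inl r"; cases "a = Inl (Suc r)"; cases "b = Inl r"; cases "b = Inl (Suc r)")
    (simp_all add: act D v la' lb' rz ca cb img_sq)
 qed
 have W: "w \<in> carrier W ==> Inr w \<in> gens r W" for w by (auto simp: gens_def)
 have "\<forall>w\<in>carrier W. \<forall>w'\<in>carrier W. \<forall>u\<in>carrier ?D.
    act ?D (Inr (w \<oplus>\<^bsub>W\<^esub> w')) u = act ?D (Inr w) u \<oplus>\<^bsub>?D\<^esub> act ?D (Inr w') u"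
  "\<forall>c. \<forall>w\<in>carrier W. \<forall>u\<in>carrier ?D. act ?D (Inr (c \<odot>\<^bsub>W\<^esub> w)) u = c \<odot>\<^bsub>?D\<^esub> act ?D (Inr w) u"
  using z(5,6) lmapD(3)[OF z(3)[OF W]] by (auto simp: D act v mult.commute)
 thus cD: "cliff_module (Suc (Suc r)) W ?D"
  unfolding cliff_module_def using fd lD rel by blast
 have ps: "De ?D ?D (psip r ?D) (j (x, y)) = j (\<zero>, (- 2) \<odot> x)" if "x \<in> carrier Z" "y \<in> carrier Z" for x y
  using that by (subst psi_elem(12)[OF cD]) (simp_all add: inD act D v img_sq)
 have z0: "x = \<zero>" if "x \<in> carrier Z" "(- 2) \<odot> x = \<zero>" for x
  using arg_cong[OF that(2), of "\<lambda>x. (- 1 / 2) \<odot> x"] that(1) by (simp add: v)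
 have z0': "(- 2) \<odot> x = \<zero> \<longleftrightarrow> x = \<zero>" if "x \<in> carrier Z" for x
  using z0[OF that] v(12) by auto
 have jinj: "j (x, y) = j (x', y') \<longleftrightarrow> x = x' \<and> y = y'" if "x \<in> carrier Z" "y \<in> carrier Z" "x' \<in> carrier Z" "y' \<in> carrier Z" for x y x' y'
  using inj_onD[OF inj, of "(x, y)" "(x', y')"] that by auto
 have cv: "carrier (vac r ?D) = (\<lambda>y. j (\<zero>, y)) ` carrier Z"
  unfolding vac_simps[OF cD] by (auto simp: D ps jinj v z0')
 note cV = cliff_module_vac[OF cD]
 let ?s = "\<lambda>u. snd (?i u)"
 have "restrict ?s (carrier (vac r ?D)) \<in> rep_hom (gens r W) (vac r ?D) Z"
 proof (rule rep_homI[OF _ cliffD(4)[OF cV]])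
  show "lmap (vac r ?D) Z ?s"
   by (rule lmapI[OF cliffD(2)[OF cV] z(2)]) (auto simp: cv vac_simps[OF cD] D ij v)
  fix a u assume a: "a \<in> gens r W" and u: "u \<in> carrier (vac r ?D)"
  have "a \<noteq> Inl r" "a \<noteq> Inl (Suc r)" using a by (auto simp: gens_def)
  thus "?s (act (vac r ?D) a u) = act Z a (?s u)"
   using u lmapD[OF z(3)[OF a]] by (auto simp: cv vac_simps[OF cD] act ij v)
 qed
 moreover have "bij_betw (restrict ?s (carrier (vac r ?D))) (carrier (vac r ?D)) (carrier Z)"
  by (rule bij_betw_byWitness[where f' = "\<lambda>y. j (\<zero>, y)"]) (auto simp: cv ij v)
 ultimately show "\<exists>\<phi>. is_iso (cliff_modules r W) (vac r ?D) Z \<phi>"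
  using is_iso_cliffI[OF cV Z] by blast
qed

lemma cliff_modules_equiv_step:
 fixes W :: "('k::{alg_closed_field, field_char_0}, 'w) module"
 shows "equivalent_categories (cliff_modules (Suc (Suc r)) W :: (('k, nat + 'w, 'v) rep, 'v => 'v) category)
  (cliff_modules r W :: (('k, nat + 'w, 'v) rep, 'v => 'v) category)"
proof (rule equivalent_categories_if_fully_faithful[OF is_category_cliff is_category_cliff,
   where F = "(vac r, \<lambda>M N \<phi>. restrict \<phi> (carrier (vac r M)))"])
 let ?C = "cliff_modules (Suc (Suc r)) W :: (('k, nat + 'w, 'v) rep, 'v => 'v) category"
 let ?D = "cliff_modules r W :: (('k, nat + 'w, 'v) rep, 'v => 'v) category"
 let ?F = "(vac r, \<lambda>M N \<phi>. restrict \<phi> (carrier (vac r M))) :: (('k, nat + 'w, 'v) rep, 'v => 'v, ('k, nat + 'w, 'v) rep, 'v => 'v) functor_data"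
 show ff: "bij_betw (snd ?F M N) (Hom ?C M N) (Hom ?D (fst ?F M) (fst ?F N))" if "M \<in> Ob ?C" "N \<in> Ob ?C" for M N
  using that vac_fully_faithful[of r W M N] by (simp add: cliff_modules_def)
 show "is_functor ?C ?D ?F"
  unfolding is_functor_def
 proof (intro conjI ballI)
  fix M assume M: "M \<in> Ob ?C"
  hence M': "cliff_module (Suc (Suc r)) W M" by (simp add: cliff_modules_def)
  show "fst ?F M \<in> Ob ?D" using cliff_module_vac[OF M'] by (simp add: cliff_modules_def)
  show "snd ?F M M (Ident ?C M) = Ident ?D (fst ?F M)"
   by (auto simp: cliff_modules_def vac_simps[OF M'] fun_eq_iff)
  fix N assume N: "N \<in> Ob ?C"
  show "snd ?F M N \<phi> \<in> Hom ?D (fst ?F M) (fst ?F N)" if "\<phi> \<in> Hom ?C M N" for \<phi>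
   using ff[OF M N] that by (auto simp: bij_betw_def)
  fix K \<phi> \<psi> assume K: "K \<in> Ob ?C" and \<phi>: "\<phi> \<in> Hom ?C M N" and \<psi>: "\<psi> \<in> Hom ?C N K"
  have "restrict \<phi> (carrier (vac r M)) \<in> rep_hom (gens r W) (vac r M) (vac r N)"
   using ff[OF M N] \<phi> by (auto simp: bij_betw_def cliff_modules_def)
  from rep_homD(4)[OF this] 
  show "snd ?F M K (Comp ?C M N K \<psi> \<phi>) = Comp ?D (fst ?F M) (fst ?F N) (fst ?F K) (snd ?F N K \<psi>) (snd ?F M N \<phi>)"
   by (auto simp: cliff_modules_def fun_eq_iff compose_def vac_simps(1)[OF M'])
 qed
 fix Z assume "Z \<in> Ob ?D"
 hence Z: "cliff_module r W Z" by (simp add: cliff_modules_def)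
 obtain j where j: "bij_betw j (carrier Z \<times> carrier Z) (carrier Z)"
  using vsp_square_bij[OF cliffD(2)[OF Z]] by blast
 show "\<exists>X\<in>Ob ?C. \<exists>f. is_iso ?D (fst ?F X) Z f"
  using double_essentially_surjective[OF Z j] by (intro bexI[of _ "double r Z j"]) (simp_all add: cliff_modules_def)
qed

lemma cliff_modules_equiv:
 fixes W :: "('k::{alg_closed_field, field_char_0}, 'w) module"
 shows "equivalent_categories (cliff_modules (2 * n + r) W :: (('k, nat + 'w, 'v) rep, 'v => 'v) category)
  (cliff_modules r W :: (('k, nat + 'w, 'v) rep, 'v => 'v) category)"
proof (induction n)
 case 0
 show ?case
  using equivalent_categories_if_related[OF is_category_cliff is_category_cliff, of r W r W "(=)"]
  unfolding cliff_modules_def by auto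
next
 case (Suc n)
 thus ?case using equivalent_categories_trans[OF cliff_modules_equiv_step] by simp
qed

subsection \<open>The free algebra\<close>

lemma free_alg_simps:
 "carrier (free_alg X) = {p. finite {u. p u \<noteq> 0} \<and> {u. p u \<noteq> 0} \<subseteq> lists X}"
 "\<zero>\<^bsub>free_alg X\<^esub> = (\<lambda>u. 0)" "\<one>\<^bsub>free_alg X\<^esub> = (\<lambda>u. if u = [] then 1 else 0)"
 "p \<oplus>\<^bsub>free_alg X\<^esub> q = (\<lambda>u. p u + q u)" "c \<odot>\<^bsub>free_alg X\<^esub> p = (\<lambda>u. c * p u)"
 "p \<otimes>\<^bsub>free_alg X\<^esub> q = (\<lambda>u. \<Sum>i\<le>length u. p (take i u) * q (drop i u))"
 by (simp_all add: free_alg_def)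

lemma free_alg_mult_support:
 "{u. (p \<otimes>\<^bsub>free_alg X\<^esub> q) u \<noteq> 0} \<subseteq> (\<lambda>(a, b). a @ b) ` ({u. p u \<noteq> 0} \<times> {u. q u \<noteq> 0})"
proof
 fix u assume "u \<in> {u. (p \<otimes>\<^bsub>free_alg X\<^esub> q) u \<noteq> 0}"
 then obtain i where "p (take i u) * q (drop i u) \<noteq> 0"
  unfolding free_alg_simps by (auto intro: sum.not_neutral_contains_not_neutral)
 thus "u \<in> (\<lambda>(a, b). a @ b) ` ({u. p u \<noteq> 0} \<times> {u. q u \<noteq> 0})"
  by (intro image_eqI[of _ _ "(take i u, drop i u)"]) auto
qed

lemma free_alg_closed:
 "p \<in> carrier (free_alg X) ==> q \<in> carrier (free_alg X) ==> (\<lambda>u. p u + q u) \<in> carrier (free_alg X)"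
 "p \<in> carrier (free_alg X) ==> (\<lambda>u. c * p u) \<in> carrier (free_alg X)"
 "p \<in> carrier (free_alg X) ==> q \<in> carrier (free_alg X) ==> p \<otimes>\<^bsub>free_alg X\<^esub> q \<in> carrier (free_alg X)"
 "(\<lambda>u. 0) \<in> carrier (free_alg X)" "\<one>\<^bsub>free_alg X\<^esub> \<in> carrier (free_alg X)"
proof -
 assume p: "p \<in> carrier (free_alg X)"
 show "(\<lambda>u. c * p u) \<in> carrier (free_alg X)"
  using p by (auto simp: free_alg_simps elim: rev_finite_subset)
 assume q: "q \<in> carrier (free_alg X)"
 have "finite ({u. p u \<noteq> 0} \<union> {u. q u \<noteq> 0})" "{u. p u + q u \<noteq> 0} \<subseteq> {u. p u \<noteq> 0} \<union> {u. q u \<noteq> 0}"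
  using p q by (auto simp: free_alg_simps)
 from finite_subset[OF this(2,1)] this(2)
 show "(\<lambda>u. p u + q u) \<in> carrier (free_alg X)"
  using p q by (auto simp: free_alg_simps)
 have f: "finite ((\<lambda>(a, b). a @ b) ` ({u. p u \<noteq> 0} \<times> {u. q u \<noteq> 0}))"
  using p q by (auto simp: free_alg_simps)
 have l: "(\<lambda>(a, b). a @ b) ` ({u. p u \<noteq> 0} \<times> {u. q u \<noteq> 0}) \<subseteq> lists X"
 proof
  fix u assume "u \<in> (\<lambda>(a, b). a @ b) ` ({u. p u \<noteq> 0} \<times> {u. q u \<noteq> 0})"
  then obtain a b where u: "u = a @ b" "p a \<noteq> 0" "q b \<noteq> 0" by auto
  hence "a \<in> lists X" "b \<in> lists X" using p q by (auto simp: free_alg_simps simp del: in_lists_conv_set)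
  thus "u \<in> lists X" using u by simp
 qed
 show "p \<otimes>\<^bsub>free_alg X\<^esub> q \<in> carrier (free_alg X)"
  using finite_subset[OF free_alg_mult_support f] subset_trans[OF free_alg_mult_support l]
  by (simp only: free_alg_simps(1) mem_Collect_eq)
qed (auto simp: free_alg_simps)

lemma free_alg_assoc:
 fixes p q s :: "'w list => 'k::field"
 shows "(p \<otimes>\<^bsub>free_alg X\<^esub> q) \<otimes>\<^bsub>free_alg X\<^esub> s = p \<otimes>\<^bsub>free_alg X\<^esub> (q \<otimes>\<^bsub>free_alg X\<^esub> s)"
proof
 fix u :: "'w list"
 define n where "n = length u"
 \<comment> \<open>The contribution of cutting the word u at positions i <= k into three pieces;
   both ways of bracketing sum it over all such pairs of cuts.\<close>
 define g where "g i k = p (take i u) * q (take (k - i) (drop i u)) * s (drop k u)" for i k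
 have "((p \<otimes>\<^bsub>free_alg X\<^esub> q) \<otimes>\<^bsub>free_alg X\<^esub> s) u = (\<Sum>k\<le>n. \<Sum>i\<le>k. g i k)"
  unfolding free_alg_simps g_def n_def
  by (intro sum.cong refl) (auto simp: sum_distrib_right min_def drop_take intro!: sum.cong)
 also have "\<dots> = (\<Sum>(k, i)\<in>(SIGMA k:{..n}. {..k}). g i k)" by (subst sum.Sigma) auto
 also have "\<dots> = (\<Sum>(i, j)\<in>(SIGMA i:{..n}. {..n - i}). g i (i + j))"
  by (rule sum.reindex_bij_witness[of _ "\<lambda>(i, j). (i + j, i)" "\<lambda>(k, i). (i, k - i)"]) auto
 also have "\<dots> = (\<Sum>i\<le>n. \<Sum>j\<le>n - i. g i (i + j))" by (subst sum.Sigma) auto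
 also have "\<dots> = (p \<otimes>\<^bsub>free_alg X\<^esub> (q \<otimes>\<^bsub>free_alg X\<^esub> s)) u"
  unfolding free_alg_simps g_def n_def
  by (intro sum.cong refl) (auto simp: sum_distrib_left mult.assoc add.commute intro!: sum.cong)
 finally show "((p \<otimes>\<^bsub>free_alg X\<^esub> q) \<otimes>\<^bsub>free_alg X\<^esub> s) u = (p \<otimes>\<^bsub>free_alg X\<^esub> (q \<otimes>\<^bsub>free_alg X\<^esub> s)) u" .
qed

definition word :: "'w list => 'w list => 'k::field" where
 "word v = (\<lambda>u. if u = v then 1 else 0)"

lemma letter_word: "letter w = word [w]"
 by (simp add: letter_def word_def)

lemma word_closed: "v \<in> lists X ==> word v \<in> carrier (free_alg X)"
 by (auto simp: free_alg_simps word_def)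

lemma word_Nil: "\<one>\<^bsub>free_alg X\<^esub> = word []"
 by (simp add: free_alg_simps word_def)

lemma word_mult: "word a \<otimes>\<^bsub>free_alg X\<^esub> word b = (word (a @ b) :: 'w list => 'k::field)"
proof
 fix u
 have "(word a \<otimes>\<^bsub>free_alg X\<^esub> word b) u = (\<Sum>i\<le>length u. if i = length a \<and> u = a @ b then 1 else 0 :: 'k)"
  unfolding free_alg_simps
 proof (intro sum.cong refl)
  fix i assume "i \<in> {..length u}"
  hence "take i u = a \<and> drop i u = b \<longleftrightarrow> i = length a \<and> a @ b = u"
   by (auto simp: append_eq_conv_conj)
  thus "word a (take i u) * word b (drop i u) = (if i = length a \<and> u = a @ b then 1 else 0 :: 'k)"
   by (auto simp: word_def)
 qed
 also have "\<dots> = word (a @ b) u" by (auto simp: word_def)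
 finally show "(word a \<otimes>\<^bsub>free_alg X\<^esub> word b) u = (word (a @ b) u :: 'k)" .
qed

lemma free_alg_one:
 "\<one>\<^bsub>free_alg X\<^esub> \<otimes>\<^bsub>free_alg X\<^esub> p = p" "p \<otimes>\<^bsub>free_alg X\<^esub> \<one>\<^bsub>free_alg X\<^esub> = p"
proof -
 have "(\<one>\<^bsub>free_alg X\<^esub> \<otimes>\<^bsub>free_alg X\<^esub> p) u = (\<Sum>i\<le>length u. if i = 0 then p u else 0)" for u
  unfolding free_alg_simps by (intro sum.cong refl) auto
 thus "\<one>\<^bsub>free_alg X\<^esub> \<otimes>\<^bsub>free_alg X\<^esub> p = p" by auto
 have "(p \<otimes>\<^bsub>free_alg X\<^esub> \<one>\<^bsub>free_alg X\<^esub>) u = (\<Sum>i\<le>length u. if i = length u then p u else 0)" for u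
  unfolding free_alg_simps by (intro sum.cong refl) auto
 thus "p \<otimes>\<^bsub>free_alg X\<^esub> \<one>\<^bsub>free_alg X\<^esub> = p" by auto
qed

lemma ring_free_alg: "ring (free_alg X :: ('k::field, 'w list => 'k) module)"
proof (rule ringI)
 show "abelian_group (free_alg X :: ('k, 'w list => 'k) module)"
 proof (rule abelian_groupI)
  fix p :: "'w list => 'k" assume "p \<in> carrier (free_alg X)"
  thus "\<exists>q\<in>carrier (free_alg X). q \<oplus>\<^bsub>free_alg X\<^esub> p = \<zero>\<^bsub>free_alg X\<^esub>"
   using free_alg_closed(2)[of p X "- 1"] by (intro bexI[of _ "\<lambda>u. - 1 * p u"]) (auto simp: free_alg_simps(2,4))
 qed (use free_alg_closed in \<open>auto simp: free_alg_simps(2,4) algebra_simps\<close>)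
 show "Group.monoid (free_alg X :: ('k, 'w list => 'k) module)"
  by (rule monoidI) (simp_all add: free_alg_closed(3,5) free_alg_assoc free_alg_one)
qed (auto simp: free_alg_simps(4,6) algebra_simps sum.distrib)

lemma free_alg_induct [consumes 1, case_names zero add]:
 assumes "p \<in> carrier (free_alg X)"
  and 0: "P (\<lambda>u. 0)"
  and step: "\<And>c v q. [|v \<in> lists X; q \<in> carrier (free_alg X); P q|] ==> P (\<lambda>u. c * word v u + q u)"
 shows "P p"
proof -
 have "P p" if "finite S" "{u. p u \<noteq> 0} \<subseteq> S" "S \<subseteq> lists X" for S p
  using that
 proof (induction S arbitrary: p)
  case empty
  hence "p = (\<lambda>u. 0)" by auto
  thus ?case using 0 by simp
 next
  case (insert v S)
  let ?q = "\<lambda>u. if u = v then 0 else p u"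
  have q: "{u. ?q u \<noteq> 0} \<subseteq> S" using insert.prems by auto
  hence "P ?q" using insert by auto
  moreover have "?q \<in> carrier (free_alg X)"
   using q insert by (auto simp: free_alg_simps intro: finite_subset)
  ultimately have "P (\<lambda>u. p v * word v u + ?q u)" using step insert.prems by auto
  moreover have "(\<lambda>u. p v * word v u + ?q u) = p" by (auto simp: word_def)
  ultimately show ?case by simp
 qed
 thus ?thesis using assms(1) by (auto simp: free_alg_simps)
qed

subsection \<open>Evaluation of the free algebra in operators\<close>

lemma sc_sc: "sc a * (sc b * S) = sc (a * b) * S"
 by (simp add: sc_mult mult.assoc)

text \<open>The homomorphism from the free algebra that sends the letter w to \<open>c w\<close>.
  The empty word goes to the unit 1 of the whole operator ring, not to the projection of a
  module.\<close>

definition ev :: "('w => ('b, 'k::field) endo) => ('w list => 'k) => ('b, 'k) endo" where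
 "ev c p = (\<Sum>u\<in>{u. p u \<noteq> 0}. sc (p u) * prod_list (map c u))"

lemma ev_superset:
 assumes "finite S" "{u. p u \<noteq> 0} \<subseteq> S"
 shows "ev c p = (\<Sum>u\<in>S. sc (p u) * prod_list (map c u))"
 unfolding ev_def using assms by (intro sum.mono_neutral_left) auto

lemma ev_zero: "ev c (\<lambda>u. 0) = 0"
 by (simp add: ev_def)

lemma ev_add:
 assumes "p \<in> carrier (free_alg X)" "q \<in> carrier (free_alg X)"
 shows "ev c (\<lambda>u. p u + q u) = ev c p + ev c q"
proof -
 let ?S = "{u. p u \<noteq> 0} \<union> {u. q u \<noteq> 0}"
 have f: "finite ?S" using assms by (auto simp: free_alg_simps)
 have "ev c (\<lambda>u. p u + q u) = (\<Sum>u\<in>?S. sc (p u + q u) * prod_list (map c u))"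
  by (rule ev_superset[OF f]) auto
 also have "\<dots> = ev c p + ev c q"
  by (simp add: ev_superset[OF f, of p] ev_superset[OF f, of q] sc_add distrib_right sum.distrib)
 finally show ?thesis .
qed

lemma ev_smult:
 assumes "p \<in> carrier (free_alg X)"
 shows "ev c (\<lambda>u. a * p u) = sc a * ev c p"
proof -
 have f: "finite {u. p u \<noteq> 0}" using assms by (auto simp: free_alg_simps)
 have "ev c (\<lambda>u. a * p u) = (\<Sum>u\<in>{u. p u \<noteq> 0}. sc (a * p u) * prod_list (map c u))"
  by (rule ev_superset[OF f]) auto
 thus ?thesis by (simp add: ev_def sc_mult mult.assoc sum_distrib_left)
qed

lemma ev_word: "ev c (word v) = prod_list (map c v)"
 by (subst ev_superset[of "{v}"]) (auto simp: word_def)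

lemma ev_mult:
 assumes "p \<in> carrier (free_alg X)" "q \<in> carrier (free_alg X)"
 shows "ev c (p \<otimes>\<^bsub>free_alg X\<^esub> q) = ev c p * ev c q"
proof -
 let ?A = "{u. p u \<noteq> 0}" and ?B = "{u. q u \<noteq> 0}"
 let ?S = "(\<lambda>(a, b). a @ b) ` (?A \<times> ?B)"
 let ?g = "\<lambda>u i. sc (p (take i u) * q (drop i u)) * prod_list (map c u)"
 have f: "finite ?A" "finite ?B" using assms by (auto simp: free_alg_simps)
 have "ev c (p \<otimes>\<^bsub>free_alg X\<^esub> q) = (\<Sum>u\<in>?S. sc ((p \<otimes>\<^bsub>free_alg X\<^esub> q) u) * prod_list (map c u))"
  using f by (intro ev_superset free_alg_mult_support) auto
 also have "\<dots> = (\<Sum>u\<in>?S. \<Sum>i\<le>length u. ?g u i)"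
  unfolding free_alg_simps by (intro sum.cong refl) (simp add: sc_sum sum_distrib_right)
 also have "\<dots> = (\<Sum>(u, i)\<in>(SIGMA u:?S. {..length u}). ?g u i)"
  using f by (subst sum.Sigma) auto
 \<comment> \<open>Only cuts whose two halves lie in the supports contribute, and these correspond
   to pairs of words by splitting and concatenating.\<close>
 also have "\<dots> = (\<Sum>(u, i)\<in>{(u, i). i \<le> length u \<and> take i u \<in> ?A \<and> drop i u \<in> ?B}. ?g u i)"
 proof (rule sum.mono_neutral_right)
  show "finite (SIGMA u:?S. {..length u})" using f by auto
  show "{(u, i). i \<le> length u \<and> take i u \<in> ?A \<and> drop i u \<in> ?B} \<subseteq> (SIGMA u:?S. {..length u})"
  proof safe
   fix u i assume "i \<le> length u" "p (take i u) \<noteq> 0" "q (drop i u) \<noteq> 0"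
   thus "u \<in> ?S" by (intro image_eqI[of _ _ "(take i u, drop i u)"]) auto
  qed
 qed auto
 also have "\<dots> = (\<Sum>(a, b)\<in>?A \<times> ?B. (sc (p a) * prod_list (map c a)) * (sc (q b) * prod_list (map c b)))"
 proof (rule sum.reindex_bij_witness[of _ "\<lambda>(a, b). (a @ b, length a)" "\<lambda>(u, i). (take i u, drop i u)"])
  fix x assume "x \<in> {(u, i). i \<le> length u \<and> take i u \<in> ?A \<and> drop i u \<in> ?B}"
  then obtain u i where x: "x = (u, i)" "i \<le> length u" by auto
  have "prod_list (map c u) = prod_list (map c (take i u)) * prod_list (map c (drop i u))"
   by (metis append_take_drop_id map_append prod_list.append)
  thus "(case case x of (u, i) => (take i u, drop i u) of (a, b) => (sc (p a) * prod_list (map c a)) * (sc (q b) * prod_list (map c b))) =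
   (case x of (u, i) => ?g u i)"
   by (simp add: x sc_mult mult.assoc sc_left_commute[of "prod_list (map c (take i u))"])
 qed auto
 also have "\<dots> = ev c p * ev c q"
  unfolding ev_def sum_product by (subst sum.cartesian_product) auto
 finally show ?thesis .
qed

lemma ev_commute:
 assumes "p \<in> carrier (free_alg X)" "\<And>w. w \<in> X ==> T * c w = c w * T"
 shows "T * ev c p = ev c p * T"
proof -
 have l: "T * prod_list (map c u) = prod_list (map c u) * T" if "u \<in> lists X" for u
  using that
 proof (induction u)
  case (Cons w u)
  thus ?case using assms(2)[of w] by simp (metis mult.assoc)
 qed simp
 show ?thesis unfolding ev_def sum_distrib_left sum_distrib_right
 proof (rule sum.cong[OF refl])
  fix u assume "u \<in> {u. p u \<noteq> 0}"
  hence "u \<in> lists X" using assms(1) by (auto simp: free_alg_simps)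
  thus "T * (sc (p u) * prod_list (map c u)) = sc (p u) * prod_list (map c u) * T"
   by (simp only: sc_left_commute l mult.assoc)
 qed
qed

text \<open>Moving T past a word costs one sign per letter, and this sign is constant on the words
  of one parity.\<close>

lemma ev_anticommute:
 assumes "p \<in> carrier (free_alg X)" "\<And>w. w \<in> X ==> T * c w = - (c w * T)" "\<And>u. p u \<noteq> 0 ==> length u mod 2 = i mod 2"
 shows "T * ev c p = sc ((- 1) ^ i) * (ev c p * T)"
proof -
 have l: "T * prod_list (map c u) = sc ((- 1) ^ length u) * (prod_list (map c u) * T)" if "u \<in> lists X" for u
  using that
 proof (induction u)
  case (Cons w u)
  have w: "w \<in> X" "u \<in> lists X" using Cons.hyps by auto
  have "T * prod_list (map c (w # u)) = - (c w * (T * prod_list (map c u)))"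
   by (simp only: list.map prod_list.Cons mult.assoc[symmetric] assms(2)[OF w(1)] mult_minus_left)
  also have "\<dots> = sc ((- 1) ^ length (w # u)) * (prod_list (map c (w # u)) * T)"
   by (simp add: Cons.IH sc_left_commute[of "c w"] mult.assoc)
  finally show ?case .
 qed simp
 show ?thesis unfolding ev_def sum_distrib_left sum_distrib_right
 proof (rule sum.cong[OF refl])
  fix u assume u: "u \<in> {u. p u \<noteq> 0}"
  hence "u \<in> lists X" using assms(1) by (auto simp: free_alg_simps)
  moreover have "(- 1 :: 'b) ^ length u = (- 1) ^ i"
   using assms(3)[of u] u by (cases "even i") (auto simp: even_iff_mod_2_eq_zero odd_iff_mod_2_eq_one)
  ultimately show "T * (sc (p u) * prod_list (map c u)) = sc ((- 1) ^ i) * (sc (p u) * prod_list (map c u) * T)"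
   by (simp only: sc_left_commute[of T] l mult.assoc sc_sc mult.commute[of "p u"])
 qed
qed

subsection \<open>The exterior algebra\<close>

definition cls :: "('k::field, 'w) module => ('w list => 'k) => ('w list => 'k) set" where
 "cls W p = ext_ideal W +>\<^bsub>free_alg (carrier W)\<^esub> p"

context
 fixes W :: "('k::field, 'w) module"
 assumes W: "vsp W"
begin

abbreviation (input) "F \<equiv> free_alg (carrier W) :: ('k, 'w list => 'k) module"

interpretation F: ring F by (rule ring_free_alg)

lemma ext_relations_subset: "ext_relations W \<subseteq> carrier F"
proof -
 note v = vsp_simps[OF W]
 have l: "letter w \<in> carrier F" if "w \<in> carrier W" for w using that word_closed[of "[w]"] by (simp add: letter_word)
 have m: "(\<lambda>u. p u - c * q u) \<in> carrier F" if "p \<in> carrier F" "q \<in> carrier F" for p q c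
  using free_alg_closed(1)[OF that(1) free_alg_closed(2)[OF that(2), of "- c"]] by simp
 have m1: "(\<lambda>u. p u - q u) \<in> carrier F" if "p \<in> carrier F" "q \<in> carrier F" for p q using m[OF that, of 1] by simp
 show ?thesis
  unfolding ext_relations_def by (auto intro!: l m m1 v free_alg_closed(2,3))
qed

lemma ideal_ext: "ideal (ext_ideal W) F"
 unfolding ext_ideal_def by (rule F.genideal_ideal[OF ext_relations_subset])

interpretation I: ideal "ext_ideal W" F by (rule ideal_ext)

lemma cls_eq:
 assumes "p \<in> carrier F" "q \<in> carrier F"
 shows "cls W p = cls W q \<longleftrightarrow> (\<lambda>u. p u - q u) \<in> ext_ideal W"
proof -
 have "p \<ominus>\<^bsub>F\<^esub> q = (\<lambda>u. p u - q u)"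
 proof -
  have "\<ominus>\<^bsub>F\<^esub> q = (\<lambda>u. - q u)"
   using free_alg_closed(2)[OF assms(2), of "- 1"] by (intro F.minus_equality) (auto simp: free_alg_simps(2,4) assms)
  thus ?thesis by (simp add: a_minus_def free_alg_simps)
 qed
 thus ?thesis
  using F.quotient_eq_iff_same_a_r_cos[OF ideal_ext assms] by (simp add: cls_def)
qed

lemma ext_alg_simps:
 "carrier (ext_alg W) = cls W ` carrier F"
 "\<one>\<^bsub>ext_alg W\<^esub> = cls W \<one>\<^bsub>F\<^esub>" "\<zero>\<^bsub>ext_alg W\<^esub> = cls W (\<lambda>u. 0)"
 "[|p \<in> carrier F; q \<in> carrier F|] ==> cls W p \<otimes>\<^bsub>ext_alg W\<^esub> cls W q = cls W (p \<otimes>\<^bsub>F\<^esub> q)"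
 "[|p \<in> carrier F; q \<in> carrier F|] ==> cls W p \<oplus>\<^bsub>ext_alg W\<^esub> cls W q = cls W (\<lambda>u. p u + q u)"
 "p \<in> carrier F ==> c \<odot>\<^bsub>ext_alg W\<^esub> cls W p = cls W (\<lambda>u. c * p u)"
proof -
 have e: "carrier (ext_alg W) = a_rcosets\<^bsub>F\<^esub> ext_ideal W" "\<one>\<^bsub>ext_alg W\<^esub> = ext_ideal W +>\<^bsub>F\<^esub> \<one>\<^bsub>F\<^esub>" "\<zero>\<^bsub>ext_alg W\<^esub> = ext_ideal W"
  "A \<otimes>\<^bsub>ext_alg W\<^esub> B = rcoset_mult F (ext_ideal W) A B" "A \<oplus>\<^bsub>ext_alg W\<^esub> B = A <+>\<^bsub>F\<^esub> B"
  "c \<odot>\<^bsub>ext_alg W\<^esub> A = rcoset_mult F (ext_ideal W) (ext_ideal W +>\<^bsub>F\<^esub> (c \<odot>\<^bsub>F\<^esub> \<one>\<^bsub>F\<^esub>)) A" for A B c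
  by (simp_all add: ext_alg_def ring.extend_def module.fields_def FactRing_def)
 show "carrier (ext_alg W) = cls W ` carrier F" by (auto simp: e cls_def A_RCOSETS_defs a_r_coset_def)
 show "\<one>\<^bsub>ext_alg W\<^esub> = cls W \<one>\<^bsub>F\<^esub>" by (simp add: e cls_def)
 have "ext_ideal W +>\<^bsub>F\<^esub> \<zero>\<^bsub>F\<^esub> = ext_ideal W" using I.a_subset by (intro F.a_coset_add_zero)
 thus "\<zero>\<^bsub>ext_alg W\<^esub> = cls W (\<lambda>u. 0)" by (simp add: e cls_def free_alg_simps)
 assume p: "p \<in> carrier F"
 have c1: "c \<odot>\<^bsub>F\<^esub> \<one>\<^bsub>F\<^esub> \<in> carrier F"
  unfolding free_alg_simps(5) by (rule free_alg_closed(2)[OF free_alg_closed(5)])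
 have "(c \<odot>\<^bsub>F\<^esub> \<one>\<^bsub>F\<^esub>) \<otimes>\<^bsub>F\<^esub> p = (\<lambda>u. c * (\<one>\<^bsub>F\<^esub> \<otimes>\<^bsub>F\<^esub> p) u)"
  by (simp add: free_alg_simps sum_distrib_left mult.assoc)
 thus "c \<odot>\<^bsub>ext_alg W\<^esub> cls W p = cls W (\<lambda>u. c * p u)"
  using I.rcoset_mult_add[OF c1 p] by (simp add: e cls_def free_alg_one)
 assume q: "q \<in> carrier F"
 show "cls W p \<otimes>\<^bsub>ext_alg W\<^esub> cls W q = cls W (p \<otimes>\<^bsub>F\<^esub> q)"
  using I.rcoset_mult_add p q by (simp add: e cls_def)
 show "cls W p \<oplus>\<^bsub>ext_alg W\<^esub> cls W q = cls W (\<lambda>u. p u + q u)"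
  using I.a_rcos_sum p q by (simp add: e cls_def free_alg_simps(4))
qed

lemma vsp_ext_alg: "vsp (ext_alg W)"
proof (rule vspI)
 note c = free_alg_closed
 show "v \<oplus>\<^bsub>ext_alg W\<^esub> (- 1) \<odot>\<^bsub>ext_alg W\<^esub> v = \<zero>\<^bsub>ext_alg W\<^esub>" if "v \<in> carrier (ext_alg W)" for v
 proof -
  obtain p where p: "p \<in> carrier F" "v = cls W p" using \<open>v \<in> _\<close> by (auto simp: ext_alg_simps)
  show ?thesis using ext_alg_simps(5)[OF p(1) c(2)[OF p(1), of "- 1"]] by (simp add: p ext_alg_simps)
 qed
qed (auto simp: ext_alg_simps free_alg_closed algebra_simps)

lemma letter_closed: "w \<in> carrier W ==> letter w \<in> carrier F"
 using word_closed[of "[w]"] by (simp add: letter_word)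

lemma cls_letter:
 "w \<in> carrier W ==> cls W (letter w) \<in> carrier (ext_alg W)"
 "[|w \<in> carrier W; w' \<in> carrier W|] ==> cls W (letter (w \<oplus>\<^bsub>W\<^esub> w')) = cls W (letter w) \<oplus>\<^bsub>ext_alg W\<^esub> cls W (letter w')"
 "w \<in> carrier W ==> cls W (letter (c \<odot>\<^bsub>W\<^esub> w)) = c \<odot>\<^bsub>ext_alg W\<^esub> cls W (letter w)"
 "w \<in> carrier W ==> cls W (letter w) \<otimes>\<^bsub>ext_alg W\<^esub> cls W (letter w) = \<zero>\<^bsub>ext_alg W\<^esub>"
proof -
 note v = vsp_simps[OF W]
 have sub: "ext_relations W \<subseteq> ext_ideal W"
  unfolding ext_ideal_def by (rule F.genideal_self[OF ext_relations_subset])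
 assume w: "w \<in> carrier W"
 show "cls W (letter w) \<in> carrier (ext_alg W)" using w letter_closed by (simp add: ext_alg_simps)
 show "cls W (letter (c \<odot>\<^bsub>W\<^esub> w)) = c \<odot>\<^bsub>ext_alg W\<^esub> cls W (letter w)"
 proof -
  have "(\<lambda>u. letter (c \<odot>\<^bsub>W\<^esub> w) u - c * letter w u) \<in> ext_ideal W"
   by (intro subsetD[OF sub]) (unfold ext_relations_def, rule UnI1, rule UnI2, rule CollectI, intro exI conjI, rule refl, rule w)
  thus ?thesis using w letter_closed v(3) by (simp add: ext_alg_simps cls_eq free_alg_closed)
 qed
 have "letter w \<otimes>\<^bsub>F\<^esub> letter w \<in> ext_ideal W"
  by (intro subsetD[OF sub]) (unfold ext_relations_def, rule UnI2, rule CollectI, intro exI conjI, rule refl, rule w)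
 thus "cls W (letter w) \<otimes>\<^bsub>ext_alg W\<^esub> cls W (letter w) = \<zero>\<^bsub>ext_alg W\<^esub>"
  using w letter_closed by (simp add: ext_alg_simps cls_eq free_alg_closed)
 assume w': "w' \<in> carrier W"
 have "(\<lambda>u. letter (w \<oplus>\<^bsub>W\<^esub> w') u - letter w u - letter w' u) \<in> ext_ideal W"
  by (intro subsetD[OF sub])
   (unfold ext_relations_def, rule UnI1, rule UnI1, rule CollectI, intro exI conjI, rule refl, rule w, rule w')
 thus "cls W (letter (w \<oplus>\<^bsub>W\<^esub> w')) = cls W (letter w) \<oplus>\<^bsub>ext_alg W\<^esub> cls W (letter w')"
  using w w' letter_closed v(2) by (simp add: ext_alg_simps cls_eq free_alg_closed diff_diff_eq)
qed

text \<open>The elements p with \<open>ev c p * P = 0\<close> form a two-sided ideal; for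
  multiplication on the right, P is moved past \<open>ev c x\<close>, with which it commutes. The
  ideal contains the relations, hence everything they generate.\<close>

lemma ev_ext_ideal:
 fixes c :: "'w => ('b, 'k) endo" and P :: "('b, 'k) endo"
 assumes P: "\<And>w. w \<in> carrier W ==> P * c w = c w * P"
  and add: "\<And>w w'. [|w \<in> carrier W; w' \<in> carrier W|] ==> c (w \<oplus>\<^bsub>W\<^esub> w') = c w + c w'"
  and sm: "\<And>a w. w \<in> carrier W ==> c (a \<odot>\<^bsub>W\<^esub> w) = sc a * c w"
  and sq: "\<And>w. w \<in> carrier W ==> c w * c w = 0"
  and p: "p \<in> ext_ideal W"
 shows "ev c p * P = 0"
proof -
 let ?J = "{p \<in> carrier F. ev c p * P = 0}"
 have m: "ev c (\<lambda>u. p u - a * q u) = ev c p - sc a * ev c q" if "p \<in> carrier F" "q \<in> carrier F" for p q a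
  using ev_add[OF that(1) free_alg_closed(2)[OF that(2), of "- a"], of c] ev_smult[OF that(2), of c "- a"] by simp
 have m1: "ev c (\<lambda>u. p u - q u) = ev c p - ev c q" if "p \<in> carrier F" "q \<in> carrier F" for p q
  using m[OF that, of 1] by simp
 have mc: "(\<lambda>u. p u - q u) \<in> carrier F" if "p \<in> carrier F" "q \<in> carrier F" for p q
  using free_alg_closed(1)[OF that(1) free_alg_closed(2)[OF that(2), of "- 1"]] by simp
 have PP: "P * ev c p = ev c p * P" if "p \<in> carrier F" for p by (rule ev_commute[OF that P])
 have "ideal ?J F"
 proof (rule idealI[OF ring_free_alg])
  show "subgroup ?J (add_monoid F)"
  proof (rule group.subgroupI)
   show "Group.group (add_monoid F)" by (rule F.a_group)
   show "?J \<subseteq> carrier (add_monoid F)" by auto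
   show "?J \<noteq> {}" using free_alg_closed(4) by (auto intro!: exI[of _ "\<lambda>u. 0"] simp: ev_zero)
   fix p q assume pq: "p \<in> ?J" "q \<in> ?J"
   show "p \<otimes>\<^bsub>add_monoid F\<^esub> q \<in> ?J"
    using pq free_alg_closed(1)[of p "carrier W" q] ev_add[of p "carrier W" q c] by (simp add: free_alg_simps(4) distrib_right)
   have "\<ominus>\<^bsub>F\<^esub> p = (\<lambda>u. - 1 * p u)"
    using free_alg_closed(2)[of p "carrier W" "- 1"] pq by (intro F.minus_equality) (auto simp: free_alg_simps(2,4))
   thus "inv\<^bsub>add_monoid F\<^esub> p \<in> ?J"
    using free_alg_closed(2)[of p "carrier W" "- 1"] ev_smult[of p "carrier W" c "- 1"] pq
    by (simp add: a_inv_def[symmetric] del: mult_minus1)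
  qed
  fix p x assume p: "p \<in> ?J" and x: "x \<in> carrier F"
  have pF: "p \<in> carrier F" "ev c p * P = 0" using p by auto
  have "ev c x * ev c p * P = 0" using pF by (simp add: mult.assoc)
  thus "x \<otimes>\<^bsub>F\<^esub> p \<in> ?J" using free_alg_closed(3)[OF x pF(1)] ev_mult[OF x pF(1), of c] by simp
  have "ev c p * ev c x * P = ev c p * P * ev c x" by (simp add: mult.assoc PP[OF x])
  thus "p \<otimes>\<^bsub>F\<^esub> x \<in> ?J" using free_alg_closed(3)[OF pF(1) x] ev_mult[OF pF(1) x, of c] pF by simp
 qed
 moreover have "ext_relations W \<subseteq> ?J"
 proof
  fix p assume "p \<in> ext_relations W"
  then consider w w' where "w \<in> carrier W" "w' \<in> carrier W" "p = (\<lambda>u. letter (w \<oplus>\<^bsub>W\<^esub> w') u - letter w u - letter w' u)"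
   | a w where "w \<in> carrier W" "p = (\<lambda>u. letter (a \<odot>\<^bsub>W\<^esub> w) u - a * letter w u)"
   | w where "w \<in> carrier W" "p = letter w \<otimes>\<^bsub>F\<^esub> letter w"
   unfolding ext_relations_def by blast
  hence "ev c p = 0"
  proof cases
   case 1
   thus ?thesis using letter_closed vsp_simps(2)[OF W]
    by (simp add: m1 mc add) (simp add: letter_word ev_word add)
  next
   case 2
   thus ?thesis using letter_closed vsp_simps(3)[OF W]
    by (simp add: m) (simp add: letter_word ev_word sm)
  next
   case 3
   thus ?thesis using letter_closed
    by (simp add: ev_mult) (simp add: letter_word ev_word sq)
  qed
  thus "p \<in> ?J" using ext_relations_subset \<open>p \<in> ext_relations W\<close> by auto
 qed
 ultimately have "ext_ideal W \<subseteq> ?J" unfolding ext_ideal_def by (rule F.genideal_minimal)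
 thus ?thesis using p by auto
qed

end

subsection \<open>Modules over the exterior algebra\<close>

text \<open>Compares only the vector space fields, so that modules over different algebras, in
  different record types, can be said to live on the same space.\<close>

definition same_space :: "('k, 'v, 'x) module_scheme => ('k, 'v, 'y) module_scheme => bool" where
 "same_space M N \<longleftrightarrow> carrier M = carrier N \<and> add M = add N \<and> zero M = zero N \<and> smult M = smult N"

lemma same_space_sym: "same_space M N ==> same_space N M"
 by (simp add: same_space_def)

lemma same_space_vsp:
 assumes "same_space M N" "vsp M"
 shows "vsp N"
proof -
 have [simp]: "carrier N = carrier M" "add N = add M" "zero N = zero M" "smult N = smult M"
  using assms(1) by (auto simp: same_space_def)
 note v = vsp_simps[OF assms(2)]
 show ?thesis by (rule vspI) (auto simp: v(1-3,5-) intro: v(4))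
qed

lemma same_space_lmap:
 assumes "same_space M N" "same_space M' N'"
 shows "lmap M M' f \<longleftrightarrow> lmap N N' f"
proof -
 have *: "lmap N N' f" if "same_space M N" "same_space M' N'" "lmap M M' f"
  for M N M' N'
  using lmapD[OF that(3)] same_space_vsp[OF that(1)] same_space_vsp[OF that(2)] that(1,2)
  by (intro lmapI) (auto simp: same_space_def)
 show ?thesis using *[OF assms] *[OF assms[THEN same_space_sym]] by blast
qed

lemma same_space_fd:
 assumes "same_space M N" "fd_vectorspace M"
 shows "fd_vectorspace N"
proof (rule fd_vectorspace_surj[OF _ assms(2)])
 show "lmap M N (\<lambda>x. x)"
  using same_space_vsp[OF assms(1)] fdD(1)[OF assms(2)] assms(1)
  by (intro lmapI) (auto simp: same_space_def)
qed (use assms(1) in \<open>simp add: same_space_def\<close>)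

lemma alg_moduleD:
 assumes "alg_module A M"
 shows "fd_vectorspace M" "vsp M" "a \<in> carrier A ==> lmap M M (act M a)" "act_closed (carrier A) M"
  "x \<in> carrier M ==> lmap A M (\<lambda>a. act M a x)"
  "x \<in> carrier M ==> act M \<one>\<^bsub>A\<^esub> x = x"
  "[|a \<in> carrier A; b \<in> carrier A; x \<in> carrier M|] ==> act M (a \<otimes>\<^bsub>A\<^esub> b) x = act M a (act M b x)"
  "[|a \<in> carrier A; x \<in> carrier M|] ==> act M a x \<in> carrier M"
 using assms fdD[of M] lmapD(3)[of M M]
 unfolding alg_module_def act_closed_def bilinear_map_def by blast+

text \<open>The letters generate the exterior algebra: the claim passes to words by induction on
  their length and to all classes by linearity of the action.\<close>

lemma hom_if_commutes_letters:
 fixes W :: "('k::field, 'w) module"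
 assumes W: "vsp W" and M: "alg_module (ext_alg W) M" and N: "alg_module (ext_alg W) N" and \<phi>: "lmap M N \<phi>"
  and letters: "\<And>w x. [|w \<in> carrier W; x \<in> carrier M|] ==> \<phi> (act M (cls W (letter w)) x) = act N (cls W (letter w)) (\<phi> x)"
  and a: "a \<in> carrier (ext_alg W)" and x: "x \<in> carrier M"
 shows "\<phi> (act M a x) = act N a (\<phi> x)"
proof -
 note m = alg_moduleD[OF M] and n = alg_moduleD[OF N] and l = lmapD[OF \<phi>]
 note e = ext_alg_simps[OF W]
 have cc: "(word u :: 'w list => 'k) \<in> carrier (free_alg (carrier W))" if "u \<in> lists (carrier W)" for u
  using that by (rule word_closed)
 have wm: "(word [w] :: 'w list => 'k) \<otimes>\<^bsub>free_alg (carrier W)\<^esub> word u = word (w # u)" for w u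
  by (simp add: word_mult)
 have words: "\<phi> (act M (cls W (word u)) x) = act N (cls W (word u)) (\<phi> x)" if "u \<in> lists (carrier W)" "x \<in> carrier M" for u x
  using that
 proof (induction u rule: list.induct)
  case Nil
  thus ?case using m(6) n(6) l(3) by (simp add: e word_Nil)
 next
  case (Cons w u)
  have w: "w \<in> carrier W" "u \<in> lists (carrier W)" using Cons.prems by auto
  have 1: "cls W (word (w # u)) = cls W (letter w) \<otimes>\<^bsub>ext_alg W\<^esub> cls W (word u)"
   using e(4)[OF letter_closed[OF W w(1)] cc[OF w(2)]] by (simp add: letter_word wm)
  have c: "cls W (letter w) \<in> carrier (ext_alg W)" "cls W (word u) \<in> carrier (ext_alg W)"
   using w cc[of u] letter_closed[OF W w(1)] by (auto simp: e(1))
  show ?case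
   unfolding 1 using m(7)[OF c Cons.prems(2)] n(7)[OF c l(3)[OF Cons.prems(2)]]
    letters[OF w(1) m(8)[OF c(2) Cons.prems(2)]] Cons.IH[OF w(2) Cons.prems(2)] by simp
 qed
 obtain p where p: "p \<in> carrier (free_alg (carrier W))" "a = cls W p" using a by (auto simp: e)
 have "\<phi> (act M (cls W p) x) = act N (cls W p) (\<phi> x)"
  using p(1)
 proof (induction rule: free_alg_induct)
  case zero
  show ?case using lmapD(6)[OF m(5)[OF x]] lmapD(6)[OF n(5)[OF l(3)[OF x]]] l(6)
   by (simp add: e(3))
 next
  case (add b v q)
  have 1: "cls W (\<lambda>u. b * word v u + q u) = b \<odot>\<^bsub>ext_alg W\<^esub> cls W (word v) \<oplus>\<^bsub>ext_alg W\<^esub> cls W q"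
   using add cc[of v] by (simp add: e(5,6) free_alg_closed(2))
  have c: "cls W q \<in> carrier (ext_alg W)" "cls W (word v) \<in> carrier (ext_alg W)" "b \<odot>\<^bsub>ext_alg W\<^esub> cls W (word v) \<in> carrier (ext_alg W)"
   using add cc[of v] vsp_simps(3)[OF vsp_ext_alg[OF W]] by (auto simp: e(1))
  have K: "act K (cls W (\<lambda>u. b * word v u + q u)) y = b \<odot>\<^bsub>K\<^esub> act K (cls W (word v)) y \<oplus>\<^bsub>K\<^esub> act K (cls W q) y"
   if "alg_module (ext_alg W) K" "y \<in> carrier K" for K :: "('k, ('w list => 'k) set, 'z, 'q) rep_scheme" and y
   unfolding 1 using lmapD(4,5)[OF alg_moduleD(5)[OF that]] c by simp
  show ?case
   unfolding K[OF M x] K[OF N l(3)[OF x]]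
   using l(4,5) m(8)[OF c(2) x] m(8)[OF c(1) x] vsp_simps(3)[OF m(2)] add.IH words[OF add.hyps(1) x] by simp
 qed
 thus ?thesis by (simp add: p)
qed

text \<open>A class acts through the evaluation of some representative. Independence of the choice
  is \<open>ext_act_cls\<close>: two representatives differ by an element of the ideal, so their
  values agree after multiplication with \<open>Pr N\<close>, which \<open>De\<close>
  absorbs.\<close>

definition ext_act :: "('k::field, 'w) module => ('k, nat + 'w, 'v) rep => ('w list => 'k) set => 'v => 'v" where
 "ext_act W N a = De N N (ev (\<lambda>w. cop N (Inr w)) (SOME p. p \<in> carrier (free_alg (carrier W)) \<and> a = cls W p))"

lemma De_De':
 assumes "fd_vectorspace M"
 shows "De M M S (De M M T x) = De M M (S * Pr M * T) x"
 using assms by (simp add: De_def app_Op lmap_id fdD)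

lemma De_Pr:
 assumes "fd_vectorspace M" "x \<in> carrier M"
 shows "De M M (T * Pr M) x = De M M T x" "De M M (Pr M * T) x = De M M T x" "De M M 1 x = x" "De M M 0 x = \<zero>\<^bsub>M\<^esub>"
proof -
 show "De M M (T * Pr M) x = De M M T x" "De M M (Pr M * T) x = De M M T x" "De M M 1 x = x"
  using assms by (simp_all add: De_def app_Op lmap_id fdD iota_kappa iota_closed)
 show "De M M 0 x = \<zero>\<^bsub>M\<^esub>"
  using iota_smult[OF assms(1), of 0 0] vsp_simps(11)[OF fdD(1)[OF assms(1)] iota_closed[OF assms(1)], of 0]
  by (simp add: De_def zero_fun_def)
qed

lemma gens_Inr: "w \<in> carrier W ==> Inr w \<in> gens r W"
 by (simp add: gens_def)

context
 fixes W :: "('k::field_char_0, 'w) module" and r :: nat and N :: "('k, nat + 'w, 'v) rep"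
 assumes W: "vsp W" and N: "cliff_module r W N"
begin

lemma cliff_ev_commute:
 "p \<in> carrier (free_alg (carrier W)) ==> Pr N * ev (\<lambda>w. cop N (Inr w)) p = ev (\<lambda>w. cop N (Inr w)) p * Pr N"
proof (rule ev_commute)
 fix w assume "w \<in> carrier W"
 hence "Inr w \<in> gens r W" by (rule gens_Inr)
 thus "Pr N * cop N (Inr w) = cop N (Inr w) * Pr N" by (simp only: cop_simps(1,2)[OF N])
qed

lemma ext_act_cls:
 assumes p: "p \<in> carrier (free_alg (carrier W))" and x: "x \<in> carrier N"
 shows "ext_act W N (cls W p) x = De N N (ev (\<lambda>w. cop N (Inr w)) p) x"
proof -
 let ?c = "\<lambda>w. cop N (Inr w)" and ?F = "free_alg (carrier W)"
 note n = cliffD[OF N]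
 define q where "q = (SOME q. q \<in> carrier ?F \<and> cls W p = cls W q)"
 have q: "q \<in> carrier ?F" "cls W p = cls W q"
  using someI[of "\<lambda>q. q \<in> carrier ?F \<and> cls W p = cls W q" p] p unfolding q_def by auto
 have nil: "?c w * ?c w = 0" if "w \<in> carrier W" for w
 proof (rule sc_cancel[of 2])
  show "sc 2 * (?c w * ?c w) = sc 2 * 0"
   using cop_simps(4)[OF N gens_Inr[OF that] gens_Inr[OF that]] by (simp add: mult_2)
 qed simp
 have "ev ?c (\<lambda>u. q u - p u) * Pr N = 0"
  by (rule ev_ext_ideal[OF W]) (use cls_eq[OF W q(1) p] q(2) nil in \<open>auto simp: cop_simps[OF N] gens_Inr\<close>)
 moreover have "ev ?c (\<lambda>u. q u - p u) = ev ?c q - ev ?c p"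
  using ev_add[OF q(1) free_alg_closed(2)[OF p, of "- 1"], of ?c] ev_smult[OF p, of ?c "- 1"] by simp
 ultimately have "ev ?c q * Pr N = ev ?c p * Pr N" by (simp add: left_diff_distrib)
 thus ?thesis
  unfolding ext_act_def q_def[symmetric] using De_Pr(1)[OF n(1) x] by metis
qed

lemma ext_act_letter:
 assumes "w \<in> carrier W" "x \<in> carrier N"
 shows "ext_act W N (cls W (letter w)) x = act N (Inr w) x"
 using ext_act_cls[OF letter_closed[OF W assms(1)] assms(2)] De_cop[OF N gens_Inr[OF assms(1)] assms(2)]
 by (simp add: letter_word ev_word)

text \<open>Stated for an arbitrary record extension of a representation, so that it serves for the
  plain and for the graded modules alike.\<close>

lemma alg_module_ext_act:
 fixes M :: "('k, ('w list => 'k) set, 'v, 'x) rep_scheme"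
 assumes s: "same_space N M" and act: "act M = ext_act W N"
 shows "alg_module (ext_alg W) M"
proof -
 let ?c = "\<lambda>w. cop N (Inr w)" and ?F = "free_alg (carrier W)"
 note n = cliffD[OF N] and fd = same_space_fd[OF s cliffD(1)[OF N]]
 note e = ext_alg_simps[OF W]
 have vM: "vsp M" using fd by (rule fdD)
 have [simp]: "carrier M = carrier N" "add M = add N" "zero M = zero N" "smult M = smult N"
  using s by (auto simp: same_space_def)
 have "lmap M M (act M a)" if "a \<in> carrier (ext_alg W)" for a
  unfolding act ext_act_def same_space_lmap[OF s s, symmetric] by (rule De_linear[OF n(1,1)])
 moreover have "lmap (ext_alg W) M (\<lambda>a. act M a x)" if x: "x \<in> carrier M" for x
 proof (rule lmapI[OF vsp_ext_alg[OF W] vM])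
  note x' = x[simplified]
  show "act M a x \<in> carrier M" for a
   unfolding act ext_act_def using lmapD(3)[OF De_linear[OF n(1,1)] x'] by simp
  show "act M (a \<oplus>\<^bsub>ext_alg W\<^esub> b) x = act M a x \<oplus>\<^bsub>M\<^esub> act M b x" if ab: "a \<in> carrier (ext_alg W)" "b \<in> carrier (ext_alg W)" for a b
  proof -
   obtain p q where pq: "p \<in> carrier ?F" "a = cls W p" "q \<in> carrier ?F" "b = cls W q" using ab by (auto simp: e)
   have "ext_act W N (cls W (\<lambda>u. p u + q u)) x = ext_act W N (cls W p) x \<oplus>\<^bsub>N\<^esub> ext_act W N (cls W q) x"
    using ext_act_cls[OF free_alg_closed(1)[OF pq(1,3)] x'] ext_act_cls[OF pq(1) x'] ext_act_cls[OF pq(3) x']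
    by (simp add: ev_add[OF pq(1,3)] De_add[OF n(1,1)])
   thus ?thesis by (simp add: act pq e)
  qed
  show "act M (c \<odot>\<^bsub>ext_alg W\<^esub> a) x = c \<odot>\<^bsub>M\<^esub> act M a x" if a: "a \<in> carrier (ext_alg W)" for a c
  proof -
   obtain p where p: "p \<in> carrier ?F" "a = cls W p" using a by (auto simp: e)
   have "ext_act W N (cls W (\<lambda>u. c * p u)) x = c \<odot>\<^bsub>N\<^esub> ext_act W N (cls W p) x"
    using ext_act_cls[OF free_alg_closed(2)[OF p(1)] x'] ext_act_cls[OF p(1) x']
    by (simp add: ev_smult[OF p(1)] De_smult[OF n(1,1)])
   thus ?thesis by (simp add: act p e)
  qed
 qed
 moreover have "act M \<one>\<^bsub>ext_alg W\<^esub> x = x" if "x \<in> carrier M" for x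
  using that ext_act_cls[OF free_alg_closed(5), of x]
  by (simp add: act e) (simp add: word_Nil ev_word De_Pr[OF n(1)])
 moreover have "act M (a \<otimes>\<^bsub>ext_alg W\<^esub> b) x = act M a (act M b x)"
  if ab: "a \<in> carrier (ext_alg W)" "b \<in> carrier (ext_alg W)" and x: "x \<in> carrier M" for a b x
 proof -
  obtain p q where pq: "p \<in> carrier ?F" "a = cls W p" "q \<in> carrier ?F" "b = cls W q" using ab by (auto simp: e)
  note x' = x[simplified]
  have c: "De N N (ev ?c q) x \<in> carrier N" using lmapD(3)[OF De_linear[OF n(1,1)] x'] .
  have "ext_act W N (cls W (p \<otimes>\<^bsub>?F\<^esub> q)) x = De N N (ev ?c p * ev ?c q) x"
   using ext_act_cls[OF free_alg_closed(3)[OF pq(1,3)] x'] by (simp add: ev_mult[OF pq(1,3)])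
  also have "\<dots> = De N N (ev ?c p * (ev ?c q * Pr N)) x"
   using De_Pr(1)[OF n(1) x', of "ev ?c p * ev ?c q"] by (simp add: mult.assoc)
  also have "\<dots> = ext_act W N (cls W p) (ext_act W N (cls W q) x)"
   unfolding ext_act_cls[OF pq(3) x'] ext_act_cls[OF pq(1) c] De_De'[OF n(1)]
   by (simp add: cliff_ev_commute[OF pq(3)] mult.assoc)
  finally show ?thesis by (simp add: act pq e)
 qed
 ultimately show ?thesis unfolding alg_module_def bilinear_map_def using fd by blast
qed

end

text \<open>Polarisation: expand the square of w + w', which vanishes, and cancel the squares of w
  and w'.\<close>

lemma cliff_letters_relation:
 fixes W :: "('k::field, 'w) module" and M :: "('k, ('w list => 'k) set, 'v, 'x) rep_scheme" (structure)
 assumes W: "vsp W" and M: "alg_module (ext_alg W) M" and w: "w \<in> carrier W" "w' \<in> carrier W" and x: "x \<in> carrier M"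
 shows "act M (cls W (letter w)) (act M (cls W (letter w')) x) \<oplus> act M (cls W (letter w')) (act M (cls W (letter w)) x) = \<zero>"
proof -
 let ?a = "\<lambda>w. act M (cls W (letter w))"
 note m = alg_moduleD[OF M] and v = vsp_simps[OF alg_moduleD(2)[OF M]] and cl = cls_letter[OF W]
 have sq: "?a w (?a w x) = \<zero>" if "w \<in> carrier W" "x \<in> carrier M" for w x
  using m(7)[OF cl(1)[OF that(1)] cl(1)[OF that(1)] that(2)] cl(4)[OF that(1)] lmapD(6)[OF m(5)[OF that(2)]] by simp
 have add: "?a (w \<oplus>\<^bsub>W\<^esub> w') x = ?a w x \<oplus> ?a w' x" if "x \<in> carrier M" for x
  using lmapD(4)[OF m(5)[OF that]] cl w by simp
 have al: "?a u (y \<oplus> z) = ?a u y \<oplus> ?a u z" "?a u y \<in> carrier M" if "u \<in> carrier W" "y \<in> carrier M" "z \<in> carrier M" for u y z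
  using lmapD[OF m(3)[OF cl(1)[OF that(1)]]] that by simp_all
 have c: "?a w x \<in> carrier M" "?a w' x \<in> carrier M" using al(2) w x by blast+
 have "\<zero> = ?a (w \<oplus>\<^bsub>W\<^esub> w') (?a (w \<oplus>\<^bsub>W\<^esub> w') x)" using sq vsp_simps(2)[OF W] w x by simp
 also have "\<dots> = (?a w (?a w x) \<oplus> ?a w (?a w' x)) \<oplus> (?a w' (?a w x) \<oplus> ?a w' (?a w' x))"
  using add[OF x] add[OF v(2)[OF c]] al(1)[OF w(1) c] al(1)[OF w(2) c] by simp
 also have "\<dots> = ?a w (?a w' x) \<oplus> ?a w' (?a w x)"
  using sq[OF w(1) x] sq[OF w(2) x] al(2)[OF w(1) c(2) c(2)] al(2)[OF w(2) c(1) c(1)] v(2,6,7) by simp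
 finally show ?thesis by simp
qed

lemma is_category_ext_modules: "is_category (ext_modules W)"
proof -
 have "vsp M \<and> act_closed (carrier (ext_alg W)) M" if "M \<in> {M. alg_module (ext_alg W) M}" for M
  using alg_moduleD(2,4) that by blast
 from is_category_reps[where Obs = "{M. alg_module (ext_alg W) M}" and Q = "\<lambda>_ _ _. True", OF this]
 show ?thesis by (simp add: ext_modules_def)
qed

lemma is_category_graded_ext_modules: "is_category (graded_ext_modules W)"
proof -
 have sub: "x \<in> carrier M" if "graded_ext_module W M" "i < 2" "x \<in> part M i" for M i x
  using that by (auto simp: graded_ext_module_def less_2_cases_iff subspace_def submodule_def)
 have 1: "vsp M \<and> act_closed (carrier (ext_alg W)) M" if "M \<in> {M. graded_ext_module W M}" for M
  using that alg_moduleD(2)[of "ext_alg W" M] alg_moduleD(4)[of "ext_alg W" M] by (simp add: graded_ext_module_def)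
 have "is_category \<lparr>Ob = {M. graded_ext_module W M},
   Hom = (\<lambda>M N. {\<phi> \<in> rep_hom (carrier (ext_alg W)) M N. \<forall>i<2. \<phi> ` part M i \<subseteq> part N i}),
   Ident = (\<lambda>M. \<lambda>x\<in>carrier M. x), Comp = (\<lambda>M N P \<psi> \<phi>. compose (carrier M) \<psi> \<phi>)\<rparr>"
 proof (rule is_category_reps[OF 1])
  show "\<forall>i<2. (\<lambda>x\<in>carrier M. x) ` part M i \<subseteq> part M i" if "M \<in> {M. graded_ext_module W M}" for M
   using that sub[of M] by auto
  fix M N K \<phi> \<psi>
  assume M: "M \<in> {M. graded_ext_module W M}"
   and h: "\<forall>i<2. \<phi> ` part M i \<subseteq> part N i" "\<forall>i<2. \<psi> ` part N i \<subseteq> part K i"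
  show "\<forall>i<2. compose (carrier M) \<psi> \<phi> ` part M i \<subseteq> part K i"
  proof (intro allI impI image_subsetI)
   fix i :: nat and x assume i: "i < 2" and x: "x \<in> part M i"
   have "\<psi> (\<phi> x) \<in> part K i" using h i x by blast
   thus "compose (carrier M) \<psi> \<phi> x \<in> part K i" using sub[of M i x] M i x by (simp add: compose_def)
  qed
 qed
 thus ?thesis by (simp add: graded_ext_modules_def)
qed

theorem cliff0_equiv_ext_modules:
 fixes W :: "('k::field_char_0, 'w) module"
 assumes W: "vsp W"
 shows "equivalent_categories (cliff_modules 0 W :: (('k, nat + 'w, 'v) rep, 'v => 'v) category)
  (ext_modules W :: (('k, ('w list => 'k) set, 'v) rep, 'v => 'v) category)"
proof (rule equivalent_categories_if_related[OF is_category_cliff is_category_ext_modules,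
  where R = "\<lambda>N M. same_space N M \<and> (\<forall>w\<in>carrier W. \<forall>x\<in>carrier N. act N (Inr w) x = act M (cls W (letter w)) x)"])
 let ?C = "cliff_modules 0 W :: (('k, nat + 'w, 'v) rep, 'v => 'v) category"
 let ?D = "ext_modules W :: (('k, ('w list => 'k) set, 'v) rep, 'v => 'v) category"
 let ?R = "\<lambda>N M. same_space N M \<and> (\<forall>w\<in>carrier W. \<forall>x\<in>carrier N. act N (Inr w) x = act M (cls W (letter w)) x)"
 have g0: "gens 0 W = Inr ` carrier W" by (simp add: gens_def)
 {
  fix N assume "N \<in> Ob ?C"
  hence N: "cliff_module 0 W N" by (simp add: cliff_modules_def)
  let ?M = "\<lparr>carrier = carrier N, mult = mult N, one = one N, zero = zero N, add = add N, smult = smult N, act = ext_act W N\<rparr>"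
  have s: "same_space N ?M" by (simp add: same_space_def)
  have "alg_module (ext_alg W) ?M" by (rule alg_module_ext_act[OF W N s]) simp
  thus "\<exists>M\<in>Ob ?D. ?R N M"
   using s ext_act_letter[OF W N] by (intro bexI[of _ ?M]) (auto simp: ext_modules_def)
 }
 {
  fix M assume "M \<in> Ob ?D"
  hence M: "alg_module (ext_alg W) M" by (simp add: ext_modules_def)
  note m = alg_moduleD[OF M] and cl = cls_letter[OF W]
  let ?N = "\<lparr>carrier = carrier M, mult = mult M, one = one M, zero = zero M, add = add M, smult = smult M,
   act = (\<lambda>a. case a of Inl i => (\<lambda>x. x) | Inr w => act M (cls W (letter w)))\<rparr> :: ('k, nat + 'w, 'v) rep"
  have s: "same_space M ?N" by (simp add: same_space_def)
  have "cliff_module 0 W ?N"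
   unfolding cliff_module_def g0
   using same_space_fd[OF s m(1)] m(3) cl lmapD(4,5)[OF m(5)]
    cliff_letters_relation[OF W M] vsp_simps(11)[OF m(2)]
   by (auto simp: same_space_lmap[OF s s, symmetric])
  thus "\<exists>N\<in>Ob ?C. ?R N M"
   using same_space_sym[OF s] by (intro bexI[of _ ?N]) (auto simp: cliff_modules_def)
 }
 fix N M assume N: "N \<in> Ob ?C" and M: "M \<in> Ob ?D" and R: "?R N M"
 have c: "carrier N = carrier M" using R by (simp add: same_space_def)
 show "Ident ?C N = Ident ?D M" using c by (simp add: cliff_modules_def ext_modules_def)
 show "Comp ?C N N' N'' = Comp ?D M M' M''" for N' M' N'' M''
  using c by (simp add: cliff_modules_def ext_modules_def)
 fix N' M' assume N': "N' \<in> Ob ?C" and M': "M' \<in> Ob ?D" and R': "?R N' M'"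
 have ms: "alg_module (ext_alg W) M" "alg_module (ext_alg W) M'" using M M' by (auto simp: ext_modules_def)
 have lm: "lmap N N' \<phi> \<longleftrightarrow> lmap M M' \<phi>" for \<phi> using same_space_lmap R R' by blast
 have "\<phi> \<in> rep_hom (gens 0 W) N N' \<longleftrightarrow> \<phi> \<in> rep_hom (carrier (ext_alg W)) M M'" for \<phi>
 proof
  assume h: "\<phi> \<in> rep_hom (gens 0 W) N N'"
  thus "\<phi> \<in> rep_hom (carrier (ext_alg W)) M M'"
   using hom_if_commutes_letters[OF W ms, of \<phi>] R R' rep_homD(3)[OF h, of "Inr _"] rep_homD(4)[OF h]
   by (auto simp: rep_hom_def lm c g0)
 next
  assume h: "\<phi> \<in> rep_hom (carrier (ext_alg W)) M M'"
  thus "\<phi> \<in> rep_hom (gens 0 W) N N'"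
   using R R' rep_homD(3)[OF h] cls_letter(1)[OF W] rep_homD(4)[OF h]
   by (auto simp: rep_hom_def lm c g0 same_space_def)
 qed
 thus "Hom ?C N N' = Hom ?D M M'" by (auto simp: cliff_modules_def ext_modules_def)
qed

section \<open>Graded modules over the exterior algebra: the grading as a Clifford generator\<close>

text \<open>The single generator of rank 1 squares to -1, so its eigenvalues are i and -i. The even
  part is taken to be the eigenspace of i, the odd part that of -i.\<close>

definition gsgn :: "nat => 'k::alg_closed_field" where
 "gsgn i = (if i = 0 then img else - img)"

lemma gsgn_simps: "gsgn 0 = img" "gsgn 1 = - img" "gsgn (Suc 0) = - img" by (simp_all add: gsgn_def)

text \<open>For an operator T of square -1 the projections to the eigenspaces of i and -i are (1 - i
  T) / 2 and (1 + i T) / 2; substituting a decomposition into them gives back its components, hence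
  uniqueness.\<close>

lemma eigenspace_decomposition:
 fixes N :: "('k::{alg_closed_field, field_char_0}, 'v, 'x) module_scheme" (structure)
 assumes T: "lmap N N T" and sq: "\<And>x. x \<in> carrier N ==> T (T x) = (- 1) \<odot> x" and x: "x \<in> carrier N"
 defines "E i \<equiv> {x \<in> carrier N. T x = gsgn i \<odot> x}"
 shows "\<exists>!p. p \<in> E 0 \<times> E 1 \<and> x = fst p \<oplus> snd p"
proof -
 note t = lmapD[OF T] and v = vsp_simps[OF lmapD(1)[OF T]]
 interpret V: vectorspace class_ring N by (rule t(1))
 let ?a = "\<lambda>x. (1 / 2) \<odot> (x \<oplus> (- img) \<odot> T x)" and ?b = "\<lambda>x. (1 / 2) \<odot> (x \<oplus> img \<odot> T x)"
 have c: "T x \<in> carrier N" "img \<odot> T x \<in> carrier N" "(- img) \<odot> T x \<in> carrier N" using t x v by auto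
 have Ta: "T (?a x) = (1 / 2) \<odot> (T x \<oplus> img \<odot> x)" "T (?b x) = (1 / 2) \<odot> (T x \<oplus> (- img) \<odot> x)"
  using x c by (simp_all add: t(4,5) sq v(2,3,9))
 have "T (?a x) = gsgn 0 \<odot> ?a x" "T (?b x) = gsgn 1 \<odot> ?b x"
  unfolding Ta gsgn_simps using x c v(4)[of "T x" "img \<odot> x"] v(4)[of "T x" "(- img) \<odot> x"]
  by (simp_all add: v(3,9,10,14) img_sq mult.assoc mult.left_commute[of img])
 hence ab: "?a x \<in> E 0" "?b x \<in> E 1" using x c v(2,3) by (auto simp: E_def)
 have sum: "x = ?a x \<oplus> ?b x"
 proof -
  have "?a x \<oplus> ?b x = (1 / 2) \<odot> x \<oplus> (((- img / 2) \<odot> T x \<oplus> (img / 2) \<odot> T x) \<oplus> (1 / 2) \<odot> x)"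
   using x c by (simp add: v(2,3,9,14) V.a_ac)
  also have "\<dots> = x" using x c by (simp add: v(7,11,13,10))
  finally show ?thesis by simp
 qed
 show ?thesis
 proof (rule ex1I[of _ "(?a x, ?b x)"])
  show "(?a x, ?b x) \<in> E 0 \<times> E 1 \<and> x = fst (?a x, ?b x) \<oplus> snd (?a x, ?b x)" using ab sum by simp
  fix p assume p: "p \<in> E 0 \<times> E 1 \<and> x = fst p \<oplus> snd p"
  obtain a b where ab: "p = (a, b)" by (cases p)
  have a: "a \<in> carrier N" "T a = img \<odot> a" "b \<in> carrier N" "T b = (- img) \<odot> b" "x = a \<oplus> b"
   using p by (auto simp: ab E_def gsgn_simps)
  have Tx: "T x = img \<odot> a \<oplus> (- img) \<odot> b" using a t(4)[of a b] by simp
  have half: "(1 / 2) \<odot> (a \<oplus> a) = a" if "a \<in> carrier N" for a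
   using that v(13)[of a "1/2" "1/2"] by (simp add: v(14,10))
  have z: "c \<oplus> (- 1) \<odot> c = \<zero>" if "c \<in> carrier N" for c using that by (simp add: v(8))
  have "?a x = (1 / 2) \<odot> ((a \<oplus> a) \<oplus> (b \<oplus> (- 1) \<odot> b))"
   unfolding Tx unfolding a(5) using a(1,3) img_sq[where ?'k = 'k]
   by (simp add: v(2,3,9,14) V.a_ac)
  hence 1: "?a x = a" using a(1,3) half[of a] by (simp add: z v(2,6))
  have "?b x = (1 / 2) \<odot> ((b \<oplus> b) \<oplus> (a \<oplus> (- 1) \<odot> a))"
   unfolding Tx unfolding a(5) using a(1,3) img_sq[where ?'k = 'k]
   by (simp add: v(2,3,9,14) V.a_ac)
  hence 2: "?b x = b" using a(1,3) half[of b] by (simp add: z v(2,6))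
  show "p = (?a x, ?b x)" using 1 2 ab by simp
 qed
qed

lemma subspace_eigen:
 fixes N :: "('k::alg_closed_field, 'v, 'x) module_scheme"
 assumes T: "lmap N N T"
 shows "VectorSpace.subspace class_ring {x \<in> carrier N. T x = gsgn i \<odot>\<^bsub>N\<^esub> x} N"
proof -
 note t = lmapD[OF T] and v = vsp_simps[OF lmapD(1)[OF T]]
 interpret vectorspace class_ring N by (rule t(1))
 show ?thesis
  by (intro VectorSpace.subspace.intro submodule.intro vectorspace_axioms module_axioms)
   (auto simp: t(4,5,6) v(2,3,12,9,14) mult.commute t(1))
qed

lemma same_space_subspace:
 assumes "same_space M N" "VectorSpace.subspace class_ring S M"
 shows "VectorSpace.subspace class_ring S (N :: ('k::field, 'v, 'y) module_scheme)"
proof -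
 have M: "vsp M" "submodule class_ring S M" using assms(2) by (auto simp: subspace_def)
 interpret N: vectorspace class_ring N using same_space_vsp[OF assms(1) M(1)] .
 show ?thesis
  using M(2) assms(1) unfolding submodule_def same_space_def
  by (intro VectorSpace.subspace.intro submodule.intro N.vectorspace_axioms N.module_axioms) auto
qed

lemma subspD:
 fixes N :: "('k::field, 'v, 'x) module_scheme"
 assumes "VectorSpace.subspace class_ring S N"
 shows "x \<in> S ==> x \<in> carrier N" "[|x \<in> S; y \<in> S|] ==> x \<oplus>\<^bsub>N\<^esub> y \<in> S" "x \<in> S ==> c \<odot>\<^bsub>N\<^esub> x \<in> S" "\<zero>\<^bsub>N\<^esub> \<in> S"
 using assms by (auto simp: subspace_def submodule_def)

lemma gradedD:
 assumes "graded_ext_module W M"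
 shows "alg_module (ext_alg W) M" "i < 2 ==> VectorSpace.subspace class_ring (part M i) M"
  "x \<in> carrier M ==> \<exists>!p. p \<in> part M 0 \<times> part M 1 \<and> x = fst p \<oplus>\<^bsub>M\<^esub> snd p"
  "[|i < 2; j < 2; a \<in> ext_part W i; x \<in> part M j|] ==> act M a x \<in> part M ((i + j) mod 2)"
 using assms by (auto simp: graded_ext_module_def less_2_cases_iff)

definition grade_op :: "('k::alg_closed_field, 'a, 'v) graded_rep => 'v => 'v" where
 "grade_op M x = (let p = THE p. p \<in> part M 0 \<times> part M 1 \<and> x = fst p \<oplus>\<^bsub>M\<^esub> snd p in
  img \<odot>\<^bsub>M\<^esub> fst p \<oplus>\<^bsub>M\<^esub> (- img) \<odot>\<^bsub>M\<^esub> snd p)"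

context
 fixes W :: "('k::{alg_closed_field, field_char_0}, 'w) module"
 assumes W: "vsp W"
begin

lemma cliff1_graded:
 assumes N: "cliff_module 1 W N"
 defines "M \<equiv> \<lparr>carrier = carrier N, mult = mult N, one = one N, zero = zero N, add = add N, smult = smult N, act = ext_act W N,
   part = (\<lambda>i. {x \<in> carrier N. act N (Inl 0) x = gsgn i \<odot>\<^bsub>N\<^esub> x})\<rparr>"
 shows "graded_ext_module W M"
proof -
 note n = cliffD[OF N] and v = vsp_simps[OF cliffD(2)[OF N]]
 have s: "same_space N M" by (simp add: same_space_def M_def)
 have g: "Inl 0 \<in> gens 1 W" by (simp add: gens_def)
 note T = n(3)[OF g]
 have sq: "act N (Inl 0) (act N (Inl 0) x) = (- 1) \<odot>\<^bsub>N\<^esub> x" if x: "x \<in> carrier N" for x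
 proof -
  have "act N (Inl 0) (act N (Inl 0) x) \<in> carrier N" using lmapD(3)[OF T] x by blast
  hence "act N (Inl 0) (act N (Inl 0) x) = (1 / 2) \<odot>\<^bsub>N\<^esub> (act N (Inl 0) (act N (Inl 0) x) \<oplus>\<^bsub>N\<^esub> act N (Inl 0) (act N (Inl 0) x))"
   by (simp add: v(14,13,10))
  thus ?thesis using n(7)[OF g g x] x by (simp add: v(9))
 qed
 have alg: "alg_module (ext_alg W) M" by (rule alg_module_ext_act[OF W N s]) (simp add: M_def)
 have "act M a x \<in> part M ((i + j) mod 2)" if ij: "i < 2" "j < 2" and a: "a \<in> ext_part W i" and x: "x \<in> part M j" for i j a x
 proof -
  let ?c = "\<lambda>w. cop N (Inr w)" and ?C = "cop N (Inl 0)"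
  obtain p where p: "p \<in> carrier (free_alg (carrier W))" "a = cls W p" "\<And>u. p u \<noteq> 0 ==> length u mod 2 = i mod 2"
   using a by (auto simp: ext_part_def cls_def)
  have x': "x \<in> carrier N" "act N (Inl 0) x = gsgn j \<odot>\<^bsub>N\<^esub> x" using x by (auto simp: M_def)
  have ax: "act M a x = De N N (ev ?c p) x" using ext_act_cls[OF W N p(1) x'(1)] by (simp add: M_def p)
  have cx: "act M a x \<in> carrier N" unfolding ax using lmapD(3)[OF De_linear[OF n(1,1)] x'(1)] .
  \<comment> \<open>Letters anticommute with the generator, so an element of degree i commutes with
    it up to the sign (-1)^i and shifts its eigenspaces by i.\<close>
  have anti: "?C * ev ?c p = sc ((- 1) ^ i) * (ev ?c p * ?C)"
  proof (rule ev_anticommute[OF p(1) _ p(3)])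
   fix w assume "w \<in> carrier W"
   thus "?C * ?c w = - (?c w * ?C)" using cop_anticommute[OF N gens_Inr g] by simp
  qed
  have C: "De N N ?C y = act N (Inl 0) y" if "y \<in> carrier N" for y using De_cop[OF N g that] .
  have PC: "Pr N * ?C = ?C" "?C * Pr N = ?C" using cop_simps(1,2)[OF N g] by auto
  have "act N (Inl 0) (act M a x) = De N N ?C (De N N (ev ?c p) x)" using C[OF cx] ax by simp
  also have "\<dots> = De N N (sc ((- 1) ^ i) * (ev ?c p * Pr N * ?C)) x"
   by (simp only: De_De'[OF n(1)] PC anti mult.assoc)
  also have "\<dots> = ((- 1) ^ i) \<odot>\<^bsub>N\<^esub> De N N (ev ?c p) (act N (Inl 0) x)"
   by (simp only: De_smult[OF n(1,1)] De_De'[OF n(1), symmetric] C[OF x'(1)])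
  also have "\<dots> = gsgn ((i + j) mod 2) \<odot>\<^bsub>N\<^esub> act M a x"
   unfolding x'(2) lmapD(5)[OF De_linear[OF n(1,1)] x'(1)] ax[symmetric]
   using ij cx by (auto simp: less_2_cases_iff gsgn_simps v(9))
  finally show ?thesis using cx by (simp add: M_def)
 qed
 thus ?thesis
  unfolding graded_ext_module_def
  using alg same_space_subspace[OF s subspace_eigen[OF T]] eigenspace_decomposition[OF T sq]
  by (auto simp: M_def)
qed

text \<open>The parity operator multiplied by i squares to -1, and it anticommutes with the letters
  because these exchange the even and the odd part.\<close>

lemma graded_cliff1:
 fixes M :: "('k, ('w list => 'k) set, 'v) graded_rep"
 assumes M: "graded_ext_module W M"
 defines "N \<equiv> \<lparr>carrier = carrier M, mult = mult M, one = one M, zero = zero M, add = add M, smult = smult M,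
   act = (\<lambda>a. case a of Inl i => grade_op M | Inr w => act M (cls W (letter w)))\<rparr> :: ('k, nat + 'w, 'v) rep"
 shows "[|a \<in> part M 0; b \<in> part M 1|] ==> grade_op M (a \<oplus>\<^bsub>M\<^esub> b) = img \<odot>\<^bsub>M\<^esub> a \<oplus>\<^bsub>M\<^esub> (- img) \<odot>\<^bsub>M\<^esub> b"
  and "cliff_module 1 W N"
  and "[|i < 2; x \<in> part M i|] ==> grade_op M x = gsgn i \<odot>\<^bsub>M\<^esub> x"
proof -
 note g = gradedD[OF M] and m = alg_moduleD[OF gradedD(1)[OF M]]
 note v = vsp_simps[OF m(2)] and cl = cls_letter[OF W]
 have two: "(0::nat) < 2" "(1::nat) < 2" by auto
 note p0 = subspD[OF g(2)[OF two(1)]] and p1 = subspD[OF g(2)[OF two(2)]]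
 have *: "grade_op M (a \<oplus>\<^bsub>M\<^esub> b) = img \<odot>\<^bsub>M\<^esub> a \<oplus>\<^bsub>M\<^esub> (- img) \<odot>\<^bsub>M\<^esub> b" if "a \<in> part M 0" "b \<in> part M 1" for a b
 proof -
  have "a \<oplus>\<^bsub>M\<^esub> b \<in> carrier M" by (rule v(2)[OF p0(1)[OF that(1)] p1(1)[OF that(2)]])
  hence "(THE p. p \<in> part M 0 \<times> part M 1 \<and> a \<oplus>\<^bsub>M\<^esub> b = fst p \<oplus>\<^bsub>M\<^esub> snd p) = (a, b)"
   using that by (intro the1_equality g(3)) auto
  thus ?thesis by (simp add: grade_op_def)
 qed
 thus "[|a \<in> part M 0; b \<in> part M 1|] ==> grade_op M (a \<oplus>\<^bsub>M\<^esub> b) = img \<odot>\<^bsub>M\<^esub> a \<oplus>\<^bsub>M\<^esub> (- img) \<odot>\<^bsub>M\<^esub> b" .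
 show "grade_op M x = gsgn i \<odot>\<^bsub>M\<^esub> x" if "i < 2" "x \<in> part M i"
  using that(1) unfolding less_2_cases_iff
 proof
  assume i: "i = 0"
  thus ?thesis using *[of x "\<zero>\<^bsub>M\<^esub>"] that(2) p0 p1 v(3) by (simp add: v(6,12) gsgn_simps)
 next
  assume i: "i = Suc 0"
  thus ?thesis using *[of "\<zero>\<^bsub>M\<^esub>" x] that(2) p0 p1 v(3) by (simp add: v(7,12) gsgn_simps)
 qed
 have dec: "\<exists>a b. x = a \<oplus>\<^bsub>M\<^esub> b \<and> a \<in> part M 0 \<and> b \<in> part M 1" if x: "x \<in> carrier M" for x
 proof -
  obtain p where "p \<in> part M 0 \<times> part M 1" "x = fst p \<oplus>\<^bsub>M\<^esub> snd p" using g(3)[OF x] by blast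
  thus ?thesis by (intro exI[of _ "fst p"] exI[of _ "snd p"]) auto
 qed
 have lT: "lmap M M (grade_op M)"
 proof (rule lmapI[OF m(2) m(2)])
  fix x assume x: "x \<in> carrier M"
  obtain a b where ab: "x = a \<oplus>\<^bsub>M\<^esub> b" "a \<in> part M 0" "b \<in> part M 1" using dec[OF x] by blast
  have c: "a \<in> carrier M" "b \<in> carrier M" using ab p0 p1 by auto
  show "grade_op M x \<in> carrier M" unfolding ab(1) *[OF ab(2,3)] using c v by simp
  show "grade_op M (k \<odot>\<^bsub>M\<^esub> x) = k \<odot>\<^bsub>M\<^esub> grade_op M x" for k
   unfolding ab(1) *[OF ab(2,3)] v(14)[OF c] *[OF p0(3)[OF ab(2)] p1(3)[OF ab(3)]]
   using c by (simp add: v(3,9,14) mult.commute)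
  fix y assume y: "y \<in> carrier M"
  obtain a' b' where ab': "y = a' \<oplus>\<^bsub>M\<^esub> b'" "a' \<in> part M 0" "b' \<in> part M 1" using dec[OF y] by blast
  have c': "a' \<in> carrier M" "b' \<in> carrier M" using ab' p0 p1 by auto
  have sw: "(a \<oplus>\<^bsub>M\<^esub> b) \<oplus>\<^bsub>M\<^esub> (a' \<oplus>\<^bsub>M\<^esub> b') = (a \<oplus>\<^bsub>M\<^esub> a') \<oplus>\<^bsub>M\<^esub> (b \<oplus>\<^bsub>M\<^esub> b')"
   if "a \<in> carrier M" "b \<in> carrier M" "a' \<in> carrier M" "b' \<in> carrier M" for a b a' b'
   using that v(2) v(5)[of a b "a' \<oplus>\<^bsub>M\<^esub> b'"] v(5)[of b a' b'] v(5)[of a' b b'] v(4)[of b a'] v(5)[of a a' "b \<oplus>\<^bsub>M\<^esub> b'"] by simp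
  show "grade_op M (x \<oplus>\<^bsub>M\<^esub> y) = grade_op M x \<oplus>\<^bsub>M\<^esub> grade_op M y"
   unfolding ab(1) ab'(1) *[OF ab(2,3)] *[OF ab'(2,3)] sw[OF c c'] *[OF p0(2)[OF ab(2) ab'(2)] p1(2)[OF ab(3) ab'(3)]]
   using c c' sw[of "img \<odot>\<^bsub>M\<^esub> a" "(- img) \<odot>\<^bsub>M\<^esub> b" "img \<odot>\<^bsub>M\<^esub> a'" "(- img) \<odot>\<^bsub>M\<^esub> b'"] by (simp add: v(3,14))
 qed
 have TT: "grade_op M (grade_op M x) \<oplus>\<^bsub>M\<^esub> grade_op M (grade_op M x) = (- 2) \<odot>\<^bsub>M\<^esub> x" if x: "x \<in> carrier M" for x
 proof -
  obtain a b where ab: "x = a \<oplus>\<^bsub>M\<^esub> b" "a \<in> part M 0" "b \<in> part M 1" using dec[OF x] by blast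
  have c: "a \<in> carrier M" "b \<in> carrier M" using ab p0 p1 by auto
  have "grade_op M (grade_op M x) = (- 1) \<odot>\<^bsub>M\<^esub> x"
   unfolding ab(1) *[OF ab(2,3)] *[OF p0(3)[OF ab(2)] p1(3)[OF ab(3)]] using c by (simp add: v(9,14) img_sq)
  thus ?thesis using x v(13)[OF x, of "- 1" "- 1"] by simp
 qed
 have anti: "grade_op M (act M (cls W (letter w)) x) \<oplus>\<^bsub>M\<^esub> act M (cls W (letter w)) (grade_op M x) = \<zero>\<^bsub>M\<^esub>"
  if w: "w \<in> carrier W" and x: "x \<in> carrier M" for w x
 proof -
  let ?l = "act M (cls W (letter w))"
  note l = lmapD[OF m(3)[OF cl(1)[OF w]]]
  obtain a b where ab: "x = a \<oplus>\<^bsub>M\<^esub> b" "a \<in> part M 0" "b \<in> part M 1" using dec[OF x] by blast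
  have c: "a \<in> carrier M" "b \<in> carrier M" using ab p0 p1 by auto
  have "cls W (letter w) \<in> ext_part W 1"
   unfolding ext_part_def cls_def using letter_closed[OF W w]
   by (intro CollectI exI[of _ "letter w"]) (auto simp: letter_def)
  hence la: "?l b \<in> part M 0" "?l a \<in> part M 1" using g(4)[of 1 0 _ a] g(4)[of 1 1 _ b] ab by (auto simp: numeral_2_eq_2)
  have lx: "?l x = ?l b \<oplus>\<^bsub>M\<^esub> ?l a" unfolding ab(1) using l(4)[OF c] v(4) l(3) c by simp
  have cc: "?l a \<in> carrier M" "?l b \<in> carrier M" using l(3) c by auto
  have "grade_op M (?l x) = img \<odot>\<^bsub>M\<^esub> ?l b \<oplus>\<^bsub>M\<^esub> (- img) \<odot>\<^bsub>M\<^esub> ?l a" unfolding lx by (rule *[OF la])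
  moreover have "?l (grade_op M x) = (- 1) \<odot>\<^bsub>M\<^esub> (img \<odot>\<^bsub>M\<^esub> ?l b \<oplus>\<^bsub>M\<^esub> (- img) \<odot>\<^bsub>M\<^esub> ?l a)"
   unfolding ab(1) *[OF ab(2,3)] using c cc l(4,5) v(4)[of "img \<odot>\<^bsub>M\<^esub> ?l a" "(- img) \<odot>\<^bsub>M\<^esub> ?l b"] by (simp add: v(3,9,14))
  ultimately show ?thesis using cc v(8) by (simp add: v(2,3))
 qed
 have s: "same_space M N" by (simp add: same_space_def N_def)
 have g1: "gens 1 W = insert (Inl 0) (Inr ` carrier W)" by (auto simp: gens_def)
 have "act N a (act N b x) \<oplus>\<^bsub>N\<^esub> act N b (act N a x) = (- 2 * cform a b) \<odot>\<^bsub>N\<^esub> x"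
  if ab: "a \<in> gens 1 W" "b \<in> gens 1 W" and x: "x \<in> carrier N" for a b x
 proof -
  have x': "x \<in> carrier M" using x by (simp add: N_def)
  have cm: "grade_op M (act M (cls W (letter w)) x) \<in> carrier M" "act M (cls W (letter w)) (grade_op M x) \<in> carrier M" if "w \<in> carrier W" for w
   using lmapD(3)[OF lT] lmapD(3)[OF m(3)[OF cl(1)[OF that]]] x' by blast+
  consider "a = Inl 0" "b = Inl 0" | w where "a = Inl 0" "b = Inr w" "w \<in> carrier W" | w where "a = Inr w" "b = Inl 0" "w \<in> carrier W"
   | w w' where "a = Inr w" "b = Inr w'" "w \<in> carrier W" "w' \<in> carrier W"
   using ab unfolding g1 by blast
  thus ?thesis
  proof cases
   case 1 thus ?thesis using TT[OF x'] by (simp add: N_def)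
  next
   case (2 w) thus ?thesis using anti[OF 2(3) x'] v(11)[OF x'] by (simp add: N_def)
  next
   case (3 w) thus ?thesis using anti[OF 3(3) x'] v(11)[OF x'] cm[OF 3(3)] v(4) by (simp add: N_def)
  next
   case (4 w w') thus ?thesis using cliff_letters_relation[OF W g(1) 4(3,4) x'] v(11)[OF x'] by (simp add: N_def)
  qed
 qed
 moreover have "lmap N N (act N a)" if "a \<in> gens 1 W" for a
  using that unfolding g1 same_space_lmap[OF s s, symmetric] using lT m(3) cl(1) by (auto simp: N_def)
 moreover have "\<forall>w\<in>carrier W. \<forall>w'\<in>carrier W. \<forall>x\<in>carrier N. act N (Inr (w \<oplus>\<^bsub>W\<^esub> w')) x = act N (Inr w) x \<oplus>\<^bsub>N\<^esub> act N (Inr w') x"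
  "\<forall>c. \<forall>w\<in>carrier W. \<forall>x\<in>carrier N. act N (Inr (c \<odot>\<^bsub>W\<^esub> w)) x = c \<odot>\<^bsub>N\<^esub> act N (Inr w) x"
  using cl lmapD(4,5)[OF m(5)] by (auto simp: N_def)
 ultimately show "cliff_module 1 W N"
  unfolding cliff_module_def using same_space_fd[OF s m(1)] by blast
qed

theorem cliff1_equiv_graded_ext_modules:
 "equivalent_categories (cliff_modules 1 W :: (('k, nat + 'w, 'v) rep, 'v => 'v) category)
  (graded_ext_modules W :: (('k, ('w list => 'k) set, 'v) graded_rep, 'v => 'v) category)"
proof (rule equivalent_categories_if_related[OF is_category_cliff is_category_graded_ext_modules,
  where R = "\<lambda>N M. same_space N M \<and> (\<forall>w\<in>carrier W. \<forall>x\<in>carrier N. act N (Inr w) x = act M (cls W (letter w)) x) \<and>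
   (\<forall>i<2. \<forall>x\<in>part M i. act N (Inl 0) x = gsgn i \<odot>\<^bsub>N\<^esub> x)"])
 let ?C = "cliff_modules 1 W :: (('k, nat + 'w, 'v) rep, 'v => 'v) category"
 let ?D = "graded_ext_modules W :: (('k, ('w list => 'k) set, 'v) graded_rep, 'v => 'v) category"
 let ?R = "\<lambda>N M. same_space N M \<and> (\<forall>w\<in>carrier W. \<forall>x\<in>carrier N. act N (Inr w) x = act M (cls W (letter w)) x) \<and>
   (\<forall>i<2. \<forall>x\<in>part M i. act N (Inl 0) x = gsgn i \<odot>\<^bsub>N\<^esub> x)"
 have g1: "gens 1 W = insert (Inl 0) (Inr ` carrier W)" by (auto simp: gens_def)
 {
  fix N assume "N \<in> Ob ?C"
  hence N: "cliff_module 1 W N" by (simp add: cliff_modules_def)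
  show "\<exists>M\<in>Ob ?D. ?R N M"
   using cliff1_graded[OF N] ext_act_letter[OF W N]
   by (intro bexI[of _ "\<lparr>carrier = carrier N, mult = mult N, one = one N, zero = zero N, add = add N, smult = smult N, act = ext_act W N,
     part = (\<lambda>i. {x \<in> carrier N. act N (Inl 0) x = gsgn i \<odot>\<^bsub>N\<^esub> x})\<rparr>"])
    (auto simp: graded_ext_modules_def same_space_def)
 }
 {
  fix M assume "M \<in> Ob ?D"
  hence M: "graded_ext_module W M" by (simp add: graded_ext_modules_def)
  show "\<exists>N\<in>Ob ?C. ?R N M"
   using graded_cliff1(2,3)[OF M]
   by (intro bexI[of _ "\<lparr>carrier = carrier M, mult = mult M, one = one M, zero = zero M, add = add M, smult = smult M,
   act = (\<lambda>a. case a of Inl i => grade_op M | Inr w => act M (cls W (letter w)))\<rparr>"])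
    (auto simp: cliff_modules_def same_space_def)
 }
 fix N M assume N: "N \<in> Ob ?C" and M: "M \<in> Ob ?D" and R: "?R N M"
 have c: "carrier N = carrier M" using R by (simp add: same_space_def)
 show "Ident ?C N = Ident ?D M" using c by (simp add: cliff_modules_def graded_ext_modules_def)
 show "Comp ?C N N' N'' = Comp ?D M M' M''" for N' M' N'' M''
  using c by (simp add: cliff_modules_def graded_ext_modules_def)
 fix N' M' assume N': "N' \<in> Ob ?C" and M': "M' \<in> Ob ?D" and R': "?R N' M'"
 have gm: "graded_ext_module W M" "graded_ext_module W M'" using M M' by (auto simp: graded_ext_modules_def)
 note g = gradedD[OF gm(1)] and g' = gradedD[OF gm(2)]
 have n: "cliff_module 1 W N" "cliff_module 1 W N'" using N N' by (auto simp: cliff_modules_def)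
 have lm: "lmap N N' \<phi> \<longleftrightarrow> lmap M M' \<phi>" for \<phi> using same_space_lmap R R' by blast
 have g0: "Inl 0 \<in> gens 1 W" by (simp add: gens_def)
 have iN: "Inl 0 \<in> gens 1 W" "\<And>w. w \<in> carrier W ==> Inr w \<in> gens 1 W" by (auto simp: gens_def)
 have ops: "smult M = smult N" "add M = add N" "smult M' = smult N'" "add M' = add N'" "carrier N' = carrier M'" "zero N' = zero M'"
  using R R' by (auto simp: same_space_def)
 note v' = vsp_simps[OF cliffD(2)[OF n(2)]]
 have gr: "\<And>i x. i < 2 ==> x \<in> part M i ==> act N (Inl 0) x = gsgn i \<odot>\<^bsub>N\<^esub> x"
  "\<And>i x. i < 2 ==> x \<in> part M' i ==> act N' (Inl 0) x = gsgn i \<odot>\<^bsub>N'\<^esub> x"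
  using R R' by blast+
 \<comment> \<open>The parts of a related graded module are the full eigenspaces: splitting an
   eigenvector y into its even and odd component and comparing the two expressions for the image of
   y makes the wrong component vanish. Hence a map commuting with the generator preserves the
   parts.\<close>
 have eig: "y \<in> part M' i" if i: "i < 2" and y: "y \<in> carrier M'" and e: "act N' (Inl 0) y = gsgn i \<odot>\<^bsub>N'\<^esub> y" for y i
 proof -
  obtain p where p: "p \<in> part M' 0 \<times> part M' 1" "y = fst p \<oplus>\<^bsub>M'\<^esub> snd p" using g'(3)[OF y] by blast
  obtain a b where ab: "a \<in> part M' 0" "b \<in> part M' 1" "y = a \<oplus>\<^bsub>N'\<^esub> b" using p by (cases p) (auto simp: ops)
  have ca: "a \<in> carrier N'" "b \<in> carrier N'"
   using subspD(1)[OF g'(2)[of 0]] subspD(1)[OF g'(2)[of 1]] ab by (auto simp: ops)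
  have Ta: "act N' (Inl 0) a = img \<odot>\<^bsub>N'\<^esub> a" "act N' (Inl 0) b = (- img) \<odot>\<^bsub>N'\<^esub> b"
   using gr(2)[of 0 a] gr(2)[of 1 b] ab by (simp_all add: gsgn_simps)
  have Ty: "act N' (Inl 0) y = img \<odot>\<^bsub>N'\<^esub> a \<oplus>\<^bsub>N'\<^esub> (- img) \<odot>\<^bsub>N'\<^esub> b"
   using lmapD(4)[OF cliffD(3)[OF n(2) g0] ca] Ta ab by simp
  have canc: "d = \<zero>\<^bsub>N'\<^esub>" if d: "d \<in> carrier N'" and s: "s \<oplus>\<^bsub>N'\<^esub> (- img) \<odot>\<^bsub>N'\<^esub> d = s \<oplus>\<^bsub>N'\<^esub> img \<odot>\<^bsub>N'\<^esub> d" and sc: "s \<in> carrier N'" for s d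
  proof -
   interpret V: vectorspace class_ring N' using cliffD(2)[OF n(2)] .
   have "(- img) \<odot>\<^bsub>N'\<^esub> d = ((- 1) \<odot>\<^bsub>N'\<^esub> s \<oplus>\<^bsub>N'\<^esub> s) \<oplus>\<^bsub>N'\<^esub> (- img) \<odot>\<^bsub>N'\<^esub> d"
    using sc d by (simp add: v'(3,7,11,13) v'(4)[of _ s] v'(8))
   also have "\<dots> = (- 1) \<odot>\<^bsub>N'\<^esub> s \<oplus>\<^bsub>N'\<^esub> (s \<oplus>\<^bsub>N'\<^esub> img \<odot>\<^bsub>N'\<^esub> d)"
    using sc d v'(3) unfolding s[symmetric] by (simp add: v'(5))
   also have "\<dots> = ((- 1) \<odot>\<^bsub>N'\<^esub> s \<oplus>\<^bsub>N'\<^esub> s) \<oplus>\<^bsub>N'\<^esub> img \<odot>\<^bsub>N'\<^esub> d" using sc d v'(3) by (simp add: v'(5))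
   also have "\<dots> = img \<odot>\<^bsub>N'\<^esub> d"
    using sc d by (simp add: v'(3,7,11,13) v'(4)[of _ s] v'(8))
   finally have "(- img) \<odot>\<^bsub>N'\<^esub> d = img \<odot>\<^bsub>N'\<^esub> d" .
   hence e: "img \<odot>\<^bsub>N'\<^esub> d \<oplus>\<^bsub>N'\<^esub> img \<odot>\<^bsub>N'\<^esub> d = img \<odot>\<^bsub>N'\<^esub> d \<oplus>\<^bsub>N'\<^esub> (- img) \<odot>\<^bsub>N'\<^esub> d" by simp
   have "(2 * img) \<odot>\<^bsub>N'\<^esub> d = (img + img) \<odot>\<^bsub>N'\<^esub> d" by simp
   also have "\<dots> = (img + - img) \<odot>\<^bsub>N'\<^esub> d" using e unfolding v'(13)[OF d] .
   also have "\<dots> = \<zero>\<^bsub>N'\<^esub>" using v'(11)[OF d] by simp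
   finally have "(2 * img) \<odot>\<^bsub>N'\<^esub> d = \<zero>\<^bsub>N'\<^esub>" .
   hence "(1 / (2 * img)) \<odot>\<^bsub>N'\<^esub> ((2 * img) \<odot>\<^bsub>N'\<^esub> d) = \<zero>\<^bsub>N'\<^esub>" by (simp add: v'(12))
   moreover have "1 / (2 * img) * (2 * img) = (1 :: 'k)" using img_nz[where ?'k = 'k] by simp
   ultimately show ?thesis using v'(9)[OF d, of "1 / (2 * img)" "2 * img"] v'(10)[OF d] by metis
  qed
  show ?thesis
   using i unfolding less_2_cases_iff
  proof
   assume i: "i = 0"
   have "b = \<zero>\<^bsub>N'\<^esub>" by (rule canc[OF ca(2), of "img \<odot>\<^bsub>N'\<^esub> a"]) (use e Ty i ab ca in \<open>simp_all add: gsgn_simps v'(14,3)\<close>)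
   thus ?thesis using ab i ca by (simp add: v'(6))
  next
   assume i: "i = Suc 0"
   have "a = \<zero>\<^bsub>N'\<^esub>"
    by (rule canc[OF ca(1), of "(- img) \<odot>\<^bsub>N'\<^esub> b"])
     (use e Ty i ab ca v'(4)[of "img \<odot>\<^bsub>N'\<^esub> a" "(- img) \<odot>\<^bsub>N'\<^esub> b"] v'(4)[of "(- img) \<odot>\<^bsub>N'\<^esub> a" "(- img) \<odot>\<^bsub>N'\<^esub> b"] in \<open>simp_all add: gsgn_simps v'(14,3)\<close>)
   thus ?thesis using ab i ca by (simp add: v'(7))
  qed
 qed
 have "\<phi> \<in> rep_hom (gens 1 W) N N' \<longleftrightarrow> \<phi> \<in> rep_hom (carrier (ext_alg W)) M M' \<and> (\<forall>i<2. \<phi> ` part M i \<subseteq> part M' i)" for \<phi>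
 proof
  assume h: "\<phi> \<in> rep_hom (gens 1 W) N N'"
  note hh = rep_homD[OF h] and hl = lmapD[OF rep_homD(2)[OF h]]
  have lM: "lmap M M' \<phi>" using hh(2) lm by blast
  have "\<phi> (act M (cls W (letter w)) x) = act M' (cls W (letter w)) (\<phi> x)" if "w \<in> carrier W" "x \<in> carrier M" for w x
   using hh(3)[OF iN(2)[OF that(1)], of x] hh(4)[of x] R R' that c ops by simp
  hence "\<phi> \<in> rep_hom (carrier (ext_alg W)) M M'"
   using hom_if_commutes_letters[OF W g(1) g'(1) lM] hh(1) lM c by (simp add: rep_hom_def)
  moreover have "\<phi> x \<in> part M' i" if i: "i < 2" and x: "x \<in> part M i" for i x
  proof (rule eig[OF i])
   have xc: "x \<in> carrier N" using subspD(1)[OF g(2)[OF i] x] c by simp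
   show "\<phi> x \<in> carrier M'" using hh(4)[OF xc] ops by simp
   have "act N (Inl 0) x = gsgn i \<odot>\<^bsub>N\<^esub> x" using R i x by blast
   thus "act N' (Inl 0) (\<phi> x) = gsgn i \<odot>\<^bsub>N'\<^esub> \<phi> x" using hh(3)[OF iN(1) xc] hl(5)[OF xc] by simp
  qed
  ultimately show "\<phi> \<in> rep_hom (carrier (ext_alg W)) M M' \<and> (\<forall>i<2. \<phi> ` part M i \<subseteq> part M' i)" by blast
 next
  assume h: "\<phi> \<in> rep_hom (carrier (ext_alg W)) M M' \<and> (\<forall>i<2. \<phi> ` part M i \<subseteq> part M' i)"
  note hh = rep_homD[OF conjunct1[OF h]]
  have lN: "lmap N N' \<phi>" using hh(2) lm by blast
  note hl = lmapD[OF lN]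
  have "\<phi> (act N (Inl 0) x) = act N' (Inl 0) (\<phi> x)" if x: "x \<in> carrier N" for x
  proof -
   obtain p where p: "p \<in> part M 0 \<times> part M 1" "x = fst p \<oplus>\<^bsub>M\<^esub> snd p" using g(3)[of x] x c by blast
   obtain a b where ab: "a \<in> part M 0" "b \<in> part M 1" "x = a \<oplus>\<^bsub>N\<^esub> b" using p by (cases p) (auto simp: ops)
   have ca: "a \<in> carrier N" "b \<in> carrier N"
    using subspD(1)[OF g(2)[of 0]] subspD(1)[OF g(2)[of 1]] ab c by auto
   have pb: "\<phi> a \<in> part M' 0" "\<phi> b \<in> part M' 1" using conjunct2[OF h] ab by (auto simp: image_subset_iff)
   have Ta: "act N (Inl 0) a = img \<odot>\<^bsub>N\<^esub> a" "act N (Inl 0) b = (- img) \<odot>\<^bsub>N\<^esub> b"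
    "act N' (Inl 0) (\<phi> a) = img \<odot>\<^bsub>N'\<^esub> \<phi> a" "act N' (Inl 0) (\<phi> b) = (- img) \<odot>\<^bsub>N'\<^esub> \<phi> b"
    using gr(1)[of 0 a] gr(1)[of 1 b] gr(2)[of 0 "\<phi> a"] gr(2)[of 1 "\<phi> b"] ab pb by (simp_all add: gsgn_simps)
   note tl = lmapD[OF cliffD(3)[OF n(1) g0]] and tl' = lmapD[OF cliffD(3)[OF n(2) g0]]
   show ?thesis
    unfolding ab(3) tl(4)[OF ca] hl(4)[OF ca] tl'(4)[OF hl(3)[OF ca(1)] hl(3)[OF ca(2)]] Ta
    using ca vsp_simps(3)[OF hl(1)] by (simp add: hl(4,5))
  qed
  moreover have "\<phi> (act N (Inr w) x) = act N' (Inr w) (\<phi> x)" if "w \<in> carrier W" "x \<in> carrier N" for w x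
   using hh(3)[OF cls_letter(1)[OF W that(1)], of x] hh(4)[of x] R R' that c ops by simp
  ultimately show "\<phi> \<in> rep_hom (gens 1 W) N N'"
   unfolding rep_hom_def g1 using hh(1) lN c by auto
 qed
 thus "Hom ?C N N' = Hom ?D M M'" by (auto simp: cliff_modules_def graded_ext_modules_def)
qed

end

subsection \<open>Vectors with coordinates below \<open>m\<close>\<close>

definition mv :: "nat => 'k::field mat => (nat => 'k) => nat => 'k" where
 "mv m A x = (\<lambda>i. if i < m then \<Sum>j<m. A $$ (i, j) * x j else 0)"

definition dot :: "nat => (nat => 'k::field) => (nat => 'k) => 'k" where
 "dot m x y = (\<Sum>i<m. x i * y i)"

text \<open>Vectors of k^m are functions on the naturals that vanish from m on. Addition and
  subtraction are then the pointwise ones of \<open>Function_Algebras\<close>, without dimension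
  side conditions.\<close>

definition supp :: "nat => (nat => 'k::field) => bool" where
 "supp m x \<longleftrightarrow> (\<forall>i\<ge>m. x i = 0)"

definition smv :: "'k::field => (nat => 'k) => nat => 'k" where
 "smv c x = (\<lambda>i. c * x i)"

definition dlt :: "nat => nat => 'k::field" where
 "dlt i = (\<lambda>j. if j = i then 1 else 0)"

lemma supp_simps [simp]:
 "supp m (mv m A x)" "supp m x ==> supp m y ==> supp m (x + y)" "supp m x ==> supp m y ==> supp m (x - y)"
 "supp m x ==> supp m (smv c x)" "supp m x ==> supp m (- x)" "i < m ==> supp m (dlt i)" "supp m 0"
 by (auto simp: supp_def mv_def smv_def dlt_def)

lemma dot_simps:
 "dot m (x + y) z = dot m x z + dot m y z" "dot m z (x + y) = dot m z x + dot m z y"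
 "dot m (x - y) z = dot m x z - dot m y z" "dot m z (x - y) = dot m z x - dot m z y"
 "dot m (smv c x) z = c * dot m x z" "dot m z (smv c x) = c * dot m z x"
 "dot m (- x) z = - dot m x z" "dot m z (- x) = - dot m z x" "dot m 0 z = 0" "dot m z 0 = 0"
 by (simp_all add: dot_def smv_def algebra_simps sum.distrib sum_distrib_left sum_subtractf sum_negf)

lemma dot_commute: "dot m x y = dot m y x"
 by (simp add: dot_def mult.commute)

lemma mv_simps:
 "mv m A (x + y) = mv m A x + mv m A y" "mv m A (x - y) = mv m A x - mv m A y" "mv m A (smv c x) = smv c (mv m A x)"
 "mv m A 0 = 0" "mv m A (- x) = - mv m A x"
 by (auto simp: mv_def smv_def fun_eq_iff algebra_simps sum.distrib sum_distrib_left sum_subtractf sum_negf)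

lemma mv_mult:
 assumes "A \<in> carrier_mat m m" "B \<in> carrier_mat m m"
 shows "mv m (A * B) x = mv m A (mv m B x)"
proof
 fix i
 have "(\<Sum>j<m. (\<Sum>k<m. A $$ (i, k) * B $$ (k, j)) * x j) = (\<Sum>k<m. A $$ (i, k) * (\<Sum>j<m. B $$ (k, j) * x j))"
  by (simp add: sum_distrib_left sum_distrib_right mult.assoc) (rule sum.swap)
 moreover have "(\<Sum>j<m. (A * B) $$ (i, j) * x j) = (\<Sum>j<m. (\<Sum>k<m. A $$ (i, k) * B $$ (k, j)) * x j)" if "i < m"
  using assms that by (intro sum.cong refl) (simp add: scalar_prod_def lessThan_atLeast0)
 moreover have "(\<Sum>k<m. A $$ (i, k) * mv m B x k) = (\<Sum>k<m. A $$ (i, k) * (\<Sum>j<m. B $$ (k, j) * x j))"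
  by (intro sum.cong refl) (simp add: mv_def)
 ultimately show "mv m (A * B) x i = mv m A (mv m B x) i"
  by (simp add: mv_def[of m "A * B"] mv_def[of m A])
qed

lemma mv_diff: "[|A \<in> carrier_mat m m; B \<in> carrier_mat m m|] ==> mv m (A - B) x = mv m A x - mv m B x"
 and mv_uminus: "A \<in> carrier_mat m m ==> mv m (- A) x = - mv m A x"
 by (auto simp: mv_def fun_eq_iff algebra_simps sum.distrib sum_subtractf sum_negf)

lemma mv_one: "supp m x ==> mv m (1\<^sub>m m) x = x"
 by (auto simp: mv_def supp_def fun_eq_iff if_distrib[of "\<lambda>a. a * _"] cong: if_cong)

lemma dot_mv:
 assumes "A \<in> carrier_mat m m"
 shows "dot m (mv m A x) y = dot m x (mv m (transpose_mat A) y)"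
proof -
 have "dot m (mv m A x) y = (\<Sum>i<m. \<Sum>j<m. A $$ (i, j) * x j * y i)"
  by (simp add: dot_def mv_def sum_distrib_right)
 also have "\<dots> = (\<Sum>j<m. \<Sum>i<m. A $$ (i, j) * x j * y i)" by (rule sum.swap)
 also have "\<dots> = dot m x (mv m (transpose_mat A) y)"
  using assms by (simp add: dot_def mv_def sum_distrib_left mult_ac)
 finally show ?thesis .
qed

lemma dot_dlt: "i < m ==> dot m x (dlt i) = x i" "i < m ==> dot m (dlt i) x = x i"
 by (simp_all add: dot_def dlt_def if_distrib[of "\<lambda>a. a * _"] if_distrib[of "\<lambda>a. _ * a"] cong: if_cong)

lemma dot_dlt_dlt: "i < m ==> j < m ==> dot m (dlt i) (dlt j) = (if i = j then 1 else 0)"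
 by (simp add: dot_dlt) (simp add: dlt_def)

lemma eq_uminus_zero: "c = - c ==> c = (0 :: 'k::field_char_0)"
 by (metis add.right_inverse mult_2 mult_eq_0_iff zero_neq_numeral)

lemma vec_zeroI:
 assumes "supp m x" "\<And>y. supp m y ==> dot m x y = 0"
 shows "x = 0"
proof
 fix i show "x i = 0 i"
 proof (cases "i < m")
  case True
  thus ?thesis using assms(2)[of "dlt i"] dot_dlt(1)[of i m x] by simp
 qed (use assms(1) in \<open>simp add: supp_def\<close>)
qed

lemma smv_simps: "smv 1 x = x" "smv 0 x = 0" "smv c 0 = 0" "smv a (smv b x) = smv (a * b) x" "- smv a x = smv (- a) x"
 "smv a (x + y) = smv a x + smv a y" "smv a (x - y) = smv a x - smv a y" "smv a (- x) = smv (- a) x"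
 by (auto simp: smv_def fun_eq_iff algebra_simps)

subsection \<open>Extending orthonormal systems\<close>

definition isom :: "nat => ((nat => 'k::field) => nat => 'k) => bool" where
 "isom m R \<longleftrightarrow> (\<forall>x. supp m x \<longrightarrow> supp m (R x)) \<and> (\<forall>x y. supp m x \<longrightarrow> supp m y \<longrightarrow> dot m (R x) (R y) = dot m x y)"

definition refl_in :: "nat => (nat => 'k::field) => (nat => 'k) => nat => 'k" where
 "refl_in m z x = x - smv (2 * dot m x z / dot m z z) z"

lemma isom_refl:
 fixes z :: "nat => 'a::field"
 shows "[|supp m z; dot m z z \<noteq> 0|] ==> isom m (refl_in m z)"
proof -
 assume z: "supp m z" "dot m z z \<noteq> 0"
 have "- (2 * b / n) * a - 2 * a / n * b + 2 * a / n * (2 * b / n) * n = 0" if "n \<noteq> 0" for a b n :: 'a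
  using that by (simp add: field_simps)
 from this[OF z(2)] have *: "dot m x z * (2 * dot m y z / dot m z z) + 2 * dot m x z / dot m z z * dot m y z =
   2 * dot m x z / dot m z z * (2 * dot m y z / dot m z z) * dot m z z" for x y
  by (simp add: algebra_simps)
 have "dot m (refl_in m z x) (refl_in m z y) = dot m x y" for x y
  unfolding refl_in_def using *[of x y] by (simp add: dot_simps dot_commute[of m z y] algebra_simps)
 thus ?thesis using z by (simp add: isom_def refl_in_def)
qed

lemma isom_comp: "isom m R ==> isom m S ==> isom m (\<lambda>x. R (S x))"
 by (simp add: isom_def)

lemma refl_in_fix: "dot m x z = 0 ==> refl_in m z x = x"
 by (simp add: refl_in_def smv_simps)

text \<open>A case of Witt's theorem, by induction on n. An isometry for the first n vectors is
  corrected by reflections that take w, the image of the next unit vector, to y. They fix the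
  earlier vectors, being reflections in combinations of w and y, which are orthogonal to those. One
  reflection in w - y is enough unless w - y is isotropic.\<close>

lemma orthonormal_extension:
 fixes x :: "nat => nat => 'k::field_char_0"
 assumes "n \<le> m" "\<And>i. i < n ==> supp m (x i)" "\<And>i j. i < n ==> j < n ==> dot m (x i) (x j) = (if i = j then 1 else 0)"
 shows "\<exists>R. isom m R \<and> (\<forall>i<n. R (dlt i) = x i)"
 using assms
proof (induction n)
 case 0
 show ?case by (intro exI[of _ "\<lambda>x. x"]) (simp add: isom_def)
next
 case (Suc n)
 obtain R where R: "isom m R" "\<And>i. i < n ==> R (dlt i) = x i"
  using Suc.IH Suc.prems by auto
 have n: "n < m" using Suc.prems(1) by simp
 define w y where "w = R (dlt n)" and "y = x n"
 have s: "supp m w" "supp m y" using R(1) n Suc.prems(2) by (auto simp: isom_def w_def y_def)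
 have ww: "dot m w w = 1" using R(1) n by (simp add: isom_def w_def dot_dlt_dlt)
 have yy: "dot m y y = 1" using Suc.prems(3) by (simp add: y_def)
 have wx: "dot m (x i) w = 0" if "i < n" for i
  using R(1) that n unfolding w_def R(2)[OF that, symmetric] by (simp add: isom_def dot_dlt_dlt)
 have yx: "dot m (x i) y = 0" if "i < n" for i using Suc.prems(3) that by (simp add: y_def)
 have "\<exists>T. isom m T \<and> T w = y \<and> (\<forall>i<n. T (x i) = x i)"
 proof (cases "dot m (w - y) (w - y) = 0")
  case False
  have "2 * dot m w (w - y) = dot m (w - y) (w - y)"
   using ww yy by (simp add: dot_simps dot_commute[of m y w])
  hence "refl_in m (w - y) w = y" using False by (simp add: refl_in_def smv_simps)
  thus ?thesis
   using isom_refl[OF _ False] s wx yx by (intro exI[of _ "refl_in m (w - y)"]) (auto intro!: refl_in_fix simp: dot_simps)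
 next
  case True
  \<comment> \<open>For isotropic w - y the vectors have inner product 1, so w + y has norm 4. Its
    reflection sends w to -y, and the reflection in y restores the sign.\<close>
  hence wy: "dot m w y = 1" using ww yy by (simp add: dot_simps dot_commute[of m y w])
  have d: "dot m (w + y) (w + y) = 4" "dot m w (w + y) = 2" using ww yy wy by (simp_all add: dot_simps dot_commute[of m y w])
  have r1: "refl_in m (w + y) w = - y" using d by (simp add: refl_in_def smv_simps)
  have r2: "refl_in m y (- y) = y" using yy by (simp add: refl_in_def dot_simps) (simp add: smv_def fun_eq_iff)
  have "isom m (refl_in m y)" "isom m (refl_in m (w + y))" by (rule isom_refl; use s yy d in simp)+
  hence i: "isom m (\<lambda>v. refl_in m y (refl_in m (w + y) v))" by (rule isom_comp)
  show ?thesis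
   using i r1 r2 wx yx
   by (intro exI[of _ "\<lambda>v. refl_in m y (refl_in m (w + y) v)"]) (auto simp: refl_in_fix dot_simps)
 qed
 then obtain T where T: "isom m T" "T w = y" "\<And>i. i < n ==> T (x i) = x i" by blast
 show ?case
  using isom_comp[OF T(1) R(1)] T R(2) by (intro exI[of _ "\<lambda>v. T (R v)"]) (auto simp: less_Suc_eq w_def y_def)
qed

lemma orthonormal_basis_extension:
 fixes x :: "nat => nat => 'k::field_char_0"
 assumes "n \<le> m" "\<And>i. i < n ==> supp m (x i)" "\<And>i j. i < n ==> j < n ==> dot m (x i) (x j) = (if i = j then 1 else 0)"
 obtains b where "\<And>i. i < n ==> b i = x i" "\<And>i. i < m ==> supp m (b i)"
  "\<And>i j. i < m ==> j < m ==> dot m (b i) (b j) = (if i = j then 1 else 0)"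
proof -
 obtain R where R: "isom m R" "\<forall>i<n. R (dlt i) = x i" using orthonormal_extension[OF assms] by blast
 show ?thesis
 proof (rule that[of "\<lambda>i. R (dlt i)"])
  show "dot m (R (dlt i)) (R (dlt j)) = (if i = j then 1 else 0)" if "i < m" "j < m" for i j
   using R(1) that by (simp add: isom_def dot_dlt_dlt)
 qed (use R in \<open>auto simp: isom_def\<close>)
qed

subsection \<open>Normal form of the second short grading\<close>

definition Em :: "nat => nat => nat => 'k::field mat" where
 "Em m i j = mat m m (\<lambda>(k, l). (if k = i \<and> l = j then 1 else 0) - (if k = j \<and> l = i then 1 else 0))"

lemma Em_carrier [simp]: "Em m i j \<in> carrier_mat m m" "dim_row (Em m i j) = m" "dim_col (Em m i j) = m"
 by (simp_all add: Em_def)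

lemma Em_index: "k < m ==> l < m ==> Em m i j $$ (k, l) = (if k = i \<and> l = j then 1 else 0) - (if k = j \<and> l = i then 1 else 0)"
 by (simp add: Em_def)

text \<open>The standard triple lives in the so(3) of the first three coordinates. Its e and f are
  isotropic combinations of E_01 and E_02, and the factor 1/2 in f makes [e,f] equal to h = i
  E_12.\<close>

definition std_e :: "nat => 'k::alg_closed_field mat" where "std_e m = Em m 0 1 + img \<cdot>\<^sub>m Em m 0 2"
definition std_f :: "nat => 'k::alg_closed_field mat" where "std_f m = (1 / 2) \<cdot>\<^sub>m Em m 0 1 + (- img / 2) \<cdot>\<^sub>m Em m 0 2"
definition std_h :: "nat => 'k::alg_closed_field mat" where "std_h m = img \<cdot>\<^sub>m Em m 1 2"

lemma img_img: "img * (img * z) = - (z :: 'k::alg_closed_field)"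
 by (simp add: mult.assoc[symmetric] img_sq)

text \<open>Extracts from similarity to diag(1, -1, 0, ..., 0) what the normal form uses: the
  eigenvalues 1 and -1 are simple, and h cubed is h.\<close>

lemma short_triple_eigen:
 fixes h :: "'k::field_char_0 mat"
 assumes m: "2 \<le> m" and sim: "similar_mat h (mat_diag m (\<lambda>i. if i = 0 then 1 else if i = 1 then - 1 else 0))"
 obtains p q where "supp m p" "supp m q" "p \<noteq> 0" "mv m h p = p" "mv m h q = - q"
  "\<And>v. supp m v ==> mv m h v = v ==> \<exists>a. v = smv a p"
  "\<And>v. supp m v ==> mv m h v = - v ==> \<exists>a. v = smv a q"
  "\<And>v. mv m h (mv m h (mv m h v)) = mv m h v"
proof -
 define D :: "'k mat" where "D = mat_diag m (\<lambda>i. if i = 0 then 1 else if i = 1 then - 1 else 0)"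
 obtain P P' where P: "similar_mat_wit h D P P'" using sim unfolding similar_mat_def D_def by blast
 have Dc: "D \<in> carrier_mat m m" "dim_row D = m" by (auto simp: D_def mat_diag_def)
 have hr: "dim_row h = m"
  using similar_mat_witD(5)[OF refl P] Dc(2) by auto
 have w: "P * P' = 1\<^sub>m m" "P' * P = 1\<^sub>m m" "h = P * D * P'" "h \<in> carrier_mat m m" "P \<in> carrier_mat m m" "P' \<in> carrier_mat m m"
  using P hr unfolding similar_mat_wit_def Let_def by auto
 have Dv: "mv m D x = (\<lambda>i. if i = 0 then x 0 else if i = 1 then - x 1 else 0)" for x
  using m by (auto simp: mv_def D_def mat_diag_def fun_eq_iff if_distrib[of "\<lambda>a. a * _"] cong: if_cong)
 have PP': "mv m P (mv m P' x) = x" "mv m P' (mv m P x) = x" if "supp m x" for x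
  using mv_mult[OF w(5,6), of x] mv_mult[OF w(6,5), of x] w(1,2) mv_one[OF that] by auto
 have hv: "mv m h x = mv m P (mv m D (mv m P' x))" for x
  unfolding w(3) using w Dc by (simp add: mv_mult)
 have s0: "supp m (dlt 0 :: nat => 'k)" "supp m (dlt 1 :: nat => 'k)" using m by (auto simp del: One_nat_def)
 have sup2: "supp m (mv m D x)" for x by simp
 have h3: "mv m h (mv m h (mv m h x)) = mv m h x" for x
 proof -
  have "mv m D (mv m D (mv m D y)) = mv m D y" for y by (auto simp: Dv fun_eq_iff)
  thus ?thesis by (simp add: hv PP'(2))
 qed
 have coords: "v = mv m P (mv m P' v)" "mv m D (mv m P' v) = mv m P' (mv m h v)" if "supp m v" for v
  using that by (simp_all add: PP' hv)
 have Pd: "mv m P (\<lambda>i. if i = k then c else 0) = smv c (mv m P (dlt k))" for k c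
 proof -
  have "(\<lambda>i. if i = k then c else 0) = smv c (dlt k)" by (auto simp: smv_def dlt_def)
  thus ?thesis by (simp add: mv_simps)
 qed
 show ?thesis
 proof (rule that[of "mv m P (dlt 0)" "mv m P (dlt 1)"])
  show "mv m P (dlt 0) \<noteq> 0"
  proof
   assume "mv m P (dlt 0) = 0"
   hence "dlt 0 = (0 :: nat => 'k)" using PP'(2)[OF s0(1)] by (simp add: mv_simps)
   from fun_cong[OF this, of 0] show False by (simp add: dlt_def)
  qed
  have "mv m D (dlt 0) = dlt 0" "mv m D (dlt 1) = - dlt 1" by (auto simp: Dv dlt_def fun_eq_iff)
  thus "mv m h (mv m P (dlt 0)) = mv m P (dlt 0)" "mv m h (mv m P (dlt 1)) = - mv m P (dlt 1)"
   unfolding hv PP'(2)[OF s0(1)] PP'(2)[OF s0(2)] by (simp_all add: mv_simps)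
  show "\<exists>a. v = smv a (mv m P (dlt 0))" if v: "supp m v" "mv m h v = v" for v
  proof -
   define u where "u = mv m P' v"
   have "mv m D u = u" using coords(2)[OF v(1)] v(2) by (simp add: u_def)
   hence ui: "u i = (if i = 0 then u 0 else if i = 1 then - u 1 else 0)" for i unfolding Dv by (rule fun_cong[OF sym])
   have "u 1 = 0" by (rule eq_uminus_zero) (use ui[of 1] in simp)
   hence "u i = 0" if "i \<noteq> 0" for i using that ui[of i] by (auto split: if_splits)
   hence "u = (\<lambda>i. if i = 0 then u 0 else 0)" by auto
   hence "v = smv (u 0) (mv m P (dlt 0))" using coords(1)[OF v(1)] Pd[of 0 "u 0"] unfolding u_def[symmetric] by metis
   thus ?thesis by blast
  qed
  show "\<exists>a. v = smv a (mv m P (dlt 1))" if v: "supp m v" "mv m h v = - v" for v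
  proof -
   define u where "u = mv m P' v"
   have "mv m D u = - u" using coords(2)[OF v(1)] v(2) by (simp add: u_def mv_simps)
   hence ui: "(- u) i = (if i = 0 then u 0 else if i = 1 then - u 1 else 0)" for i unfolding Dv by (rule fun_cong[OF sym])
   have "u 0 = 0" by (rule eq_uminus_zero) (use ui[of 0] in simp)
   hence "u i = 0" if "i \<noteq> 1" for i using that ui[of i] by (auto split: if_splits)
   hence "u = (\<lambda>i. if i = 1 then u 1 else 0)" by auto
   hence "v = smv (u 1) (mv m P (dlt 1))" using coords(1)[OF v(1)] Pd[of 1 "u 1"] unfolding u_def[symmetric] by metis
   thus ?thesis by blast
  qed
 qed (use h3 in simp_all)
qed

lemma so_lie_simps:
 "carrier (so_lie m) = {A \<in> carrier_mat m m. transpose_mat A = - A}" "bracket (so_lie m) A B = A * B - B * A"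
 "A \<oplus>\<^bsub>so_lie m\<^esub> B = A + B" "\<zero>\<^bsub>so_lie m\<^esub> = 0\<^sub>m m m" "c \<odot>\<^bsub>so_lie m\<^esub> A = c \<cdot>\<^sub>m A"
 by (simp_all add: so_lie_def module.extend_def lie.fields_def module_mat_def)

lemma vsp_so_lie: "vsp (so_lie m :: ('k::field, 'k mat) lie)"
proof (rule vspI)
 fix A B :: "'k mat" and c :: 'k
 assume A: "A \<in> carrier (so_lie m)"
 show "c \<odot>\<^bsub>so_lie m\<^esub> A \<in> carrier (so_lie m)" "A \<oplus>\<^bsub>so_lie m\<^esub> (- 1) \<odot>\<^bsub>so_lie m\<^esub> A = \<zero>\<^bsub>so_lie m\<^esub>"
 proof -
  have "A \<in> carrier_mat m m" using A by (simp add: so_lie_simps)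
  hence "transpose_mat (c \<cdot>\<^sub>m A) = c \<cdot>\<^sub>m transpose_mat A" by (intro eq_matI) auto
  also have "\<dots> = c \<cdot>\<^sub>m (- A)" using A by (simp add: so_lie_simps)
  also have "\<dots> = - (c \<cdot>\<^sub>m A)" using A by (intro eq_matI) (auto simp: so_lie_simps)
  finally show "c \<odot>\<^bsub>so_lie m\<^esub> A \<in> carrier (so_lie m)" using A by (simp add: so_lie_simps)
  show "A \<oplus>\<^bsub>so_lie m\<^esub> (- 1) \<odot>\<^bsub>so_lie m\<^esub> A = \<zero>\<^bsub>so_lie m\<^esub>" using A by (auto simp: so_lie_simps intro!: eq_matI)
 qed
 assume B: "B \<in> carrier (so_lie m)"
 show "A \<oplus>\<^bsub>so_lie m\<^esub> B \<in> carrier (so_lie m)"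
  using A B by (auto simp: so_lie_simps transpose_add)
qed (auto simp: so_lie_simps algebra_simps intro!: eq_matI)

text \<open>V is the sum of the lines of eigenvectors p, q for 1, -1 and of the kernel of h.
  Skewness makes p and q isotropic and orthogonal to the kernel. The operator e maps p into the
  kernel and the kernel into the line of q; f goes the other way. On the kernel both are given by
  inner products with a = e p and b = f q, and [e,f] = h forces a and b to be proportional. Scaling
  yields a unit vector u and an isotropic pair, from which an orthonormal basis adapted to the
  triple is built.\<close>

lemma second_short_triple_normal_form:
 fixes e h f :: "'k::{alg_closed_field, field_char_0} mat"
 assumes m: "3 \<le> m" and triple: "second_short_triple m e h f"
 obtains Q where "Q \<in> carrier_mat m m" "transpose_mat Q * Q = 1\<^sub>m m" "Q * transpose_mat Q = 1\<^sub>m m"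
  "transpose_mat Q * e * Q = std_e m" "transpose_mat Q * h * Q = std_h m" "transpose_mat Q * f * Q = std_f m"
proof -
 have sk: "e \<in> carrier_mat m m" "transpose_mat e = - e" "h \<in> carrier_mat m m" "transpose_mat h = - h"
  "f \<in> carrier_mat m m" "transpose_mat f = - f"
  and rel: "e * f - f * e = h" "h * e - e * h = \<ominus>\<^bsub>so_lie m\<^esub> e" "h * f - f * h = f"
  and sim: "similar_mat h (mat_diag m (\<lambda>i. if i = 0 then 1 else if i = 1 then - 1 else 0))"
  using triple by (auto simp: second_short_triple_def short_triple_def sl2_relations_def so_lie_simps)
 have "\<ominus>\<^bsub>so_lie m\<^esub> e = (- 1) \<cdot>\<^sub>m e"
  using sk by (subst vsp_simps(15)[OF vsp_so_lie]) (auto simp: so_lie_simps)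
 also have "\<dots> = - e" by (auto intro!: eq_matI)
 finally have rel2: "h * e - e * h = - e" using rel by simp
 let ?e = "mv m e" and ?h = "mv m h" and ?f = "mv m f"
 have re: "?h (?e x) = ?e (?h x) - ?e x" "?h (?f x) = ?f (?h x) + ?f x" "?e (?f x) - ?f (?e x) = ?h x" for x
 proof -
  have c: "h * e \<in> carrier_mat m m" "e * h \<in> carrier_mat m m" "h * f \<in> carrier_mat m m" "f * h \<in> carrier_mat m m"
   "e * f \<in> carrier_mat m m" "f * e \<in> carrier_mat m m" using sk by auto
  have "?h (?e x) - ?e (?h x) = - ?e x"
   using arg_cong[OF rel2, of "\<lambda>A. mv m A x"] sk c by (simp add: mv_diff mv_mult mv_uminus)
  thus "?h (?e x) = ?e (?h x) - ?e x" by (simp add: algebra_simps)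
  have "?h (?f x) - ?f (?h x) = ?f x"
   using arg_cong[OF rel(3), of "\<lambda>A. mv m A x"] sk c by (simp add: mv_diff mv_mult)
  thus "?h (?f x) = ?f (?h x) + ?f x" by (simp add: algebra_simps)
  show "?e (?f x) - ?f (?e x) = ?h x"
   using arg_cong[OF rel(1), of "\<lambda>A. mv m A x"] sk c by (simp add: mv_diff mv_mult)
 qed
 have skew: "dot m (?e x) y = - dot m x (?e y)" "dot m (?h x) y = - dot m x (?h y)" "dot m (?f x) y = - dot m x (?f y)" for x y
  using dot_mv[OF sk(1), of x y] dot_mv[OF sk(3), of x y] dot_mv[OF sk(5), of x y] sk by (simp_all add: mv_uminus dot_simps)
 have half: "c = 0" if "c = - c" for c :: 'k using that by (rule eq_uminus_zero)
 have m2: "2 \<le> m" using m by simp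
 obtain p0 q0 where pq0: "supp m p0" "supp m q0" "p0 \<noteq> 0" "?h p0 = p0" "?h q0 = - q0"
  and ev1: "\<And>v. supp m v ==> ?h v = v ==> \<exists>a. v = smv a p0"
  and evm: "\<And>v. supp m v ==> ?h v = - v ==> \<exists>a. v = smv a q0"
  and h3: "\<And>v. ?h (?h (?h v)) = ?h v"
  using short_triple_eigen[OF m2 sim] by blast
 have pp0: "dot m p0 p0 = 0" "dot m q0 q0 = 0"
  using half skew(2)[of p0 p0] skew(2)[of q0 q0] pq0 by (simp_all add: dot_simps)
 have pz: "dot m p0 z = 0" "dot m q0 z = 0" if "?h z = 0" for z
  using skew(2)[of p0 z] skew(2)[of q0 z] that pq0 by (simp_all add: dot_simps)
 \<comment> \<open>By h^3 = h, the projections to the three eigenspaces are (h^2 + h) / 2, (h^2 - h)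
   / 2 and 1 - h^2.\<close>
 have dec: "\<exists>a b z. v = smv a p0 + smv b q0 + z \<and> supp m z \<and> ?h z = 0" if v: "supp m v" for v
 proof -
  define v1 v2 where "v1 = smv (1/2) (?h (?h v) + ?h v)" and "v2 = smv (1/2) (?h (?h v) - ?h v)"
  have "?h v1 = v1" "?h v2 = - v2" unfolding v1_def v2_def by (simp_all add: mv_simps h3 smv_simps add.commute)
  then obtain a b where ab: "v1 = smv a p0" "v2 = smv b q0" using ev1[of v1] evm[of v2] v1_def v2_def by auto
  have "v = smv a p0 + smv b q0 + (v - ?h (?h v))"
   unfolding ab[symmetric] v1_def v2_def by (simp add: smv_def fun_eq_iff field_simps)
  moreover have "?h (v - ?h (?h v)) = 0" by (simp add: mv_simps h3)
  ultimately show ?thesis using v by (metis supp_simps(1,3))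
 qed
 \<comment> \<open>Otherwise p0 is orthogonal to all three eigenspaces, hence zero because the form
   is non-degenerate.\<close>
 have pqnz: "dot m p0 q0 \<noteq> 0"
 proof
  assume *: "dot m p0 q0 = 0"
  have "dot m p0 v = 0" if "supp m v" for v
   using dec[OF that] * pp0 pz by (auto simp: dot_simps)
  thus False using vec_zeroI[OF pq0(1)] pq0(3) by blast
 qed
 define a where "a = ?e p0"
 have ha: "?h a = 0" using re(1)[of p0] pq0 by (simp add: a_def)
 \<comment> \<open>As e lowers eigenvalues of h by 1, the vector \<open>?e q0\<close> has eigenvalue
   -2, and h^3 = h leaves only 0 for it. In the same way \<open>?f p0\<close>, of eigenvalue 2,
   vanishes.\<close>
 have eq0: "?e q0 = 0"
 proof -
  have 1: "?h (?e q0) = smv (- 2) (?e q0)" using re(1)[of q0] pq0 by (simp add: mv_simps smv_def fun_eq_iff)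
  have "smv (- 8) (?e q0) = smv (- 2) (?e q0)" using h3[of "?e q0"] unfolding 1 mv_simps by (simp add: smv_simps 1)
  thus ?thesis by (auto simp: smv_def fun_eq_iff)
 qed
 have fp0: "?f p0 = 0"
 proof -
  have 1: "?h (?f p0) = smv 2 (?f p0)" using re(2)[of p0] pq0 by (simp add: mv_simps smv_def fun_eq_iff)
  have "smv 8 (?f p0) = smv 2 (?f p0)" using h3[of "?f p0"] unfolding 1 mv_simps by (simp add: smv_simps 1)
  thus ?thesis by (auto simp: smv_def fun_eq_iff)
 qed
 define c where "c = dot m p0 q0"
 define q where "q = smv (1 / c) q0"
 have c0: "c \<noteq> 0" using pqnz by (simp add: c_def)
 have q: "supp m q" "?h q = - q" "dot m p0 q = 1" "dot m q q = 0" "?e q = 0" "\<And>z. ?h z = 0 ==> dot m q z = 0"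
  using pq0 c0 pp0 eq0 pz by (auto simp: q_def mv_simps dot_simps c_def smv_simps)
 have q0q: "smv t q0 = smv (t * c) q" for t using c0 by (simp add: q_def smv_simps)
 define b where "b = ?f q"
 have hb: "?h b = 0" using re(2)[of q] q by (simp add: b_def mv_simps)
 have ez: "?e z = smv (- dot m a z) q" if z: "?h z = 0" for z
 proof -
  have "?h (?e z) = - ?e z" using re(1)[of z] z by (simp add: mv_simps)
  then obtain t where t: "?e z = smv t q0" using evm[of "?e z"] by auto
  have "t * c = dot m p0 (?e z)" unfolding t q0q by (simp add: dot_simps q)
  also have "\<dots> = - dot m a z" using skew(1)[of p0 z] by (simp add: a_def)
  finally show ?thesis unfolding t q0q by simp
 qed
 have fz: "?f z = smv (- dot m b z) p0" if z: "?h z = 0" for z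
 proof -
  have "?h (?f z) = ?f z" using re(2)[of z] z by (simp add: mv_simps)
  then obtain t where t: "?f z = smv t p0" using ev1[of "?f z"] by auto
  have "t = dot m q (?f z)" unfolding t by (simp add: dot_simps q dot_commute[of m q p0])
  also have "\<dots> = - dot m b z" using skew(3)[of q z] by (simp add: b_def)
  finally show ?thesis unfolding t by simp
 qed
 have qnz: "q \<noteq> 0" using q(3) by (auto simp: dot_simps)
 have ab: "dot m a b = 1"
 proof -
  have "smv (- dot m a b) q = - q" using re(3)[of q] q ez[OF hb] by (simp add: b_def mv_simps)
  hence "smv (1 - dot m a b) q = 0" by (auto simp: smv_def fun_eq_iff algebra_simps)
  thus ?thesis using qnz by (auto simp: smv_def fun_eq_iff)
 qed
 \<comment> \<open>The relation [e,f] = h applied to a, which h kills, makes (a,a) b equal to (a,b)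
   a. Since (a,b) = 1, the vector a cannot be isotropic.\<close>
 have aab: "smv (dot m a a) b = a"
 proof -
  have "?e (?f a) - ?f (?e a) = 0" using re(3)[of a] ha by simp
  hence "smv (- dot m b a) a - smv (- dot m a a) b = 0"
   unfolding fz[OF ha] ez[OF ha] mv_simps a_def[symmetric] b_def[symmetric] .
  thus ?thesis using ab by (simp add: dot_commute[of m b a] smv_def fun_eq_iff)
 qed
 define N where "N = dot m a a"
 have N0: "N \<noteq> 0"
 proof
  assume "N = 0"
  hence "a = 0" using aab by (simp add: N_def smv_simps)
  thus False using ab by (simp add: dot_simps)
 qed
 obtain s where s: "s ^ 2 = N" using nth_root_exists[of 2 N] by auto
 have s0: "s \<noteq> 0" using s N0 by auto
 have ss: "s * s = N" using s by (simp add: power2_eq_square)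
 \<comment> \<open>With s a square root of (a,a), the vector u has norm 1, P and q' still have
   product 1, and now e P = u = f q'.\<close>
 define u P q' where "u = smv (1 / s) a" and "P = smv (1 / s) p0" and "q' = smv s q"
 have bu: "b = smv (1 / s) u"
  using arg_cong[OF aab, of "smv (1 / N)"] N0 s0 by (simp add: u_def smv_simps N_def[symmetric] ss[symmetric])
 have F1: "supp m u" "supp m P" "supp m q'" using pq0 q by (simp_all add: u_def P_def q'_def a_def)
 have F2: "?h u = 0" "?h P = P" "?h q' = - q'"
  by (simp_all add: u_def P_def q'_def mv_simps ha pq0 q smv_simps)
 have F3: "?e P = u" "?e q' = 0" "?f P = 0" by (simp_all add: u_def P_def q'_def mv_simps a_def q fp0 smv_simps)
 have F4: "?f q' = u" using s0 by (simp add: q'_def mv_simps b_def[symmetric] bu smv_simps)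
 have F5: "dot m u u = 1" using s0 by (simp add: u_def dot_simps N_def[symmetric] ss[symmetric])
 have F6: "dot m P P = 0" "dot m q' q' = 0" "dot m P q' = 1" using s0 by (simp_all add: P_def q'_def dot_simps pp0 q)
 have F7: "dot m P u = 0" "dot m q' u = 0" using pz(1)[OF ha] q(6)[OF ha] by (simp_all add: P_def q'_def u_def dot_simps)
 have F8: "dot m q' P = 1" "dot m u P = 0" "dot m u q' = 0" using F6(3) F7 by (simp_all add: dot_commute[of m q' P] dot_commute[of m u P] dot_commute[of m u q'])
 note F = F1 F2 F3 F4 F5 F6 F7 F8
 have eZ: "?e z = smv (- dot m u z) q'" if "?h z = 0" for z
  unfolding ez[OF that] q'_def u_def using s0 by (simp add: dot_simps smv_simps)
 have fZ: "?f z = smv (- dot m u z) P" if "?h z = 0" for z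
  unfolding fz[OF that] bu P_def using s0 by (simp add: dot_simps smv_simps)
 \<comment> \<open>The vector u and the two orthonormal vectors of the hyperbolic plane of P and q'
   in terms of which q' is B 1 + i B 2, as \<open>std_e\<close> demands.\<close>
 define x where "x i = (if i = 0 then u else if i = (1::nat) then smv (1 / 2) q' + P else smv (- img / 2) q' + smv img P)" for i
 have xo: "dot m (x i) (x j) = (if i = j then 1 else 0)" if "i < 3" "j < 3" for i j
 proof -
  have "i = 0 \<or> i = 1 \<or> i = 2" "j = 0 \<or> j = 1 \<or> j = 2" using that by auto
  thus ?thesis using F img_sq[where ?'k = 'k] by (auto simp: x_def dot_simps)
 qed
 obtain B where B: "\<And>i. i < 3 ==> B i = x i" "\<And>i. i < m ==> supp m (B i)"
  "\<And>i j. i < m ==> j < m ==> dot m (B i) (B j) = (if i = j then 1 else 0)"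
  by (rule orthonormal_basis_extension[of 3 m x]) (use m F xo in \<open>auto simp: x_def\<close>)
 have B012: "B 0 = u" "B 1 = smv (1 / 2) q' + P" "B 2 = smv (- img / 2) q' + smv img P" using B(1) by (auto simp: x_def)
 have q'B: "q' = B 1 + smv img (B 2)" "P = smv (1 / 2) (B 1) + smv (- img / 2) (B 2)"
  unfolding B012 by (simp_all add: smv_def fun_eq_iff field_simps img_img)
 \<comment> \<open>A basis vector orthogonal to P and q' has no component along p0 and q0, so it
   lies in the kernel of h; being orthogonal to u as well, it is also killed by e and f.\<close>
 have hB: "?h (B j) = 0" "dot m u (B j) = 0" if j: "3 \<le> j" "j < m" for j
 proof -
  have o: "dot m (B j) (B 0) = 0" "dot m (B j) (B 1) = 0" "dot m (B j) (B 2) = 0" using B(3)[of j] that m by auto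
  hence o': "dot m (B j) q' = 0" "dot m (B j) P = 0" unfolding q'B by (simp_all add: dot_simps)
  show "dot m u (B j) = 0" using o(1) by (simp add: B012 dot_commute)
  obtain t r z where z: "B j = smv t p0 + smv r q0 + z" "supp m z" "?h z = 0" using dec[OF B(2)[OF j(2)]] by blast
  have p0P: "p0 = smv s P" "q0 = smv (c / s) q'" using s0 c0 by (simp_all add: P_def q'_def q_def smv_simps)
  have zz: "dot m z P = 0" "dot m z q' = 0" using pz(1)[OF z(3)] q(6)[OF z(3)] by (simp_all add: P_def q'_def dot_simps dot_commute[of m z])
  have "t * s = 0" using o'(1) unfolding z(1) p0P by (simp add: dot_simps F zz)
  moreover have "r * (c / s) = 0" using o'(2) unfolding z(1) p0P by (simp add: dot_simps F zz)
  ultimately have "B j = z" using s0 c0 unfolding z(1) by (simp add: smv_simps)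
  thus "?h (B j) = 0" using z(3) by simp
 qed
 define Q where "Q = mat m m (\<lambda>(i, j). B j i)"
 have Qc: "Q \<in> carrier_mat m m" "dim_row Q = m" "dim_col Q = m" by (auto simp: Q_def)
 have QQ: "transpose_mat Q * Q = 1\<^sub>m m"
  using B(3) by (intro eq_matI) (auto simp: Q_def scalar_prod_def dot_def lessThan_atLeast0)
 have QQ': "Q * transpose_mat Q = 1\<^sub>m m" using mat_mult_left_right_inverse[OF _ Qc(1) QQ] Qc by simp
 have col: "(A * Q) $$ (i, j) = mv m A (B j) i" if "A \<in> carrier_mat m m" "i < m" "j < m" for A i j
  using that by (simp add: Q_def scalar_prod_def mv_def lessThan_atLeast0)
 have lin: "(Q * A) $$ (i, j) = (\<Sum>k<m. B k i * A $$ (k, j))" if "A \<in> carrier_mat m m" "i < m" "j < m" for A i j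
  using that by (simp add: Q_def scalar_prod_def lessThan_atLeast0)
 have conj: "transpose_mat Q * A * Q = A'" if "A \<in> carrier_mat m m" "A' \<in> carrier_mat m m" 
  "\<And>i j. i < m ==> j < m ==> mv m A (B j) i = (\<Sum>k<m. B k i * A' $$ (k, j))" for A A'
 proof -
  have "A * Q = Q * A'" using that Qc by (intro eq_matI) (auto simp: col lin simp del: index_mult_mat(1))
  hence "transpose_mat Q * (A * Q) = (transpose_mat Q * Q) * A'" using that Qc by (simp add: assoc_mult_mat[of _ m m])
  thus ?thesis using that Qc QQ by (simp add: assoc_mult_mat[of _ m m _ m _ m])
 qed
 have Esum: "(\<Sum>k<m. B k i * Em m r t $$ (k, j)) = (if j = t then B r i else 0) - (if j = r then B t i else 0)"
  if "r < m" "t < m" "j < m" for r t i j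
 proof -
  have "(\<Sum>k<m. B k i * Em m r t $$ (k, j)) = (\<Sum>k<m. (if k = r then (if j = t then B k i else 0) else 0) - (if k = t then (if j = r then B k i else 0) else 0))"
   using that by (intro sum.cong refl) (auto simp: Em_index)
  thus ?thesis using that by (simp add: sum_subtractf)
 qed
 have Lsum: "(\<Sum>k<m. B k i * (x \<cdot>\<^sub>m Em m r t + y \<cdot>\<^sub>m Em m r' t') $$ (k, j)) =
  x * (\<Sum>k<m. B k i * Em m r t $$ (k, j)) + y * (\<Sum>k<m. B k i * Em m r' t' $$ (k, j))" if "j < m" for x y r t r' t' i j
  using that by (simp add: distrib_left sum.distrib sum_distrib_left mult.left_commute)
 have j: "j = 0 \<or> j = 1 \<or> j = 2 \<or> 3 \<le> j" for j :: nat by auto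
 have mm: "0 < m" "1 < m" "2 < m" using m by auto
 have std: "std_e m = 1 \<cdot>\<^sub>m Em m 0 1 + img \<cdot>\<^sub>m Em m 0 2" "std_f m = (1 / 2) \<cdot>\<^sub>m Em m 0 1 + (- img / 2) \<cdot>\<^sub>m Em m 0 2"
  "std_h m = img \<cdot>\<^sub>m Em m 1 2 + 0 \<cdot>\<^sub>m Em m 0 1"
  by (auto simp: std_e_def std_f_def std_h_def intro!: eq_matI)
 have stdc: "std_e m \<in> carrier_mat m m" "std_f m \<in> carrier_mat m m" "std_h m \<in> carrier_mat m m"
  by (auto simp: std_e_def std_f_def std_h_def)
 show ?thesis
 proof (rule that[OF Qc(1) QQ QQ'])
  show "transpose_mat Q * e * Q = std_e m"
  proof (rule conj[OF sk(1) stdc(1)])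
   fix i k assume ik: "i < m" "k < m"
   have "?e (B 0) = - (B 1 + smv img (B 2))" "?e (B 1) = B 0" "?e (B 2) = smv img (B 0)"
    unfolding q'B(1)[symmetric] using eZ[OF F2(1)] by (simp_all add: B012 B012(2)[unfolded One_nat_def] mv_simps F smv_simps) (simp add: smv_def fun_eq_iff)
   moreover have "?e (B k) = 0" if "3 \<le> k" using eZ[OF hB(1)[OF that ik(2)]] hB(2)[OF that ik(2)] by (simp add: smv_simps)
   ultimately show "?e (B k) i = (\<Sum>l<m. B l i * std_e m $$ (l, k))"
    unfolding std Lsum[OF ik(2)] Esum[OF mm(1,2) ik(2)] Esum[OF mm(1,3) ik(2)] using j[of k] by (auto simp: smv_def)
  qed
  show "transpose_mat Q * f * Q = std_f m"
  proof (rule conj[OF sk(5) stdc(2)])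
   fix i k assume ik: "i < m" "k < m"
   have "?f (B 0) = - (smv (1 / 2) (B 1) + smv (- img / 2) (B 2))" "?f (B 1) = smv (1 / 2) (B 0)" "?f (B 2) = smv (- img / 2) (B 0)"
    unfolding q'B(2)[symmetric] using fZ[OF F2(1)] by (simp_all add: B012 B012(2)[unfolded One_nat_def] mv_simps F smv_simps) (simp add: smv_def fun_eq_iff)?
   moreover have "?f (B k) = 0" if "3 \<le> k" using fZ[OF hB(1)[OF that ik(2)]] hB(2)[OF that ik(2)] by (simp add: smv_simps)
   ultimately show "?f (B k) i = (\<Sum>l<m. B l i * std_f m $$ (l, k))"
    unfolding std Lsum[OF ik(2)] Esum[OF mm(1,2) ik(2)] Esum[OF mm(1,3) ik(2)] using j[of k] by (auto simp: smv_def)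
  qed
  show "transpose_mat Q * h * Q = std_h m"
  proof (rule conj[OF sk(3) stdc(3)])
   fix i k assume ik: "i < m" "k < m"
   have "?h (B 0) = 0" "?h (B 1) = smv (- img) (B 2)" "?h (B 2) = smv img (B 1)"
    unfolding B012 mv_simps F by (simp_all add: smv_def fun_eq_iff field_simps img_img)
   moreover have "?h (B k) = 0" if "3 \<le> k" using hB(1)[OF that ik(2)] .
   ultimately show "?h (B k) i = (\<Sum>l<m. B l i * std_h m $$ (l, k))"
    unfolding std Lsum[OF ik(2)] Esum[OF mm(2,3) ik(2)] Esum[OF mm(1,2) ik(2)] using j[of k] by (auto simp: smv_def)
  qed
 qed
qed

subsection \<open>The Lie algebra \<open>so(m) \<ltimes> (W \<otimes> V)\<close> in coordinates\<close>

lemma lie_homD: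
 assumes "lie_hom L N \<phi>"
 shows "lmap L N \<phi>" "[|x \<in> carrier L; y \<in> carrier L|] ==> \<phi> (bracket L x y) = bracket N (\<phi> x) (\<phi> y)"
 using assms by (auto simp: lie_hom_def)

lemma lieD:
 fixes L (structure)
 assumes "lie_algebra L"
 shows "vsp L" "x \<in> carrier L ==> lmap L L (bracket L x)" "y \<in> carrier L ==> lmap L L (\<lambda>x. bracket L x y)"
  "x \<in> carrier L ==> bracket L x x = \<zero>"
  "[|x \<in> carrier L; y \<in> carrier L|] ==> bracket L x y \<in> carrier L"
  "[|x \<in> carrier L; y \<in> carrier L; z \<in> carrier L|] ==>
    bracket L x (bracket L y z) \<oplus> bracket L y (bracket L z x) \<oplus> bracket L z (bracket L x y) = \<zero>"
proof -
 show "x \<in> carrier L ==> lmap L L (bracket L x)" using assms by (simp add: lie_algebra_def bilinear_map_def)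
 from lmapD(3)[OF this]
 show "[|x \<in> carrier L; y \<in> carrier L|] ==> bracket L x y \<in> carrier L" by blast
qed (use assms in \<open>auto simp: lie_algebra_def bilinear_map_def\<close>)

lemma bracket_skew:
 fixes L (structure)
 assumes L: "lie_algebra L" and "x \<in> carrier L" "y \<in> carrier L"
 shows "bracket L x y = (- 1) \<odot> bracket L y x"
proof -
 note l = lieD[OF L] and v = vsp_simps[OF lieD(1)[OF L]]
 interpret V: vectorspace class_ring L by (rule l(1))
 have c: "bracket L x y \<in> carrier L" "bracket L y x \<in> carrier L" using l(5) assms by auto
 have "\<zero> = bracket L (x \<oplus> y) (x \<oplus> y)" using l(4) v(2) assms by simp
 also have "\<dots> = (bracket L x x \<oplus> bracket L y x) \<oplus> (bracket L x y \<oplus> bracket L y y)"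
  using lmapD(4)[OF l(2)[OF v(2)[OF assms(2,3)]] assms(2,3)]
   lmapD(4)[OF l(3)[OF assms(2)] assms(2,3)] lmapD(4)[OF l(3)[OF assms(3)] assms(2,3)] by simp
 also have "\<dots> = bracket L x y \<oplus> bracket L y x"
  using l(4) assms c by (simp add: v(6,7) v(4)[of "bracket L y x"])
 finally have "bracket L x y \<oplus> bracket L y x = \<zero>" by simp
 hence "bracket L x y = \<ominus> bracket L y x" using c V.minus_equality by metis
 thus ?thesis using v(15) c by simp
qed

lemma finsum_additive:
 fixes W (structure) and c :: "'w => 'a::ab_group_add"
 assumes "vsp W" "\<And>x y. [|x \<in> carrier W; y \<in> carrier W|] ==> c (x \<oplus> y) = c x + c y"
  and "finite S" "\<And>j. j \<in> S ==> f j \<in> carrier W"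
 shows "c (\<Oplus>j\<in>S. f j) = (\<Sum>j\<in>S. c (f j))"
proof -
 interpret vectorspace class_ring W by fact
 have z: "c \<zero> = 0" using assms(2)[of "\<zero>" "\<zero>"] by simp
 show ?thesis using assms(3,4)
 proof (induction S)
  case (insert a S)
  hence "(\<Oplus>j\<in>insert a S. f j) = f a \<oplus> (\<Oplus>j\<in>S. f j)" by (intro finsum_insert) auto
  thus ?case using insert by (simp add: assms(2) Pi_iff)
 qed (simp add: z)
qed

lemma tensor_std_simps:
 "carrier (tensor_std m W) = {..<m} \<rightarrow>\<^sub>E carrier W" "\<zero>\<^bsub>tensor_std m W\<^esub> = (\<lambda>i\<in>{..<m}. \<zero>\<^bsub>W\<^esub>)"
 "x \<oplus>\<^bsub>tensor_std m W\<^esub> y = (\<lambda>i\<in>{..<m}. x i \<oplus>\<^bsub>W\<^esub> y i)" "c \<odot>\<^bsub>tensor_std m W\<^esub> x = (\<lambda>i\<in>{..<m}. c \<odot>\<^bsub>W\<^esub> x i)"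
 by (simp_all add: tensor_std_def)

lemma vsp_tensor_std:
 assumes W: "vsp W"
 shows "vsp (tensor_std m W)"
proof -
 note v = vsp_simps[OF W]
 interpret V: vectorspace class_ring W by (rule W)
 show ?thesis
  by (rule vspI)
   (auto simp: tensor_std_simps PiE_iff v(1-3,6-) extensional_def fun_eq_iff restrict_def V.a_ac)
qed

lemma so_semidirect_simps:
 "carrier (so_semidirect m W) = carrier (so_lie m) \<times> ({..<m} \<rightarrow>\<^sub>E carrier W)"
 "\<zero>\<^bsub>so_semidirect m W\<^esub> = (0\<^sub>m m m, \<zero>\<^bsub>tensor_std m W\<^esub>)"
 "a \<oplus>\<^bsub>so_semidirect m W\<^esub> b = (fst a + fst b, snd a \<oplus>\<^bsub>tensor_std m W\<^esub> snd b)"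
 "c \<odot>\<^bsub>so_semidirect m W\<^esub> a = (c \<cdot>\<^sub>m fst a, c \<odot>\<^bsub>tensor_std m W\<^esub> snd a)"
 "bracket (so_semidirect m W) (A, x) (B, y) =
  (A * B - B * A, tensor_std_act m W A y \<ominus>\<^bsub>tensor_std m W\<^esub> tensor_std_act m W B x)"
 by (simp_all add: so_semidirect_def semidirect_def module.extend_def lie.fields_def so_lie_simps tensor_std_simps(1))

context
 fixes m :: nat and W :: "('k::field, 'w) module"
 assumes W: "fd_vectorspace W"
begin

lemma vW: "vsp W" using W by (rule fdD)

abbreviation (input) "tsp \<equiv> tensor_std m W"
abbreviation (input) "tact \<equiv> tensor_std_act m W"
abbreviation (input) "kcrd x i \<equiv> kappa W (x i)"

text \<open>The entries of a tensor lie in W and are compared through their coordinates in k, so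
  that identities between matrix actions become identities between finite sums of scalars.\<close>

lemma tensor_eqI:
 assumes "x \<in> carrier tsp" "y \<in> carrier tsp" "\<And>i b. i < m ==> kcrd x i b = kcrd y i b"
 shows "x = y"
proof (rule PiE_ext)
 show "x \<in> {..<m} \<rightarrow>\<^sub>E carrier W" "y \<in> {..<m} \<rightarrow>\<^sub>E carrier W" using assms by (simp_all add: tensor_std_simps)
 fix i assume i: "i \<in> {..<m}"
 have "kcrd x i = kcrd y i" using assms(3) i by auto
 have c: "x i \<in> carrier W" "y i \<in> carrier W" using assms(1,2) i by (auto simp: tensor_std_simps)
 have "x i = iota W (kcrd x i)" using iota_kappa[OF W c(1)] by simp
 also have "\<dots> = y i" using iota_kappa[OF W c(2)] \<open>kcrd x i = kcrd y i\<close> by simp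
 finally show "x i = y i" .
qed

lemma tensor_std_act_closed: "x \<in> carrier tsp ==> tact A x \<in> carrier tsp"
proof -
 interpret vectorspace class_ring W by (rule vW)
 show "x \<in> carrier tsp ==> tact A x \<in> carrier tsp"
  by (auto simp: tensor_std_simps tensor_std_act_def PiE_iff intro!: finsum_closed)
qed

lemma additive_act:
 fixes c :: "'w => 'a::ab_group_add"
 assumes "\<And>x y. [|x \<in> carrier W; y \<in> carrier W|] ==> c (x \<oplus>\<^bsub>W\<^esub> y) = c x + c y" "x \<in> carrier tsp" "i < m"
 shows "c (tact A x i) = (\<Sum>j<m. c (A $$ (i, j) \<odot>\<^bsub>W\<^esub> x j))"
 using assms vsp_simps(3)[OF vW]
 by (simp add: tensor_std_act_def) (intro finsum_additive[OF vW], auto simp: tensor_std_simps PiE_iff)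

lemma kappa_act:
 assumes x: "x \<in> carrier tsp" and "i < m"
 shows "kcrd (tact A x) i b = (\<Sum>j<m. A $$ (i, j) * kcrd x j b)"
proof -
 have "kcrd (tact A x) i b = (\<Sum>j<m. kappa W (A $$ (i, j) \<odot>\<^bsub>W\<^esub> x j) b)"
  by (rule additive_act[of "\<lambda>w. kappa W w b"]) (simp_all add: assms kappa_add[OF W])
 also have "\<dots> = (\<Sum>j<m. A $$ (i, j) * kcrd x j b)"
  using x by (intro sum.cong refl) (auto simp: tensor_std_simps kappa_smult[OF W] PiE_iff)
 finally show ?thesis .
qed

lemma kappa_tensor_ops:
 assumes "x \<in> carrier tsp" "y \<in> carrier tsp" "i < m"
 shows "kcrd (x \<oplus>\<^bsub>tsp\<^esub> y) i b = kcrd x i b + kcrd y i b" "kcrd (c \<odot>\<^bsub>tsp\<^esub> x) i b = c * kcrd x i b"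
  "kcrd (x \<ominus>\<^bsub>tsp\<^esub> y) i b = kcrd x i b - kcrd y i b" "kcrd \<zero>\<^bsub>tsp\<^esub> i b = 0"
proof -
 have c: "x i \<in> carrier W" "y i \<in> carrier W" using assms by (auto simp: tensor_std_simps PiE_iff)
 show "kcrd (x \<oplus>\<^bsub>tsp\<^esub> y) i b = kcrd x i b + kcrd y i b" "kcrd (c \<odot>\<^bsub>tsp\<^esub> x) i b = c * kcrd x i b" "kcrd \<zero>\<^bsub>tsp\<^esub> i b = 0"
  using assms c by (simp_all add: tensor_std_simps kappa_add[OF W] kappa_smult[OF W] kappa_zero[OF W])
 show "kcrd (x \<ominus>\<^bsub>tsp\<^esub> y) i b = kcrd x i b - kcrd y i b"
  using assms c vsp_simps(3)[OF vW] vsp_simps(16)[OF vsp_tensor_std[OF vW] assms(1,2)]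
  by (simp add: tensor_std_simps kappa_add[OF W] kappa_smult[OF W])
qed

lemma tensor_std_closed:
 "[|x \<in> carrier tsp; y \<in> carrier tsp|] ==> x \<oplus>\<^bsub>tsp\<^esub> y \<in> carrier tsp" "x \<in> carrier tsp ==> c \<odot>\<^bsub>tsp\<^esub> x \<in> carrier tsp"
 "[|x \<in> carrier tsp; y \<in> carrier tsp|] ==> x \<ominus>\<^bsub>tsp\<^esub> y \<in> carrier tsp" "\<zero>\<^bsub>tsp\<^esub> \<in> carrier tsp"
 using vsp_simps[OF vsp_tensor_std[OF vW]] by auto

lemma tensor_std_act_mult:
 assumes "A \<in> carrier_mat m m" "B \<in> carrier_mat m m" "x \<in> carrier tsp"
 shows "tact A (tact B x) = tact (A * B) x"
proof (rule tensor_eqI)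
 fix i b assume i: "i < m"
 have "kcrd (tact A (tact B x)) i b = (\<Sum>j<m. A $$ (i, j) * (\<Sum>k<m. B $$ (j, k) * kcrd x k b))"
  using assms i tensor_std_act_closed by (simp add: kappa_act)
 also have "\<dots> = (\<Sum>k<m. (\<Sum>j<m. A $$ (i, j) * B $$ (j, k)) * kcrd x k b)"
  by (simp add: sum_distrib_left sum_distrib_right mult.assoc) (rule sum.swap)
 also have "\<dots> = kcrd (tact (A * B) x) i b"
  using assms i by (simp add: kappa_act scalar_prod_def lessThan_atLeast0)
 finally show "kcrd (tact A (tact B x)) i b = kcrd (tact (A * B) x) i b" .
qed (use assms tensor_std_act_closed in blast)+

lemma tensor_std_act_one:
 assumes "x \<in> carrier tsp"
 shows "tact (1\<^sub>m m) x = x"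
proof (rule tensor_eqI)
 fix i b assume "i < m"
 thus "kcrd (tact (1\<^sub>m m) x) i b = kcrd x i b"
  using assms by (simp add: kappa_act if_distrib[of "\<lambda>a. a * _"] cong: if_cong)
qed (use assms tensor_std_act_closed in blast)+

lemma tensor_std_act_linear:
 assumes "x \<in> carrier tsp" "y \<in> carrier tsp"
 shows "tact A (x \<oplus>\<^bsub>tsp\<^esub> y) = tact A x \<oplus>\<^bsub>tsp\<^esub> tact A y" "tact A (x \<ominus>\<^bsub>tsp\<^esub> y) = tact A x \<ominus>\<^bsub>tsp\<^esub> tact A y" "tact A (c \<odot>\<^bsub>tsp\<^esub> x) = c \<odot>\<^bsub>tsp\<^esub> tact A x"
  "tact A \<zero>\<^bsub>tsp\<^esub> = \<zero>\<^bsub>tsp\<^esub>"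
 using assms
 by (auto intro!: tensor_eqI simp: tensor_std_closed tensor_std_act_closed kappa_act kappa_tensor_ops
   algebra_simps sum.distrib sum_subtractf sum_distrib_left)

text \<open>The automorphism of the semidirect product induced by an orthogonal change of basis Q of
  V: conjugation on so(m), the transpose of Q on the factor V of the tensor product.\<close>

definition conj_map :: "'k mat => 'k mat \<times> (nat => 'w) => 'k mat \<times> (nat => 'w)" where
 "conj_map Q = (\<lambda>(A, x). (transpose_mat Q * A * Q, tact (transpose_mat Q) x))"

abbreviation (input) "soL \<equiv> so_semidirect m W"

lemma conj_map_closed:
 assumes Q: "Q \<in> carrier_mat m m" and a: "a \<in> carrier soL"
 shows "conj_map Q a \<in> carrier soL"
proof -
 obtain A x where ax: "a = (A, x)" by (cases a)
 have A: "A \<in> carrier_mat m m" "transpose_mat A = - A" "x \<in> carrier tsp" using a by (auto simp: ax so_semidirect_simps so_lie_simps tensor_std_simps)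
 have "transpose_mat (transpose_mat Q * A * Q) = transpose_mat Q * (transpose_mat A * Q)"
  using A Q by (simp add: transpose_mult[of _ m m _ m])
 also have "\<dots> = transpose_mat Q * (- (A * Q))" using A Q by simp
 also have "\<dots> = - (transpose_mat Q * (A * Q))"
  using A Q by (intro eq_matI) (auto simp: scalar_prod_def sum_negf)
 finally show ?thesis
  using A Q tensor_std_act_closed[OF A(3)] by (simp add: ax conj_map_def so_semidirect_simps so_lie_simps tensor_std_simps assoc_mult_mat[of _ m m _ m _ m])
qed

lemma conj_map_inverse:
 assumes Q: "Q \<in> carrier_mat m m" "transpose_mat Q * Q = 1\<^sub>m m" "Q * transpose_mat Q = 1\<^sub>m m" and a: "a \<in> carrier soL"
 shows "conj_map Q (conj_map (transpose_mat Q) a) = a"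
proof -
 obtain A x where ax: "a = (A, x)" by (cases a)
 have A: "A \<in> carrier_mat m m" "x \<in> carrier tsp" using a by (auto simp: ax so_semidirect_simps so_lie_simps tensor_std_simps)
 have "transpose_mat Q * (Q * A * transpose_mat Q) * Q = (transpose_mat Q * Q) * A * (transpose_mat Q * Q)"
  using Q(1) A by (simp add: assoc_mult_mat[of _ m m _ m _ m])
 thus ?thesis
  using Q A by (simp add: ax conj_map_def tensor_std_act_mult tensor_std_act_one)
qed

lemma lie_hom_conj_map:
 assumes L: "lie_algebra soL" and Q: "Q \<in> carrier_mat m m" "Q * transpose_mat Q = 1\<^sub>m m"
 shows "lie_hom soL soL (conj_map Q)"
 unfolding lie_hom_def
proof (intro conjI ballI lmapI)
 let ?Q = "transpose_mat Q"
 show v: "vsp soL" "vsp soL" using lieD(1)[OF L] by auto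
 show "conj_map Q a \<in> carrier soL" if "a \<in> carrier soL" for a using conj_map_closed[OF Q(1) that] .
 have mem: "fst a \<in> carrier_mat m m" "snd a \<in> carrier tsp" if "a \<in> carrier soL" for a
  using that by (cases a; simp add: so_semidirect_simps(1) so_lie_simps(1) tensor_std_simps(1))+
 have Qt: "?Q \<in> carrier_mat m m" using Q by simp
 have tri: "?Q * A * Q \<in> carrier_mat m m" if "A \<in> carrier_mat m m" for A using that Q(1) by simp
 fix a b c assume a: "a \<in> carrier soL"
 have "?Q * (c \<cdot>\<^sub>m fst a) * Q = c \<cdot>\<^sub>m (?Q * fst a * Q)"
  using mem(1)[OF a] Q(1) by (simp add: mult_smult_distrib[of _ m m] mult_smult_assoc_mat[of _ m m])
 thus "conj_map Q (c \<odot>\<^bsub>soL\<^esub> a) = c \<odot>\<^bsub>soL\<^esub> conj_map Q a"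
  using mem[OF a] by (simp add: conj_map_def so_semidirect_simps case_prod_beta tensor_std_act_linear)
 assume b: "b \<in> carrier soL"
 have "?Q * (fst a + fst b) * Q = ?Q * fst a * Q + ?Q * fst b * Q"
  using mem(1)[OF a] mem(1)[OF b] Q(1) by (simp add: mult_add_distrib_mat[of _ m m _ m] add_mult_distrib_mat[of _ m m _ _ m])
 thus "conj_map Q (a \<oplus>\<^bsub>soL\<^esub> b) = conj_map Q a \<oplus>\<^bsub>soL\<^esub> conj_map Q b"
  using mem[OF a] mem[OF b] by (simp add: conj_map_def so_semidirect_simps case_prod_beta tensor_std_act_linear)
 obtain A x B y where ab: "a = (A, x)" "b = (B, y)" by (cases a; cases b)
 have c: "A \<in> carrier_mat m m" "B \<in> carrier_mat m m" "x \<in> carrier tsp" "y \<in> carrier tsp" using mem[OF a] mem[OF b] by (auto simp: ab)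
 have m2: "(?Q * A * Q) * (?Q * B * Q) = ?Q * (A * B) * Q" if "A \<in> carrier_mat m m" "B \<in> carrier_mat m m" for A B
 proof -
  have "(?Q * A * Q) * (?Q * B * Q) = ?Q * A * (Q * ?Q) * B * Q" using that Q(1) by (simp add: assoc_mult_mat[of _ m m _ m _ m])
  thus ?thesis using that Q by (simp add: assoc_mult_mat[of _ m m _ m _ m])
 qed
 have m3: "?Q * (A * B - B * A) * Q = ?Q * (A * B) * Q - ?Q * (B * A) * Q"
  using c Q(1) by (simp add: mult_minus_distrib_mat[of _ m m _ m] minus_mult_distrib_mat[of _ m m _ _ m])
 have a2: "tact (?Q * A * Q) (tact ?Q y) = tact ?Q (tact A y)" if "A \<in> carrier_mat m m" "y \<in> carrier tsp" for A y
 proof -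
  have "?Q * A * Q * ?Q = ?Q * A" using that Q by (simp add: assoc_mult_mat[of _ m m _ m _ m])
  thus ?thesis using that Q(1) by (simp add: tensor_std_act_mult)
 qed
 show "conj_map Q (bracket soL a b) = bracket soL (conj_map Q a) (conj_map Q b)"
  using c by (simp add: ab conj_map_def so_semidirect_simps m2 m3 a2 tensor_std_act_linear tensor_std_act_closed)
qed

end

subsection \<open>Automorphisms of the base of a central extension\<close>

lemma lie_hom_comp:
 assumes "lie_hom L N \<phi>" "lie_hom N K \<psi>"
 shows "lie_hom L K (\<lambda>x. \<psi> (\<phi> x))"
 using lmap_comp[OF lie_homD(1)[OF assms(1)] lie_homD(1)[OF assms(2)]]
  lie_homD(2)[OF assms(1)] lie_homD(2)[OF assms(2)] lmapD(3)[OF lie_homD(1)[OF assms(1)]]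
 by (simp add: lie_hom_def)

lemma central_extension_automorphism:
 assumes E: "central_extension E \<pi> L" and t: "lie_hom L L \<theta>" "lie_hom L L \<theta>'"
  and inv: "\<And>x. x \<in> carrier L ==> \<theta> (\<theta>' x) = x" "\<And>x. x \<in> carrier L ==> \<theta>' (\<theta> x) = x"
 shows "central_extension E (\<lambda>x. \<theta> (\<pi> x)) L"
proof -
 have E': "lie_algebra E" "lie_algebra L" "lie_hom E L \<pi>" "\<pi> ` carrier E = carrier L"
  "\<And>x y. [|x \<in> carrier E; \<pi> x = \<zero>\<^bsub>L\<^esub>; y \<in> carrier E|] ==> bracket E x y = \<zero>\<^bsub>E\<^esub>"
  using E by (auto simp: central_extension_def)
 note t1 = lmapD[OF lie_homD(1)[OF t(1)]] and t2 = lmapD[OF lie_homD(1)[OF t(2)]]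
 have "(\<lambda>x. \<theta> (\<pi> x)) ` carrier E = \<theta> ` carrier L" unfolding E'(4)[symmetric] by (simp add: image_image)
 also have "\<dots> = carrier L" using inv t1(3) t2(3) by force
 finally have im: "(\<lambda>x. \<theta> (\<pi> x)) ` carrier E = carrier L" .
 have "\<pi> x = \<zero>\<^bsub>L\<^esub>" if x: "x \<in> carrier E" "\<theta> (\<pi> x) = \<zero>\<^bsub>L\<^esub>" for x
 proof -
  have "\<pi> x \<in> carrier L" using E'(4) x(1) by blast
  from inv(2)[OF this] show ?thesis unfolding x(2) t2(6) by (rule sym)
 qed
 thus ?thesis
  unfolding central_extension_def using E' lie_hom_comp[OF E'(3) t(1)] im by blast
qed

text \<open>A competitor for \<theta> after \<pi> becomes a competitor for \<pi> by composing its
  projection with the inverse of \<theta>, and the homomorphisms over L are the same in both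
  readings.\<close>

lemma universal_central_extension_automorphism:
 fixes G :: "('k::field, 'e) lie"
 assumes G: "universal_central_extension G \<pi> L" and t: "lie_hom L L \<theta>" "lie_hom L L \<theta>'"
  and inv: "\<And>x. x \<in> carrier L ==> \<theta> (\<theta>' x) = x" "\<And>x. x \<in> carrier L ==> \<theta>' (\<theta> x) = x"
 shows "universal_central_extension G (\<lambda>x. \<theta> (\<pi> x)) L"
 unfolding universal_central_extension_def
proof (intro conjI allI impI)
 have c: "central_extension G \<pi> L" using G by (simp add: universal_central_extension_def)
 show "central_extension G (\<lambda>x. \<theta> (\<pi> x)) L" by (rule central_extension_automorphism[OF c t inv])
 fix E' :: "('k, 'e) lie" and \<pi>' assume E': "central_extension E' \<pi>' L"
 have "central_extension E' (\<lambda>x. \<theta>' (\<pi>' x)) L" by (rule central_extension_automorphism[OF E' t(2,1) inv(2,1)])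
 hence ex: "\<exists>!\<phi>. \<phi> \<in> extensional (carrier G) \<and> lie_hom G E' \<phi> \<and> (\<forall>x\<in>carrier G. \<theta>' (\<pi>' (\<phi> x)) = \<pi> x)"
  by (rule G[unfolded universal_central_extension_def, THEN conjunct2, rule_format])
 have p: "\<pi> x \<in> carrier L" if "x \<in> carrier G" for x using c that by (auto simp: central_extension_def)
 have p': "\<pi>' x \<in> carrier L" if "x \<in> carrier E'" for x using E' that by (auto simp: central_extension_def)
 have "(\<forall>x\<in>carrier G. \<theta>' (\<pi>' (\<phi> x)) = \<pi> x) \<longleftrightarrow> (\<forall>x\<in>carrier G. \<pi>' (\<phi> x) = \<theta> (\<pi> x))" if "lie_hom G E' \<phi>" for \<phi>
  using inv p p'[OF lmapD(3)[OF lie_homD(1)[OF that]]] by metis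
 thus "\<exists>!\<phi>. \<phi> \<in> extensional (carrier G) \<and> lie_hom G E' \<phi> \<and> (\<forall>x\<in>carrier G. \<pi>' (\<phi> x) = \<theta> (\<pi> x))"
  using ex by (metis (no_types, lifting))
qed

text \<open>The triple enters only through the condition that lifts project to it, and applying an
  injective map to both sides of that condition changes nothing.\<close>

lemma S_half_automorphism:
 assumes c: "central_extension G \<pi> L" and inj: "inj_on \<theta> (carrier L)" and efh: "e \<in> carrier L" "h \<in> carrier L" "f \<in> carrier L"
 shows "S_half G (\<lambda>x. \<theta> (\<pi> x)) (\<theta> e) (\<theta> h) (\<theta> f) = S_half G \<pi> e h f"
proof -
 have p: "\<pi> x \<in> carrier L" if "x \<in> carrier G" for x using c that by (auto simp: central_extension_def)
 have "\<theta> (\<pi> x) = \<theta> a \<longleftrightarrow> \<pi> x = a" if "x \<in> carrier G" "a \<in> carrier L" for x a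
  using inj_onD[OF inj _ p[OF that(1)] that(2)] by auto
 hence "(sl2_relations G e' h' f' \<and> \<theta> (\<pi> e') = \<theta> e \<and> \<theta> (\<pi> h') = \<theta> h \<and> \<theta> (\<pi> f') = \<theta> f \<and> Z) \<longleftrightarrow>
  (sl2_relations G e' h' f' \<and> \<pi> e' = e \<and> \<pi> h' = h \<and> \<pi> f' = f \<and> Z)" for e' h' f' Z
  using efh unfolding sl2_relations_def by blast
 thus ?thesis unfolding S_half_def by simp
qed

subsection \<open>Sums of two-dimensional simple modules of the short subalgebra\<close>

lemma subspaceI_vsp:
 fixes M :: "('k::field, 'v, 'x) module_scheme"
 assumes "vsp M" "S \<subseteq> carrier M" "\<zero>\<^bsub>M\<^esub> \<in> S" "\<And>x y. [|x \<in> S; y \<in> S|] ==> x \<oplus>\<^bsub>M\<^esub> y \<in> S" "\<And>c x. x \<in> S ==> c \<odot>\<^bsub>M\<^esub> x \<in> S"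
 shows "VectorSpace.subspace class_ring S M"
proof -
 interpret vectorspace class_ring M by fact
 show ?thesis using assms(2-) by (intro VectorSpace.subspace.intro submodule.intro vectorspace_axioms module_axioms) auto
qed

lemma lmap_finsum:
 assumes "lmap M N f" "finite S" "\<And>i. i \<in> S ==> u i \<in> carrier M"
 shows "f (\<Oplus>\<^bsub>M\<^esub>i\<in>S. u i) = (\<Oplus>\<^bsub>N\<^esub>i\<in>S. f (u i))"
proof -
 note f = lmapD[OF assms(1)]
 interpret M: vectorspace class_ring M using f(1) .
 interpret N: vectorspace class_ring N using f(2) .
 show ?thesis using assms(2,3)
 proof (induction S)
  case (insert a S)
  thus ?case using f(3) by (simp add: M.finsum_insert N.finsum_insert M.finsum_closed f(4) Pi_def)
 qed (simp add: f(6))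
qed

lemma finsum_in_subspace:
 fixes M (structure)
 assumes "vsp M" "finite S" "\<And>i. i \<in> S ==> u i \<in> K" "K \<subseteq> carrier M" "\<zero> \<in> K" "\<And>x y. [|x \<in> K; y \<in> K|] ==> x \<oplus> y \<in> K"
 shows "(\<Oplus>i\<in>S. u i) \<in> K"
proof -
 interpret vectorspace class_ring M by fact
 show ?thesis using assms(2,3)
 proof (induction S)
  case (insert a S)
  hence "(\<Oplus>i\<in>insert a S. u i) = u a \<oplus> (\<Oplus>i\<in>S. u i)" using assms(4) by (intro finsum_insert) auto
  thus ?case using insert assms(6) by simp
 qed (use assms(5) in simp)
qed

text \<open>Independent subsets of U stay independent in M, so their size is bounded by the
  dimension of M; a maximal one exists and is a basis of U.\<close>

lemma subspace_basis:
 fixes M :: "('k::field, 'v, 'x) module_scheme" (structure)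
 assumes M: "fd_vectorspace M" and U: "VectorSpace.subspace class_ring U M"
 obtains B where "finite B" "vectorspace.basis class_ring (M\<lparr>carrier := U\<rparr>) B" "B \<subseteq> U"
  "\<And>y. y \<in> U ==> \<exists>!a. a \<in> B \<rightarrow>\<^sub>E UNIV \<and> (\<Oplus>b\<in>B. a b \<odot> b) = y"
proof -
 let ?U = "M\<lparr>carrier := U\<rparr>"
 interpret M: vectorspace class_ring M using fdD(1)[OF M] .
 interpret U: vectorspace class_ring ?U by (rule M.subspace_is_vs[OF U])
 note uc = subspD[OF U]
 have sub: "submodule class_ring U M" using U by (simp add: subspace_def)
 have indep: "finite A \<and> card A \<le> M.dim" if "A \<subseteq> U" "\<not> U.lin_dep A" for A
 proof -
  have "\<not> M.lin_dep A"
  proof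
   assume "M.lin_dep A"
   then obtain S a v where S: "finite S" "S \<subseteq> A" "a \<in> S \<rightarrow> UNIV" "M.lincomb a S = \<zero>" "v \<in> S" "a v \<noteq> 0"
    unfolding M.lin_dep_def by auto
   have "U.lincomb a S = M.lincomb a S"
    using M.lincomb_not_depend[of S U a] S that(1) sub by auto
   hence "U.lin_dep A" unfolding U.lin_dep_def using S by auto
   thus False using that by blast
  qed
  thus ?thesis using M.li_le_dim[of A] M that(1) uc(1) by (auto simp: fd_vectorspace_def)
 qed
 have "\<exists>A. finite A \<and> maximal A (\<lambda>S. S \<subseteq> carrier ?U \<and> \<not> U.lin_dep S)"
 proof (rule maximal_exists[of _ M.dim "{}"])
  show "{} \<subseteq> carrier ?U \<and> \<not> U.lin_dep {}" by (auto simp: U.lin_dep_def)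
 qed (use indep in auto)
 then obtain B where A: "finite B" "maximal B (\<lambda>S. S \<subseteq> carrier ?U \<and> \<not> U.lin_dep S)" by blast
 have B: "U.basis B" by (rule U.max_li_is_basis) (use A in \<open>auto simp: maximal_def\<close>)
 hence BU: "B \<subseteq> U" by (simp add: U.basis_def)
 show ?thesis
 proof (rule that[OF A(1) B BU])
  fix y assume y: "y \<in> U"
  have "U.lincomb a B = (\<Oplus>b\<in>B. a b \<odot> b)" for a
   using M.lincomb_not_depend[of B U a] A(1) BU sub by (simp add: M.lincomb_def)
  thus "\<exists>!a. a \<in> B \<rightarrow>\<^sub>E UNIV \<and> (\<Oplus>b\<in>B. a b \<odot> b) = y"
   using U.basis_criterion[OF A(1)] B BU y by auto
 qed
qed

lemma basis2_if_dim_2: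
 fixes M :: "('k::field, 'v, 'x) module_scheme" (structure)
 assumes M: "fd_vectorspace M" and U: "VectorSpace.subspace class_ring U M" and dim: "vectorspace.dim class_ring (M\<lparr>carrier := U\<rparr>) = 2"
 obtains b1 b2 where "b1 \<in> U" "b2 \<in> U" "\<And>y. y \<in> U ==> \<exists>a c. y = a \<odot> b1 \<oplus> c \<odot> b2"
  "\<And>a c. a \<odot> b1 \<oplus> c \<odot> b2 = \<zero> ==> a = 0 \<and> c = 0"
proof -
 interpret M: vectorspace class_ring M using fdD(1)[OF M] .
 interpret U: vectorspace class_ring "M\<lparr>carrier := U\<rparr>" by (rule M.subspace_is_vs[OF U])
 note uc = subspD[OF U]
 obtain B where B: "finite B" "U.basis B" "B \<subseteq> U" and crit: "\<And>y. y \<in> U ==> \<exists>!a. a \<in> B \<rightarrow>\<^sub>E UNIV \<and> (\<Oplus>b\<in>B. a b \<odot> b) = y"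
  by (rule subspace_basis[OF M U]) (rule that)
 have "card B = 2" using U.dim_basis[OF B(1,2)] dim by simp
 then obtain b1 b2 where b: "B = {b1, b2}" "b1 \<noteq> b2" by (auto simp: card_2_iff)
 have bU: "b1 \<in> U" "b2 \<in> U" "b1 \<in> carrier M" "b2 \<in> carrier M" using B(3) b uc(1) by auto
 have lc: "(\<Oplus>b\<in>B. a b \<odot> b) = a b1 \<odot> b1 \<oplus> a b2 \<odot> b2" for a
  using b bU by (simp add: M.finsum_insert vsp_simps(3,6)[OF fdD(1)[OF M]])
 show ?thesis
 proof (rule that[OF bU(1,2)])
  show "\<exists>a c. y = a \<odot> b1 \<oplus> c \<odot> b2" if "y \<in> U" for y
   using crit[OF that] unfolding lc by metis
  fix a c assume z: "a \<odot> b1 \<oplus> c \<odot> b2 = \<zero>"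
  let ?f = "restrict (\<lambda>x. if x = b1 then a else c) B" and ?g = "restrict (\<lambda>x. 0) B"
  have z': "(\<Oplus>b\<in>B. ?f b \<odot> b) = \<zero>" "(\<Oplus>b\<in>B. ?g b \<odot> b) = \<zero>"
   unfolding lc using b z bU by (auto simp: vsp_simps[OF fdD(1)[OF M]])
  have "?f \<in> B \<rightarrow>\<^sub>E UNIV" "?g \<in> B \<rightarrow>\<^sub>E UNIV" by auto
  hence "?f = ?g" using crit[OF uc(4)] z' by blast
  from fun_cong[OF this, of b1] fun_cong[OF this, of b2] show "a = 0 \<and> c = 0" using b by simp
 qed
qed

text \<open>The hypotheses make l, l + 1 and l + 2 roots of one monic quadratic polynomial, but the
  second difference of such a polynomial is 2, not 0.\<close>

lemma three_roots:
 fixes l :: "'k::field_char_0"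
 assumes "(a - l) * (d - l) = q" "(a - (l + 1)) * (d - (l + 1)) = q" "(a - (l + 2)) * (d - (l + 2)) = q"
 shows False
proof -
 have "(a - l) * (d - l) - (a - (l + 1)) * (d - (l + 1)) = a + d - (2 * l + 1)"
  "(a - (l + 1)) * (d - (l + 1)) - (a - (l + 2)) * (d - (l + 2)) = a + d - (2 * l + 3)" by (simp_all add: algebra_simps)
 hence "a + d - (2 * l + 1) = 0" "a + d - (2 * l + 3) = 0" unfolding assms by simp_all
 hence "(a + d - (2 * l + 1)) - (a + d - (2 * l + 3)) = 0" by simp
 thus False by simp
qed

locale short_ops =
 fixes M :: "('k::{alg_closed_field, field_char_0}, 'v, 'x) module_scheme" (structure) and e h f :: "'v => 'v"
 assumes M: "fd_vectorspace M" and lin: "lmap M M e" "lmap M M h" "lmap M M f"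
  and rel: "\<And>x. x \<in> carrier M ==> h x = e (f x) \<oplus> (- 1) \<odot> f (e x)"
   "\<And>x. x \<in> carrier M ==> h (e x) = e (h x) \<oplus> (- 1) \<odot> e x"
   "\<And>x. x \<in> carrier M ==> h (f x) = f (h x) \<oplus> f x"
begin

lemmas le = lmapD[OF lin(1)] and lh = lmapD[OF lin(2)] and lf = lmapD[OF lin(3)]
lemmas v = vsp_simps[OF fdD(1)[OF M]]

sublocale V: vectorspace class_ring M using fdD(1)[OF M] .

text \<open>The weight argument for sl_2 in dimension two: some eigenvector y of h is killed by f,
  the span of y and e y is invariant and hence the whole plane, and the trace condition on h = [e,f]
  fixes the eigenvalue 1/2. The relations can then be checked on y and e y.\<close>

lemma plane_relations:
 assumes U: "VectorSpace.subspace class_ring U M" and inv: "\<And>x. x \<in> U ==> e x \<in> U \<and> h x \<in> U \<and> f x \<in> U"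
  and simple: "\<And>U'. [|VectorSpace.subspace class_ring U' M; \<And>x. x \<in> U' ==> e x \<in> U' \<and> h x \<in> U' \<and> f x \<in> U'; U' \<subseteq> U|] ==>
    U' = {\<zero>} \<or> U' = U"
  and dim: "vectorspace.dim class_ring (M\<lparr>carrier := U\<rparr>) = 2" and x: "x \<in> U"
 shows "e (e x) = \<zero>" "f (f x) = \<zero>" "e (f x) \<oplus> f (e x) = (- 1 / 2) \<odot> x"
proof -
 note uc = subspD[OF U]
 obtain b1 b2 where b: "b1 \<in> U" "b2 \<in> U" "\<And>y. y \<in> U ==> \<exists>a c. y = a \<odot> b1 \<oplus> c \<odot> b2"
  "\<And>a c. a \<odot> b1 \<oplus> c \<odot> b2 = \<zero> ==> a = 0 \<and> c = 0"
  using basis2_if_dim_2[OF M U dim] by metis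
 have bM: "b1 \<in> carrier M" "b2 \<in> carrier M" using b uc by auto
 have uniq: "a = a' \<and> c = c'" if "a \<odot> b1 \<oplus> c \<odot> b2 = a' \<odot> b1 \<oplus> c' \<odot> b2" for a a' c c'
 proof -
  have "(a - a') \<odot> b1 \<oplus> (c - c') \<odot> b2 = (a \<odot> b1 \<oplus> c \<odot> b2) \<oplus> (- 1) \<odot> (a' \<odot> b1 \<oplus> c' \<odot> b2)"
   using bM v(13)[OF bM(1), of a "- a'", symmetric] v(13)[OF bM(2), of c "- c'", symmetric] by (simp add: v(2,3,9,14) V.a_ac)
  also have "\<dots> = \<zero>" unfolding that using bM by (intro v(8)) (simp add: v(2,3))
  finally show ?thesis using b(4) by fastforce
 qed
 obtain a c where hb1: "h b1 = a \<odot> b1 \<oplus> c \<odot> b2" using b(3) inv b(1) by blast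
 obtain q d where hb2: "h b2 = q \<odot> b1 \<oplus> d \<odot> b2" using b(3) inv b(2) by blast
 have hc: "h (s \<odot> b1 \<oplus> t \<odot> b2) = (s * a + t * q) \<odot> b1 \<oplus> (s * c + t * d) \<odot> b2" for s t
  using bM v(13)[OF bM(1), of "s * a" "t * q", symmetric] v(13)[OF bM(2), of "s * c" "t * d", symmetric]
  by (simp add: lh(4,5) v(2,3,9,14) hb1 hb2 V.a_ac)
 \<comment> \<open>Every eigenvalue of h on the plane is a root of its characteristic polynomial;
   the matrix entries of h are a, q, c, d.\<close>
 have root: "(a - l) * (d - l) = q * c" if y: "y \<in> U" "y \<noteq> \<zero>" "h y = l \<odot> y" for y l
 proof -
  obtain s t where st: "y = s \<odot> b1 \<oplus> t \<odot> b2" using b(3) y by blast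
  have "l \<odot> y = (l * s) \<odot> b1 \<oplus> (l * t) \<odot> b2" unfolding st using bM by (simp add: v(3,9,14))
  hence eq: "s * a + t * q = l * s" "s * c + t * d = l * t" using y(3) uniq unfolding st hc by metis+
  have "s \<noteq> 0 \<or> t \<noteq> 0" using y(2) bM unfolding st by (auto simp: v)
  moreover have "s * ((a - l) * (d - l)) = s * (q * c)" "t * ((a - l) * (d - l)) = t * (q * c)"
  proof -
   have 1: "s * (a - l) = - (t * q)" "t * (d - l) = - (s * c)"
    using eq by (simp_all add: algebra_simps eq_neg_iff_add_eq_0)
   have "s * ((a - l) * (d - l)) = (s * (a - l)) * (d - l)" by simp
   also have "\<dots> = - (q * (t * (d - l)))" unfolding 1(1) by simp
   also have "\<dots> = s * (q * c)" unfolding 1(2) by simp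
   finally show "s * ((a - l) * (d - l)) = s * (q * c)" .
   have "t * ((a - l) * (d - l)) = (t * (d - l)) * (a - l)" by simp
   also have "\<dots> = - (c * (s * (a - l)))" unfolding 1(2) by simp
   also have "\<dots> = t * (q * c)" unfolding 1(1) by simp
   finally show "t * ((a - l) * (d - l)) = t * (q * c)" .
  qed
  ultimately show ?thesis by auto
 qed
 \<comment> \<open>If the entry q is 0, then b2 is an eigenvector. Otherwise the characteristic
   polynomial has a root l, since its discriminant has a square root, and the coordinates (q, l - a)
   solve the eigenvector equations.\<close>
 have ev: "\<exists>l y. y \<in> U \<and> y \<noteq> \<zero> \<and> h y = l \<odot> y"
 proof (cases "q = 0")
  case True
  have "b2 \<noteq> \<zero>" using b(4)[of 0 1] bM by (auto simp: v)
  thus ?thesis using hb2 b(2) bM True by (auto simp: v intro!: exI[of _ d] exI[of _ b2])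
 next
  case False
  obtain z where z: "z ^ 2 = (a - d) ^ 2 + 4 * (q * c)" using nth_root_exists[of 2 "(a - d) ^ 2 + 4 * (q * c)"] by auto
  define l where "l = (a + d + z) / 2"
  have l: "(l - a) * (l - d) = q * c"
  proof -
   have "(l - a) * (l - d) = (z ^ 2 - (a - d) ^ 2) / 4"
    unfolding l_def by (simp add: power2_eq_square field_simps)
   thus ?thesis unfolding z by simp
  qed
  let ?y = "q \<odot> b1 \<oplus> (l - a) \<odot> b2"
  have "?y \<noteq> \<zero>" using b(4)[of q "l - a"] False by auto
  moreover have "q * a + (l - a) * q = l * q" "q * c + (l - a) * d = l * (l - a)" using l by (simp_all add: algebra_simps)
  hence "h ?y = l \<odot> ?y" unfolding hc using bM by (simp add: v(3,9,14))
  moreover have "?y \<in> U" using b(1,2) uc(2,3) by simp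
  ultimately show ?thesis by blast
 qed
 have up: "h (f y) = (l + 1) \<odot> f y" "h (e y) = (l + (- 1)) \<odot> e y" if "y \<in> carrier M" "h y = l \<odot> y" for y l
  using rel(2,3)[OF that(1)] that lf(3,5) le(3,5) v(13)[of "f y" l 1] v(13)[of "e y" l "- 1"] by (simp_all add: v(10))
 \<comment> \<open>Each application of f raises the eigenvalue by 1. Three nonzero vectors in this
   chain would contradict \<open>three_roots\<close>, so y or f y is a nonzero eigenvector killed by
   f.\<close>
 have "\<exists>l y. y \<in> U \<and> y \<noteq> \<zero> \<and> h y = l \<odot> y \<and> f y = \<zero>"
 proof -
  obtain l y where y: "y \<in> U" "y \<noteq> \<zero>" "h y = l \<odot> y" using ev by blast
  show ?thesis
  proof (cases "f y = \<zero>")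
   case False
   have fy: "f y \<in> U" "h (f y) = (l + 1) \<odot> f y" using inv y uc up by auto
   have ffy: "f (f y) \<in> U" "h (f (f y)) = (l + 2) \<odot> f (f y)" using inv fy uc up(1)[of "f y" "l + 1"] by (auto simp: add.assoc)
   have "f (f y) = \<zero>"
    using three_roots[OF root[OF y] root[OF fy(1) False fy(2)]] root[OF ffy(1) _ ffy(2)] by blast
   thus ?thesis using fy False by blast
  qed (use y in blast)
 qed
 then obtain l y where y: "y \<in> U" "y \<noteq> \<zero>" "h y = l \<odot> y" "f y = \<zero>" by blast
 let ?z = "e y"
 have c: "y \<in> carrier M" "?z \<in> carrier M" "?z \<in> U" using y uc inv by auto
 have hz: "h ?z = (l + (- 1)) \<odot> ?z" using up c y by blast
 have fz: "f ?z = (- l) \<odot> y"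
 proof -
  have "l \<odot> y = (- 1) \<odot> f ?z" using rel(1)[OF c(1)] y le(6) lf(3)[OF c(2)] by (simp add: v(3,7))
  hence "(- 1) \<odot> (l \<odot> y) = f ?z" using lf(3)[OF c(2)] by (simp add: v(9,10))
  thus ?thesis using c by (simp add: v(9))
 qed
 \<comment> \<open>Otherwise l, l - 1 and l - 2 would all be eigenvalues of h on the plane.\<close>
 have ez: "e ?z = \<zero>"
 proof (rule ccontr)
  assume n: "e ?z \<noteq> \<zero>"
  hence nz: "?z \<noteq> \<zero>" using le(6) by auto
  have "h (e ?z) = (l + (- 2)) \<odot> e ?z" using up(2)[OF c(2) hz] by (simp add: add.assoc)
  hence "(a - (l - 2)) * (d - (l - 2)) = q * c" using root[of "e ?z" "l - 2"] n inv c by simp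
  moreover have "(a - (l - 1)) * (d - (l - 1)) = q * c" using root[of ?z "l - 1"] nz c hz by simp
  ultimately show False using three_roots[of a "l - 2" d "q * c"] root[OF y(1-3)] by simp
 qed
 let ?S = "{s \<odot> y \<oplus> t \<odot> ?z | s t. True}"
 have ops: "e (s \<odot> y \<oplus> t \<odot> ?z) = s \<odot> ?z" "f (s \<odot> y \<oplus> t \<odot> ?z) = (- t * l) \<odot> y"
  "h (s \<odot> y \<oplus> t \<odot> ?z) = (s * l) \<odot> y \<oplus> (t * (l + - 1)) \<odot> ?z" for s t
  using c by (simp_all add: le(4,5) lf(4,5) lh(4,5) v(3,6,7,9,12) ez fz hz y(3,4))
 have Ssub: "?S \<subseteq> U" using y c uc by auto
 have "VectorSpace.subspace class_ring ?S M"
 proof (rule subspaceI_vsp[OF fdD(1)[OF M]])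
  show "?S \<subseteq> carrier M" using Ssub uc by auto
  show "\<zero> \<in> ?S" using c by (auto simp: v intro!: exI[of _ 0])
  show "k \<odot> x \<in> ?S" if x: "x \<in> ?S" for k x
  proof -
   obtain s t where "x = s \<odot> y \<oplus> t \<odot> ?z" using x by blast
   hence "k \<odot> x = (k * s) \<odot> y \<oplus> (k * t) \<odot> ?z" using c by (simp add: v(3,9,14))
   thus ?thesis by blast
  qed
  fix x x' assume "x \<in> ?S" "x' \<in> ?S"
  then obtain s t s' t' where "x = s \<odot> y \<oplus> t \<odot> ?z" "x' = s' \<odot> y \<oplus> t' \<odot> ?z" by blast
  hence "x \<oplus> x' = (s + s') \<odot> y \<oplus> (t + t') \<odot> ?z"
   using c v(13)[OF c(1), of s s', symmetric] v(13)[OF c(2), of t t', symmetric] by (simp add: v(3) V.a_ac)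
  thus "x \<oplus> x' \<in> ?S" by blast
 qed
 moreover have "e x \<in> ?S \<and> h x \<in> ?S \<and> f x \<in> ?S" if xS: "x \<in> ?S" for x
 proof -
  obtain s t where x: "x = s \<odot> y \<oplus> t \<odot> ?z" using xS by blast
  have "s \<odot> ?z = 0 \<odot> y \<oplus> s \<odot> ?z" "(- t * l) \<odot> y = (- t * l) \<odot> y \<oplus> 0 \<odot> ?z"
   using c by (simp_all add: v(3,6,7,11))
  thus ?thesis unfolding x ops by blast
 qed
 moreover have "y = 1 \<odot> y \<oplus> 0 \<odot> ?z" using c by (simp add: v(6,10,11))
 hence "y \<in> ?S" by blast
 ultimately have SU: "?S = U" using simple[OF _ _ Ssub] y(2) by blast
 have "?z \<noteq> \<zero>"
 proof
  assume z: "?z = \<zero>"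
  have *: "\<exists>s. u = s \<odot> y" if u: "u \<in> U" for u
  proof -
   obtain s t where "u = s \<odot> y \<oplus> t \<odot> ?z" using u SU by blast
   hence "u = s \<odot> y" using z c by (simp add: v(3,6,12))
   thus ?thesis by blast
  qed
  obtain s t where st: "b1 = s \<odot> y" "b2 = t \<odot> y" using * b(1,2) by metis
  have "t \<odot> b1 \<oplus> (- s) \<odot> b2 = \<zero>" using c v(13)[OF c(1), of "t * s" "- (s * t)"] by (simp add: st v(9,11) mult.commute)
  hence "t = 0" using b(4) by blast
  hence "b2 = \<zero>" using st c by (simp add: v(11))
  thus False using b(4)[of 0 1] bM by (simp add: v(3,6,10,11))
 qed
 \<comment> \<open>The eigenvalue of e y is l - 1 because e lowers it, and also -l because h (e y) =
   e (f (e y)) = -l (e y); hence l = 1/2.\<close>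
 have l2: "- l = l + - 1"
 proof (rule ccontr)
  assume n: "- l \<noteq> l + - 1"
  have "h ?z = e (f ?z)" using rel(1)[OF c(2)] ez lf(6) le(3) lf(3) c by (simp add: v(6,12))
  hence "(l + - 1) \<odot> ?z = (- l) \<odot> ?z" unfolding hz fz le(5)[OF c(1)] .
  hence "(l + - 1 + l) \<odot> ?z = (- l + l) \<odot> ?z"
   using v(13)[OF c(2), of "l + - 1" l] v(13)[OF c(2), of "- l" l] by metis
  hence "inverse (l + - 1 + l) \<odot> ((l + - 1 + l) \<odot> ?z) = \<zero>" using c by (simp add: v(11,12))
  moreover have "l + - 1 + l \<noteq> 0" using n by (metis add.commute minus_unique)
  ultimately show False using \<open>?z \<noteq> \<zero>\<close> v(9)[OF c(2)] v(10)[OF c(2)] left_inverse by metis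
 qed
 have "2 * l = 1" using l2 by (metis add.commute add_diff_cancel_right' diff_add_cancel minus_unique mult_2 neg_eq_iff_add_eq_0 uminus_add_conv_diff)
 hence l: "l = 1 / 2" by (simp add: field_simps)
 obtain s t where st: "x = s \<odot> y \<oplus> t \<odot> ?z" using x SU by blast
 show "e (e x) = \<zero>" "f (f x) = \<zero>"
  unfolding st ops using c by (simp_all add: le(5) lf(5) ez y(4) v(12))
 show "e (f x) \<oplus> f (e x) = (- 1 / 2) \<odot> x"
  unfolding st ops using c by (simp add: le(5) lf(5) fz l v(3,9,14) V.a_comm mult.commute)
qed

text \<open>The vectors satisfying the three relations form a subspace, and it contains each of the
  planes, hence also their sums.\<close>

lemma planes_rel:
 fixes n :: nat
 assumes U: "\<And>i. i < n ==> VectorSpace.subspace class_ring (U i) M" "\<And>i x. [|i < n; x \<in> U i|] ==> e x \<in> U i \<and> h x \<in> U i \<and> f x \<in> U i"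
  and simple: "\<And>i U'. [|i < n; VectorSpace.subspace class_ring U' M; \<And>x. x \<in> U' ==> e x \<in> U' \<and> h x \<in> U' \<and> f x \<in> U'; U' \<subseteq> U i|] ==>
    U' = {\<zero>} \<or> U' = U i"
  and dim: "\<And>i. i < n ==> vectorspace.dim class_ring (M\<lparr>carrier := U i\<rparr>) = 2"
  and dec: "\<And>x. x \<in> carrier M ==> \<exists>u \<in> Pi\<^sub>E {..<n} U. x = (\<Oplus>i\<in>{..<n}. u i)"
  and x: "x \<in> carrier M"
 shows "e (e x) = \<zero>" "f (f x) = \<zero>" "e (f x) \<oplus> f (e x) = (- 1 / 2) \<odot> x"
proof -
 let ?K = "{x \<in> carrier M. e (e x) = \<zero> \<and> f (f x) = \<zero> \<and> e (f x) \<oplus> f (e x) = (- 1 / 2) \<odot> x}"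
 obtain u where u: "u \<in> Pi\<^sub>E {..<n} U" "x = (\<Oplus>i\<in>{..<n}. u i)" using dec[OF x] by blast
 have "(\<Oplus>i\<in>{..<n}. u i) \<in> ?K"
 proof (rule finsum_in_subspace[OF fdD(1)[OF M]])
  fix i assume "i \<in> {..<n}"
  hence i: "i < n" "u i \<in> U i" using u by auto
  show "u i \<in> ?K"
   using plane_relations[OF U(1)[OF i(1)] U(2)[OF i(1)] simple[OF i(1)] dim[OF i(1)] i(2)] subspD(1)[OF U(1)[OF i(1)] i(2)]
   by blast
 next
  fix x y assume xy: "x \<in> ?K" "y \<in> ?K"
  have c: "x \<in> carrier M" "y \<in> carrier M" using xy by auto
  have "e (f (x \<oplus> y)) \<oplus> f (e (x \<oplus> y)) = (e (f x) \<oplus> f (e x)) \<oplus> (e (f y) \<oplus> f (e y))"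
   using c by (simp add: le(3,4) lf(3,4) V.a_ac)
  thus "x \<oplus> y \<in> ?K" using xy c by (simp add: le(3,4) lf(3,4) v(2,6,14) v(6)[OF v(1)])
 qed (auto simp: le(6) lf(6) v(1,12) v(6)[OF v(1)])
 thus "e (e x) = \<zero>" "f (f x) = \<zero>" "e (f x) \<oplus> f (e x) = (- 1 / 2) \<odot> x" using u(2) by auto
qed

end

text \<open>Up to scaling, the relations of one fermionic creation and annihilation pair, that is,
  of the Clifford algebra of a hyperbolic plane. Its modules are sums of copies of a two-dimensional
  one, each generated by a vector killed by f.\<close>

locale plane_ops =
 fixes M :: "('k::field_char_0, 'v, 'x) module_scheme" (structure) and e f :: "'v => 'v"
 assumes M: "fd_vectorspace M" and lin: "lmap M M e" "lmap M M f"
  and sq: "\<And>x. x \<in> carrier M ==> e (e x) = \<zero>" "\<And>x. x \<in> carrier M ==> f (f x) = \<zero>"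
  and ef: "\<And>x. x \<in> carrier M ==> e (f x) \<oplus> f (e x) = (- 1 / 2) \<odot> x"
begin

lemmas le = lmapD[OF lin(1)] and lf = lmapD[OF lin(2)]
lemmas v = vsp_simps[OF fdD(1)[OF M]]

sublocale V: vectorspace class_ring M using fdD(1)[OF M] .

definition pl :: "'v => 'v set" where
 "pl b = {s \<odot> b \<oplus> t \<odot> e b | s t. True}"

lemma f_e: "[|b \<in> carrier M; f b = \<zero>|] ==> f (e b) = (- 1 / 2) \<odot> b"
 using ef[of b] le(6) le(3)[of b] lf(3)[of "e b"] by (simp add: v(7))

lemma pl_ops:
 assumes b: "b \<in> carrier M" "f b = \<zero>"
 shows "e (s \<odot> b \<oplus> t \<odot> e b) = s \<odot> e b" "f (s \<odot> b \<oplus> t \<odot> e b) = (- t / 2) \<odot> b"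
 using b le(3)[OF b(1)] by (simp_all add: le(4,5) lf(4,5) v(3,6,7,9,12) sq f_e)

lemma pl_mem: "b \<in> carrier M ==> b \<in> pl b" "b \<in> carrier M ==> s \<odot> e b \<in> pl b" "b \<in> carrier M ==> s \<odot> b \<in> pl b"
proof -
 assume b: "b \<in> carrier M"
 have "b = 1 \<odot> b \<oplus> 0 \<odot> e b" "s \<odot> e b = 0 \<odot> b \<oplus> s \<odot> e b" "s \<odot> b = s \<odot> b \<oplus> 0 \<odot> e b"
  using b le(3)[OF b] by (simp_all add: v(3,6,7,10,11))
 thus "b \<in> pl b" "s \<odot> e b \<in> pl b" "s \<odot> b \<in> pl b" unfolding pl_def by blast+
qed

lemma pl_closed:
 assumes b: "b \<in> carrier M"
 shows "pl b \<subseteq> carrier M" "x \<in> pl b ==> y \<in> pl b ==> x \<oplus> y \<in> pl b" "x \<in> pl b ==> c \<odot> x \<in> pl b"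
proof -
 note c = b le(3)[OF b]
 show "pl b \<subseteq> carrier M" using c by (auto simp: pl_def v(2,3))
 show "c \<odot> x \<in> pl b" if x: "x \<in> pl b"
 proof -
  obtain s t where "x = s \<odot> b \<oplus> t \<odot> e b" using x unfolding pl_def by blast
  hence "c \<odot> x = (c * s) \<odot> b \<oplus> (c * t) \<odot> e b" using c by (simp add: v(3,9,14))
  thus ?thesis unfolding pl_def by blast
 qed
 assume "x \<in> pl b" "y \<in> pl b"
 then obtain s t s' t' where "x = s \<odot> b \<oplus> t \<odot> e b" "y = s' \<odot> b \<oplus> t' \<odot> e b" unfolding pl_def by blast
 hence "x \<oplus> y = (s + s') \<odot> b \<oplus> (t + t') \<odot> e b"
  using c v(13)[OF c(1), of s s', symmetric] v(13)[OF c(2), of t t', symmetric] by (simp add: v(3) V.a_ac)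
 thus "x \<oplus> y \<in> pl b" unfolding pl_def by blast
qed

lemma pl_subspace: "b \<in> carrier M ==> VectorSpace.subspace class_ring (pl b) M"
 using pl_closed[of b] pl_mem(3)[of b 0] by (intro subspaceI_vsp[OF fdD(1)[OF M]]) (simp_all add: v(11))

lemma pl_invariant: "[|b \<in> carrier M; f b = \<zero>; x \<in> pl b|] ==> e x \<in> pl b \<and> f x \<in> pl b"
 using pl_mem[of b] pl_ops[of b] unfolding pl_def[of b] by fastforce

lemma smult_cancel_zero: "[|x \<in> carrier M; c \<odot> x = \<zero>; x \<noteq> \<zero>|] ==> c = 0"
 using v(9)[of x "inverse c" c] v(10,12) by (cases "c = 0") auto

lemma pl_independent:
 assumes b: "b \<in> carrier M" "f b = \<zero>" "b \<noteq> \<zero>" and z: "s \<odot> b \<oplus> t \<odot> e b = \<zero>"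
 shows "s = 0 \<and> t = 0"
proof -
 have "(- t / 2) \<odot> b = \<zero>" using pl_ops(2)[OF b(1,2), of s t] z lf(6) by simp
 hence "t = 0" using smult_cancel_zero[OF b(1)] b(3) by fastforce
 moreover from this have "s \<odot> b = \<zero>" using z b le(3)[OF b(1)] by (simp add: v(3,6,11))
 ultimately show ?thesis using smult_cancel_zero[OF b(1)] b(3) by blast
qed

lemma pl_unique:
 assumes b: "b \<in> carrier M" "f b = \<zero>" "b \<noteq> \<zero>"
  and eq: "s \<odot> b \<oplus> t \<odot> e b = s' \<odot> b \<oplus> t' \<odot> e b"
 shows "s = s' \<and> t = t'"
proof -
 note c = b(1) le(3)[OF b(1)]
 have "(s - s') \<odot> b \<oplus> (t - t') \<odot> e b = (s \<odot> b \<oplus> t \<odot> e b) \<oplus> (- 1) \<odot> (s' \<odot> b \<oplus> t' \<odot> e b)"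
  using c v(13)[OF c(1), of s "- s'", symmetric] v(13)[OF c(2), of t "- t'", symmetric] by (simp add: v(2,3,9,14) V.a_ac)
 also have "\<dots> = \<zero>" unfolding eq using c by (intro v(8)) (simp add: v(2,3))
 finally show ?thesis using pl_independent[OF b] by fastforce
qed

lemma pl_dim:
 assumes b: "b \<in> carrier M" "f b = \<zero>" "b \<noteq> \<zero>"
 shows "vectorspace.dim class_ring (M\<lparr>carrier := pl b\<rparr>) = 2"
proof -
 note c = b(1) le(3)[OF b(1)]
 interpret U: vectorspace class_ring "M\<lparr>carrier := pl b\<rparr>" by (rule V.subspace_is_vs[OF pl_subspace[OF b(1)]])
 have ne: "b \<noteq> e b" using f_e[OF b(1,2)] b smult_cancel_zero[OF b(1), of "- 1 / 2"] by auto
 have mem: "b \<in> pl b" "e b \<in> pl b" using pl_mem[OF b(1)] pl_mem(2)[OF b(1), of 1] c by (auto simp: v(10))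
 have lc: "U.lincomb a {b, e b} = a b \<odot> b \<oplus> a (e b) \<odot> e b" for a
  unfolding U.lincomb_def using ne mem c pl_closed(3)[OF b(1)] by (simp add: U.finsum_insert v(3,6))
 have "U.basis {b, e b}"
 proof -
  have "\<exists>!a. a \<in> {b, e b} \<rightarrow>\<^sub>E UNIV \<and> U.lincomb a {b, e b} = y" if y: "y \<in> pl b" for y
  proof -
   obtain s t where st: "y = s \<odot> b \<oplus> t \<odot> e b" using y unfolding pl_def by blast
   show ?thesis
   proof (rule ex1I[of _ "restrict (\<lambda>x. if x = b then s else t) {b, e b}"])
    fix a assume a: "a \<in> {b, e b} \<rightarrow>\<^sub>E UNIV \<and> U.lincomb a {b, e b} = y"
    hence "a b = s \<and> a (e b) = t" using pl_unique[OF b] unfolding lc st by blast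
    thus "a = restrict (\<lambda>x. if x = b then s else t) {b, e b}"
     using a ne by (intro PiE_ext[of a "{b, e b}"]) auto
   qed (use ne in \<open>auto simp: lc st\<close>)
  qed
  thus ?thesis using U.basis_criterion[of "{b, e b}"] mem by auto
 qed
 thus ?thesis using U.dim_basis[of "{b, e b}"] ne by simp
qed

text \<open>If b is missing, then no nonzero multiple of b lies in the subspace. Applying f to an
  element s b + t (e b) gives a multiple of b, so t = 0, and then s = 0.\<close>

lemma pl_minimal:
 assumes b: "b \<in> carrier M" "f b = \<zero>" and U': "VectorSpace.subspace class_ring U' M" "U' \<subseteq> pl b"
  and inv: "\<And>x. x \<in> U' ==> e x \<in> U' \<and> f x \<in> U'"
 shows "U' = {\<zero>} \<or> U' = pl b"
proof (cases "b \<in> U'")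
 case True
 hence "pl b \<subseteq> U'" using subspD[OF U'(1)] inv[of b] by (auto simp: pl_def)
 thus ?thesis using U' by blast
next
 case False
 have scale: "c = 0" if "c \<odot> b \<in> U'" for c
 proof (rule ccontr)
  assume "c \<noteq> 0"
  hence "b = inverse c \<odot> (c \<odot> b)" using b by (simp add: v(9,10))
  thus False using subspD(3)[OF U'(1) that, of "inverse c"] False by simp
 qed
 have "x = \<zero>" if x: "x \<in> U'" for x
 proof -
  obtain s t where st: "x = s \<odot> b \<oplus> t \<odot> e b" using x U'(2) unfolding pl_def by blast
  have "(- t / 2) \<odot> b \<in> U'" using inv[OF x] unfolding st pl_ops[OF b] by blast
  hence t: "t = 0" using scale by fastforce
  have "s \<odot> b \<in> U'" using x b le(3)[OF b(1)] unfolding st t by (simp add: v(3,6,11))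
  hence "s = 0" using scale by blast
  thus ?thesis using t b le(3)[OF b(1)] st by (simp add: v(1,11) v(6)[OF v(1)])
 qed
 thus ?thesis using subspD(4)[OF U'(1)] by blast
qed

end

text \<open>A basis of the kernel of f generates the planes. They are independent and fill M because
  M is the direct sum of the kernel of f and its image under e.\<close>

lemma sum_of_simple_planesI:
 fixes M :: "('k::field_char_0, 'a, 'v) rep" (structure)
 assumes ops: "plane_ops M (act M e) (act M f)"
  and h: "\<And>x. x \<in> carrier M ==> act M h x = act M e (act M f x) \<oplus> (- 1) \<odot> act M f (act M e x)"
 shows "sum_of_simple_planes {e, h, f} M"
proof -
 interpret plane_ops M "act M e" "act M f" by fact
 let ?e = "act M e" and ?f = "act M f"
 let ?K = "{x \<in> carrier M. ?f x = \<zero>}"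
 have K: "VectorSpace.subspace class_ring ?K M"
  by (rule subspaceI_vsp[OF fdD(1)[OF M]]) (auto simp: lf(4,5,6) v(1,2,3,12) v(6)[OF v(1)])
 obtain B where B: "finite B" "vectorspace.basis class_ring (M\<lparr>carrier := ?K\<rparr>) B" "B \<subseteq> ?K" and crit: "\<And>y. y \<in> ?K ==> \<exists>!a. a \<in> B \<rightarrow>\<^sub>E UNIV \<and> (\<Oplus>b\<in>B. a b \<odot> b) = y"
  by (rule subspace_basis[OF M K]) (rule that)
 obtain g where g: "bij_betw g {..<card B} B" using ex_bij_betw_nat_finite[OF B(1)] by (auto simp: atLeast0LessThan)
 define n where "n = card B"
 have gB: "g i \<in> carrier M" "?f (g i) = \<zero>" "?e (g i) \<in> carrier M" if "i < n" for i
  using bij_betwE[OF g] that B(3) le(3) unfolding n_def by auto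
 have reindex: "(\<Oplus>b\<in>B. a b \<odot> b) = (\<Oplus>i\<in>{..<n}. a (g i) \<odot> g i)" for a
  using V.finsum_reindex[of "\<lambda>b. a b \<odot> b" g "{..<n}"] g B(3) unfolding bij_betw_def n_def by (simp add: v(3) Pi_def subset_iff)
 have comb_ex: "\<exists>s. y = (\<Oplus>i\<in>{..<n}. s i \<odot> g i)" if y: "y \<in> ?K" for y
 proof -
  obtain a where "(\<Oplus>b\<in>B. a b \<odot> b) = y" using ex1_implies_ex[OF crit[OF y]] by blast
  thus ?thesis unfolding reindex by (intro exI[of _ "\<lambda>i. a (g i)"]) simp
 qed
 have comb_eq: "s i = t i" if eq: "(\<Oplus>i\<in>{..<n}. s i \<odot> g i) = (\<Oplus>i\<in>{..<n}. t i \<odot> g i)" and i: "i < n" for s t :: "nat => 'k" and i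
 proof -
  let ?g' = "inv_into {..<n} g"
  have inv: "?g' (g j) = j" if "j < n" for j using g that unfolding bij_betw_def n_def by (simp add: inv_into_f_f)
  have sum: "(\<Oplus>b\<in>B. restrict (\<lambda>b. r (?g' b)) B b \<odot> b) = (\<Oplus>i\<in>{..<n}. r i \<odot> g i)" for r :: "nat => 'k"
   unfolding reindex using inv gB bij_betwE[OF g] by (intro V.finsum_cong') (auto simp: v(3) n_def)
  have "(\<Oplus>i\<in>{..<n}. t i \<odot> g i) \<in> ?K"
   by (rule finsum_in_subspace[OF fdD(1)[OF M]]) (use gB in \<open>auto simp: lf(4,5,6) v(1,2,3,12) v(6)[OF v(1)]\<close>)
  then obtain a where a: "\<And>r. [|r \<in> B \<rightarrow>\<^sub>E UNIV; (\<Oplus>b\<in>B. r b \<odot> b) = (\<Oplus>i\<in>{..<n}. t i \<odot> g i)|] ==> r = a"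
   using crit[of "\<Oplus>i\<in>{..<n}. t i \<odot> g i"] unfolding Ex1_def by blast
  have "restrict (\<lambda>b. s (?g' b)) B = a" using sum[of s] eq by (intro a) auto
  moreover have "restrict (\<lambda>b. t (?g' b)) B = a" using sum[of t] by (intro a) auto
  ultimately have "restrict (\<lambda>b. s (?g' b)) B = restrict (\<lambda>b. t (?g' b)) B" by simp
  from fun_cong[OF this, of "g i"] show ?thesis using bij_betwE[OF g] i inv[OF i] by (auto simp: n_def)
 qed
 have nz: "g i \<noteq> \<zero>" if i: "i < n" for i
 proof
  assume z: "g i = \<zero>"
  have "(\<Oplus>j\<in>{..<n}. (if j = i then 1 else 0) \<odot> g j) = (\<Oplus>j\<in>{..<n}. 0 \<odot> g j)"
   using z gB by (intro V.finsum_cong') (auto simp: v(1,3,11,12))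
  from comb_eq[OF this i] show False by simp
 qed
 have simple: "simple_subspace {e, h, f} M (pl (g i))" if i: "i < n" for i
 proof -
  note gi = gB[OF i] and p = pl_subspace[OF gB(1)[OF i]]
  note pc = subspD[OF p]
  have hin: "act M h x \<in> pl (g i)" if "x \<in> pl (g i)" for x
   using pl_invariant[OF gi(1,2)] pc that by (simp add: h)
  have "pl (g i) \<noteq> {\<zero>}" using pl_mem(1)[OF gi(1)] nz[OF i] by auto
  thus ?thesis unfolding simple_subspace_def invariant_subspace_def
   using p hin pl_invariant[OF gi(1,2)] pl_minimal[OF gi(1,2)] by auto
 qed
 have sum_u: "?f (\<Oplus>i\<in>{..<n}. u i) = (\<Oplus>i\<in>{..<n}. ?f (u i))" "?e (\<Oplus>i\<in>{..<n}. u i) = (\<Oplus>i\<in>{..<n}. ?e (u i))"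
  if "\<And>i. i < n ==> u i \<in> carrier M" for u
  using that by (auto intro!: lmap_finsum[OF lin(1)] lmap_finsum[OF lin(2)])
 have dec: "\<exists>!u. u \<in> Pi\<^sub>E {..<n} (\<lambda>i. pl (g i)) \<and> x = (\<Oplus>i\<in>{..<n}. u i)" if x: "x \<in> carrier M" for x
 proof -
  \<comment> \<open>The anticommutator -1/2 splits x as y + e z with y and z in the kernel of f, and
    both are then expanded in the basis of that kernel.\<close>
  let ?y = "(- 2) \<odot> ?f (?e x)" and ?z = "(- 2) \<odot> ?f x"
  have yz: "?y \<in> ?K" "?z \<in> ?K" using x by (auto simp: le(3) lf(3,5) v(3,12) sq)
  obtain s where s: "?y = (\<Oplus>i\<in>{..<n}. s i \<odot> g i)" using comb_ex[OF yz(1)] by blast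
  obtain t where t: "?z = (\<Oplus>i\<in>{..<n}. t i \<odot> g i)" using comb_ex[OF yz(2)] by blast
  note st = s t
  have "x = (- 2) \<odot> (?e (?f x) \<oplus> ?f (?e x))" using x by (simp add: ef v(9,10))
  also have "\<dots> = ?y \<oplus> ?e ?z" using x by (simp add: le(3,5) lf(3) v(3,14) V.a_comm)
  also have "?e ?z = (\<Oplus>i\<in>{..<n}. t i \<odot> ?e (g i))"
   unfolding st using gB by (subst sum_u(2)) (auto simp: v(3) le(5) intro!: V.finsum_cong')
  also have "?y \<oplus> \<dots> = (\<Oplus>i\<in>{..<n}. s i \<odot> g i \<oplus> t i \<odot> ?e (g i))"
   unfolding st using gB by (intro V.finsum_addf[symmetric]) (auto simp: v(3))
  finally have xs: "x = (\<Oplus>i\<in>{..<n}. s i \<odot> g i \<oplus> t i \<odot> ?e (g i))" .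
  \<comment> \<open>Applying f to a decomposition isolates the coefficients of the vectors e (g i),
    and applying f after e isolates those of the vectors g i.\<close>
  have uniq: "u i = s i \<odot> g i \<oplus> t i \<odot> ?e (g i)"
   if u: "u \<in> Pi\<^sub>E {..<n} (\<lambda>i. pl (g i))" "x = (\<Oplus>i\<in>{..<n}. u i)" and i: "i < n" for u i
  proof -
   have "\<forall>i. \<exists>a c. i < n \<longrightarrow> u i = a \<odot> g i \<oplus> c \<odot> ?e (g i)" using u(1) unfolding pl_def PiE_def Pi_def by blast
   then obtain a c where ac: "\<And>i. i < n ==> u i = a i \<odot> g i \<oplus> c i \<odot> ?e (g i)" by metis
   have uM: "u i \<in> carrier M" if "i < n" for i using gB[OF that] ac[OF that] by (simp add: v(2,3))
   have fu: "?f (\<Oplus>i\<in>{..<n}. u i) = (\<Oplus>i\<in>{..<n}. ?f (u i))" "?e (\<Oplus>i\<in>{..<n}. u i) = (\<Oplus>i\<in>{..<n}. ?e (u i))"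
    using sum_u[of u] uM by blast+
   have "?f x = (\<Oplus>i\<in>{..<n}. (- c i / 2) \<odot> g i)"
    unfolding u(2) fu using gB by (intro V.finsum_cong') (auto simp: ac pl_ops(2) v(3))
   moreover have "?f x = (\<Oplus>i\<in>{..<n}. (- t i / 2) \<odot> g i)"
    unfolding xs using gB by (subst sum_u(1)) (auto simp: pl_ops(2) v(2,3) intro!: V.finsum_cong')
   ultimately have "- c i / 2 = - t i / 2" using comb_eq[of "\<lambda>i. - c i / 2" "\<lambda>i. - t i / 2"] i by simp
   moreover have "?f (?e x) = (\<Oplus>i\<in>{..<n}. (- a i / 2) \<odot> g i)"
    unfolding u(2) fu using gB uM
    by (subst sum_u(1)) (auto simp: ac pl_ops(1) le(3) lf(5) f_e v(3,9) intro!: V.finsum_cong')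
   moreover have "?f (?e x) = (\<Oplus>i\<in>{..<n}. (- s i / 2) \<odot> g i)"
    unfolding xs using gB
    by (subst sum_u(2), simp add: v(2,3), subst sum_u(1)) (auto simp: pl_ops(1) le(3) lf(5) f_e v(2,3,9) intro!: V.finsum_cong')
   ultimately have "a i = s i" "c i = t i" using comb_eq[of "\<lambda>i. - a i / 2" "\<lambda>i. - s i / 2"] i by simp_all
   thus ?thesis using ac[OF i] by simp
  qed
  show ?thesis
  proof (rule ex1I[of _ "restrict (\<lambda>i. s i \<odot> g i \<oplus> t i \<odot> ?e (g i)) {..<n}"])
   show "restrict (\<lambda>i. s i \<odot> g i \<oplus> t i \<odot> ?e (g i)) {..<n} \<in> Pi\<^sub>E {..<n} (\<lambda>i. pl (g i)) \<and>
    x = (\<Oplus>i\<in>{..<n}. restrict (\<lambda>i. s i \<odot> g i \<oplus> t i \<odot> ?e (g i)) {..<n} i)"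
   proof
    show "restrict (\<lambda>i. s i \<odot> g i \<oplus> t i \<odot> ?e (g i)) {..<n} \<in> Pi\<^sub>E {..<n} (\<lambda>i. pl (g i))"
     unfolding pl_def by auto
    show "x = (\<Oplus>i\<in>{..<n}. restrict (\<lambda>i. s i \<odot> g i \<oplus> t i \<odot> ?e (g i)) {..<n} i)"
     using gB by (subst xs, intro V.finsum_cong') (auto simp: v(2,3))
   qed
   fix u assume u: "u \<in> Pi\<^sub>E {..<n} (\<lambda>i. pl (g i)) \<and> x = (\<Oplus>i\<in>{..<n}. u i)"
   show "u = restrict (\<lambda>i. s i \<odot> g i \<oplus> t i \<odot> ?e (g i)) {..<n}"
   proof
    fix i show "u i = restrict (\<lambda>i. s i \<odot> g i \<oplus> t i \<odot> ?e (g i)) {..<n} i"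
     using uniq[OF conjunct1[OF u] conjunct2[OF u], of i] u by (cases "i < n") auto
   qed
  qed
 qed
 show ?thesis unfolding sum_of_simple_planes_def
  by (rule exI[of _ n], rule exI[of _ "\<lambda>i. pl (g i)"]) (use simple dec pl_dim gB nz in auto)
qed

subsection \<open>Central extensions\<close>

lemma vsp_eqI:
 fixes V (structure)
 assumes "vsp V" "x \<in> carrier V" "y \<in> carrier V" "x \<oplus> (- 1) \<odot> y = \<zero>"
 shows "x = y"
proof -
 interpret vectorspace class_ring V by fact
 have "x \<oplus> \<ominus> y = \<zero>" using assms vsp_simps(15)[OF assms(1)] by simp
 thus ?thesis using assms(2,3) minus_equality[of x "\<ominus> y"] by simp
qed

locale central_ext =
 fixes G :: "('k::field, 'e) lie" (structure) and \<pi> :: "'e => 'l" and L :: "('k, 'l) lie"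
 assumes ce: "central_extension G \<pi> L"
begin

lemma GL: "lie_algebra G" "lie_algebra L" "lie_hom G L \<pi>" "\<pi> ` carrier G = carrier L"
 and central: "[|x \<in> carrier G; \<pi> x = \<zero>\<^bsub>L\<^esub>; y \<in> carrier G|] ==> bracket G x y = \<zero>"
 using ce by (auto simp: central_extension_def)

lemmas g = lieD[OF GL(1)] and l = lieD[OF GL(2)]
lemmas p = lmapD[OF lie_homD(1)[OF GL(3)]] and pb = lie_homD(2)[OF GL(3)]
lemmas vG = vsp_simps[OF g(1)] and vL = vsp_simps[OF l(1)]

definition lift :: "'l => 'e" where
 "lift a = (SOME x. x \<in> carrier G \<and> \<pi> x = a)"

lemma lift: "a \<in> carrier L ==> lift a \<in> carrier G" "a \<in> carrier L ==> \<pi> (lift a) = a"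
proof -
 assume "a \<in> carrier L"
 hence "a \<in> \<pi> ` carrier G" by (simp add: GL(4))
 hence "\<exists>x. x \<in> carrier G \<and> \<pi> x = a" by (simp add: image_iff) metis
 from someI_ex[OF this] show "lift a \<in> carrier G" "\<pi> (lift a) = a" unfolding lift_def by auto
qed

text \<open>The bracket of G as a pairing on L. Although it is defined with chosen lifts,
  \<open>bracket_eq_Bk\<close> shows that any lifts give the same value, because two lifts differ by
  a central element. It is therefore bilinear and skew.\<close>

definition Bk :: "'l => 'l => 'e" where
 "Bk a b = bracket G (lift a) (lift b)"

lemma bracket_cong_left:
 assumes "x \<in> carrier G" "x' \<in> carrier G" "y \<in> carrier G" "\<pi> x = \<pi> x'"
 shows "bracket G x y = bracket G x' y"
proof (rule vsp_eqI[OF g(1) g(5)[OF assms(1,3)] g(5)[OF assms(2,3)]])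
 let ?d = "x \<oplus> (- 1) \<odot> x'"
 have d: "?d \<in> carrier G" using assms by (simp add: vG(2,3))
 have "\<pi> ?d = \<zero>\<^bsub>L\<^esub>" using assms p(3)[of x'] by (simp add: p(4,5) vG(3) vL(8))
 hence "bracket G ?d y = \<zero>" using central d assms(3) by blast
 thus "bracket G x y \<oplus> (- 1) \<odot> bracket G x' y = \<zero>"
  using assms lmapD(4,5)[OF g(3)[OF assms(3)]] by (simp add: vG(3))
qed

lemma bracket_eq_Bk:
 assumes "x \<in> carrier G" "y \<in> carrier G"
 shows "bracket G x y = Bk (\<pi> x) (\<pi> y)"
proof -
 note c = p(3)[OF assms(1)] p(3)[OF assms(2)]
 have "bracket G x y = bracket G (lift (\<pi> x)) y" by (rule bracket_cong_left) (use assms c lift in auto)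
 also have "\<dots> = (- 1) \<odot> bracket G y (lift (\<pi> x))" by (rule bracket_skew[OF GL(1)]) (use assms c lift in auto)
 also have "bracket G y (lift (\<pi> x)) = bracket G (lift (\<pi> y)) (lift (\<pi> x))" by (rule bracket_cong_left) (use assms c lift in auto)
 also have "(- 1) \<odot> \<dots> = Bk (\<pi> x) (\<pi> y)"
  unfolding Bk_def by (rule bracket_skew[OF GL(1), symmetric]) (use assms c lift in auto)
 finally show ?thesis .
qed

lemma Bk_closed: "[|a \<in> carrier L; b \<in> carrier L|] ==> Bk a b \<in> carrier G"
 and pi_Bk: "[|a \<in> carrier L; b \<in> carrier L|] ==> \<pi> (Bk a b) = bracket L a b"
 unfolding Bk_def using lift pb g(5) by simp_all

lemma Bk_skew: "[|a \<in> carrier L; b \<in> carrier L|] ==> Bk a b = (- 1) \<odot> Bk b a"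
 unfolding Bk_def by (intro bracket_skew GL(1) lift)

lemma Bk_add_left:
 assumes "a \<in> carrier L" "a' \<in> carrier L" "b \<in> carrier L"
 shows "Bk (a \<oplus>\<^bsub>L\<^esub> a') b = Bk a b \<oplus> Bk a' b"
proof -
 have "Bk (a \<oplus>\<^bsub>L\<^esub> a') b = bracket G (lift a \<oplus> lift a') (lift b)"
  using assms lift by (simp add: bracket_eq_Bk p(4) vG(2))
 thus ?thesis unfolding Bk_def using assms lift lmapD(4)[OF g(3)] by simp
qed

lemma Bk_smult_left:
 assumes "a \<in> carrier L" "b \<in> carrier L"
 shows "Bk (c \<odot>\<^bsub>L\<^esub> a) b = c \<odot> Bk a b"
proof -
 have "Bk (c \<odot>\<^bsub>L\<^esub> a) b = bracket G (c \<odot> lift a) (lift b)"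
  using assms lift by (simp add: bracket_eq_Bk p(5) vG(3))
 thus ?thesis unfolding Bk_def using assms lift lmapD(5)[OF g(3)] by simp
qed

end

lemma subalgebra_extension:
 assumes D: "VectorSpace.subspace class_ring D G" "\<And>x y. [|x \<in> D; y \<in> D|] ==> bracket G x y \<in> D"
  and ce: "central_extension G \<pi> L" and im: "\<pi> ` D = carrier L"
 shows "central_extension (G\<lparr>carrier := D\<rparr>) \<pi> L"
proof -
 let ?D = "G\<lparr>carrier := D\<rparr>"
 interpret central_ext G \<pi> L by unfold_locales fact
 interpret GV: vectorspace class_ring G by (rule g(1))
 note d = subspD[OF D(1)]
 have vD: "vsp ?D" by (rule GV.subspace_is_vs[OF D(1)])
 have "lie_algebra ?D"
  unfolding lie_algebra_def bilinear_map_def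
 proof (intro conjI ballI vD lmapI)
  fix x y assume xy: "x \<in> carrier ?D" "y \<in> carrier ?D"
  fix z c assume z: "z \<in> carrier ?D"
  have c: "x \<in> carrier G" "y \<in> carrier G" "z \<in> carrier G" using xy z d(1) by auto
  show "bracket ?D x (y \<oplus>\<^bsub>?D\<^esub> z) = bracket ?D x y \<oplus>\<^bsub>?D\<^esub> bracket ?D x z"
   "bracket ?D (y \<oplus>\<^bsub>?D\<^esub> z) x = bracket ?D y x \<oplus>\<^bsub>?D\<^esub> bracket ?D z x"
   using lmapD(4)[OF g(2)[OF c(1)]] lmapD(4)[OF g(3)[OF c(1)]] c by simp_all
  show "bracket ?D x (bracket ?D y z) \<oplus>\<^bsub>?D\<^esub> bracket ?D y (bracket ?D z x) \<oplus>\<^bsub>?D\<^esub>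
    bracket ?D z (bracket ?D x y) = \<zero>\<^bsub>?D\<^esub>"
   using g(6)[OF c] by simp
 next
  fix x y c assume xy: "x \<in> carrier ?D" "y \<in> carrier ?D"
  have c: "x \<in> carrier G" "y \<in> carrier G" using xy d(1) by auto
  show "bracket ?D x (c \<odot>\<^bsub>?D\<^esub> y) = c \<odot>\<^bsub>?D\<^esub> bracket ?D x y"
   "bracket ?D (c \<odot>\<^bsub>?D\<^esub> y) x = c \<odot>\<^bsub>?D\<^esub> bracket ?D y x"
   using lmapD(5)[OF g(2)[OF c(1)]] lmapD(5)[OF g(3)[OF c(1)]] c by simp_all
  show "bracket ?D x y \<in> carrier ?D" "bracket ?D y x \<in> carrier ?D" using D(2) xy by auto
  show "bracket ?D x x = \<zero>\<^bsub>?D\<^esub>" using g(4) c by simp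
 qed
 moreover have "lie_hom ?D L \<pi>"
  unfolding lie_hom_def using d(1) pb p(3,4,5) by (auto intro!: lmapI vD l(1))
 ultimately show ?thesis
  unfolding central_extension_def using GL(2) im central d(1) by simp
qed

text \<open>The subalgebra D is itself a central extension of L on the type \<open>'e\<close>, so
  universality maps G into D over L. Composed with the inclusion this is an endomorphism of G over
  L, as is the identity; by uniqueness they agree, so G lies in D. This replaces any explicit
  generation statement about G.\<close>

lemma subalgebra_eq_universal_extension:
 fixes G :: "('k::field, 'e) lie"
 assumes G: "universal_central_extension G \<pi> L"
  and D: "VectorSpace.subspace class_ring D G" "\<And>x y. [|x \<in> D; y \<in> D|] ==> bracket G x y \<in> D" and im: "\<pi> ` D = carrier L"
 shows "D = carrier G"
proof -
 have ce: "central_extension G \<pi> L"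
  and un: "\<And>(E' :: ('k, 'e) lie) \<pi>'. central_extension E' \<pi>' L ==>
    \<exists>!\<phi>. \<phi> \<in> extensional (carrier G) \<and> lie_hom G E' \<phi> \<and> (\<forall>x\<in>carrier G. \<pi>' (\<phi> x) = \<pi> x)"
  by (simp add: G[unfolded universal_central_extension_def])
   (rule G[unfolded universal_central_extension_def, THEN conjunct2, rule_format])
 interpret central_ext G \<pi> L by unfold_locales fact
 note d = subspD[OF D(1)]
 obtain \<phi> where \<phi>: "\<phi> \<in> extensional (carrier G)" "lie_hom G (G\<lparr>carrier := D\<rparr>) \<phi>" "\<forall>x\<in>carrier G. \<pi> (\<phi> x) = \<pi> x"
  using un[OF subalgebra_extension[OF D ce im]] by blast
 note f = lmapD[OF lie_homD(1)[OF \<phi>(2)]]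
 have "lie_hom G G \<phi>"
  unfolding lie_hom_def using f(3,4,5) d(1) lie_homD(2)[OF \<phi>(2)] by (auto intro!: lmapI g(1))
 moreover have "lie_hom G G (restrict (\<lambda>x. x) (carrier G))"
  unfolding lie_hom_def using g(5) vG(2,3) by (auto intro!: lmapI g(1))
 ultimately have "\<phi> = restrict (\<lambda>x. x) (carrier G)"
  using un[OF ce] \<phi>(1,3) by (metis (no_types, lifting) restrict_apply' restrict_extensional)
 hence "x \<in> D" if "x \<in> carrier G" for x using f(3)[OF that] that by simp
 thus ?thesis using d(1) by blast
qed

lemma lie_moduleD:
 assumes "lie_module G M"
 shows "fd_vectorspace M" "vsp M" "x \<in> carrier G ==> lmap M M (act M x)" "u \<in> carrier M ==> lmap G M (\<lambda>x. act M x u)"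
  "[|x \<in> carrier G; y \<in> carrier G; u \<in> carrier M|] ==> act M (bracket G x y) u = act M x (act M y u) \<ominus>\<^bsub>M\<^esub> act M y (act M x u)"
  "act_closed (carrier G) M"
 using assms fdD(1)[of M] lmapD(3)[of M M]
 by (auto simp: lie_module_def bilinear_map_def act_closed_def)

locale ext_rep = central_ext G \<pi> L for G :: "('k::field, 'e) lie" and \<pi> :: "'e => 'l" and L :: "('k, 'l) lie" +
 fixes M :: "('k, 'e, 'v) rep"
 assumes M: "lie_module G M"
begin

lemmas m = lie_moduleD[OF M]

lemma R_simps:
 "x \<in> carrier G ==> Pr M * cop M x = cop M x" "x \<in> carrier G ==> cop M x * Pr M = cop M x"
 "[|x \<in> carrier G; y \<in> carrier G|] ==> cop M (x \<oplus>\<^bsub>G\<^esub> y) = cop M x + cop M y"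
 "x \<in> carrier G ==> cop M (c \<odot>\<^bsub>G\<^esub> x) = sc c * cop M x"
 "[|x \<in> carrier G; y \<in> carrier G|] ==> cop M (bracket G x y) = cop M x * cop M y - cop M y * cop M x"
proof -
 show "x \<in> carrier G ==> Pr M * cop M x = cop M x" "x \<in> carrier G ==> cop M x * Pr M = cop M x"
  using Pr_Op[OF m(1,1) m(3)] by blast+
 assume x: "x \<in> carrier G"
 have "cop M (c \<odot>\<^bsub>G\<^esub> x) = Op M M (\<lambda>u. c \<odot>\<^bsub>M\<^esub> act M x u)"
  using lmapD(5)[OF m(4)] x by (intro Op_cong m(1)) blast
 thus "cop M (c \<odot>\<^bsub>G\<^esub> x) = sc c * cop M x" using Op_smult[OF m(1,1) m(3)[OF x]] by simp
 assume y: "y \<in> carrier G"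
 have "cop M (x \<oplus>\<^bsub>G\<^esub> y) = Op M M (\<lambda>u. act M x u \<oplus>\<^bsub>M\<^esub> act M y u)"
  using lmapD(4)[OF m(4)] x y by (intro Op_cong m(1)) blast
 thus "cop M (x \<oplus>\<^bsub>G\<^esub> y) = cop M x + cop M y" using Op_add[OF m(1,1) m(3)[OF x] m(3)[OF y]] by simp
 have "cop M (bracket G x y) = Op M M (\<lambda>u. act M x (act M y u) \<ominus>\<^bsub>M\<^esub> act M y (act M x u))"
  using m(5) x y by (intro Op_cong m(1)) blast
 also have "\<dots> = Op M M (\<lambda>u. act M x (act M y u)) - Op M M (\<lambda>u. act M y (act M x u))"
  by (intro Op_diff m(1) lmap_comp[OF m(3) m(3)] x y)
 finally show "cop M (bracket G x y) = cop M x * cop M y - cop M y * cop M x"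
  using Op_mult[OF m(1,1,1) m(3)[OF y] m(3)[OF x]] Op_mult[OF m(1,1,1) m(3)[OF x] m(3)[OF y]] by simp
qed

definition rho :: "'l => 'l => ('v, 'k) endo" where
 "rho a b = cop M (Bk a b)"

lemma R_bracket: "[|x \<in> carrier G; y \<in> carrier G|] ==> cop M x * cop M y - cop M y * cop M x = rho (\<pi> x) (\<pi> y)"
 using R_simps(5) bracket_eq_Bk by (simp add: rho_def)

lemma rho_simps:
 "[|a \<in> carrier L; a' \<in> carrier L; b \<in> carrier L|] ==> rho (a \<oplus>\<^bsub>L\<^esub> a') b = rho a b + rho a' b"
 "[|a \<in> carrier L; b \<in> carrier L|] ==> rho (c \<odot>\<^bsub>L\<^esub> a) b = sc c * rho a b"
 "[|a \<in> carrier L; b \<in> carrier L; b' \<in> carrier L|] ==> rho a (b \<oplus>\<^bsub>L\<^esub> b') = rho a b + rho a b'"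
 "[|a \<in> carrier L; b \<in> carrier L|] ==> rho a (c \<odot>\<^bsub>L\<^esub> b) = sc c * rho a b"
 "[|a \<in> carrier L; b \<in> carrier L; a' \<in> carrier L; b' \<in> carrier L|] ==>
  rho a b * rho a' b' - rho a' b' * rho a b = rho (bracket L a b) (bracket L a' b')"
 "a \<in> carrier L ==> rho a \<zero>\<^bsub>L\<^esub> = 0"
proof -
 have skew: "rho a b = - rho b a" if "a \<in> carrier L" "b \<in> carrier L" for a b
  unfolding rho_def Bk_skew[OF that] using R_simps(4)[OF Bk_closed[OF that(2,1)], of "- 1"] by simp
 show add: "rho (a \<oplus>\<^bsub>L\<^esub> a') b = rho a b + rho a' b" if "a \<in> carrier L" "a' \<in> carrier L" "b \<in> carrier L" for a a' b
  using that by (simp add: rho_def Bk_add_left R_simps(3) Bk_closed)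
 show smult: "rho (c \<odot>\<^bsub>L\<^esub> a) b = sc c * rho a b" if "a \<in> carrier L" "b \<in> carrier L" for a b c
  using that by (simp add: rho_def Bk_smult_left R_simps(4) Bk_closed)
 show "rho a (b \<oplus>\<^bsub>L\<^esub> b') = rho a b + rho a b'" if "a \<in> carrier L" "b \<in> carrier L" "b' \<in> carrier L" for a b b'
  using that add skew[of a b] skew[of a b'] skew[of a "b \<oplus>\<^bsub>L\<^esub> b'"] vL(2) by simp
 show sr: "rho a (c \<odot>\<^bsub>L\<^esub> b) = sc c * rho a b" if "a \<in> carrier L" "b \<in> carrier L" for a b c
  using that smult skew[of a b] skew[of a "c \<odot>\<^bsub>L\<^esub> b"] vL(3) by simp
 show "rho a b * rho a' b' - rho a' b' * rho a b = rho (bracket L a b) (bracket L a' b')"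
  if "a \<in> carrier L" "b \<in> carrier L" "a' \<in> carrier L" "b' \<in> carrier L"
  using that R_bracket[of "Bk a b" "Bk a' b'"] Bk_closed pi_Bk unfolding rho_def by simp
 show "rho a \<zero>\<^bsub>L\<^esub> = 0" if "a \<in> carrier L" for a
  using sr[OF that vL(1), of 0] vL(11)[OF vL(1)] by simp
qed

end

subsection \<open>Recovering Clifford relations from iterated commutators\<close>

abbreviation (input) cm :: "'a::ring => 'a => 'a" where
 "cm x y \<equiv> x * y - y * x"

lemma endo_double: "S + S = T + T ==> S = (T :: ('b, 'k::field_char_0) endo)"
 by (rule sc_cancel[of 2]) (simp_all add: mult_2)

lemma sc_prod: "sc a * x * (sc b * y) = sc (a * b) * (x * y :: ('b, 'k::field) endo)"
proof -
 have "sc a * x * (sc b * y) = sc a * (sc b * (x * y))" by (simp only: mult.assoc sc_left_commute[of x])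
 thus ?thesis by (simp only: sc_sc)
qed

lemma cm_scale: "cm (sc a * x) (sc b * y) = sc (a * b) * cm x (y :: ('b, 'k::field) endo)"
 by (simp only: sc_prod right_diff_distrib mult.commute[of b])

text \<open>As c squares to -1, the double commutator is -2 X - 2 c X c. If it equals -4 X, then c X
  c = X, and multiplication by c gives the claim.\<close>

lemma anticommute_if_double_commutator:
 fixes c :: "('b, 'k::field_char_0) endo"
 assumes c: "c * c = - p" and X: "p * X = X" "X * p = X" and h: "cm c (cm c X) = - (X + X + X + X)"
 shows "c * X = - (X * c)"
proof -
 have 1: "c * (c * X) = - X" "X * (c * c) = - X" using c X by (simp_all add: mult.assoc[symmetric])
 have "cm c (cm c X) = - X - c * (X * c) - (c * (X * c) + X)"
  using 1 by (simp add: algebra_simps)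
 hence "c * (X * c) + c * (X * c) = X + X" unfolding h by (simp add: algebra_simps)
 hence "c * (X * c) = X" by (rule endo_double)
 hence "c * (c * (X * c)) = c * X" by simp
 moreover have "c * (c * (X * c)) = (c * c) * X * c" by (simp only: mult.assoc)
 ultimately show ?thesis using c X by simp
qed

text \<open>The same expansion -2 X - 2 c X c of the double commutator: when it vanishes, c X c =
  -X, and multiplication by c turns this into commutation.\<close>

lemma commute_if_double_commutator:
 fixes c :: "('b, 'k::field_char_0) endo"
 assumes c: "c * c = - p" and X: "p * X = X" "X * p = X" and h: "cm c (cm c X) = 0"
 shows "c * X = X * c"
proof -
 have 1: "c * (c * X) = - X" "X * (c * c) = - X" using c X by (simp_all add: mult.assoc[symmetric])
 have "cm c (cm c X) = - X - c * (X * c) - (c * (X * c) + X)"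
  using 1 by (simp add: algebra_simps)
 hence "c * (X * c) + c * (X * c) = - X + - X" unfolding h by (simp add: algebra_simps)
 hence "c * (X * c) = - X" by (rule endo_double)
 hence "c * (c * (X * c)) = - (c * X)" by simp
 moreover have "c * (c * (X * c)) = (c * c) * X * c" by (simp only: mult.assoc)
 ultimately show ?thesis using c X by simp
qed

locale cliff_pair =
 fixes c d p :: "('b, 'k::field_char_0) endo"
 assumes sq: "c * c = - p" "d * d = - p" and anti: "c * d = - (d * c)"
  and pc: "p * c = c" "c * p = c" "p * d = d" "d * p = d"
begin

text \<open>The two hypotheses combine to c (d X + X d) = 0, and c is invertible up to the
  projection p.\<close>

lemma anticommute_second:
 assumes X: "p * X = X" "c * X = - (X * c)" "(c * d) * X = X * (c * d)"
 shows "d * X = - (X * d)"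
proof -
 have "c * (d * X + X * d) = 0"
  using X(3) arg_cong[OF X(2), of "\<lambda>y. y * d"] by (simp add: algebra_simps)
 hence "(c * c) * (d * X + X * d) = 0" by (simp only: mult.assoc mult_zero_right)
 hence "p * (d * X + X * d) = 0" unfolding sq by simp
 hence "(p * d) * X + (p * X) * d = 0" by (simp only: mult.assoc distrib_left)
 thus ?thesis unfolding pc X by (simp add: eq_neg_iff_add_eq_0)
qed

text \<open>If d commutes with S and with c S although it anticommutes with c, then c S d equals its
  own negative; cancelling c and d leaves S = 0.\<close>

lemma zero_if_commute:
 assumes S: "p * S = S" "S * p = S" "d * S = S * d" "d * (c * S) = (c * S) * d"
 shows "S = 0"
proof -
 have "c * S * d = - (c * S * d)"
 proof -
  have "c * S * d = (d * c) * S" using S(4) by (simp add: mult.assoc)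
  also have "\<dots> = - (c * (d * S))" using anti by (simp add: mult.assoc[symmetric])
  also have "\<dots> = - (c * S * d)" unfolding S(3) by (simp only: mult.assoc)
  finally show ?thesis .
 qed
 hence "c * S * d + c * S * d = 0 + 0" by (metis add.right_inverse add_0)
 hence "c * S * d = 0" by (rule endo_double)
 hence "(c * c) * S * (d * d) = 0" by (metis mult.assoc mult_zero_left mult_zero_right)
 thus ?thesis using S by (simp add: sq)
qed

end

subsection \<open>Modules over the extension as Clifford modules\<close>

text \<open>An abstract form of so(m) extended by W tensor V, where P s stands for E_0j or w tensor
  b_0. These elements form a Lie triple system whose triple product is given by
  \<open>cform\<close>, and L is spanned by them and their brackets. The bound on r provides two
  orthogonal generators of norm 1.\<close>

locale cliff_lie =
 fixes r :: nat and W :: "('k::{alg_closed_field, field_char_0}, 'w) module" and L :: "('k, 'l) lie" (structure) and P :: "nat + 'w => 'l"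
 assumes lie: "lie_algebra L" and W: "vsp W" and r: "2 \<le> r"
  and P: "s \<in> gens r W ==> P s \<in> carrier L"
  and P_add: "[|w \<in> carrier W; w' \<in> carrier W|] ==> P (Inr (w \<oplus>\<^bsub>W\<^esub> w')) = P (Inr w) \<oplus> P (Inr w')"
  and P_smult: "w \<in> carrier W ==> P (Inr (c \<odot>\<^bsub>W\<^esub> w)) = c \<odot> P (Inr w)"
  and triple: "[|s \<in> gens r W; t \<in> gens r W; u \<in> gens r W|] ==>
   bracket L (P s) (bracket L (P t) (P u)) = (- cform s t) \<odot> P u \<oplus> cform s u \<odot> P t"
  and span: "[|VectorSpace.subspace class_ring K L; \<And>s. s \<in> gens r W ==> P s \<in> K;
   \<And>s t. [|s \<in> gens r W; t \<in> gens r W|] ==> bracket L (P s) (P t) \<in> K|] ==> K = carrier L"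
begin

abbreviation (input) "a0 \<equiv> Inl 0 :: nat + 'w"
abbreviation (input) "a1 \<equiv> Inl (Suc 0) :: nat + 'w"

text \<open>A generator of norm 1 orthogonal to s. All w in W share the partner \<open>a0\<close>,
  which later makes the lifts linear in w.\<close>

definition bb :: "nat + 'w => nat + 'w" where
 "bb s = (if s = a0 then a1 else a0)"

text \<open>Chosen so that P s is the bracket of P (bb s) with Q s: by the triple product, the
  double bracket of P (bb s) with P s is -P s. Writing P s as a bracket is what gives it a canonical
  lift.\<close>

definition Q :: "nat + 'w => 'l" where
 "Q s = (- 1) \<odot> bracket L (P (bb s)) (P s)"

definition "std3_e = P a0 \<oplus> img \<odot> P a1"
definition "std3_h = (- img) \<odot> bracket L (P a0) (P a1)"
definition "std3_f = (1 / 2) \<odot> P a0 \<oplus> (- img / 2) \<odot> P a1"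

lemma mem: "a0 \<in> gens r W" "a1 \<in> gens r W" "bb s \<in> gens r W"
 using r by (auto simp: gens_def bb_def)

lemmas la = lieD[OF lie]
lemmas w = vsp_simps[OF la(1)]

lemma cform_bb: "cform (bb s) (bb s) = 1" "s \<noteq> bb s" "cform (bb s) s = 0"
 by (auto simp: bb_def) (cases s; simp)+

lemma cform_commute: "cform s t = cform t s"
 by (cases s; cases t; simp)

lemma PP_closed: "[|s \<in> gens r W; t \<in> gens r W|] ==> bracket L (P s) (P t) \<in> carrier L"
 using la(5) P by blast

lemma Q_closed: "s \<in> gens r W ==> Q s \<in> carrier L"
 unfolding Q_def using PP_closed mem(3) w(3) by blast

lemma PQ: "s \<in> gens r W ==> bracket L (P (bb s)) (Q s) = P s"
proof -
 assume s: "s \<in> gens r W"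
 note l2 = lmapD[OF la(2)[OF P[OF mem(3)[of s]]]]
 have "bracket L (P (bb s)) (Q s) = (- 1) \<odot> bracket L (P (bb s)) (bracket L (P (bb s)) (P s))"
  unfolding Q_def using PP_closed[OF mem(3)[of s] s] by (rule l2(5))
 also have "\<dots> = P s"
  using triple[OF mem(3)[of s] mem(3)[of s] s] P[OF s] P[OF mem(3)[of s]]
  by (simp add: cform_bb w(3,6,9,10,11))
 finally show ?thesis .
qed

lemma triple_skew:
 assumes "s \<in> gens r W" "t \<in> gens r W" "u \<in> gens r W"
 shows "bracket L (bracket L (P t) (P u)) (P s) = cform s t \<odot> P u \<oplus> (- cform s u) \<odot> P t"
 using bracket_skew[OF lie PP_closed[OF assms(2,3)] P[OF assms(1)]] triple[OF assms] P assms
 by (simp add: w(3,9,14))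

end

locale cliff_ext = central_ext G \<pi> L + cliff_lie r W L P
 for G :: "('k::{alg_closed_field, field_char_0}, 'e) lie" and \<pi> :: "'e => 'l" and L :: "('k, 'l) lie"
  and r :: nat and W :: "('k, 'w) module" and P :: "nat + 'w => 'l"
begin

text \<open>The bracket of two lifts depends only on their images, so \<open>X s\<close> is a canonical lift of \<open>P s\<close>.\<close>

definition X :: "nat + 'w => 'e" where
 "X s = Bk (P (bb s)) (Q s)"

lemma X_closed: "s \<in> gens r W ==> X s \<in> carrier G" and pi_X: "s \<in> gens r W ==> \<pi> (X s) = P s"
 unfolding X_def using Bk_closed pi_Bk P[OF mem(3)] Q_closed PQ by simp_all

end

locale cliff_ext_rep = cliff_ext G \<pi> L r W P + ext_rep G \<pi> L M
 for G :: "('k::{alg_closed_field, field_char_0}, 'e) lie" and \<pi> :: "'e => 'l" and L :: "('k, 'l) lie"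
  and r :: nat and W :: "('k, 'w) module" and P :: "nat + 'w => 'l" and M :: "('k, 'e, 'v) rep"
begin

abbreviation (input) "Xo s \<equiv> cop M (X s)"

lemma cm_X_rho:
 assumes "s \<in> gens r W" "a \<in> carrier L" "b \<in> carrier L"
 shows "cm (Xo s) (rho a b) = rho (P s) (bracket L a b)" "cm (rho a b) (Xo s) = rho (bracket L a b) (P s)"
 using rho_simps(5)[of "P (bb s)" "Q s" a b] rho_simps(5)[of a b "P (bb s)" "Q s"] P[OF mem(3)] Q_closed PQ assms
 by (simp_all add: X_def rho_def)

lemma cm_X_X: "[|s \<in> gens r W; t \<in> gens r W|] ==> cm (Xo s) (Xo t) = rho (P s) (P t)"
 using R_bracket[of "X s" "X t"] X_closed pi_X by simp

lemma Xo_eq: "s \<in> gens r W ==> Xo s = - rho (P (bb s)) (bracket L (P (bb s)) (P s))"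
 using rho_simps(4)[of "P (bb s)" "bracket L (P (bb s)) (P s)" "- 1"] P mem(3) PP_closed
 by (simp add: X_def rho_def Q_def)

text \<open>In the spin representation the element P s acts as half a Clifford generator; hence the
  factor 2.\<close>

definition C :: "nat + 'w => ('v, 'k) endo" where
 "C s = sc 2 * Xo s"

lemma C_closed: "s \<in> gens r W ==> Pr M * C s = C s" "s \<in> gens r W ==> C s * Pr M = C s"
 using R_simps(1,2)[OF X_closed] by (simp_all add: C_def sc_left_commute[of "Pr M"] mult.assoc del: sc_numeral)

text \<open>In L the double bracket of P a0 with P s is -P s. In G this holds for the canonical
  lifts without a central error, because \<open>Xo s\<close> is by definition built from that same
  bracket. The factor 4 comes from the two factors 2 of \<open>C a0\<close>.\<close>

lemma C_double_commutator:
 assumes "s \<in> gens r W" "s \<noteq> a0"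
 shows "cm (C a0) (cm (C a0) (C s)) = - (C s + C s + C s + C s)"
proof -
 have b: "bb s = a0" using assms by (simp add: bb_def)
 have "cm (Xo a0) (cm (Xo a0) (Xo s)) = - Xo s"
  using cm_X_X[OF mem(1) assms(1)] cm_X_rho(1)[OF mem(1) P[OF mem(1)] P[OF assms(1)]] Xo_eq[OF assms(1)] b by simp
 moreover have "cm (C a0) (cm (C a0) (C s)) = sc (2 * (2 * 2)) * cm (Xo a0) (cm (Xo a0) (Xo s))"
  unfolding C_def by (simp only: cm_scale)
 moreover have "sc (2 * (2 * 2)) = sc (2::'k) + sc 2 + sc 2 + (sc 2 :: ('v, 'k) endo)" by (simp only: sc_add[symmetric]) simp
 ultimately show ?thesis unfolding C_def by (simp only: distrib_right mult_minus_right)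
qed

context
 assumes pair: "cliff_pair (C a0) (C a1) (Pr M)"
begin

interpretation cliff_pair "C a0" "C a1" "Pr M" by (rule pair)

lemma C_anticommute0: "[|s \<in> gens r W; s \<noteq> a0|] ==> C a0 * C s = - (C s * C a0)"
 using anticommute_if_double_commutator[OF sq(1)] C_closed C_double_commutator by blast

text \<open>The product of the first two generators is, up to scale, the action of [P a0, P a1],
  which commutes with P s in L. In G this only makes the commutator central, so it is the double
  commutator that vanishes; as the product squares to -1, it then commutes with \<open>C s\<close>.
  Anticommutation with \<open>C a0\<close> is already known and can be cancelled.\<close>

lemma C_anticommute1:
 assumes s: "s \<in> gens r W" "s \<noteq> a0" "s \<noteq> a1"
 shows "C a1 * C s = - (C s * C a1)"
proof (rule anticommute_second)
 show "Pr M * C s = C s" "C a0 * C s = - (C s * C a0)" using C_closed s C_anticommute0 by auto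
 let ?K = "C a0 * C a1"
 have K: "?K = sc 2 * rho (P a0) (P a1)"
 proof -
  have "?K + ?K = cm (C a0) (C a1)" using anti by simp
  also have "\<dots> = sc (2 * 2) * rho (P a0) (P a1)" unfolding C_def cm_scale cm_X_X[OF mem(1,2)] ..
  also have "\<dots> = sc 2 * rho (P a0) (P a1) + sc 2 * rho (P a0) (P a1)"
   by (simp only: distrib_right[symmetric] sc_add[symmetric]) simp
  finally show ?thesis by (rule endo_double)
 qed
 have z: "bracket L (bracket L (P a0) (P a1)) (P s) = \<zero>\<^bsub>L\<^esub>"
 proof -
  have "cform s a0 = (0::'k)" "cform s a1 = (0::'k)" using s by (cases s; simp)+
  thus ?thesis using triple_skew[OF s(1) mem(1,2)] P mem(1,2) w(1,6,11) by simp
 qed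
 have "cm (rho (P a0) (P a1)) (cm (rho (P a0) (P a1)) (Xo s)) = 0"
  unfolding cm_X_rho(2)[OF s(1) P[OF mem(1)] P[OF mem(2)]]
  using rho_simps(5)[of "P a0" "P a1" "bracket L (P a0) (P a1)" "P s"] P mem(1,2) s(1) PP_closed z rho_simps(6) by simp
 hence "cm ?K (cm ?K (C s)) = 0" unfolding K unfolding C_def cm_scale by simp
 moreover have "?K * ?K = - Pr M"
 proof -
  have "?K * ?K = C a0 * (C a1 * C a0) * C a1" by (simp only: mult.assoc)
  also have "C a1 * C a0 = - ?K" using anti by simp
  also have "C a0 * (- ?K) * C a1 = - ((C a0 * C a0) * (C a1 * C a1))" by (simp add: mult.assoc)
  also have "\<dots> = - (Pr M * Pr M)" unfolding sq by simp
  also have "Pr M * Pr M = Pr M" using Pr_Op(1)[OF m(1,1) lmap_id[OF m(2)]] .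
  finally show ?thesis .
 qed
 ultimately show "?K * C s = C s * ?K" using commute_if_double_commutator C_closed[OF s(1)] by blast
qed

text \<open>The deviation ?T from the Clifford relation commutes with \<open>C a1\<close>, since
  both factors anticommute with it. The product C a0 ?T commutes with \<open>C a1\<close> as well:
  it is 4 (?Y + ?b Xo a0), where ?Y is the double commutator of the three lifts, and in L the
  corresponding double bracket is -?b P a0. As the first two generators anticommute,
  \<open>zero_if_commute\<close> gives ?T = 0.\<close>

lemma C_relation_generic:
 assumes s: "s \<in> gens r W" "s \<noteq> a0" "s \<noteq> a1" and t: "t \<in> gens r W" "t \<noteq> a0" "t \<noteq> a1"
 shows "C s * C t + C t * C s = sc (- 2 * cform s t) * Pr M"
proof -
 let ?b = "cform s t :: 'k" and ?Y = "rho (bracket L (P a0) (P s)) (P t)"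
 let ?S = "C s * C t + C t * C s"
 let ?T = "?S + sc (2 * ?b) * Pr M"
 have PP: "Pr M * Pr M = Pr M" using Pr_Op(1)[OF m(1,1) lmap_id[OF m(2)]] .
 have cY: "cm (cm (Xo a0) (Xo s)) (Xo t) = ?Y"
  unfolding cm_X_X[OF mem(1) s(1)] using cm_X_rho(2)[OF t(1) P[OF mem(1)] P[OF s(1)]] .
 have f: "cform t a0 = 0" using t by (cases t) simp_all
 have br: "bracket L (bracket L (P a0) (P s)) (P t) = (- ?b) \<odot>\<^bsub>L\<^esub> P a0"
  using triple_skew[OF t(1) mem(1) s(1)] P mem(1) s(1) w(3,7,11) by (simp add: f cform_commute[of t s])
 have "cm ?Y (Xo a1) = rho ((- ?b) \<odot>\<^bsub>L\<^esub> P a0) (P a1)"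
  using cm_X_rho(2)[OF mem(2) PP_closed[OF mem(1) s(1)] P[OF t(1)]] br by simp
 also have "\<dots> = - (sc ?b * rho (P a0) (P a1))" using rho_simps(2)[of "P a0" "P a1" "- ?b"] P mem(1,2) by simp
 finally have Y1: "cm ?Y (Xo a1) = - (sc ?b * cm (Xo a0) (Xo a1))" unfolding cm_X_X[OF mem(1,2)] .
 have com: "(?Y + sc ?b * Xo a0) * Xo a1 = Xo a1 * (?Y + sc ?b * Xo a0)"
 proof -
  have "cm (?Y + sc ?b * Xo a0) (Xo a1) = cm ?Y (Xo a1) + sc ?b * cm (Xo a0) (Xo a1)"
   by (simp add: algebra_simps sc_left_commute[of "Xo a1"])
  thus ?thesis unfolding Y1 by simp
 qed
 have cS: "C a0 * ?S = sc 4 * ?Y"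
 proof (rule endo_double)
  have st: "C a0 * C s = - (C s * C a0)" "C t * C a0 = - (C a0 * C t)" using C_anticommute0 s t by auto
  have "cm (cm (C a0) (C s)) (C t) = sc (2 * 2 * 2) * ?Y" unfolding C_def cm_scale cY ..
  moreover have "cm (C a0) (C s) = C a0 * C s + C a0 * C s" using st(1) by simp
  moreover have "C t * (C a0 * C s) = - (C a0 * (C t * C s))"
   using arg_cong[OF st(2), of "\<lambda>y. y * C s"] by (simp add: mult.assoc)
  ultimately have "C a0 * ?S + C a0 * ?S = sc (2 * 2 * 2) * ?Y" by (simp add: algebra_simps del: sc_numeral)
  also have "\<dots> = sc 4 * ?Y + sc 4 * ?Y" by (simp only: distrib_right[symmetric] sc_add[symmetric]) simp
  finally show "C a0 * ?S + C a0 * ?S = sc 4 * ?Y + sc 4 * ?Y" .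
 qed
 have cT: "C a0 * ?T = sc 4 * (?Y + sc ?b * Xo a0)"
 proof -
  have "C a0 * (sc (2 * ?b) * Pr M) = sc (2 * ?b) * C a0" using C_closed(2)[OF mem(1)] by (simp add: sc_left_commute[of "C a0"])
  also have "\<dots> = sc 4 * (sc ?b * Xo a0)" unfolding C_def sc_sc by (simp add: mult.commute)
  finally show ?thesis using cS by (simp add: distrib_left)
 qed
 have "?T = 0"
 proof (rule zero_if_commute)
  have C1: "Pr M * (C s * C t) = C s * C t" "Pr M * (C t * C s) = C t * C s" using C_closed(1) s t by (simp_all add: mult.assoc[symmetric])
  have C2: "C s * C t * Pr M = C s * C t" "C t * C s * Pr M = C t * C s" using C_closed(2) s t by (simp_all add: mult.assoc)
  show "Pr M * ?T = ?T" "?T * Pr M = ?T"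
   using C1 C2 PP by (simp_all add: distrib_left distrib_right sc_left_commute[of "Pr M"] mult.assoc)
  have a: "C a1 * C s = - (C s * C a1)" "C a1 * C t = - (C t * C a1)" using C_anticommute1 s t by auto
  have q: "C a1 * (x * y) = (x * y) * C a1" if "C a1 * x = - (x * C a1)" "C a1 * y = - (y * C a1)" for x y
  proof -
   have "C a1 * (x * y) = (C a1 * x) * y" by (simp only: mult.assoc)
   also have "\<dots> = - (x * (C a1 * y))" unfolding that(1) by (simp add: mult.assoc)
   also have "\<dots> = (x * y) * C a1" unfolding that(2) by (simp add: mult.assoc)
   finally show ?thesis .
  qed
  show "C a1 * ?T = ?T * C a1"
   using q[OF a] q[OF a(2,1)] C_closed[OF mem(2)]
   by (simp add: distrib_left distrib_right sc_left_commute[of "C a1"] mult.assoc)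
  have "Xo a1 * (C a0 * ?T) = (C a0 * ?T) * Xo a1"
   unfolding cT using com by (simp add: sc_left_commute[of "Xo a1"] mult.assoc del: sc_numeral)
  thus "C a1 * (C a0 * ?T) = (C a0 * ?T) * C a1"
   unfolding C_def[of a1] by (simp only: mult.assoc sc_left_commute[of "C a0"] sc_left_commute[of ?T])
 qed
 thus ?thesis by (simp add: eq_neg_iff_add_eq_0)
qed

lemma C_relation:
 assumes s: "s \<in> gens r W" and t: "t \<in> gens r W"
 shows "C s * C t + C t * C s = sc (- 2 * cform s t) * Pr M"
proof -
 have sq': "C x * C x + C x * C x = sc (- 2) * Pr M" if "x = a0 \<or> x = a1" for x
  using that sq by (auto simp: mult_2)
 have cf: "cform a0 x = (0::'k)" "cform x a0 = (0::'k)" if "x \<noteq> a0" for x using that by (cases x; simp)+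
 have cf': "cform a1 x = (0::'k)" "cform x a1 = (0::'k)" if "x \<noteq> a1" for x using that by (cases x; simp)+
 consider "s = a0" "t = a0" | "s = a0" "t \<noteq> a0" | "s \<noteq> a0" "t = a0" | "s = a1" "t = a1" | "s = a1" "t \<noteq> a1" "t \<noteq> a0" | "s \<noteq> a1" "s \<noteq> a0" "t = a1"
  | "s \<noteq> a0" "s \<noteq> a1" "t \<noteq> a0" "t \<noteq> a1" by blast
 thus ?thesis
 proof cases
  case 7 thus ?thesis using C_relation_generic s t by blast
 qed (use sq' cf cf' C_anticommute0 C_anticommute1 s t in \<open>simp_all del: sc_numeral\<close>)
qed

end

end

section \<open>The standard short triple in terms of the first two Clifford generators\<close>

context cliff_lie
begin

lemma P_bracket_linear:
 assumes "x \<in> carrier L" "y \<in> carrier L" "z \<in> carrier L"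
 shows "bracket L x (y \<oplus> z) = bracket L x y \<oplus> bracket L x z" "bracket L (y \<oplus> z) x = bracket L y x \<oplus> bracket L z x"
  "bracket L x (c \<odot> y) = c \<odot> bracket L x y" "bracket L (c \<odot> y) x = c \<odot> bracket L y x"
 using lmapD(4,5)[OF la(2)[OF assms(1)]] lmapD(4,5)[OF la(3)[OF assms(1)]] assms by simp_all

lemma sl2_std: "sl2_relations L std3_e std3_h std3_f"
proof -
 interpret V: vectorspace class_ring L by (rule la(1))
 let ?b = "bracket L (P a0) (P a1)"
 note c = P[OF mem(1)] P[OF mem(2)] PP_closed[OF mem(1,2)]
 note bl = P_bracket_linear
 have b10: "bracket L (P a1) (P a0) = (- 1) \<odot> ?b" using bracket_skew[OF lie c(2,1)] .
 have b0: "bracket L ?b (P a0) = P a1" "bracket L ?b (P a1) = (- 1) \<odot> P a0"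
  using triple_skew[OF mem(1) mem(1,2)] triple_skew[OF mem(2) mem(1,2)] c by (simp_all add: w(3,6,7,10,11))
 have two: "(- img / 2) \<odot> ?b \<oplus> (- img / 2) \<odot> ?b = (- img) \<odot> ?b"
  using w(13)[OF c(3), of "- img / 2" "- img / 2"] by simp
 have "bracket L std3_e std3_f = (- img / 2) \<odot> ?b \<oplus> (- img / 2) \<odot> ?b"
  unfolding std3_e_def std3_f_def using c
  by (simp add: bl w(2,3,6,7,9,12,14) la(4,5) b10)
 hence 1: "bracket L std3_e std3_f = std3_h" unfolding two std3_h_def .
 have 2: "bracket L std3_h std3_e = \<ominus> std3_e"
  unfolding std3_e_def std3_h_def using c
  by (simp add: bl w(2,3,9,14,15) b0 img_sq V.a_comm)
 have 3: "bracket L std3_h std3_f = std3_f"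
  unfolding std3_f_def std3_h_def using c
  by (simp add: bl w(2,3,9,10,14,15) b0 img_sq V.a_comm)
 have "std3_e \<in> carrier L" "std3_h \<in> carrier L" "std3_f \<in> carrier L"
  unfolding std3_e_def std3_h_def std3_f_def using c by (simp_all add: w(2,3))
 thus ?thesis unfolding sl2_relations_def using 1 2 3 by blast
qed

lemma generated:
 assumes K: "VectorSpace.subspace class_ring K L" "\<And>x y. [|x \<in> K; y \<in> K|] ==> bracket L x y \<in> K" and P: "\<And>s. s \<in> gens r W ==> P s \<in> K"
 shows "K = carrier L"
 by (rule span[OF K(1) P]) (use P K(2) in auto)

end

lemma short_ops_lie_module:
 fixes M :: "('k::{alg_closed_field, field_char_0}, 'e, 'v) rep" (structure)
 assumes G: "lie_algebra G" and M: "lie_module G M" and sl2: "sl2_relations G e h f"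
 shows "short_ops M (act M e) (act M h) (act M f)"
proof -
 note m = lie_moduleD[OF M] and v = vsp_simps[OF lie_moduleD(2)[OF M]]
 interpret V: vectorspace class_ring M by (rule m(2))
 have c: "e \<in> carrier G" "h \<in> carrier G" "f \<in> carrier G" and br: "bracket G e f = h" "bracket G h e = \<ominus>\<^bsub>G\<^esub> e" "bracket G h f = f"
  using sl2 by (auto simp: sl2_relations_def)
 have move: "a = b \<oplus> d" if "d = a \<ominus> b" "a \<in> carrier M" "b \<in> carrier M" for a b d
  using that by (simp add: V.minus_eq V.a_ac V.r_neg V.r_neg1)
 note cl = lmapD(3)[OF m(3)]
 show ?thesis
 proof (rule short_ops.intro[OF m(1) m(3)[OF c(1)] m(3)[OF c(2)] m(3)[OF c(3)]])
  fix x assume x: "x \<in> carrier M"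
  show "act M h x = act M e (act M f x) \<oplus> (- 1) \<odot> act M f (act M e x)"
   using m(5)[OF c(1,3) x] v(16) cl[OF c(1)] cl[OF c(3)] x by (simp add: br)
  have "(- 1) \<odot> act M e x = act M (\<ominus>\<^bsub>G\<^esub> e) x"
   using lmapD(7)[OF m(4)[OF x] c(1)] v(15)[OF cl[OF c(1) x]] by simp
  hence "(- 1) \<odot> act M e x = act M h (act M e x) \<ominus> act M e (act M h x)"
   using m(5)[OF c(2,1) x] by (simp add: br)
  thus "act M h (act M e x) = act M e (act M h x) \<oplus> (- 1) \<odot> act M e x"
   by (rule move) (use cl c x in auto)
  have "act M f x = act M h (act M f x) \<ominus> act M f (act M h x)"
   using m(5)[OF c(2,3) x] by (simp add: br)
  thus "act M h (act M f x) = act M f (act M h x) \<oplus> act M f x"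
   by (rule move) (use cl c x in auto)
 qed
qed

text \<open>A dictionary between identities on vectors, in which categories and simple planes are
  phrased, and identities of operators, in which the Clifford calculus takes place.\<close>

lemma Op_rel:
 fixes M (structure)
 assumes M: "fd_vectorspace M" "lmap M M e" "lmap M M f"
 shows "(\<And>x. x \<in> carrier M ==> e (f x) = \<zero>) ==> Op M M e * Op M M f = 0"
  and "[|Op M M e * Op M M f = 0; x \<in> carrier M|] ==> e (f x) = \<zero>"
  and "(\<And>x. x \<in> carrier M ==> e (f x) \<oplus> f (e x) = c \<odot> x) ==> Op M M e * Op M M f + Op M M f * Op M M e = sc c * Pr M"
  and "[|Op M M e * Op M M f + Op M M f * Op M M e = sc c * Pr M; x \<in> carrier M|] ==> e (f x) \<oplus> f (e x) = c \<odot> x"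
proof -
 have ef: "Op M M e * Op M M f = Op M M (\<lambda>x. e (f x))" "Op M M f * Op M M e = Op M M (\<lambda>x. f (e x))"
  using Op_mult[OF M(1,1,1)] M by auto
 note lef = lmap_comp[OF M(3,2)] and lfe = lmap_comp[OF M(2,3)]
 have s: "Op M M e * Op M M f + Op M M f * Op M M e = Op M M (\<lambda>x. e (f x) \<oplus> f (e x))"
  unfolding ef by (rule Op_add[OF M(1,1) lef lfe, symmetric])
 have i: "lmap M M (\<lambda>x. x)" using lmap_id fdD(1)[OF M(1)] .
 have k: "sc c * Pr M = Op M M (\<lambda>x. c \<odot> x)" by (rule Op_smult[OF M(1,1) i, symmetric])
 have z: "lmap M M (\<lambda>x. \<zero>)" using lmap_zero fdD(1)[OF M(1)] by blast
 show "Op M M e * Op M M f = 0" if "\<And>x. x \<in> carrier M ==> e (f x) = \<zero>"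
 proof -
  have "Op M M (\<lambda>x. e (f x)) = Op M M (\<lambda>x. \<zero>)" by (rule Op_cong[OF M(1)]) (rule that)
  thus ?thesis unfolding ef using Op_zero[OF M(1,1)] by simp
 qed
 show "e (f x) = \<zero>" if "Op M M e * Op M M f = 0" "x \<in> carrier M"
  using Op_eqD[OF M(1,1) lef z _ that(2)] that(1) Op_zero[OF M(1,1)] unfolding ef by simp
 show "Op M M e * Op M M f + Op M M f * Op M M e = sc c * Pr M" if "\<And>x. x \<in> carrier M ==> e (f x) \<oplus> f (e x) = c \<odot> x"
  unfolding s k using Op_cong[OF M(1) that] .
 show "e (f x) \<oplus> f (e x) = c \<odot> x" if "Op M M e * Op M M f + Op M M f * Op M M e = sc c * Pr M" "x \<in> carrier M"
  using Op_eqD[OF M(1,1) lmap_add[OF lef lfe] lmap_smult[OF i] _ that(2)] that(1) unfolding s k by blast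
qed

lemma square_sum: "(x + y) * (x + y) = x * x + y * y + (x * y + y * (x :: 'a::ring))"
 and square_diff: "(x - y) * (x - y) = x * x + y * y - (x * y + y * x)"
 by (simp_all add: algebra_simps)

context cliff_ext_rep
begin

lemma rho_skew: "[|a \<in> carrier L; b \<in> carrier L|] ==> rho a b = - rho b a"
 unfolding rho_def using Bk_skew[of a b] R_simps(4)[OF Bk_closed[of b a], of "- 1"] by simp

text \<open>Each of e and f is, up to sign, its own bracket with h, so the operators of any lift are
  determined by the images in L. They can be expanded by bilinearity in the brackets that define
  \<open>Xo a0\<close> and \<open>Xo a1\<close>.\<close>

lemma cop_lifts:
 assumes sl2: "sl2_relations G e' h' f'" and pi: "\<pi> e' = std3_e" "\<pi> h' = std3_h" "\<pi> f' = std3_f"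
 shows "cop M e' = sc (1 / 2) * (C a0 + sc img * C a1)" "cop M f' = sc (1 / 4) * (C a0 - sc img * C a1)"
proof -
 have c: "e' \<in> carrier G" "h' \<in> carrier G" "f' \<in> carrier G" and br: "bracket G h' e' = \<ominus>\<^bsub>G\<^esub> e'" "bracket G h' f' = f'"
  using sl2 by (auto simp: sl2_relations_def)
 let ?b = "bracket L (P a0) (P a1)"
 note pc = P[OF mem(1)] P[OF mem(2)] PP_closed[OF mem(1,2)]
 have b10: "bracket L (P a1) (P a0) = (- 1) \<odot>\<^bsub>L\<^esub> ?b" using bracket_skew[OF lie pc(2,1)] .
 have B: "Xo a1 = - rho (P a0) ?b" using Xo_eq[OF mem(2)] by (simp add: bb_def)
 have A: "Xo a0 = rho (P a1) ?b" using Xo_eq[OF mem(1)] rho_simps(4)[OF pc(2,3), of "- 1"] by (simp add: bb_def b10)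
 have cl: "std3_e \<in> carrier L" "std3_h \<in> carrier L" "std3_f \<in> carrier L"
  using sl2_std by (auto simp: sl2_relations_def)
 have "- cop M e' = cop M (bracket G h' e')"
  unfolding br vG(15)[OF c(1)] using R_simps(4)[OF c(1), of "- 1"] by simp
 also have "\<dots> = rho std3_h std3_e" using bracket_eq_Bk[OF c(2,1)] by (simp add: rho_def pi)
 finally have E: "cop M e' = rho std3_e std3_h" using rho_skew[OF cl(1,2)] by (metis minus_minus)
 have F: "cop M f' = - rho std3_f std3_h"
  using bracket_eq_Bk[OF c(2,3)] rho_skew[OF cl(2,3)] unfolding br pi by (simp add: rho_def)
 have half: "sc (1 / 2) * C s = Xo s" "sc (1 / 4) * C s = sc (1 / 2) * Xo s" for s
  unfolding C_def sc_sc by (simp_all del: sc_numeral)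
 have "rho std3_e std3_h = sc (- img) * (rho (P a0) ?b + sc img * rho (P a1) ?b)"
  unfolding std3_e_def std3_h_def using pc by (simp add: rho_simps w(2,3))
 also have "\<dots> = Xo a0 + sc img * Xo a1"
  unfolding A B distrib_left sc_sc by (simp add: img_sq)
 finally show "cop M e' = sc (1 / 2) * (C a0 + sc img * C a1)"
  unfolding E distrib_left sc_left_commute[of "sc (1 / 2)"] half .
 have "rho std3_f std3_h = sc (- img) * (sc (1 / 2) * rho (P a0) ?b + sc (- img / 2) * rho (P a1) ?b)"
  unfolding std3_f_def std3_h_def using pc by (simp add: rho_simps w(2,3))
 also have "\<dots> = - (sc (1 / 2) * (Xo a0 - sc img * Xo a1))"
  unfolding A B distrib_left right_diff_distrib sc_sc by (simp add: img_sq sc_sc)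
 finally show "cop M f' = sc (1 / 4) * (C a0 - sc img * C a1)"
  unfolding F right_diff_distrib sc_left_commute[of "sc (1 / 4)"] half by (simp add: sc_sc)
qed

text \<open>On a sum of planes e and f square to 0 and have anticommutator -1/2. With E = e and D =
  2 f the first two generators are E + D and -i (E - D), so their squares are the anticommutator -1
  of E and D.\<close>

lemma pair_if_planes:
 assumes sl2: "sl2_relations G e' h' f'" and pi: "\<pi> e' = std3_e" "\<pi> h' = std3_h" "\<pi> f' = std3_f"
  and planes: "sum_of_simple_planes {e', h', f'} M"
 shows "cliff_pair (C a0) (C a1) (Pr M)"
proof -
 interpret short_ops M "act M e'" "act M h'" "act M f'" by (rule short_ops_lie_module[OF GL(1) M sl2])
 obtain n U where nU: "\<forall>i<(n::nat). simple_subspace {e', h', f'} M (U i) \<and> vectorspace.dim class_ring (M\<lparr>carrier := U i\<rparr>) = 2"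
  and dec0: "\<forall>x\<in>carrier M. \<exists>!u. u \<in> Pi\<^sub>E {..<n} U \<and> x = (\<Oplus>\<^bsub>M\<^esub>i\<in>{..<n}. u i)"
  using planes[unfolded sum_of_simple_planes_def] by (elim exE conjE) (rule that)
 note simple = nU[rule_format, THEN conjunct1] and dim = nU[rule_format, THEN conjunct2] and dec = dec0[rule_format]
 have rels: "act M e' (act M e' x) = \<zero>\<^bsub>M\<^esub>" "act M f' (act M f' x) = \<zero>\<^bsub>M\<^esub>"
  "act M e' (act M f' x) \<oplus>\<^bsub>M\<^esub> act M f' (act M e' x) = (- 1 / 2) \<odot>\<^bsub>M\<^esub> x" if x: "x \<in> carrier M" for x
 proof -
  have a: "VectorSpace.subspace class_ring (U i) M" if "i < n" for i
   using simple[OF that] by (simp add: simple_subspace_def invariant_subspace_def)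
  have b: "act M e' x \<in> U i \<and> act M h' x \<in> U i \<and> act M f' x \<in> U i" if "i < n" "x \<in> U i" for i x
   using simple[OF that(1)] that(2) by (simp add: simple_subspace_def invariant_subspace_def)
  have c: "U' = {\<zero>\<^bsub>M\<^esub>} \<or> U' = U i" if "i < n" "VectorSpace.subspace class_ring U' M"
   "\<And>x. x \<in> U' ==> act M e' x \<in> U' \<and> act M h' x \<in> U' \<and> act M f' x \<in> U'" "U' \<subseteq> U i" for i U'
  proof -
   have "invariant_subspace {e', h', f'} M U'" using that(2,3) by (auto simp: invariant_subspace_def)
   thus ?thesis using simple[OF that(1)] that(4) unfolding simple_subspace_def by blast
  qed
  have d: "\<exists>u \<in> Pi\<^sub>E {..<n} U. x = (\<Oplus>\<^bsub>M\<^esub>i\<in>{..<n}. u i)" if "x \<in> carrier M" for x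
   using ex1_implies_ex[OF dec[OF that]] by blast
  note rr = planes_rel[of n U, OF a b c dim d x]
  show "act M e' (act M e' x) = \<zero>\<^bsub>M\<^esub>" "act M f' (act M f' x) = \<zero>\<^bsub>M\<^esub>"
   "act M e' (act M f' x) \<oplus>\<^bsub>M\<^esub> act M f' (act M e' x) = (- 1 / 2) \<odot>\<^bsub>M\<^esub> x" by (rule rr; assumption)+
 qed
 let ?E = "cop M e'" and ?D = "sc 2 * cop M f'"
 note op = Op_rel[OF m(1)]
 have ee: "?E * ?E = 0" using op(1)[OF lin(1,1)] rels by blast
 have ff: "cop M f' * cop M f' = 0" using op(1)[OF lin(3,3)] rels by blast
 have "?E * cop M f' + cop M f' * ?E = sc (- 1 / 2) * Pr M" by (rule op(3)[OF lin(1,3)]) (use rels in blast)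
 hence "sc 2 * (?E * cop M f' + cop M f' * ?E) = - Pr M" by (simp add: sc_sc del: sc_numeral)
 hence ed: "?E * ?D + ?D * ?E = - Pr M" by (simp add: distrib_left sc_left_commute[of ?E] mult.assoc del: sc_numeral)
 have dd: "?D * ?D = 0" unfolding sc_prod ff by simp
 have ED: "?E = sc (1 / 2) * (C a0 + sc img * C a1)" "?D = sc (1 / 2) * (C a0 - sc img * C a1)"
  unfolding cop_lifts[OF sl2 pi] sc_sc by simp_all
 have c0: "C a0 = ?E + ?D"
 proof -
  have "?E + ?D = sc (1 / 2) * (C a0 + C a0)" unfolding ED distrib_left[symmetric] by simp
  also have "C a0 + C a0 = sc 2 * C a0" by (simp add: mult_2)
  finally show ?thesis unfolding sc_sc by simp
 qed
 have c1: "C a1 = sc (- img) * (?E - ?D)"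
 proof -
  have "?E - ?D = sc (1 / 2) * (sc img * C a1 + sc img * C a1)" unfolding ED right_diff_distrib[symmetric] by simp
  also have "sc img * C a1 + sc img * C a1 = sc 2 * (sc img * C a1)" by (simp add: mult_2)
  finally show ?thesis unfolding sc_sc by (simp add: sc_sc img_sq)
 qed
 show ?thesis
 proof
  show "C a0 * C a0 = - Pr M" unfolding c0 square_sum ee dd ed by simp
  have "(?E - ?D) * (?E - ?D) = Pr M" unfolding square_diff ee dd ed by simp
  thus "C a1 * C a1 = - Pr M" unfolding c1 sc_prod by (simp add: img_sq)
  have "(?E + ?D) * (?E - ?D) = - ((?E - ?D) * (?E + ?D))" using ee dd by (simp add: distrib_left distrib_right left_diff_distrib right_diff_distrib del: sc_numeral)
  moreover have "C a0 * C a1 = sc (- img) * ((?E + ?D) * (?E - ?D))" unfolding c0 c1 by (rule sc_left_commute)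
  moreover have "C a1 * C a0 = sc (- img) * ((?E - ?D) * (?E + ?D))" unfolding c0 c1 by (rule mult.assoc)
  ultimately show "C a0 * C a1 = - (C a1 * C a0)" by (simp del: sc_numeral)
 qed (use C_closed mem in auto)
qed

text \<open>Up to the factors 1/2 and 1/4 the operators e and f are the isotropic combinations of
  the first two generators. These have anticommutator -4, so e and f have -4/8 = -1/2, which is the
  criterion of \<open>sum_of_simple_planesI\<close>.\<close>

lemma planes_if_pair:
 assumes sl2: "sl2_relations G e' h' f'" and pi: "\<pi> e' = std3_e" "\<pi> h' = std3_h" "\<pi> f' = std3_f"
  and pair: "cliff_pair (C a0) (C a1) (Pr M)"
 shows "sum_of_simple_planes {e', h', f'} M"
proof (rule sum_of_simple_planesI)
 interpret S: short_ops M "act M e'" "act M h'" "act M f'" by (rule short_ops_lie_module[OF GL(1) M sl2])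
 interpret cliff_pair "C a0" "C a1" "Pr M" by (rule pair)
 note op = Op_rel[OF m(1)]
 let ?p = "C a0 + sc img * C a1" and ?q = "C a0 - sc img * C a1"
 note mul = mult.assoc sc_left_commute[of "C a0"] sc_left_commute[of "C a1"]
 have pq: "?p * ?p = 0" "?q * ?q = 0" "?p * ?q + ?q * ?p = - (sc 4 * Pr M)"
 proof -
  have 4: "sc 4 * Pr M = Pr M + Pr M + (Pr M + Pr M)"
  proof -
   have "sc 4 = (1 + 1 + (1 + 1) :: ('v, 'k) endo)" by simp
   thus ?thesis by (simp only: distrib_right mult_1_left)
  qed
  show "?p * ?p = 0" "?q * ?q = 0"
   by (simp_all add: distrib_left distrib_right left_diff_distrib right_diff_distrib mul sc_sc img_sq sq anti)
  show "?p * ?q + ?q * ?p = - (sc 4 * Pr M)"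
   unfolding 4 by (simp add: distrib_left distrib_right left_diff_distrib right_diff_distrib mul sc_sc img_sq sq anti)
 qed
 note cl = cop_lifts[OF sl2 pi]
 show "plane_ops M (act M e') (act M f')"
 proof (rule plane_ops.intro[OF m(1) S.lin(1,3)])
  fix x assume x: "x \<in> carrier M"
  have "cop M e' * cop M e' = 0" "cop M f' * cop M f' = 0" unfolding cl sc_prod pq by simp_all
  thus "act M e' (act M e' x) = \<zero>\<^bsub>M\<^esub>" "act M f' (act M f' x) = \<zero>\<^bsub>M\<^esub>"
   using op(2)[OF S.lin(1,1) _ x] op(2)[OF S.lin(3,3) _ x] by blast+
  have "cop M e' * cop M f' + cop M f' * cop M e' = sc (1 / 2 * (1 / 4)) * (?p * ?q + ?q * ?p)"
   unfolding cl sc_prod by (simp add: distrib_left)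
  also have "\<dots> = sc (- 1 / 2) * Pr M" unfolding pq mult_minus_right sc_sc by simp
  finally show "act M e' (act M f' x) \<oplus>\<^bsub>M\<^esub> act M f' (act M e' x) = (- 1 / 2) \<odot>\<^bsub>M\<^esub> x" by (rule op(4)[OF S.lin(1,3) _ x])
 qed
 show "act M h' x = act M e' (act M f' x) \<oplus>\<^bsub>M\<^esub> (- 1) \<odot>\<^bsub>M\<^esub> act M f' (act M e' x)" if "x \<in> carrier M" for x
  by (rule S.rel(1)[OF that])
qed

lemma C_Op: 
 assumes "s \<in> gens r W"
 shows "lmap M M (\<lambda>x. 2 \<odot>\<^bsub>M\<^esub> act M (X s) x)" "Op M M (\<lambda>x. 2 \<odot>\<^bsub>M\<^esub> act M (X s) x) = C s"
 unfolding C_def by (rule lmap_smult[OF m(3)[OF X_closed[OF assms]]]) (rule Op_smult[OF m(1,1) m(3)[OF X_closed[OF assms]]])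

lemma C_linear:
 "[|w \<in> carrier W; w' \<in> carrier W|] ==> C (Inr (w \<oplus>\<^bsub>W\<^esub> w')) = C (Inr w) + C (Inr w')"
 "w \<in> carrier W ==> C (Inr (c \<odot>\<^bsub>W\<^esub> w)) = sc c * C (Inr w)"
proof -
 \<comment> \<open>The common partner makes X (Inr w) a bracket that is linear in w, so no central
   error can spoil additivity.\<close>
 have b: "bb (Inr u) = a0" for u by (simp add: bb_def)
 have g: "Inr u \<in> gens r W" if "u \<in> carrier W" for u using that by (simp add: gens_def)
 note pc = P[OF mem(1)] P[OF g]
 have X: "Xo (Inr u) = - rho (P a0) (bracket L (P a0) (P (Inr u)))" if "u \<in> carrier W" for u
  using Xo_eq[OF g[OF that]] unfolding b .
 note vW = vsp_simps[OF W]
 show "C (Inr (w \<oplus>\<^bsub>W\<^esub> w')) = C (Inr w) + C (Inr w')" if "w \<in> carrier W" "w' \<in> carrier W" for w w'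
  using that pc PP_closed[OF mem(1) g] unfolding C_def
  by (simp add: X vW(2) P_add P_bracket_linear rho_simps(3) distrib_left right_diff_distrib del: sc_numeral)
 show "C (Inr (c \<odot>\<^bsub>W\<^esub> w)) = sc c * C (Inr w)" if "w \<in> carrier W" for w
  using that pc PP_closed[OF mem(1) g] unfolding C_def
  by (simp add: X vW(3) P_smult P_bracket_linear rho_simps(4) sc_left_commute[of "sc 2"] del: sc_numeral)
qed

end

section \<open>Clifford modules from Lie modules, and comparison of morphisms\<close>

context cliff_ext
begin

definition related :: "('k, 'e, 'v) rep => ('k, nat + 'w, 'v) rep => bool" where
 "related M N \<longleftrightarrow> same_space M N \<and> (\<forall>s\<in>gens r W. \<forall>x\<in>carrier M. act N s x = 2 \<odot>\<^bsub>M\<^esub> act M (X s) x)"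

lemma S_half_object:
 assumes "M \<in> Ob (S_half G \<pi> std3_e std3_h std3_f :: (('k, 'e, 'v) rep, 'v => 'v) category)"
 obtains e' h' f' where "lie_module G M" "sl2_relations G e' h' f'" "\<pi> e' = std3_e" "\<pi> h' = std3_h" "\<pi> f' = std3_f"
  "sum_of_simple_planes {e', h', f'} M"
 using assms unfolding S_half_def by auto

lemma cliff_module_of_object:
 assumes "M \<in> Ob (S_half G \<pi> std3_e std3_h std3_f :: (('k, 'e, 'v) rep, 'v => 'v) category)"
 shows "\<exists>N \<in> Ob (cliff_modules r W). related M N"
proof -
 obtain e' h' f' where M: "lie_module G M" and sl2: "sl2_relations G e' h' f'" "\<pi> e' = std3_e" "\<pi> h' = std3_h" "\<pi> f' = std3_f"
  and planes: "sum_of_simple_planes {e', h', f'} M" by (rule S_half_object[OF assms])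
 interpret cliff_ext_rep G \<pi> L r W P M by unfold_locales (rule M)
 let ?A = "\<lambda>s x. 2 \<odot>\<^bsub>M\<^esub> act M (X s) x"
 let ?N = "\<lparr>carrier = carrier M, mult = mult M, one = one M, zero = zero M, add = add M, smult = smult M, act = ?A\<rparr> :: ('k, nat + 'w, 'v) rep"
 note pair = pair_if_planes[OF sl2 planes]
 have s: "same_space M ?N" by (simp add: same_space_def)
 note lA = C_Op(1) and oA = C_Op(2)
 note vW = vsp_simps[OF W]
 have rel: "?A a (?A b x) \<oplus>\<^bsub>M\<^esub> ?A b (?A a x) = (- 2 * cform a b) \<odot>\<^bsub>M\<^esub> x"
  if "a \<in> gens r W" "b \<in> gens r W" "x \<in> carrier M" for a b x
  using Op_rel(4)[OF m(1) lA[OF that(1)] lA[OF that(2)] _ that(3)] C_relation[OF pair that(1,2)]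
  unfolding oA[OF that(1)] oA[OF that(2)] by blast
 have g: "Inr u \<in> gens r W" if "u \<in> carrier W" for u using that by (simp add: gens_def)
 have add: "?A (Inr (w \<oplus>\<^bsub>W\<^esub> w')) x = ?A (Inr w) x \<oplus>\<^bsub>M\<^esub> ?A (Inr w') x" if "w \<in> carrier W" "w' \<in> carrier W" "x \<in> carrier M" for w w' x
 proof (rule Op_eqD[OF m(1,1) lA[OF g[OF vW(2)[OF that(1,2)]]] lmap_add[OF lA[OF g[OF that(1)]] lA[OF g[OF that(2)]]] _ that(3)])
  show "Op M M (?A (Inr (w \<oplus>\<^bsub>W\<^esub> w'))) = Op M M (\<lambda>x. ?A (Inr w) x \<oplus>\<^bsub>M\<^esub> ?A (Inr w') x)"
   unfolding Op_add[OF m(1,1) lA[OF g[OF that(1)]] lA[OF g[OF that(2)]]] oA[OF g[OF that(1)]] oA[OF g[OF that(2)]] oA[OF g[OF vW(2)[OF that(1,2)]]]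
   by (rule C_linear(1)[OF that(1,2)])
 qed
 have smult: "?A (Inr (c \<odot>\<^bsub>W\<^esub> w)) x = c \<odot>\<^bsub>M\<^esub> ?A (Inr w) x" if "w \<in> carrier W" "x \<in> carrier M" for w x c
 proof (rule Op_eqD[OF m(1,1) lA[OF g[OF vW(3)[OF that(1)]]] lmap_smult[OF lA[OF g[OF that(1)]]] _ that(2)])
  show "Op M M (?A (Inr (c \<odot>\<^bsub>W\<^esub> w))) = Op M M (\<lambda>x. c \<odot>\<^bsub>M\<^esub> ?A (Inr w) x)"
   unfolding Op_smult[OF m(1,1) lA[OF g[OF that(1)]]] oA[OF g[OF that(1)]] oA[OF g[OF vW(3)[OF that(1)]]]
   by (rule C_linear(2)[OF that(1)])
 qed
 have "cliff_module r W ?N"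
  unfolding cliff_module_def using same_space_fd[OF s m(1)] lA rel add smult
  by (simp add: same_space_lmap[OF s s, symmetric])
 thus ?thesis using s by (intro bexI[of _ ?N]) (simp_all add: related_def cliff_modules_def)
qed

text \<open>For a map commuting with the Clifford generators, the elements of G whose action
  commutes with it form a subalgebra containing all X s. Its image in L contains all P s, hence is
  L, and a universal central extension has no proper subalgebra mapping onto L.\<close>

lemma hom_related:
 assumes G: "universal_central_extension G \<pi> L" and M: "lie_module G M" "lie_module G M'"
  and N: "cliff_module r W N" "cliff_module r W N'" and R: "related M N" "related M' N'"
 shows "rep_hom (carrier G) M M' = rep_hom (gens r W) N N'"
proof -
 note m = lie_moduleD[OF M(1)] and m' = lie_moduleD[OF M(2)]
 have s: "same_space M N" "same_space M' N'" and a: "\<And>s x. [|s \<in> gens r W; x \<in> carrier M|] ==> act N s x = 2 \<odot>\<^bsub>M\<^esub> act M (X s) x"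
  "\<And>s x. [|s \<in> gens r W; x \<in> carrier M'|] ==> act N' s x = 2 \<odot>\<^bsub>M'\<^esub> act M' (X s) x"
  using R by (auto simp: related_def)
 have c: "carrier N = carrier M" using s by (simp add: same_space_def)
 note v' = vsp_simps[OF m'(2)] and cl = lmapD(3)[OF m(3)] and cl' = lmapD(3)[OF m'(3)]
 show ?thesis
 proof (intro equalityI subsetI)
  fix \<phi> assume f: "\<phi> \<in> rep_hom (carrier G) M M'"
  note h = rep_homD[OF f] and l = lmapD[OF rep_homD(2)[OF f]]
  have "\<phi> (act N s x) = act N' s (\<phi> x)" if "s \<in> gens r W" "x \<in> carrier M" for s x
   using that h(3)[OF X_closed[OF that(1)] that(2)] l(5)[OF cl[OF X_closed[OF that(1)] that(2)]] l(3)[OF that(2)] by (simp add: a)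
  thus "\<phi> \<in> rep_hom (gens r W) N N'" using h(1,2) c by (simp add: rep_hom_def same_space_lmap[OF s])
 next
  fix \<phi> assume f: "\<phi> \<in> rep_hom (gens r W) N N'"
  note h = rep_homD[OF f]
  have lm: "lmap M M' \<phi>" using h(2) by (simp add: same_space_lmap[OF s])
  note l = lmapD[OF lm]
  let ?D = "{x \<in> carrier G. \<forall>u\<in>carrier M. \<phi> (act M x u) = act M' x (\<phi> u)}"
  have D: "VectorSpace.subspace class_ring ?D G"
  proof (rule subspaceI_vsp[OF g(1)])
   show "\<zero>\<^bsub>G\<^esub> \<in> ?D" using lmapD(6)[OF m(4)] lmapD(6)[OF m'(4)] l(3,6) vG(1) by simp
   fix x c assume x: "x \<in> ?D"
   show "c \<odot>\<^bsub>G\<^esub> x \<in> ?D"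
    using x lmapD(5)[OF m(4)] lmapD(5)[OF m'(4)] l(3,5) cl vG(3) by simp
   fix y assume y: "y \<in> ?D"
   show "x \<oplus>\<^bsub>G\<^esub> y \<in> ?D"
    using x y lmapD(4)[OF m(4)] lmapD(4)[OF m'(4)] l(3,4) cl vG(2) by simp
  qed auto
  have Db: "bracket G x y \<in> ?D" if "x \<in> ?D" "y \<in> ?D" for x y
   using that g(5) m(5) m'(5) l(3,8) cl by simp
  have DX: "X s \<in> ?D" if gs: "s \<in> gens r W" for s
  proof -
   have "\<phi> (act M (X s) u) = act M' (X s) (\<phi> u)" if u: "u \<in> carrier M" for u
   proof -
    have "\<phi> (act N s u) = act N' s (\<phi> u)" using h(3) gs u c by simp
    hence "2 \<odot>\<^bsub>M'\<^esub> \<phi> (act M (X s) u) = 2 \<odot>\<^bsub>M'\<^esub> act M' (X s) (\<phi> u)"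
     using a gs u l(3)[OF u] l(5)[OF cl[OF X_closed[OF gs] u]] by simp
    hence "(1 / 2) \<odot>\<^bsub>M'\<^esub> (2 \<odot>\<^bsub>M'\<^esub> \<phi> (act M (X s) u)) = (1 / 2) \<odot>\<^bsub>M'\<^esub> (2 \<odot>\<^bsub>M'\<^esub> act M' (X s) (\<phi> u))" by simp
    thus ?thesis using l(3)[OF cl[OF X_closed[OF gs] u]] cl'[OF X_closed[OF gs] l(3)[OF u]] by (simp add: v'(9,10))
   qed
   thus ?thesis using X_closed[OF gs] by simp
  qed
  have "\<pi> ` ?D = carrier L"
  proof (rule generated)
   note d = subspD[OF D]
   show "VectorSpace.subspace class_ring (\<pi> ` ?D) L"
   proof (rule subspaceI_vsp[OF la(1)])
    show "\<pi> ` ?D \<subseteq> carrier L" using p(3) by blast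
    show "\<zero>\<^bsub>L\<^esub> \<in> \<pi> ` ?D" by (rule image_eqI[of _ _ "\<zero>\<^bsub>G\<^esub>"], rule p(6)[symmetric], rule d(4))
    show "c \<odot>\<^bsub>L\<^esub> x \<in> \<pi> ` ?D" if x: "x \<in> \<pi> ` ?D" for c x
    proof -
     obtain x' where x': "x' \<in> ?D" "x = \<pi> x'" using x by (rule imageE)
     show ?thesis by (rule image_eqI[of _ _ "c \<odot>\<^bsub>G\<^esub> x'"], unfold x'(2), rule p(5)[OF d(1)[OF x'(1)], symmetric], rule d(3)[OF x'(1)])
    qed
    show "x \<oplus>\<^bsub>L\<^esub> y \<in> \<pi> ` ?D" if x: "x \<in> \<pi> ` ?D" and y: "y \<in> \<pi> ` ?D" for x y
    proof -
     obtain x' where x': "x' \<in> ?D" "x = \<pi> x'" using x by (rule imageE)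
     obtain y' where y': "y' \<in> ?D" "y = \<pi> y'" using y by (rule imageE)
     show ?thesis by (rule image_eqI[of _ _ "x' \<oplus>\<^bsub>G\<^esub> y'"], unfold x'(2) y'(2), rule p(4)[OF d(1)[OF x'(1)] d(1)[OF y'(1)], symmetric], rule d(2)[OF x'(1) y'(1)])
    qed
   qed
   show "bracket L x y \<in> \<pi> ` ?D" if x: "x \<in> \<pi> ` ?D" and y: "y \<in> \<pi> ` ?D" for x y
   proof -
    obtain x' where x': "x' \<in> ?D" "x = \<pi> x'" using x by (rule imageE)
    obtain y' where y': "y' \<in> ?D" "y = \<pi> y'" using y by (rule imageE)
    show ?thesis by (rule image_eqI[of _ _ "bracket G x' y'"], unfold x'(2) y'(2), rule pb[OF d(1)[OF x'(1)] d(1)[OF y'(1)], symmetric], rule Db[OF x'(1) y'(1)])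
   qed
   show "P s \<in> \<pi> ` ?D" if "s \<in> gens r W" for s
    by (rule image_eqI[of _ _ "X s"], rule pi_X[OF that, symmetric], rule DX[OF that])
  qed
  hence "?D = carrier G" using subalgebra_eq_universal_extension[OF G D Db] by blast
  thus "\<phi> \<in> rep_hom (carrier G) M M'" using h(1) lm c by (auto simp: rep_hom_def)
 qed
qed

end

subsection \<open>Transport of Lie algebras\<close>

definition transport_lie :: "('l => 'e) => ('k, 'l) lie => ('k, 'e) lie" where
 "transport_lie j E = \<lparr>carrier = carrier (transport j E), mult = mult (transport j E), one = one (transport j E),
  zero = zero (transport j E), add = add (transport j E), smult = smult (transport j E),
  bracket = (\<lambda>x y. j (bracket E (inv_into (carrier E) j x) (inv_into (carrier E) j y)))\<rparr>"

lemma central_extension_transport: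
 fixes E :: "('k::field, 'm) lie" and j :: "'m => 'e"
 assumes ce: "central_extension E \<pi> L" and j: "inj_on j (carrier E)"
 shows "central_extension (transport_lie j E) (\<lambda>x. \<pi> (inv_into (carrier E) j x)) L"
  and "lie_hom (transport_lie j E) E (inv_into (carrier E) j)"
proof -
 interpret central_ext E \<pi> L by unfold_locales fact
 let ?T = "transport_lie j E" and ?i = "inv_into (carrier E) j"
 have s: "same_space (transport j E) ?T" by (simp add: same_space_def transport_lie_def)
 have sE: "same_space E E" "same_space L L" by (simp_all add: same_space_def)
 have vT: "vsp ?T" by (rule same_space_vsp[OF s vsp_transport(1)[OF g(1) j]])
 have lj: "lmap E ?T j" using vsp_transport(2)[OF g(1) j] unfolding same_space_lmap[OF sE(1) s] .
 have li: "lmap ?T E ?i" using vsp_transport(3)[OF g(1) j] unfolding same_space_lmap[OF s sE(1)] .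
 note i = lmapD[OF li]
 have cT: "carrier ?T = j ` carrier E" by (simp add: transport_lie_def)
 have ji: "j (?i x) = x" if "x \<in> carrier ?T" for x using that f_inv_into_f[of x j "carrier E"] by (simp add: cT)
 have ij: "?i (j x) = x" if "x \<in> carrier E" for x using that j by (simp add: inv_into_f_f)
 have bT: "bracket ?T x y = j (bracket E (?i x) (?i y))" for x y by (simp add: transport_lie_def)
 have ib: "?i (bracket ?T x y) = bracket E (?i x) (?i y)" if "x \<in> carrier ?T" "y \<in> carrier ?T" for x y
  unfolding bT using ij g(5) i(3) that by blast
 show h: "lie_hom ?T E ?i" unfolding lie_hom_def using li ib by blast
 have eq: "x = y" if "x \<in> carrier ?T" "y \<in> carrier ?T" "?i x = ?i y" for x y using ji that by metis
 have bc: "bracket ?T x y \<in> carrier ?T" if "x \<in> carrier ?T" "y \<in> carrier ?T" for x y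
  unfolding bT using lmapD(3)[OF lj] g(5) i(3) that by blast
 note vTs = vsp_simps[OF vT]
 have zero: "x = \<zero>\<^bsub>?T\<^esub>" if "x \<in> carrier ?T" "?i x = \<zero>\<^bsub>E\<^esub>" for x using eq[OF that(1) vTs(1)] that(2) i(6) by simp
 have "lie_algebra ?T"
  unfolding lie_algebra_def bilinear_map_def
 proof (intro conjI ballI vT)
  fix x assume x: "x \<in> carrier ?T"
  have "lmap ?T ?T (\<lambda>y. j (bracket E (?i x) (?i y)))" "lmap ?T ?T (\<lambda>y. j (bracket E (?i y) (?i x)))"
   by (rule lmap_comp[OF lmap_comp[OF li g(2)[OF i(3)[OF x]]] lj],
    rule lmap_comp[OF lmap_comp[OF li g(3)[OF i(3)[OF x]]] lj])
  thus "lmap ?T ?T (bracket ?T x)" "lmap ?T ?T (\<lambda>y. bracket ?T y x)" by (simp_all add: transport_lie_def)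
  show "bracket ?T x x = \<zero>\<^bsub>?T\<^esub>" by (rule zero[OF bc[OF x x]]) (simp add: ib x g(4) i(3))
  fix y z assume y: "y \<in> carrier ?T" and z: "z \<in> carrier ?T"
  show "bracket ?T x (bracket ?T y z) \<oplus>\<^bsub>?T\<^esub> bracket ?T y (bracket ?T z x) \<oplus>\<^bsub>?T\<^esub> bracket ?T z (bracket ?T x y) = \<zero>\<^bsub>?T\<^esub>"
   by (rule zero) (simp_all add: x y z bc vTs(2) i(3,4) ib g(6))
 qed
 moreover have "(\<lambda>x. \<pi> (?i x)) ` carrier ?T = carrier L"
 proof -
  have "(\<lambda>x. \<pi> (?i x)) ` carrier ?T = \<pi> ` carrier E" unfolding cT image_image using ij by (intro image_cong) auto
  thus ?thesis unfolding GL(4) .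
 qed
 moreover have "bracket ?T x y = \<zero>\<^bsub>?T\<^esub>" if "x \<in> carrier ?T" "\<pi> (?i x) = \<zero>\<^bsub>L\<^esub>" "y \<in> carrier ?T" for x y
  by (rule zero) (simp_all add: bc that ib central i(3))
 ultimately show "central_extension ?T (\<lambda>x. \<pi> (?i x)) L"
  unfolding central_extension_def using GL(2) lie_hom_comp[OF h GL(3)] by blast
qed

text \<open>Iterated pairing: an injection of A x A into A encodes the lists of a fixed length over
  A in A.\<close>

fun code :: "('e \<times> 'e => 'e) => 'e => 'e list => 'e" where
 "code b z [] = z"
| "code b z (x # xs) = b (x, code b z xs)"

lemma code_inj:
 assumes b: "inj_on b (A \<times> A)" "b ` (A \<times> A) \<subseteq> A" "z \<in> A" and "set xs \<subseteq> A" "set ys \<subseteq> A" "length xs = length ys" "code b z xs = code b z ys"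
 shows "xs = ys"
proof -
 have cl: "code b z us \<in> A" if "set us \<subseteq> A" for us using that b(2,3) by (induction us) auto
 show ?thesis using assms(6,4,5,7)
 proof (induction xs ys rule: list_induct2)
  case (Cons x xs y ys)
  hence "(x, code b z xs) = (y, code b z ys)" using cl by (intro inj_onD[OF b(1)]) auto
  thus ?case using Cons by simp
 qed simp
qed

subsection \<open>Operators determined by finitely many entries\<close>

lemma app_sum: "app T (\<Sum>b\<in>B. f b) = (\<Sum>b\<in>B. app T (f b))"
proof (induction B rule: infinite_finite_induct)
 case (insert a B)
 have "app T (sum f (insert a B)) = app T (f a + sum f B)" unfolding sum.insert[OF insert(1,2)] ..
 also have "\<dots> = app T (f a) + (\<Sum>b\<in>B. app T (f b))" unfolding app_add insert(3) ..
 finally show ?case unfolding sum.insert[OF insert(1,2)] .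
qed (use app_smult[of T 0 "0"] in \<open>simp_all add: zero_fun_def\<close>)

text \<open>An operator cut down by \<open>Pr N\<close> on both sides is determined by its matrix in
  the chosen basis. This finite set of scalars is what gets encoded when operators are copied to
  another type.\<close>

lemma endo_eq_if_entries:
 fixes N :: "('k::field, 'v, 'x) module_scheme"
 assumes N: "fd_vectorspace N" and T: "Pr N * S = S" "S * Pr N = S" "Pr N * T = T" "T * Pr N = T"
  and eq: "\<And>b b'. [|b \<in> coord_basis N; b' \<in> coord_basis N|] ==> app S (\<lambda>v. if v = b then 1 else 0) b' = app T (\<lambda>v. if v = b then 1 else 0) b'"
 shows "S = T"
proof (rule endo_eqI, rule ext)
 fix \<phi> v
 let ?B = "coord_basis N"
 have id: "lmap N N (\<lambda>x. x)" using lmap_id fdD(1)[OF N] .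
 have P: "app (Pr N) \<chi> = kappa N (iota N \<chi>)" for \<chi> using app_Op[OF N N id] .
 let ?\<psi> = "app (Pr N) \<phi>"
 have out: "app (Pr N) \<chi> b = 0" if "b \<notin> ?B" for \<chi> b unfolding P using kappa_outside[OF N iota_closed[OF N]] that by blast
 have sum_app: "(\<Sum>b\<in>B. f b) v = (\<Sum>b\<in>B. f b v)" for B v and f :: "'v => 'v => 'k"
  by (induction B rule: infinite_finite_induct) simp_all
 have \<psi>: "?\<psi> = (\<Sum>b\<in>?B. (\<lambda>v. ?\<psi> b * (if v = b then 1 else 0)))"
 proof
  fix v
  have "(\<Sum>b\<in>?B. (\<lambda>v. ?\<psi> b * (if v = b then 1 else 0))) v = (\<Sum>b\<in>?B. ?\<psi> b * (if v = b then 1 else 0))"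
   by (rule sum_app)
  also have "\<dots> = ?\<psi> v" using out[of v \<phi>] coord_basis(1)[OF N] by (cases "v \<in> ?B") (simp_all add: if_distrib[of "\<lambda>a. _ * a"] cong: if_cong)
  finally show "?\<psi> v = (\<Sum>b\<in>?B. (\<lambda>v. ?\<psi> b * (if v = b then 1 else 0))) v" by simp
 qed
 have ex: "app U \<phi> v = (\<Sum>b\<in>?B. ?\<psi> b * app U (\<lambda>v. if v = b then 1 else 0) v)" if "U * Pr N = U" for U
 proof -
  have "app U \<phi> = app U ?\<psi>" using arg_cong[OF that, of "\<lambda>S. app S \<phi>"] by simp
  also have "\<dots> = app U (\<Sum>b\<in>?B. (\<lambda>v. ?\<psi> b * (if v = b then 1 else 0)))" using \<psi> by (rule arg_cong)
  also have "\<dots> = (\<Sum>b\<in>?B. (\<lambda>v. ?\<psi> b * app U (\<lambda>v. if v = b then 1 else 0) v))" unfolding app_sum by (simp only: app_smult)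
  finally show ?thesis by (simp only: sum_app)
 qed
 show "app S \<phi> v = app T \<phi> v"
 proof (cases "v \<in> ?B")
  case True
  thus ?thesis unfolding ex[OF T(2)] ex[OF T(4)] using eq by (intro sum.cong) simp_all
 next
  case False
  have "app U \<phi> v = 0" if "Pr N * U = U" for U
   using out[OF False, of "app U \<phi>"] arg_cong[OF that, of "\<lambda>S. app S \<phi> v"] by simp
  thus ?thesis using T by simp
 qed
qed

subsection \<open>The spin action up to central operators\<close>

text \<open>The intersection of the commutant and the bicommutant of the Clifford operators, cut
  down by \<open>Pr N\<close>. The first condition makes its elements central for the action, the
  second makes them commute with each other; products of two operators c_w and c_w' qualify.\<close>

definition ccenter :: "nat => ('k::field, 'w) module => ('k, nat + 'w, 'v) rep => ('v, 'k) endo set" where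
 "ccenter r W N = {T. Pr N * T = T \<and> T * Pr N = T \<and> (\<forall>s\<in>gens r W. T * cop N s = cop N s * T) \<and>
  (\<forall>S. (\<forall>s\<in>gens r W. S * cop N s = cop N s * S) \<longrightarrow> T * S = S * T)}"

lemma ccenterD:
 assumes "T \<in> ccenter r W N"
 shows "Pr N * T = T" "T * Pr N = T" "s \<in> gens r W ==> T * cop N s = cop N s * T"
  "S \<in> ccenter r W N ==> T * S = S * T"
 using assms unfolding ccenter_def by blast+

lemma ccenter_closed:
 fixes N :: "('k::field, nat + 'w, 'v) rep"
 shows "0 \<in> ccenter r W N" "[|S \<in> ccenter r W N; T \<in> ccenter r W N|] ==> S + T \<in> ccenter r W N"
 "[|S \<in> ccenter r W N; T \<in> ccenter r W N|] ==> S - T \<in> ccenter r W N"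
 "T \<in> ccenter r W N ==> sc c * T \<in> ccenter r W N"
proof -
 show "0 \<in> ccenter r W N" "[|S \<in> ccenter r W N; T \<in> ccenter r W N|] ==> S + T \<in> ccenter r W N"
  "[|S \<in> ccenter r W N; T \<in> ccenter r W N|] ==> S - T \<in> ccenter r W N"
  by (auto simp: ccenter_def distrib_left distrib_right left_diff_distrib right_diff_distrib)
 have l: "S * (sc c * T) = sc c * (S * T)" for S T :: "('v, 'k) endo" by (rule sc_left_commute)
 show "T \<in> ccenter r W N ==> sc c * T \<in> ccenter r W N"
  by (simp add: ccenter_def l mult.assoc)
qed

text \<open>A linear map to operators that is a homomorphism up to \<open>ccenter\<close>. The
  condition is imposed only on brackets of generators; its extension to all of L is
  \<open>defect\<close>.\<close>

locale spin_map = cliff_lie r W L P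
 for r :: nat and W :: "('k::{alg_closed_field, field_char_0}, 'w) module" and L :: "('k, 'l) lie" (structure) and P :: "nat + 'w => 'l" +
 fixes N :: "('k, nat + 'w, 'v) rep" and \<sigma> :: "'l => ('v, 'k) endo"
 assumes N: "cliff_module r W N"
  and \<sigma>_add: "[|a \<in> carrier L; b \<in> carrier L|] ==> \<sigma> (a \<oplus> b) = \<sigma> a + \<sigma> b"
  and \<sigma>_smult: "a \<in> carrier L ==> \<sigma> (c \<odot> a) = sc c * \<sigma> a"
  and \<sigma>_P: "s \<in> gens r W ==> \<sigma> (P s) = sc (1 / 2) * cop N s"
  and \<sigma>_PP: "[|s \<in> gens r W; t \<in> gens r W|] ==>
   sc (1 / 4) * cm (cop N s) (cop N t) - \<sigma> (bracket L (P s) (P t)) \<in> ccenter r W N"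
begin

abbreviation (input) "Z \<equiv> ccenter r W N"
abbreviation (input) "d s \<equiv> cop N s"
abbreviation (input) "\<delta> a b \<equiv> cm (\<sigma> a) (\<sigma> b) - \<sigma> (bracket L a b)"

lemmas zD = ccenterD[where r = r and W = W and N = N]
lemmas zc = ccenter_closed[where r = r and W = W and N = N]
lemmas n = cop_simps[OF N]

lemma \<sigma>_zero: "\<sigma> \<zero> = 0"
 using \<sigma>_smult[OF w(1), of 0] w(11)[OF w(1)] by simp

lemma \<sigma>_PP': 
 assumes "s \<in> gens r W" "t \<in> gens r W"
 obtains z where "z \<in> Z" "\<sigma> (bracket L (P s) (P t)) = sc (1 / 4) * cm (d s) (d t) - z"
proof -
 have "\<sigma> (bracket L (P s) (P t)) = sc (1 / 4) * cm (d s) (d t) - (sc (1 / 4) * cm (d s) (d t) - \<sigma> (bracket L (P s) (P t)))" by simp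
 thus ?thesis using that \<sigma>_PP[OF assms] by blast
qed

text \<open>By the spanning property of L it suffices to look at generators and their brackets, and
  on a bracket \<sigma> is a commutator of Clifford operators minus a central term.\<close>

lemma central_\<sigma>:
 assumes z: "z \<in> Z" and a: "a \<in> carrier L"
 shows "z * \<sigma> a = \<sigma> a * z"
proof -
 let ?K = "{a \<in> carrier L. z * \<sigma> a = \<sigma> a * z}"
 have sl: "S * (sc c * T) = sc c * (S * T)" for c and S T :: "('v, 'k) endo" by (rule sc_left_commute)
 have "?K = carrier L"
 proof (rule span)
  show "VectorSpace.subspace class_ring ?K L"
   by (rule subspaceI_vsp[OF la(1)]) (auto simp: w(1-3) \<sigma>_zero \<sigma>_add \<sigma>_smult distrib_left distrib_right sl mult.assoc)
  show "P s \<in> ?K" if "s \<in> gens r W" for s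
   using P[OF that] zD(3)[OF z that] by (simp add: \<sigma>_P[OF that] sl mult.assoc)
  fix s t assume st: "s \<in> gens r W" "t \<in> gens r W"
  obtain z' where z': "z' \<in> Z" "\<sigma> (bracket L (P s) (P t)) = sc (1 / 4) * cm (d s) (d t) - z'" using \<sigma>_PP'[OF st] .
  have "z * (d s * d t) = (d s * d t) * z" if "s \<in> gens r W" "t \<in> gens r W" for s t
  proof -
   have "z * (d s * d t) = (z * d s) * d t" by (simp only: mult.assoc)
   also have "\<dots> = d s * (z * d t)" unfolding zD(3)[OF z that(1)] by (rule mult.assoc)
   also have "\<dots> = (d s * d t) * z" unfolding zD(3)[OF z that(2)] by (rule mult.assoc[symmetric])
   finally show ?thesis .
  qed
  hence "z * (sc (1 / 4) * cm (d s) (d t)) = (sc (1 / 4) * cm (d s) (d t)) * z"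
   using st by (simp only: sl mult.assoc right_diff_distrib left_diff_distrib)
  thus "bracket L (P s) (P t) \<in> ?K"
   using zD(4)[OF z z'(1)] PP_closed[OF st] unfolding mem_Collect_eq z'(2) right_diff_distrib left_diff_distrib by simp
 qed
 thus ?thesis using a by blast
qed

lemma \<sigma>_proj:
 assumes a: "a \<in> carrier L"
 shows "Pr N * \<sigma> a = \<sigma> a \<and> \<sigma> a * Pr N = \<sigma> a"
proof -
 let ?K = "{a \<in> carrier L. Pr N * \<sigma> a = \<sigma> a \<and> \<sigma> a * Pr N = \<sigma> a}"
 have sl: "S * (sc c * T) = sc c * (S * T)" for c and S T :: "('v, 'k) endo" by (rule sc_left_commute)
 have "?K = carrier L"
 proof (rule span)
  show "VectorSpace.subspace class_ring ?K L"
   by (rule subspaceI_vsp[OF la(1)]) (auto simp: w(1-3) \<sigma>_zero \<sigma>_add \<sigma>_smult distrib_left distrib_right sl mult.assoc)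
  show "P s \<in> ?K" if "s \<in> gens r W" for s
   using P[OF that] n(1,2)[OF that] by (simp add: \<sigma>_P[OF that] sl mult.assoc)
  fix s t assume st: "s \<in> gens r W" "t \<in> gens r W"
  obtain z' where z': "z' \<in> Z" "\<sigma> (bracket L (P s) (P t)) = sc (1 / 4) * cm (d s) (d t) - z'" using \<sigma>_PP'[OF st] .
  have "Pr N * (d s * d t) = d s * d t" "d s * d t * Pr N = d s * d t" if "s \<in> gens r W" "t \<in> gens r W" for s t
   using n(1,2) that by (simp_all add: mult.assoc) (simp add: n(1) that flip: mult.assoc)
  hence "Pr N * (sc (1 / 4) * cm (d s) (d t)) = sc (1 / 4) * cm (d s) (d t)" "(sc (1 / 4) * cm (d s) (d t)) * Pr N = sc (1 / 4) * cm (d s) (d t)"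
   using st by (simp_all only: sl mult.assoc right_diff_distrib left_diff_distrib)
  thus "bracket L (P s) (P t) \<in> ?K"
   using zD(1,2)[OF z'(1)] PP_closed[OF st] unfolding mem_Collect_eq z'(2) right_diff_distrib left_diff_distrib by simp
 qed
 thus ?thesis using a by blast
qed

lemma triple_ring: "cm x (cm y z) = (x * y + y * x) * z + z * (x * y + y * x) - (y * (x * z + z * x) + (x * z + z * x) * y)"
 for x y z :: "'a::ring"
 by (simp add: algebra_simps)

text \<open>The central error in the inner bracket drops out of the commutator, and the Clifford
  relations evaluate the remaining double commutator exactly. So \<sigma> has no defect between P
  and [P,P].\<close>

lemma \<sigma>_triple:
 assumes "s \<in> gens r W" "t \<in> gens r W" "u \<in> gens r W"
 shows "cm (\<sigma> (P s)) (\<sigma> (bracket L (P t) (P u))) = \<sigma> (bracket L (P s) (bracket L (P t) (P u)))"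
proof -
 have sl: "S * (sc c * T) = sc c * (S * T)" for c and S T :: "('v, 'k) endo" by (rule sc_left_commute)
 obtain z where z: "z \<in> Z" "\<sigma> (bracket L (P t) (P u)) = sc (1 / 4) * cm (d t) (d u) - z" using \<sigma>_PP'[OF assms(2,3)] .
 have "cm (\<sigma> (P s)) (\<sigma> (bracket L (P t) (P u))) = cm (\<sigma> (P s)) (sc (1 / 4) * cm (d t) (d u))"
  unfolding z(2) using central_\<sigma>[OF z(1) P[OF assms(1)]] by (simp add: right_diff_distrib left_diff_distrib)
 also have "\<dots> = sc (1 / 8) * cm (d s) (cm (d t) (d u))"
  unfolding \<sigma>_P[OF assms(1)] cm_scale by simp
 also have "cm (d s) (cm (d t) (d u)) = sc (- 4 * cform s t) * d u + sc (4 * cform s u) * d t"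
 proof -
  have two: "sc (c + c) * T = sc c * T + sc c * T" for c and T :: "('v, 'k) endo" by (simp only: sc_add distrib_right)
  have "cm (d s) (cm (d t) (d u)) = sc (- 2 * cform s t) * d u + sc (- 2 * cform s t) * d u - (sc (- 2 * cform s u) * d t + sc (- 2 * cform s u) * d t)"
   unfolding triple_ring n(4)[OF assms(1,2)] n(4)[OF assms(1,3)] using n(1,2)[OF assms(2)] n(1,2)[OF assms(3)]
   by (simp only: sl mult.assoc)
  thus ?thesis unfolding two[symmetric] by simp
 qed
 also have "sc (1 / 8) * (sc (- 4 * cform s t) * d u + sc (4 * cform s u) * d t) = sc (- cform s t) * \<sigma> (P u) + sc (cform s u) * \<sigma> (P t)"
  unfolding \<sigma>_P[OF assms(2)] \<sigma>_P[OF assms(3)] distrib_left sc_sc by simp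
 also have "\<dots> = \<sigma> (bracket L (P s) (bracket L (P t) (P u)))"
  unfolding triple[OF assms] using P assms by (simp add: \<sigma>_add \<sigma>_smult w(3))
 finally show ?thesis .
qed

lemma \<sigma>_smult_left: "cm (sc c * S) T = sc c * cm S T" "cm S (sc c * T) = sc c * cm S T" for S T :: "('v, 'k) endo"
 by (simp_all only: sc_left_commute[of S] sc_left_commute[of T] mult.assoc right_diff_distrib)

text \<open>For fixed s the defect is linear in b; it is central on generators by assumption and
  vanishes on their brackets by \<open>\<sigma>_triple\<close>.\<close>

lemma defect_P:
 assumes s: "s \<in> gens r W" and b: "b \<in> carrier L"
 shows "\<delta> (P s) b \<in> Z"
proof -
 let ?K = "{b \<in> carrier L. \<delta> (P s) b \<in> Z}"
 note bl = P_bracket_linear[OF P[OF s]]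
 have "?K = carrier L"
 proof (rule span)
  show "VectorSpace.subspace class_ring ?K L"
  proof (rule subspaceI_vsp[OF la(1)])
   show "\<zero> \<in> ?K" using zc(1) lmapD(6)[OF la(2)[OF P[OF s]]] by (simp add: w(1) \<sigma>_zero)
   show "x \<oplus> y \<in> ?K" if "x \<in> ?K" "y \<in> ?K" for x y
   proof -
    have "\<delta> (P s) (x \<oplus> y) = \<delta> (P s) x + \<delta> (P s) y"
     using that la(5)[OF P[OF s]] by (simp add: bl \<sigma>_add distrib_left distrib_right)
    thus ?thesis using that zc(2) w(2) by simp
   qed
   show "c \<odot> x \<in> ?K" if "x \<in> ?K" for c x
   proof -
    have "\<delta> (P s) (c \<odot> x) = sc c * \<delta> (P s) x"
     using that la(5)[OF P[OF s]] bl(3)[of x x c] by (simp add: \<sigma>_smult \<sigma>_smult_left right_diff_distrib)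
    thus ?thesis using that zc(4) w(3) by simp
   qed
  qed auto
  show "P t \<in> ?K" if t: "t \<in> gens r W" for t
  proof -
   have "cm (\<sigma> (P s)) (\<sigma> (P t)) = sc (1 / 4) * cm (d s) (d t)" unfolding \<sigma>_P[OF s] \<sigma>_P[OF t] cm_scale by simp
   thus ?thesis using \<sigma>_PP[OF s t] P[OF t] by simp
  qed
  show "bracket L (P t) (P u) \<in> ?K" if "t \<in> gens r W" "u \<in> gens r W" for t u
   using \<sigma>_triple[OF s that] PP_closed[OF that] zc(1) by simp
 qed
 thus ?thesis using b by blast
qed

lemma jacobi:
 assumes "x \<in> carrier L" "y \<in> carrier L" "z \<in> carrier L"
 shows "bracket L (bracket L x y) z = bracket L x (bracket L y z) \<oplus> (- 1) \<odot> bracket L y (bracket L x z)"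
proof (rule vsp_eqI[OF la(1), symmetric])
 note c = la(5)
 have "bracket L y (bracket L z x) = (- 1) \<odot> bracket L y (bracket L x z)"
  using bracket_skew[OF lie assms(3,1)] P_bracket_linear(3)[OF assms(2) c[OF assms(1,3)] c[OF assms(1,3)], of "- 1"] by simp
 thus "bracket L x (bracket L y z) \<oplus> (- 1) \<odot> bracket L y (bracket L x z) \<oplus> (- 1) \<odot> bracket L (bracket L x y) z = \<zero>"
  using la(6)[OF assms] bracket_skew[OF lie assms(3) c[OF assms(1,2)]] by simp
qed (use assms la(5) w(2,3) in auto)

text \<open>The elements with central defect against everything form a subalgebra: by the Jacobi
  identity in L and among operators, the defect of [x,y] against b is the defect of x against [y,b]
  minus that of y against [x,b]. Since it contains the generators, it is L.\<close>

lemma defect: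
 assumes a: "a \<in> carrier L" and b: "b \<in> carrier L"
 shows "\<delta> a b \<in> Z"
proof -
 let ?K = "{a \<in> carrier L. \<forall>b\<in>carrier L. \<delta> a b \<in> Z}"
 note bl = P_bracket_linear
 have "?K = carrier L"
 proof (rule generated)
  show "VectorSpace.subspace class_ring ?K L"
  proof (rule subspaceI_vsp[OF la(1)])
   show "\<zero> \<in> ?K" using zc(1) lmapD(6)[OF la(3)] by (simp add: w(1) \<sigma>_zero)
   show "x \<oplus> y \<in> ?K" if "x \<in> ?K" "y \<in> ?K" for x y
   proof -
    have "\<delta> (x \<oplus> y) b = \<delta> x b + \<delta> y b" if "b \<in> carrier L" for b
     using \<open>x \<in> ?K\<close> \<open>y \<in> ?K\<close> that la(5) bl(2)[of b x y] by (simp add: \<sigma>_add distrib_left distrib_right)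
    thus ?thesis using that zc(2) w(2) by simp
   qed
   show "c \<odot> x \<in> ?K" if "x \<in> ?K" for c x
   proof -
    have "\<delta> (c \<odot> x) b = sc c * \<delta> x b" if "b \<in> carrier L" for b
     using \<open>x \<in> ?K\<close> that la(5) bl(4)[of b x x c] by (simp add: \<sigma>_smult \<sigma>_smult_left right_diff_distrib)
    thus ?thesis using that zc(4) w(3) by simp
   qed
  qed auto
  show "P s \<in> ?K" if "s \<in> gens r W" for s using defect_P[OF that] P[OF that] by blast
  fix x y assume "x \<in> ?K" "y \<in> ?K"
  hence x: "x \<in> carrier L" "\<And>b. b \<in> carrier L ==> \<delta> x b \<in> Z" and y: "y \<in> carrier L" "\<And>b. b \<in> carrier L ==> \<delta> y b \<in> Z" by auto
  have "\<delta> (bracket L x y) b \<in> Z" if b: "b \<in> carrier L" for b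
  proof -
   have xb: "bracket L x b \<in> carrier L" "bracket L y b \<in> carrier L" using la(5) x y b by auto
   have c: "cm z (\<sigma> q) = 0" "cm (\<sigma> q) z = 0" if "z \<in> Z" "q \<in> carrier L" for z q using central_\<sigma>[OF that] by simp_all
   let ?z0 = "\<delta> x y" and ?z1 = "\<delta> y b" and ?z2 = "\<delta> x b"
   have zs: "?z0 \<in> Z" "?z1 \<in> Z" "?z2 \<in> Z" using x y b by auto
   have "cm (\<sigma> (bracket L x y)) (\<sigma> b) = cm (cm (\<sigma> x) (\<sigma> y)) (\<sigma> b) - cm ?z0 (\<sigma> b)" by (simp add: left_diff_distrib right_diff_distrib)
   also have "\<dots> = cm (\<sigma> x) (cm (\<sigma> y) (\<sigma> b)) - cm (\<sigma> y) (cm (\<sigma> x) (\<sigma> b))" unfolding c(1)[OF zs(1) b] by (simp add: algebra_simps)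
   also have "cm (\<sigma> x) (cm (\<sigma> y) (\<sigma> b)) = cm (\<sigma> x) (\<sigma> (bracket L y b)) + cm (\<sigma> x) ?z1" by (simp add: left_diff_distrib right_diff_distrib)
   also have "cm (\<sigma> y) (cm (\<sigma> x) (\<sigma> b)) = cm (\<sigma> y) (\<sigma> (bracket L x b)) + cm (\<sigma> y) ?z2" by (simp add: left_diff_distrib right_diff_distrib)
   finally have e: "cm (\<sigma> (bracket L x y)) (\<sigma> b) = cm (\<sigma> x) (\<sigma> (bracket L y b)) - cm (\<sigma> y) (\<sigma> (bracket L x b))"
    unfolding c(2)[OF zs(2) x(1)] c(2)[OF zs(3) y(1)] by simp
   have "\<sigma> (bracket L (bracket L x y) b) = \<sigma> (bracket L x (bracket L y b)) - \<sigma> (bracket L y (bracket L x b))"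
    unfolding jacobi[OF x(1) y(1) b] using la(5)[OF x(1) xb(2)] la(5)[OF y(1) xb(1)] by (simp add: \<sigma>_add \<sigma>_smult w(3))
   hence "\<delta> (bracket L x y) b = \<delta> x (bracket L y b) - \<delta> y (bracket L x b)" unfolding e by simp
   thus ?thesis using x(2)[OF xb(2)] y(2)[OF xb(1)] zc(3) by simp
  qed
  thus "bracket L x y \<in> ?K" using la(5)[OF x(1) y(1)] by blast
 qed
 thus ?thesis using a b by blast
qed

text \<open>The pairs of an element a and an operator in the coset of \<sigma> a modulo the central
  operators. Its bracket is the plain commutator, so the Jacobi identity is inherited and no cocycle
  has to be written down; the kernel of the first projection consists of central operators.\<close>

definition spin_ext :: "('k, 'l \<times> ('v, 'k) endo) lie" where
 "spin_ext = \<lparr>carrier = {a. fst a \<in> carrier L \<and> snd a - \<sigma> (fst a) \<in> Z}, mult = (\<lambda>a b. a), one = (\<zero>, 0), zero = (\<zero>, 0),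
  add = (\<lambda>a b. (fst a \<oplus> fst b, snd a + snd b)), smult = (\<lambda>c a. (c \<odot> fst a, sc c * snd a)),
  bracket = (\<lambda>a b. (bracket L (fst a) (fst b), cm (snd a) (snd b)))\<rparr>"

lemma spin_ext_simps:
 "carrier spin_ext = {a. fst a \<in> carrier L \<and> snd a - \<sigma> (fst a) \<in> Z}" "\<zero>\<^bsub>spin_ext\<^esub> = (\<zero>, 0)"
 "a \<oplus>\<^bsub>spin_ext\<^esub> b = (fst a \<oplus> fst b, snd a + snd b)" "c \<odot>\<^bsub>spin_ext\<^esub> a = (c \<odot> fst a, sc c * snd a)"
 "bracket spin_ext a b = (bracket L (fst a) (fst b), cm (snd a) (snd b))"
 by (simp_all add: spin_ext_def)

lemma spin_ext_mem:
 assumes "a \<in> carrier spin_ext"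
 obtains z where "z \<in> Z" "snd a = \<sigma> (fst a) + z" "fst a \<in> carrier L"
 using that[of "snd a - \<sigma> (fst a)"] assms by (simp add: spin_ext_simps)

lemma cm_spin_ext:
 assumes a: "a \<in> carrier spin_ext" and b: "b \<in> carrier spin_ext"
 shows "cm (snd a) (snd b) = cm (\<sigma> (fst a)) (\<sigma> (fst b))"
proof -
 obtain y where y: "y \<in> Z" "snd a = \<sigma> (fst a) + y" "fst a \<in> carrier L" using spin_ext_mem[OF a] .
 obtain z where z: "z \<in> Z" "snd b = \<sigma> (fst b) + z" "fst b \<in> carrier L" using spin_ext_mem[OF b] .
 show ?thesis unfolding y(2) z(2)
  using central_\<sigma>[OF y(1) z(3)] central_\<sigma>[OF z(1) y(3)] zD(4)[OF y(1) z(1)] by (simp add: distrib_left distrib_right)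
qed

lemma spin_ext_closed:
 assumes a: "a \<in> carrier spin_ext" and b: "b \<in> carrier spin_ext"
 shows "a \<oplus>\<^bsub>spin_ext\<^esub> b \<in> carrier spin_ext" "c \<odot>\<^bsub>spin_ext\<^esub> a \<in> carrier spin_ext" "bracket spin_ext a b \<in> carrier spin_ext"
proof -
 have c: "fst a \<in> carrier L" "fst b \<in> carrier L" "snd a - \<sigma> (fst a) \<in> Z" "snd b - \<sigma> (fst b) \<in> Z" using a b by (simp_all add: spin_ext_simps)
 have e: "snd a + snd b - (\<sigma> (fst a) + \<sigma> (fst b)) = (snd a - \<sigma> (fst a)) + (snd b - \<sigma> (fst b))" by simp
 have "snd a + snd b - (\<sigma> (fst a) + \<sigma> (fst b)) \<in> Z" unfolding e by (rule zc(2)[OF c(3,4)])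
 thus "a \<oplus>\<^bsub>spin_ext\<^esub> b \<in> carrier spin_ext" using c(1,2) w(2) by (simp add: spin_ext_simps \<sigma>_add)
 show "c \<odot>\<^bsub>spin_ext\<^esub> a \<in> carrier spin_ext" using c zc(4)[OF c(3), of c] w(3) by (simp add: spin_ext_simps \<sigma>_smult right_diff_distrib)
 show "bracket spin_ext a b \<in> carrier spin_ext"
  using c defect la(5) cm_spin_ext[OF a b] by (simp add: spin_ext_simps)
qed

lemma central_extension_spin: "central_extension spin_ext fst L"
proof -
 interpret V: vectorspace class_ring L by (rule la(1))
 let ?E = spin_ext
 have z: "\<zero>\<^bsub>?E\<^esub> \<in> carrier ?E" using zc(1) w(1) by (simp add: spin_ext_simps \<sigma>_zero)
 have f: "fst a \<in> carrier L" if "a \<in> carrier ?E" for a using that by (simp add: spin_ext_simps)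
 have vE: "vsp ?E"
 proof (rule vspI[OF z spin_ext_closed(1,2)])
 qed (use f in \<open>simp_all add: spin_ext_simps(2-5) w(1-3,6-16) V.a_ac sc_add sc_mult distrib_left distrib_right mult.assoc add_ac\<close>)
 note bl = P_bracket_linear
 have "lie_algebra ?E"
  unfolding lie_algebra_def bilinear_map_def
 proof (intro conjI ballI vE lmapI spin_ext_closed(3))
  fix x y c assume xy: "x \<in> carrier ?E" "y \<in> carrier ?E"
  show "bracket ?E x (c \<odot>\<^bsub>?E\<^esub> y) = c \<odot>\<^bsub>?E\<^esub> bracket ?E x y" "bracket ?E (c \<odot>\<^bsub>?E\<^esub> y) x = c \<odot>\<^bsub>?E\<^esub> bracket ?E y x"
   using bl(3)[OF f[OF xy(1)] f[OF xy(2)] f[OF xy(2)], of c] bl(4)[OF f[OF xy(1)] f[OF xy(2)] f[OF xy(2)], of c]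
   by (simp_all add: spin_ext_simps \<sigma>_smult_left)
  show "bracket ?E x x = \<zero>\<^bsub>?E\<^esub>" using la(4)[OF f[OF xy(1)]] by (simp add: spin_ext_simps)
  fix z assume z: "z \<in> carrier ?E"
  show "bracket ?E x (y \<oplus>\<^bsub>?E\<^esub> z) = bracket ?E x y \<oplus>\<^bsub>?E\<^esub> bracket ?E x z" "bracket ?E (y \<oplus>\<^bsub>?E\<^esub> z) x = bracket ?E y x \<oplus>\<^bsub>?E\<^esub> bracket ?E z x"
   using bl(1,2)[OF f[OF xy(1)] f[OF xy(2)] f[OF z]] by (simp_all add: spin_ext_simps distrib_left distrib_right)
  show "bracket ?E x (bracket ?E y z) \<oplus>\<^bsub>?E\<^esub> bracket ?E y (bracket ?E z x) \<oplus>\<^bsub>?E\<^esub> bracket ?E z (bracket ?E x y) = \<zero>\<^bsub>?E\<^esub>"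
   using la(6)[OF f[OF xy(1)] f[OF xy(2)] f[OF z]] by (simp add: spin_ext_simps algebra_simps)
 qed
 moreover have "lie_hom ?E L fst"
  unfolding lie_hom_def using f by (auto intro!: lmapI vE la(1) simp: spin_ext_simps)
 moreover have "fst ` carrier ?E = carrier L"
 proof -
  have "a \<in> fst ` carrier ?E" if "a \<in> carrier L" for a
   using that zc(1) by (intro image_eqI[of _ _ "(a, \<sigma> a)"]) (simp_all add: spin_ext_simps)
  thus ?thesis using f by blast
 qed
 moreover have "bracket ?E x y = \<zero>\<^bsub>?E\<^esub>" if "x \<in> carrier ?E" "fst x = \<zero>" "y \<in> carrier ?E" for x y
  using cm_spin_ext[OF that(1,3)] that(2) lmapD(6)[OF la(3)[OF f[OF that(3)]]] by (simp add: spin_ext_simps \<sigma>_zero)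
 ultimately show ?thesis unfolding central_extension_def using lie by blast
qed

lemma spin_ext_proj: "a \<in> carrier spin_ext ==> Pr N * snd a = snd a \<and> snd a * Pr N = snd a"
 using \<sigma>_proj[of "fst a"] zD(1,2) by (elim spin_ext_mem) (simp add: distrib_left distrib_right)

text \<open>Universality only speaks about Lie algebras on the type \<open>'e\<close>, so \<open>spin_ext\<close> has to be copied there; an operator is coded
 by its finite matrix, and scalars by their multiples of a fixed element of \<open>G\<close>.\<close>

lemma spin_ext_inj:
 fixes G :: "('k, 'e) lie"
 assumes ce: "central_extension G \<pi> L" and nz: "x0 \<in> carrier G" "x0 \<noteq> \<zero>\<^bsub>G\<^esub>"
 shows "\<exists>j :: 'l \<times> ('v, 'k) endo => 'e. inj_on j (carrier spin_ext)"
proof -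
 interpret central_ext G \<pi> L by unfold_locales fact
 note fd = cliffD(1)[OF N]
 obtain b where b: "bij_betw b (carrier G \<times> carrier G) (carrier G)" using vsp_square_bij[OF g(1)] by blast
 obtain bs where bs: "set bs = coord_basis N \<times> coord_basis N"
  using finite_list[OF finite_cartesian_product[OF coord_basis(1)[OF fd] coord_basis(1)[OF fd]]] by blast
 let ?en = "\<lambda>T (u, v). app T (\<lambda>v'. if v' = u then 1 else 0) v \<odot>\<^bsub>G\<^esub> x0"
 let ?l = "\<lambda>a. lift (fst a) # map (?en (snd a)) bs"
 have "inj_on (\<lambda>a. code b \<zero>\<^bsub>G\<^esub> (?l a)) (carrier spin_ext)"
 proof (rule inj_onI)
  fix x y assume x: "x \<in> carrier spin_ext" and y: "y \<in> carrier spin_ext" and eq: "code b \<zero>\<^bsub>G\<^esub> (?l x) = code b \<zero>\<^bsub>G\<^esub> (?l y)"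
  have f: "fst x \<in> carrier L" "fst y \<in> carrier L" using x y by (simp_all add: spin_ext_simps)
  have cl: "set (?l a) \<subseteq> carrier G" if "fst a \<in> carrier L" for a
   using lift(1)[OF that] nz(1) vG(3) by auto
  have "?l x = ?l y"
   by (rule code_inj[of b "carrier G" "\<zero>\<^bsub>G\<^esub>"]) (use b vG(1) cl f eq in \<open>simp_all add: bij_betw_def\<close>)
  hence "lift (fst x) = lift (fst y)" and m: "map (?en (snd x)) bs = map (?en (snd y)) bs" by auto
  hence "fst x = fst y" using lift(2)[OF f(1)] lift(2)[OF f(2)] by metis
  moreover have "snd x = snd y"
  proof (rule endo_eq_if_entries[OF fd])
   fix u v assume "u \<in> coord_basis N" "v \<in> coord_basis N"
   hence "(u, v) \<in> set bs" using bs by blast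
   hence "?en (snd x) (u, v) = ?en (snd y) (u, v)" using m unfolding map_eq_conv by blast
   thus "app (snd x) (\<lambda>v'. if v' = u then 1 else 0) v = app (snd y) (\<lambda>v'. if v' = u then 1 else 0) v"
    using injD[OF vsp_infinite(1)[OF g(1) nz]] by simp
  qed (use spin_ext_proj x y in auto)
  ultimately show "x = y" by (simp add: prod_eq_iff)
 qed
 thus ?thesis by blast
qed

end

section \<open>Lie modules from Clifford modules\<close>

context cliff_ext
begin

text \<open>Universality, applied to a copy of \<open>spin_ext\<close> on the type
  \<open>'e\<close>, gives a homomorphism from G over L; its operator component \<tau> is the
  action. What remains is that the canonical lifts act as half the generators and that the triple
  acts by planes.\<close>

lemma object_of_cliff_module:
 fixes N :: "('k, nat + 'w, 'v) rep"
 assumes G: "universal_central_extension G \<pi> L" and nz: "P a0 \<noteq> \<zero>\<^bsub>L\<^esub>" and \<sigma>: "spin_map r W L P N \<sigma>"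
 shows "\<exists>M \<in> Ob (S_half G \<pi> std3_e std3_h std3_f). related M N"
proof -
 interpret S: spin_map r W L P N \<sigma> by fact
 note N = S.N and fd = cliffD(1)[OF S.N]
 let ?E = "S.spin_ext" and ?x0 = "lift (P a0)"
 have x0: "?x0 \<in> carrier G" "?x0 \<noteq> \<zero>\<^bsub>G\<^esub>" using lift[OF P[OF mem(1)]] nz p(6) by auto
 obtain j :: "'l \<times> ('v, 'k) endo => 'e" where j: "inj_on j (carrier ?E)" using S.spin_ext_inj[OF ce x0] by blast
 let ?i = "inv_into (carrier ?E) j"
 note ct = central_extension_transport[OF S.central_extension_spin j]
 have "\<exists>!\<phi>. \<phi> \<in> extensional (carrier G) \<and> lie_hom G (transport_lie j ?E) \<phi> \<and> (\<forall>x\<in>carrier G. fst (?i (\<phi> x)) = \<pi> x)"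
  using G[unfolded universal_central_extension_def, THEN conjunct2, rule_format, OF ct(1)] .
 then obtain \<phi> where \<phi>: "lie_hom G (transport_lie j ?E) \<phi>" "\<And>x. x \<in> carrier G ==> fst (?i (\<phi> x)) = \<pi> x" by blast
 define \<psi> where "\<psi> x = ?i (\<phi> x)" for x
 have hom: "lie_hom G ?E \<psi>" unfolding \<psi>_def by (rule lie_hom_comp[OF \<phi>(1) ct(2)])
 note h = lmapD[OF lie_homD(1)[OF hom]]
 have fst: "fst (\<psi> x) = \<pi> x" if "x \<in> carrier G" for x using \<phi>(2)[OF that] by (simp add: \<psi>_def)
 define \<tau> where "\<tau> x = snd (\<psi> x)" for x
 have \<tau>: "\<tau> (x \<oplus>\<^bsub>G\<^esub> y) = \<tau> x + \<tau> y" "\<tau> (c \<odot>\<^bsub>G\<^esub> x) = sc c * \<tau> x" "\<tau> (bracket G x y) = cm (\<tau> x) (\<tau> y)" "Pr N * \<tau> x = \<tau> x"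
  "cm (\<tau> x) (\<tau> y) = cm (\<sigma> (\<pi> x)) (\<sigma> (\<pi> y))"
  if "x \<in> carrier G" "y \<in> carrier G" for x y c
  using that h(4)[OF that] h(5)[OF that(1), of c] lie_homD(2)[OF hom that] S.spin_ext_proj[OF h(3)[OF that(1)]]
   S.cm_spin_ext[OF h(3)[OF that(1)] h(3)[OF that(2)]] fst[OF that(1)] fst[OF that(2)]
  by (simp_all add: \<tau>_def S.spin_ext_simps)
 \<comment> \<open>A canonical lift is a bracket, so \<tau> of it is the commutator of \<sigma> (P
   (bb s)) and \<sigma> (Q s): the unknown central parts of \<tau> cancel, and
   \<open>\<sigma>_triple\<close> evaluates this commutator exactly.\<close>
 have \<tau>X: "\<tau> (X s) = sc (1 / 2) * cop N s" if s: "s \<in> gens r W" for s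
 proof -
  have Qc: "Q s \<in> carrier L" by (rule Q_closed[OF s])
  have c: "lift (P (bb s)) \<in> carrier G" "lift (Q s) \<in> carrier G" "\<pi> (lift (P (bb s))) = P (bb s)" "\<pi> (lift (Q s)) = Q s"
   using lift[OF P[OF mem(3)[of s]]] lift[OF Qc] by auto
  have "\<tau> (X s) = cm (\<sigma> (P (bb s))) (\<sigma> (Q s))"
   unfolding X_def Bk_def \<tau>(3)[OF c(1,2)] \<tau>(5)[OF c(1,2)] c(3,4) ..
  also have "\<sigma> (Q s) = sc (- 1) * \<sigma> (bracket L (P (bb s)) (P s))" unfolding Q_def by (rule S.\<sigma>_smult[OF PP_closed[OF mem(3) s]])
  also have "cm (\<sigma> (P (bb s))) (sc (- 1) * \<sigma> (bracket L (P (bb s)) (P s))) = sc (- 1) * cm (\<sigma> (P (bb s))) (\<sigma> (bracket L (P (bb s)) (P s)))"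
   by (rule S.\<sigma>_smult_left)
  also have "\<dots> = sc (- 1) * \<sigma> (bracket L (P (bb s)) (bracket L (P (bb s)) (P s)))" unfolding S.\<sigma>_triple[OF mem(3) mem(3) s] ..
  also have "\<dots> = \<sigma> ((- 1) \<odot>\<^bsub>L\<^esub> bracket L (P (bb s)) (bracket L (P (bb s)) (P s)))"
   by (rule S.\<sigma>_smult[symmetric]) (rule la(5)[OF P[OF mem(3)] PP_closed[OF mem(3) s]])
  also have "(- 1) \<odot>\<^bsub>L\<^esub> bracket L (P (bb s)) (bracket L (P (bb s)) (P s)) = P s"
   using PQ[OF s] P_bracket_linear(3)[OF P[OF mem(3)[of s]] PP_closed[OF mem(3)[of s] s] PP_closed[OF mem(3)[of s] s], of "- 1"] by (simp add: Q_def)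
  finally show ?thesis unfolding S.\<sigma>_P[OF s] .
 qed
 let ?M = "\<lparr>carrier = carrier N, mult = mult N, one = one N, zero = zero N, add = add N, smult = smult N, act = (\<lambda>x. De N N (\<tau> x))\<rparr> :: ('k, 'e, 'v) rep"
 have s: "same_space N ?M" by (simp add: same_space_def)
 have fdM: "fd_vectorspace ?M" by (rule same_space_fd[OF s fd])
 note vN = vsp_simps[OF cliffD(2)[OF N]]
 have dl: "lmap N N (De N N T)" for T by (rule De_linear[OF fd fd])
 note dcl = lmapD(3)[OF dl]
 have M: "lie_module G ?M"
  unfolding lie_module_def bilinear_map_def
 proof (intro conjI ballI fdM)
  show "lmap ?M ?M (act ?M x)" for x using dl by (simp add: same_space_lmap[OF s s, symmetric])
  show "lmap G ?M (\<lambda>x. act ?M x u)" if "u \<in> carrier ?M" for u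
   using that dcl \<tau>(1,2) De_add[OF fd fd] De_smult[OF fd fd] by (intro lmapI g(1) fdD(1)[OF fdM]) simp_all
  fix x y u assume x: "x \<in> carrier G" and y: "y \<in> carrier G" and "u \<in> carrier ?M"
  hence u: "u \<in> carrier N" by simp
  have DD: "De N N (\<tau> x) (De N N (\<tau> y) u) = De N N (\<tau> x * \<tau> y) u" if "y \<in> carrier G" for x y
   unfolding De_De'[OF fd] mult.assoc \<tau>(4)[OF that that] ..
  have "De N N (\<tau> (bracket G x y)) u = De N N (\<tau> x * \<tau> y + sc (- 1) * (\<tau> y * \<tau> x)) u" unfolding \<tau>(3)[OF x y] by simp
  also have "\<dots> = De N N (\<tau> x) (De N N (\<tau> y) u) \<oplus>\<^bsub>N\<^esub> (- 1) \<odot>\<^bsub>N\<^esub> De N N (\<tau> y) (De N N (\<tau> x) u)"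
   unfolding De_add[OF fd fd] De_smult[OF fd fd] DD[OF x] DD[OF y] ..
  finally show "act ?M (bracket G x y) u = act ?M x (act ?M y u) \<ominus>\<^bsub>?M\<^esub> act ?M y (act ?M x u)"
   using vsp_simps(16)[OF fdD(1)[OF fdM]] dcl u by simp
 qed
 have R: "related ?M N"
 proof -
  have "act N s x = 2 \<odot>\<^bsub>N\<^esub> De N N (\<tau> (X s)) x" if "s \<in> gens r W" "x \<in> carrier N" for s x
   using De_cop[OF N that] lmapD(3)[OF cliffD(3)[OF N that(1)] that(2)] unfolding \<tau>X[OF that(1)] De_smult[OF fd fd] by (simp add: vN(9,10))
  thus ?thesis using same_space_sym[OF s] by (simp add: related_def)
 qed
 interpret R: cliff_ext_rep G \<pi> L r W P ?M by unfold_locales (rule M)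
 have rel: "R.C s * R.C t + R.C t * R.C s = sc (- 2 * cform s t) * Pr ?M" if st: "s \<in> gens r W" "t \<in> gens r W" for s t
 proof -
  have a: "2 \<odot>\<^bsub>?M\<^esub> act ?M (X s) x = act N s x" if "s \<in> gens r W" "x \<in> carrier ?M" for s x using R that by (simp add: related_def)
  have cl: "act N s x \<in> carrier ?M" if "s \<in> gens r W" "x \<in> carrier ?M" for s x using lmapD(3)[OF cliffD(3)[OF N that(1)]] that(2) by simp
  show ?thesis unfolding R.C_Op(2)[OF st(1), symmetric] R.C_Op(2)[OF st(2), symmetric]
  proof (rule Op_rel(3)[OF fdM R.C_Op(1)[OF st(1)] R.C_Op(1)[OF st(2)]])
   fix x assume x: "x \<in> carrier ?M"
   show "2 \<odot>\<^bsub>?M\<^esub> act ?M (X s) (2 \<odot>\<^bsub>?M\<^esub> act ?M (X t) x) \<oplus>\<^bsub>?M\<^esub> 2 \<odot>\<^bsub>?M\<^esub> act ?M (X t) (2 \<odot>\<^bsub>?M\<^esub> act ?M (X s) x) = (- 2 * cform s t) \<odot>\<^bsub>?M\<^esub> x"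
    unfolding a[OF st(1) x] a[OF st(2) x] a[OF st(1) cl[OF st(2) x]] a[OF st(2) cl[OF st(1) x]]
    using cliffD(7)[OF N st, of x] x by simp
  qed
 qed
 have pair: "cliff_pair (R.C a0) (R.C a1) (Pr ?M)"
 proof
  show "R.C a0 * R.C a0 = - Pr ?M" "R.C a1 * R.C a1 = - Pr ?M"
   by (rule endo_double, simp add: rel[OF mem(1,1)] mult_2, rule endo_double, simp add: rel[OF mem(2,2)] mult_2)
  show "R.C a0 * R.C a1 = - (R.C a1 * R.C a0)" using rel[OF mem(1,2)] by (simp add: eq_neg_iff_add_eq_0)
 qed (use R.C_closed mem in auto)
 have sL: "std3_e \<in> carrier L" "std3_h \<in> carrier L" "std3_f \<in> carrier L"
  and bL: "bracket L std3_e std3_f = std3_h" "bracket L std3_h std3_e = \<ominus>\<^bsub>L\<^esub> std3_e"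
   "bracket L std3_h std3_f = std3_f"
  using sl2_std by (auto simp: sl2_relations_def)
 \<comment> \<open>Each member of the triple is a bracket of the other ones, namely e = [e,h], h =
   [e,f] and f = [h,f]; these brackets, formed in G, satisfy the relations without a central
   error.\<close>
 let ?e = "Bk std3_e std3_h" and ?h = "Bk std3_e std3_f" and ?f = "Bk std3_h std3_f"
 have cG: "?e \<in> carrier G" "?h \<in> carrier G" "?f \<in> carrier G" using Bk_closed sL by auto
 have pe: "\<pi> ?e = std3_e"
  unfolding pi_Bk[OF sL(1,2)] bracket_skew[OF lie sL(1,2)] bL(2) using sL(1) by (simp add: w(9,10,15))
 have ph: "\<pi> ?h = std3_h" "\<pi> ?f = std3_f" using pi_Bk sL bL by auto
 have sl2: "sl2_relations G ?e ?h ?f"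
  unfolding sl2_relations_def using cG bracket_eq_Bk[OF cG(1,3)] bracket_eq_Bk[OF cG(2,1)] bracket_eq_Bk[OF cG(2,3)] Bk_skew[OF sL(2,1)] vG(15)[OF cG(1)]
  by (simp add: pe ph)
 have "sum_of_simple_planes {?e, ?h, ?f} ?M" by (rule R.planes_if_pair[OF sl2 pe ph pair])
 hence "?M \<in> Ob (S_half G \<pi> std3_e std3_h std3_f)"
  unfolding S_half_def using M sl2 pe ph by auto
 thus ?thesis using R by blast
qed

lemma is_category_S_half: "is_category (S_half G \<pi> e h f)"
proof -
 have "vsp M \<and> act_closed (carrier G) M" if "M \<in> Ob (S_half G \<pi> e h f)" for M :: "('k, 'e, 'v) rep"
  using lie_moduleD(2,6)[of G M] that by (auto simp: S_half_def)
 from is_category_reps[where Obs = "Ob (S_half G \<pi> e h f)" and Q = "\<lambda>_ _ _. True", OF this] show ?thesis by (simp add: S_half_def)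
qed

theorem S_half_equiv_cliff_modules:
 assumes G: "universal_central_extension G \<pi> L" and nz: "P a0 \<noteq> \<zero>\<^bsub>L\<^esub>"
  and \<sigma>: "\<And>N :: ('k, nat + 'w, 'v) rep. cliff_module r W N ==> \<exists>\<sigma>. spin_map r W L P N \<sigma>"
 shows "equivalent_categories (S_half G \<pi> std3_e std3_h std3_f :: (('k, 'e, 'v) rep, 'v => 'v) category)
  (cliff_modules r W :: (('k, nat + 'w, 'v) rep, 'v => 'v) category)"
proof -
 let ?S = "S_half G \<pi> std3_e std3_h std3_f :: (('k, 'e, 'v) rep, 'v => 'v) category"
 let ?C = "cliff_modules r W :: (('k, nat + 'w, 'v) rep, 'v => 'v) category"
 let ?R = "related :: ('k, 'e, 'v) rep => ('k, nat + 'w, 'v) rep => bool"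
 have cat: "is_category ?S" "is_category ?C" by (rule is_category_S_half, rule is_category_cliff)
 show ?thesis
 proof (rule equivalent_categories_if_related[OF cat, where R = ?R])
 show "\<exists>N\<in>Ob ?C. related M N" if "M \<in> Ob ?S" for M by (rule cliff_module_of_object[OF that])
 show "\<exists>M\<in>Ob ?S. related M N" if N: "N \<in> Ob ?C" for N
  using \<sigma>[of N] N object_of_cliff_module[OF G nz] by (auto simp: cliff_modules_def)
 fix M N M' N' assume M: "M \<in> Ob ?S" and N: "N \<in> Ob ?C" and R: "related M N"
 have c: "carrier M = carrier N" using R by (simp add: related_def same_space_def)
 show "Ident ?S M = Ident ?C N" using c by (simp add: S_half_def cliff_modules_def)
 show "Comp ?S M X' X'' = Comp ?C N Y' Y''" for X' X'' Y' Y'' using c by (simp add: S_half_def cliff_modules_def)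
 assume M': "M' \<in> Ob ?S" and N': "N' \<in> Ob ?C" and R': "related M' N'"
 have "lie_module G M" "lie_module G M'" using M M' by (auto simp: S_half_def)
 moreover have "cliff_module r W N" "cliff_module r W N'" using N N' by (auto simp: cliff_modules_def)
 ultimately show "Hom ?S M M' = Hom ?C N N'"
  using hom_related[OF G _ _ _ _ R R'] by (simp add: S_half_def cliff_modules_def)
 qed
qed

end

subsection \<open>The Lie algebra \<open>so(m) \<ltimes> (W \<otimes> V)\<close> in terms of Clifford generators\<close>

text \<open>The (a, b) entry of g u v / 2 times the matrix E_uv, rewritten as a difference of two
  Kronecker deltas in the summation index (u, v).\<close>

lemma pair_delta:
 fixes g :: "nat => nat => 'k::field_char_0"
 shows "g u v / 2 * ((if a = u \<and> b = v then 1 else 0) - (if a = v \<and> b = u then 1 else 0)) =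
  (if (u, v) = (a, b) then g a b / 2 else 0) - (if (u, v) = (b, a) then g b a / 2 else 0)"
proof (cases "u = a \<and> v = b")
 case True
 hence uv: "u = a" "v = b" by auto
 show ?thesis unfolding uv by (cases "a = b") simp_all
next
 case F: False
 show ?thesis
 proof (cases "u = b \<and> v = a")
  case True
  hence uv: "u = b" "v = a" by auto
  have "a \<noteq> b" using F uv by auto
  thus ?thesis unfolding uv by simp
 next
  case False
  have n: "\<not> (a = u \<and> b = v)" "\<not> (a = v \<and> b = u)" "(u, v) \<noteq> (a, b)" "(u, v) \<noteq> (b, a)" using F False by auto
  show ?thesis unfolding if_not_P[OF n(1)] if_not_P[OF n(2)] if_not_P[OF n(3)] if_not_P[OF n(4)] by simp
 qed
qed

context
 fixes m :: nat and W :: "('k::{alg_closed_field, field_char_0}, 'w) module"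
 assumes m: "3 \<le> m" and fW: "fd_vectorspace W" and L: "lie_algebra (so_semidirect m W)"
begin

abbreviation (input) "LL \<equiv> so_semidirect m W"
abbreviation (input) "ca y a b \<equiv> fst y $$ (a, b)"
abbreviation (input) "ck y a b \<equiv> kappa W (snd y a) b"

lemma vsW: "vsp W" using fW by (rule fdD)

lemmas lL = lieD[OF L]
lemmas vL = vsp_simps[OF lL(1)]
lemmas vWs = vsp_simps[OF vsW]

lemma so_mem:
 assumes "y \<in> carrier LL"
 shows "fst y \<in> carrier_mat m m" "transpose_mat (fst y) = - fst y" "snd y \<in> carrier (tensor_std m W)"
  "a < m ==> snd y a \<in> carrier W" "[|a < m; b < m|] ==> ca y b a = - ca y a b"
proof -
 show 1: "fst y \<in> carrier_mat m m" "transpose_mat (fst y) = - fst y" "snd y \<in> carrier (tensor_std m W)" "a < m ==> snd y a \<in> carrier W"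
  using assms by (cases y; auto simp: so_semidirect_simps so_lie_simps tensor_std_simps PiE_iff)+
 show "ca y b a = - ca y a b" if "a < m" "b < m"
  using arg_cong[OF 1(2), of "\<lambda>A. A $$ (a, b)"] 1(1) that by simp
qed

lemma so_eqI:
 assumes "x \<in> carrier LL" "y \<in> carrier LL" "\<And>a b. [|a < m; b < m|] ==> ca x a b = ca y a b" "\<And>a b. a < m ==> ck x a b = ck y a b"
 shows "x = y"
proof (rule prod_eqI)
 show "fst x = fst y" using so_mem(1)[OF assms(1)] so_mem(1)[OF assms(2)] assms(3) by (intro eq_matI) auto
 show "snd x = snd y" by (rule tensor_eqI[OF fW so_mem(3)[OF assms(1)] so_mem(3)[OF assms(2)] assms(4)])
qed

lemma so_smult:
 assumes x: "x \<in> carrier LL" and a: "a < m"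
 shows "b < m ==> ca (c \<odot>\<^bsub>LL\<^esub> x) a b = c * ca x a b" "ck (c \<odot>\<^bsub>LL\<^esub> x) a b' = c * ck x a b'"
  "snd (c \<odot>\<^bsub>LL\<^esub> x) a = c \<odot>\<^bsub>W\<^esub> snd x a"
 using so_mem(1)[OF x] kappa_tensor_ops(2)[OF fW so_mem(3)[OF x] so_mem(3)[OF x] a] a
 by (auto simp: so_semidirect_simps tensor_std_simps)

lemma so_zero: "[|a < m; b < m|] ==> ca \<zero>\<^bsub>LL\<^esub> a b = 0" "a < m ==> ck \<zero>\<^bsub>LL\<^esub> a b' = 0"
 by (simp_all add: so_semidirect_simps tensor_std_simps kappa_zero[OF fW])

lemma so_coord:
 assumes x: "x \<in> carrier LL" and y: "y \<in> carrier LL" and a: "a < m"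
 shows "b < m ==> ca (x \<oplus>\<^bsub>LL\<^esub> y) a b = ca x a b + ca y a b" "ck (x \<oplus>\<^bsub>LL\<^esub> y) a b' = ck x a b' + ck y a b'"
  "snd (x \<oplus>\<^bsub>LL\<^esub> y) a = snd x a \<oplus>\<^bsub>W\<^esub> snd y a"
  "b < m ==> ca (bracket LL x y) a b = (\<Sum>k<m. ca x a k * ca y k b) - (\<Sum>k<m. ca y a k * ca x k b)"
  "ck (bracket LL x y) a b' = (\<Sum>k<m. ca x a k * ck y k b') - (\<Sum>k<m. ca y a k * ck x k b')"
proof -
 note mx = so_mem[OF x] and my = so_mem[OF y]
 have d: "dim_row (fst x) = m" "dim_col (fst x) = m" "dim_row (fst y) = m" "dim_col (fst y) = m" using mx(1) my(1) by auto
 show "b < m ==> ca (x \<oplus>\<^bsub>LL\<^esub> y) a b = ca x a b + ca y a b"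
  using d a by (simp add: so_semidirect_simps)
 show "ck (x \<oplus>\<^bsub>LL\<^esub> y) a b' = ck x a b' + ck y a b'"
  using kappa_tensor_ops[OF fW mx(3) my(3) a] by (simp add: so_semidirect_simps)
 show "snd (x \<oplus>\<^bsub>LL\<^esub> y) a = snd x a \<oplus>\<^bsub>W\<^esub> snd y a"
  using a by (simp add: so_semidirect_simps tensor_std_simps)
 have br: "bracket LL x y = (fst x * fst y - fst y * fst x, tensor_std_act m W (fst x) (snd y) \<ominus>\<^bsub>tensor_std m W\<^esub> tensor_std_act m W (fst y) (snd x))"
  by (cases x; cases y) (simp add: so_semidirect_simps)
 show "ca (bracket LL x y) a b = (\<Sum>k<m. ca x a k * ca y k b) - (\<Sum>k<m. ca y a k * ca x k b)" if "b < m"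
  using d a that by (simp add: br scalar_prod_def lessThan_atLeast0)
 show "ck (bracket LL x y) a b' = (\<Sum>k<m. ca x a k * ck y k b') - (\<Sum>k<m. ca y a k * ck x k b')"
  unfolding br snd_conv
  using kappa_tensor_ops(3)[OF fW tensor_std_act_closed[OF fW my(3)] tensor_std_act_closed[OF fW mx(3)] a] kappa_act[OF fW my(3) a] kappa_act[OF fW mx(3) a]
  by simp
qed

definition Le :: "nat => nat => 'k mat \<times> (nat => 'w)" where
 "Le i j = (Em m i j, \<zero>\<^bsub>tensor_std m W\<^esub>)"

definition Lt :: "nat => 'w => 'k mat \<times> (nat => 'w)" where
 "Lt j w = (0\<^sub>m m m, \<lambda>i\<in>{..<m}. if i = j then w else \<zero>\<^bsub>W\<^esub>)"

lemma Le_mem: "Le i j \<in> carrier LL"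
proof -
 have "transpose_mat (Em m i j) = - (Em m i j :: 'k mat)"
  by (intro eq_matI) (simp_all add: Em_index conj_commute)
 thus ?thesis by (auto simp: Le_def so_semidirect_simps so_lie_simps tensor_std_simps vWs(1))
qed

lemma Lt_mem: "w \<in> carrier W ==> Lt j w \<in> carrier LL"
 by (auto simp: Lt_def so_semidirect_simps so_lie_simps vWs(1))

lemma Le_coord: "[|a < m; b < m|] ==> ca (Le i j) a b = (if a = i \<and> b = j then 1 else 0) - (if a = j \<and> b = i then 1 else 0)" 
  "a < m ==> ck (Le i j) a b' = 0"
 and Le_snd: "a < m ==> snd (Le i j) a = \<zero>\<^bsub>W\<^esub>"
 by (simp_all add: Le_def Em_index tensor_std_simps kappa_zero[OF fW])

lemma Lt_coord: "[|a < m; b < m|] ==> ca (Lt j w) a b = 0" "a < m ==> ck (Lt j w) a b' = (if a = j then kappa W w b' else 0)"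
 and Lt_snd: "a < m ==> snd (Lt j w) a = (if a = j then w else \<zero>\<^bsub>W\<^esub>)"
 by (simp_all add: Lt_def kappa_zero[OF fW])

lemma sum_Em_left:
 assumes "i < m" "j < m" "a < m"
 shows "(\<Sum>k<m. ca (Le i j) a k * g k) = (if a = i then g j else 0) - (if a = j then g i else (0::'k))"
proof -
 have "(\<Sum>k<m. ca (Le i j) a k * g k) = (\<Sum>k<m. (if k = j then (if a = i then g j else 0) else 0) - (if k = i then (if a = j then g i else 0) else 0))"
  using assms by (intro sum.cong) (auto simp: Le_coord)
 thus ?thesis using assms by (simp add: sum_subtractf)
qed

lemma sum_Em_right:
 assumes "i < m" "j < m" "b < m"
 shows "(\<Sum>k<m. g k * ca (Le i j) k b) = (if b = j then g i else 0) - (if b = i then g j else (0::'k))"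
proof -
 have "(\<Sum>k<m. g k * ca (Le i j) k b) = (\<Sum>k<m. (if k = i then (if b = j then g i else 0) else 0) - (if k = j then (if b = i then g j else 0) else 0))"
  using assms by (intro sum.cong) (auto simp: Le_coord)
 thus ?thesis using assms by (simp add: sum_subtractf)
qed

lemma bracket_Le:
 assumes y: "y \<in> carrier LL" and "i < m" "j < m" "a < m"
 shows "b < m ==> ca (bracket LL (Le i j) y) a b =
   (if a = i then ca y j b else 0) - (if a = j then ca y i b else 0) - ((if b = j then ca y a i else 0) - (if b = i then ca y a j else 0))"
  "ck (bracket LL (Le i j) y) a b' = (if a = i then ck y j b' else 0) - (if a = j then ck y i b' else 0)"
proof -
 show "b < m ==> ca (bracket LL (Le i j) y) a b =
   (if a = i then ca y j b else 0) - (if a = j then ca y i b else 0) - ((if b = j then ca y a i else 0) - (if b = i then ca y a j else 0))"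
  unfolding so_coord(4)[OF Le_mem y assms(4)] sum_Em_left[OF assms(2-4)] sum_Em_right[OF assms(2,3)] ..
 have "(\<Sum>k<m. ca y a k * ck (Le i j) k b') = 0" by (intro sum.neutral) (simp add: Le_coord)
 thus "ck (bracket LL (Le i j) y) a b' = (if a = i then ck y j b' else 0) - (if a = j then ck y i b' else 0)"
  unfolding so_coord(5)[OF Le_mem y assms(4)] sum_Em_left[OF assms(2-4)] by simp
qed

lemma bracket_Lt:
 assumes y: "y \<in> carrier LL" and w: "w \<in> carrier W" and "j < m" "a < m"
 shows "b < m ==> ca (bracket LL (Lt j w) y) a b = 0"
  "ck (bracket LL (Lt j w) y) a b' = - (ca y a j * kappa W w b')"
proof -
 have z: "(\<Sum>k<m. ca (Lt j w) a k * g k) = 0" for g :: "nat => 'k" using assms by (intro sum.neutral) (simp add: Lt_coord)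
 have z': "(\<Sum>k<m. g k * ca (Lt j w) k b) = 0" if "b < m" for g :: "nat => 'k" and b using that by (intro sum.neutral) (simp add: Lt_coord)
 show "b < m ==> ca (bracket LL (Lt j w) y) a b = 0"
  unfolding so_coord(4)[OF Lt_mem[OF w] y assms(4)] using z z' by simp
 have "(\<Sum>k<m. ca y a k * ck (Lt j w) k b') = (\<Sum>k<m. if k = j then ca y a j * kappa W w b' else 0)"
  by (intro sum.cong) (auto simp: Lt_coord)
 thus "ck (bracket LL (Lt j w) y) a b' = - (ca y a j * kappa W w b')"
  unfolding so_coord(5)[OF Lt_mem[OF w] y assms(4)] using z assms by simp
qed

text \<open>The odd part with respect to the symmetry of V that changes the sign of b_0: the
  matrices E_0j and the tensors w tensor b_0. The index shifts by one because b_0 itself is not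
  among the Clifford generators.\<close>

definition soP :: "nat + 'w => 'k mat \<times> (nat => 'w)" where
 "soP s = (case s of Inl j => Le 0 (Suc j) | Inr w => Lt 0 w)"

lemma soP_simps: "soP (Inl j) = Le 0 (Suc j)" "soP (Inr w) = Lt 0 w"
 by (simp_all add: soP_def)

lemma so_gens_cases:
 assumes "s \<in> gens (m - 1) W"
 obtains j where "s = Inl j" "Suc j < m" | w where "s = Inr w" "w \<in> carrier W"
 using assms m by (auto simp: gens_def)

lemma soP_mem: "s \<in> gens (m - 1) W ==> soP s \<in> carrier LL"
 by (elim so_gens_cases) (simp_all add: soP_simps Le_mem Lt_mem)

lemma soP_brackets:
 "[|Suc i < m; Suc j < m|] ==> bracket LL (soP (Inl i)) (soP (Inl j)) = (- 1) \<odot>\<^bsub>LL\<^esub> Le (Suc i) (Suc j)"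
 "[|Suc i < m; w \<in> carrier W|] ==> bracket LL (soP (Inl i)) (soP (Inr w)) = (- 1) \<odot>\<^bsub>LL\<^esub> Lt (Suc i) w"
 "[|Suc i < m; w \<in> carrier W|] ==> bracket LL (soP (Inr w)) (soP (Inl i)) = Lt (Suc i) w"
 "[|w \<in> carrier W; w' \<in> carrier W|] ==> bracket LL (soP (Inr w)) (soP (Inr w')) = \<zero>\<^bsub>LL\<^esub>"
proof -
 have z: "0 < m" using m by simp
 note c = bracket_Le bracket_Lt so_smult(1,2) so_zero Le_coord Lt_coord
 show "bracket LL (soP (Inl i)) (soP (Inl j)) = (- 1) \<odot>\<^bsub>LL\<^esub> Le (Suc i) (Suc j)" if sij: "Suc i < m" "Suc j < m"
  unfolding soP_simps
 proof (rule so_eqI[OF lL(5)[OF Le_mem Le_mem] vL(3)[OF Le_mem]])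
  fix a b assume a: "a < m"
  show "ca (bracket LL (Le 0 (Suc i)) (Le 0 (Suc j))) a b = ca ((- 1) \<odot>\<^bsub>LL\<^esub> Le (Suc i) (Suc j)) a b"
   if b: "b < m"
   unfolding bracket_Le(1)[OF Le_mem z sij(1) a b] so_smult(1)[OF Le_mem a b]
    Le_coord(1)[OF a b] Le_coord(1)[OF sij(1) b] Le_coord(1)[OF a sij(1)] Le_coord(1)[OF z b] Le_coord(1)[OF a z]
   by (cases a; cases b; cases "i = j") simp_all
  show "ck (bracket LL (Le 0 (Suc i)) (Le 0 (Suc j))) a b' = ck ((- 1) \<odot>\<^bsub>LL\<^esub> Le (Suc i) (Suc j)) a b'" for b'
   unfolding bracket_Le(2)[OF Le_mem z sij(1) a] so_smult(2)[OF Le_mem a] Le_coord(2)[OF a] Le_coord(2)[OF sij(1)] Le_coord(2)[OF z] by simp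
 qed
 show "bracket LL (soP (Inl i)) (soP (Inr w)) = (- 1) \<odot>\<^bsub>LL\<^esub> Lt (Suc i) w" if "Suc i < m" "w \<in> carrier W"
  unfolding soP_simps by (rule so_eqI) (use that z Le_mem Lt_mem lL(5) vL(3) in \<open>auto simp: c\<close>)
 show "bracket LL (soP (Inr w)) (soP (Inl i)) = Lt (Suc i) w" if "Suc i < m" "w \<in> carrier W"
  unfolding soP_simps by (rule so_eqI) (use that z Le_mem Lt_mem lL(5) vL(3) in \<open>auto simp: c\<close>)
 show "bracket LL (soP (Inr w)) (soP (Inr w')) = \<zero>\<^bsub>LL\<^esub>" if "w \<in> carrier W" "w' \<in> carrier W"
  unfolding soP_simps by (rule so_eqI) (use that z Lt_mem lL(5) vL(1) in \<open>auto simp: c\<close>)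
qed

lemma bracket_Le_Le:
 assumes "Suc i < m" "Suc j < m" "Suc k < m"
 shows "bracket LL (Le 0 (Suc i)) (Le (Suc j) (Suc k)) =
  (if i = j then 1 else 0) \<odot>\<^bsub>LL\<^esub> Le 0 (Suc k) \<oplus>\<^bsub>LL\<^esub> (if i = k then - 1 else 0) \<odot>\<^bsub>LL\<^esub> Le 0 (Suc j)"
proof (rule so_eqI[OF lL(5)[OF Le_mem Le_mem] vL(2)[OF vL(3)[OF Le_mem] vL(3)[OF Le_mem]]])
 have z: "0 < m" using m by simp
 fix a b assume a: "a < m"
 show "ca (bracket LL (Le 0 (Suc i)) (Le (Suc j) (Suc k))) a b =
  ca ((if i = j then 1 else 0) \<odot>\<^bsub>LL\<^esub> Le 0 (Suc k) \<oplus>\<^bsub>LL\<^esub> (if i = k then - 1 else 0) \<odot>\<^bsub>LL\<^esub> Le 0 (Suc j)) a b" if b: "b < m"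
  unfolding bracket_Le(1)[OF Le_mem z assms(1) a b] so_coord(1)[OF vL(3)[OF Le_mem] vL(3)[OF Le_mem] a b] so_smult(1)[OF Le_mem a b]
   Le_coord(1)[OF a b] Le_coord(1)[OF assms(1) b] Le_coord(1)[OF a assms(1)] Le_coord(1)[OF z b] Le_coord(1)[OF a z]
  by (cases a; cases b; cases "i = j"; cases "i = k") simp_all
 show "ck (bracket LL (Le 0 (Suc i)) (Le (Suc j) (Suc k))) a b' =
  ck ((if i = j then 1 else 0) \<odot>\<^bsub>LL\<^esub> Le 0 (Suc k) \<oplus>\<^bsub>LL\<^esub> (if i = k then - 1 else 0) \<odot>\<^bsub>LL\<^esub> Le 0 (Suc j)) a b'" for b'
  unfolding bracket_Le(2)[OF Le_mem z assms(1) a] so_coord(2)[OF vL(3)[OF Le_mem] vL(3)[OF Le_mem] a] so_smult(2)[OF Le_mem a]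
   Le_coord(2)[OF a] Le_coord(2)[OF assms(1)] Le_coord(2)[OF z] by simp
qed

lemma bracket_Le_Lt:
 assumes "Suc i < m" "Suc j < m" and w: "w \<in> carrier W"
 shows "bracket LL (Le 0 (Suc i)) (Lt (Suc j) w) = (if i = j then 1 else 0) \<odot>\<^bsub>LL\<^esub> Lt 0 w"
proof (rule so_eqI[OF lL(5)[OF Le_mem Lt_mem[OF w]] vL(3)[OF Lt_mem[OF w]]])
 have z: "0 < m" using m by simp
 fix a b assume a: "a < m"
 show "ca (bracket LL (Le 0 (Suc i)) (Lt (Suc j) w)) a b = ca ((if i = j then 1 else 0) \<odot>\<^bsub>LL\<^esub> Lt 0 w) a b" if b: "b < m"
  unfolding bracket_Le(1)[OF Lt_mem[OF w] z assms(1) a b] so_smult(1)[OF Lt_mem[OF w] a b]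
   Lt_coord(1)[OF a b] Lt_coord(1)[OF assms(1) b] Lt_coord(1)[OF a assms(1)] Lt_coord(1)[OF z b] Lt_coord(1)[OF a z] by simp
 show "ck (bracket LL (Le 0 (Suc i)) (Lt (Suc j) w)) a b' = ck ((if i = j then 1 else 0) \<odot>\<^bsub>LL\<^esub> Lt 0 w) a b'" for b'
  unfolding bracket_Le(2)[OF Lt_mem[OF w] z assms(1) a] so_smult(2)[OF Lt_mem[OF w] a]
   Lt_coord(2)[OF a] Lt_coord(2)[OF assms(1)] Lt_coord(2)[OF z] by (cases a; cases "i = j") simp_all
qed

text \<open>Only the column of b_0 of the matrix part of y enters the bracket with w tensor b_0,
  since W tensor V is abelian.\<close>

lemma bracket_Lt_zero:
 assumes w: "w \<in> carrier W" and y: "y \<in> carrier LL" "\<And>a. a < m ==> ca y a 0 = 0"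
 shows "bracket LL (Lt 0 w) y = \<zero>\<^bsub>LL\<^esub>"
proof (rule so_eqI[OF lL(5)[OF Lt_mem[OF w] y(1)] vL(1)])
 have z: "0 < m" using m by simp
 fix a b assume a: "a < m"
 show "ca (bracket LL (Lt 0 w) y) a b = ca \<zero>\<^bsub>LL\<^esub> a b" if b: "b < m"
  unfolding bracket_Lt(1)[OF y(1) w z a b] so_zero(1)[OF a b] ..
 show "ck (bracket LL (Lt 0 w) y) a b' = ck \<zero>\<^bsub>LL\<^esub> a b'" for b'
  unfolding bracket_Lt(2)[OF y(1) w z a] so_zero(2)[OF a] y(2)[OF a] by simp
qed

lemma soP_triple:
 assumes s: "s \<in> gens (m - 1) W" and t: "t \<in> gens (m - 1) W" and u: "u \<in> gens (m - 1) W"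
 shows "bracket LL (soP s) (bracket LL (soP t) (soP u)) = (- cform s t) \<odot>\<^bsub>LL\<^esub> soP u \<oplus>\<^bsub>LL\<^esub> cform s u \<odot>\<^bsub>LL\<^esub> soP t"
 using s
proof (cases rule: so_gens_cases)
 case s: (1 i)
 note sm = lmapD(5)[OF lL(2)[OF Le_mem]] and sz = lmapD(6)[OF lL(2)[OF Le_mem]]
 show ?thesis using t
 proof (cases rule: so_gens_cases)
  case t: (1 j)
  show ?thesis using u
  proof (cases rule: so_gens_cases)
   case u: (1 k)
   show ?thesis unfolding s(1) t(1) u(1) soP_brackets(1)[OF t(2) u(2)] unfolding soP_simps sm[OF Le_mem] bracket_Le_Le[OF s(2) t(2) u(2)]
    by (simp add: vL(3,9,14) Le_mem)
  next
   case u: (2 w)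
   show ?thesis unfolding s(1) t(1) u(1) soP_brackets(2)[OF t(2) u(2)] unfolding soP_simps sm[OF Lt_mem[OF u(2)]] bracket_Le_Lt[OF s(2) t(2) u(2)]
    using Lt_mem[OF u(2)] Le_mem by (simp add: vL(3,6,9,11))
  qed
 next
  case t: (2 w)
  show ?thesis using u
  proof (cases rule: so_gens_cases)
   case u: (1 k)
   show ?thesis unfolding s(1) t(1) u(1) soP_brackets(3)[OF u(2) t(2)] unfolding soP_simps bracket_Le_Lt[OF s(2) u(2) t(2)]
    using Lt_mem[OF t(2)] Le_mem by (simp add: vL(3,7,11))
  next
   case u: (2 w')
   show ?thesis unfolding s(1) t(1) u(1) soP_brackets(4)[OF t(2) u(2)] unfolding soP_simps sz
    using Lt_mem[OF t(2)] Lt_mem[OF u(2)] vL(6)[OF vL(1)] by (simp add: vL(11))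
  qed
 qed
next
 case s: (2 w0)
 note sm = lmapD(5)[OF lL(2)[OF Lt_mem[OF s(2)]]] and sz = lmapD(6)[OF lL(2)[OF Lt_mem[OF s(2)]]]
 have z: "0 < m" using m by simp
 have c0: "cform s v = (0::'k)" for v unfolding s(1) by simp
 have e: "bracket LL (Lt 0 w0) (Le (Suc j) (Suc k)) = \<zero>\<^bsub>LL\<^esub>" for j k
  by (rule bracket_Lt_zero[OF s(2) Le_mem]) (use z in \<open>simp add: Le_coord\<close>)
 have e': "bracket LL (Lt 0 w0) (Lt (Suc j) w) = \<zero>\<^bsub>LL\<^esub>" if "w \<in> carrier W" for j w
  by (rule bracket_Lt_zero[OF s(2) Lt_mem[OF that]]) (use z in \<open>simp add: Lt_coord\<close>)
 have "bracket LL (Lt 0 w0) (bracket LL (soP t) (soP u)) = \<zero>\<^bsub>LL\<^esub>"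
  using t
 proof (cases rule: so_gens_cases)
  case t: (1 j)
  show ?thesis using u
  proof (cases rule: so_gens_cases)
   case u: (1 k)
   show ?thesis unfolding t(1) u(1) soP_brackets(1)[OF t(2) u(2)] sm[OF Le_mem] e by (rule vL(12))
  next
   case u: (2 w)
   show ?thesis unfolding t(1) u(1) soP_brackets(2)[OF t(2) u(2)] sm[OF Lt_mem[OF u(2)]] e'[OF u(2)] by (rule vL(12))
  qed
 next
  case t: (2 w)
  show ?thesis using u
  proof (cases rule: so_gens_cases)
   case u: (1 k)
   show ?thesis unfolding t(1) u(1) soP_brackets(3)[OF u(2) t(2)] e'[OF t(2)] ..
  next
   case u: (2 w')
   show ?thesis unfolding t(1) u(1) soP_brackets(4)[OF t(2) u(2)] sz ..
  qed
 qed
 thus ?thesis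
  unfolding c0 using soP_mem[OF t] soP_mem[OF u] vL(6)[OF vL(1)] by (simp add: s(1) soP_simps vL(11))
qed

text \<open>The remaining basis elements are brackets of generators: E_ij with i, j > 0 is, up to
  sign, the bracket of E_0i and E_0j, and w tensor b_j is the bracket of w tensor b_0 with
  E_0j.\<close>

lemma soP_span:
 assumes K: "VectorSpace.subspace class_ring K LL" and P: "\<And>s. s \<in> gens (m - 1) W ==> soP s \<in> K"
  and PP: "\<And>s t. [|s \<in> gens (m - 1) W; t \<in> gens (m - 1) W|] ==> bracket LL (soP s) (soP t) \<in> K"
 shows "K = carrier LL"
proof -
 interpret V: vectorspace class_ring LL by (rule lL(1))
 note k = subspD[OF K]
 have gi: "Inl j \<in> gens (m - 1) W" if "Suc j < m" for j using that by (auto simp: gens_def)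
 have gw: "Inr w \<in> gens (m - 1) W" if "w \<in> carrier W" for w using that by (auto simp: gens_def)
 have neg: "y = (- 1) \<odot>\<^bsub>LL\<^esub> ((- 1) \<odot>\<^bsub>LL\<^esub> y)" if "y \<in> carrier LL" for y using that by (simp add: vL(9,10))
 have Le0: "Le 0 j \<in> K" if "j < m" for j
 proof (cases j)
  case 0
  have "Le 0 0 = \<zero>\<^bsub>LL\<^esub>" by (rule so_eqI) (simp_all add: Le_mem vL(1) Le_coord so_zero)
  thus ?thesis using k(4) 0 by simp
 qed (use P[OF gi] that in \<open>simp add: soP_simps\<close>)
 have LeK: "Le i j \<in> K" if ij: "i < m" "j < m" for i j
 proof (cases i)
  case 0 thus ?thesis using Le0 ij by simp
 next
  case (Suc i')
  show ?thesis
  proof (cases j)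
   case 0
   have "Le i 0 = (- 1) \<odot>\<^bsub>LL\<^esub> Le 0 i" by (rule so_eqI) (simp_all add: Le_mem vL(3) Le_coord so_smult(1,2)[OF Le_mem])
   thus ?thesis using k(3)[OF Le0[OF ij(1)]] 0 by simp
  next
   case (Suc j')
   have "(- 1) \<odot>\<^bsub>LL\<^esub> Le i j \<in> K" using PP[OF gi gi, of i' j'] soP_brackets(1)[of i' j'] ij Suc \<open>i = Suc i'\<close> by simp
   from k(3)[OF this, of "- 1"] show ?thesis using neg[OF Le_mem] by simp
  qed
 qed
 have LtK: "Lt j w \<in> K" if "j < m" "w \<in> carrier W" for j w
 proof (cases j)
  case 0 thus ?thesis using P[OF gw[OF that(2)]] by (simp add: soP_simps)
 next
  case (Suc j') thus ?thesis using PP[OF gw[OF that(2)] gi, of j'] soP_brackets(3)[of j' w] that by simp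
 qed
 have "y \<in> K" if y: "y \<in> carrier LL" for y
 proof -
  let ?S = "{..<m} \<times> {..<m}"
  \<comment> \<open>The double sum meets each pair of indices twice, as (u, v) and as (v, u), and
    the two terms agree by skewness; hence the division by 2.\<close>
  let ?f = "\<lambda>p. (ca y (fst p) (snd p) / 2) \<odot>\<^bsub>LL\<^esub> Le (fst p) (snd p)" and ?g = "\<lambda>j. Lt j (snd y j)"
  let ?u = "\<Oplus>\<^bsub>LL\<^esub>p\<in>?S. ?f p" and ?v = "\<Oplus>\<^bsub>LL\<^esub>j\<in>{..<m}. ?g j"
  have sub: "K \<subseteq> carrier LL" using k(1) by blast
  have uK: "?u \<in> K"
  proof (rule finsum_in_subspace[OF lL(1) _ _ sub k(4) k(2)])
   show "?f p \<in> K" if "p \<in> ?S" for p by (rule k(3), rule LeK) (use that in auto)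
  qed simp_all
  have vK: "?v \<in> K"
  proof (rule finsum_in_subspace[OF lL(1) _ _ sub k(4) k(2)])
   show "?g j \<in> K" if "j \<in> {..<m}" for j by (rule LtK) (use that so_mem(4)[OF y] in auto)
  qed simp_all
  have fc: "?f p \<in> carrier LL" for p using Le_mem vL(3) by blast
  have gc: "?g j \<in> carrier LL" if "j \<in> {..<m}" for j using Lt_mem so_mem(4)[OF y] that by blast
  have cu: "ca ?u a b = ca y a b" if ab: "a < m" "b < m" for a b
  proof -
   have "ca ?u a b = (\<Sum>p\<in>?S. ca (?f p) a b)"
    by (rule finsum_additive[OF lL(1), where c = "\<lambda>l. ca l a b"]) (use ab so_coord(1) fc in auto)
   also have "\<dots> = (\<Sum>p\<in>?S. (if p = (a, b) then ca y a b / 2 else 0) - (if p = (b, a) then ca y b a / 2 else 0))"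
   proof (intro sum.cong refl)
    fix p :: "nat \<times> nat"
    obtain u v where p: "p = (u, v)" by (cases p)
    have e: "ca (?f p) a b = ca y u v / 2 * ((if a = u \<and> b = v then 1 else 0) - (if a = v \<and> b = u then 1 else 0))"
     unfolding so_smult(1)[OF Le_mem ab] Le_coord(1)[OF ab] p fst_conv snd_conv ..
    show "ca (?f p) a b = (if p = (a, b) then ca y a b / 2 else 0) - (if p = (b, a) then ca y b a / 2 else 0)"
     unfolding e unfolding p by (rule pair_delta)
   qed
   also have "\<dots> = ca y a b / 2 - ca y b a / 2" using ab by (simp add: sum_subtractf)
   also have "\<dots> = ca y a b" using so_mem(5)[OF y ab] by simp
   finally show ?thesis .
  qed
  have cu': "ck ?u a b = 0" if a: "a < m" for a b
  proof -
   have "ck ?u a b = (\<Sum>p\<in>?S. ck (?f p) a b)"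
    by (rule finsum_additive[OF lL(1), where c = "\<lambda>l. ck l a b"]) (use a so_coord(2) fc in auto)
   thus ?thesis using a by (simp add: so_smult(2)[OF Le_mem] Le_coord)
  qed
  have cv: "ca ?v a b = 0" if ab: "a < m" "b < m" for a b
  proof -
   have "ca ?v a b = (\<Sum>j\<in>{..<m}. ca (?g j) a b)"
    by (rule finsum_additive[OF lL(1), where c = "\<lambda>l. ca l a b"]) (use ab so_coord(1) gc in auto)
   thus ?thesis using ab by (simp add: Lt_coord)
  qed
  have cv': "ck ?v a b = ck y a b" if a: "a < m" for a b
  proof -
   have "ck ?v a b = (\<Sum>j\<in>{..<m}. ck (?g j) a b)"
    by (rule finsum_additive[OF lL(1), where c = "\<lambda>l. ck l a b"]) (use a so_coord(2) gc in auto)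
   also have "\<dots> = (\<Sum>j\<in>{..<m}. if j = a then ck y a b else 0)" using a by (intro sum.cong) (auto simp: Lt_coord)
   finally show ?thesis using a by simp
  qed
  have "y = ?u \<oplus>\<^bsub>LL\<^esub> ?v"
  proof (rule so_eqI[OF y vL(2)[OF k(1)[OF uK] k(1)[OF vK]]])
   fix a b assume a: "a < m"
   show "ca y a b = ca (?u \<oplus>\<^bsub>LL\<^esub> ?v) a b" if b: "b < m"
    unfolding so_coord(1)[OF k(1)[OF uK] k(1)[OF vK] a b] cu[OF a b] cv[OF a b] by simp
   show "ck y a b' = ck (?u \<oplus>\<^bsub>LL\<^esub> ?v) a b'" for b'
    unfolding so_coord(2)[OF k(1)[OF uK] k(1)[OF vK] a] cu'[OF a] cv'[OF a] by simp
  qed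
  thus ?thesis using k(2)[OF uK vK] by simp
 qed
 thus ?thesis using k(1) by blast
qed

lemma cliff_lie_so: "cliff_lie (m - 1) W LL soP"
proof (rule cliff_lie.intro[OF L vsW])
 show "2 \<le> m - 1" using m by simp
 show "soP (Inr (w \<oplus>\<^bsub>W\<^esub> w')) = soP (Inr w) \<oplus>\<^bsub>LL\<^esub> soP (Inr w')" if "w \<in> carrier W" "w' \<in> carrier W" for w w'
  unfolding soP_simps
  by (rule so_eqI) (use that in \<open>simp_all add: Lt_mem vL(2) vWs(2) Lt_coord so_coord(1,2)[OF Lt_mem Lt_mem] kappa_add[OF fW]\<close>)
 show "soP (Inr (c \<odot>\<^bsub>W\<^esub> w)) = c \<odot>\<^bsub>LL\<^esub> soP (Inr w)" if "w \<in> carrier W" for c w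
  unfolding soP_simps
  by (rule so_eqI) (use that in \<open>simp_all add: Lt_mem vL(3) vWs(3) Lt_coord so_smult(1,2)[OF Lt_mem] kappa_smult[OF fW]\<close>)
 show "soP s \<in> carrier LL" if "s \<in> gens (m - 1) W" for s by (rule soP_mem[OF that])
 show "bracket LL (soP s) (bracket LL (soP t) (soP u)) = (- cform s t) \<odot>\<^bsub>LL\<^esub> soP u \<oplus>\<^bsub>LL\<^esub> cform s u \<odot>\<^bsub>LL\<^esub> soP t"
  if "s \<in> gens (m - 1) W" "t \<in> gens (m - 1) W" "u \<in> gens (m - 1) W" for s t u by (rule soP_triple[OF that])
 show "K = carrier LL" if "VectorSpace.subspace class_ring K LL" "\<And>s. s \<in> gens (m - 1) W ==> soP s \<in> K"
  "\<And>s t. [|s \<in> gens (m - 1) W; t \<in> gens (m - 1) W|] ==> bracket LL (soP s) (soP t) \<in> K" for K by (rule soP_span[OF that])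
qed

lemma soP_nonzero: "soP (Inl 0) \<noteq> \<zero>\<^bsub>LL\<^esub>"
proof
 assume "soP (Inl 0) = \<zero>\<^bsub>LL\<^esub>"
 hence "ca (Le 0 1) 0 1 = ca \<zero>\<^bsub>LL\<^esub> 0 1" by (simp add: soP_simps)
 thus False using m so_zero(1)[of 0 1] by (simp add: Le_coord)
qed

lemma std3_so:
 "cliff_lie.std3_e LL soP = (std_e m, \<zero>\<^bsub>tensor_std m W\<^esub>)"
 "cliff_lie.std3_h LL soP = (std_h m, \<zero>\<^bsub>tensor_std m W\<^esub>)"
 "cliff_lie.std3_f LL soP = (std_f m, \<zero>\<^bsub>tensor_std m W\<^esub>)"
proof -
 interpret cliff_lie "m - 1" W LL soP by (rule cliff_lie_so)
 note vt = vsp_simps[OF vsp_tensor_std[OF vsW, of m]]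
 show "std3_e = (std_e m, \<zero>\<^bsub>tensor_std m W\<^esub>)" "std3_f = (std_f m, \<zero>\<^bsub>tensor_std m W\<^esub>)"
  unfolding std3_e_def std3_f_def soP_simps std_e_def std_f_def Le_def
  by (simp_all add: so_semidirect_simps(3,4) vt(1,6,12) numeral_2_eq_2)
 have "std3_h = img \<odot>\<^bsub>LL\<^esub> Le 1 2"
  unfolding std3_h_def using soP_brackets(1)[of 0 "Suc 0"] m Le_mem
  by (simp add: vL(9) numeral_2_eq_2)
 thus "std3_h = (std_h m, \<zero>\<^bsub>tensor_std m W\<^esub>)"
  by (simp add: Le_def std_h_def so_semidirect_simps(4) vt(12))
qed

subsection \<open>The spin action of \<open>so(m) \<ltimes> (W \<otimes> V)\<close> on a Clifford module\<close>

text \<open>The spin representation, extended to W tensor V. As the bracket of E_0i and E_0j is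
  -E_ij, the matrix E_ij must act as -1/4 of the commutator of the two generators; the full double
  sum supplies both orders of the product. Likewise w tensor b_j acts as -1/2 times the product of
  its two generators.\<close>

definition so_spin :: "('k, nat + 'w, 'v) rep => 'k mat \<times> (nat => 'w) => ('v, 'k) endo" where
 "so_spin N y =
  sc (1 / 2) * (\<Sum>j<m - 1. sc (ca y 0 (Suc j)) * cop N (Inl j)) + sc (1 / 2) * cop N (Inr (snd y 0))
  - sc (1 / 4) * (\<Sum>i<m - 1. \<Sum>j<m - 1. sc (ca y (Suc i) (Suc j)) * (cop N (Inl i) * cop N (Inl j)))
  - sc (1 / 2) * (\<Sum>j<m - 1. cop N (Inl j) * cop N (Inr (snd y (Suc j))))"

lemma sum_delta2:
 assumes "i < n" "j < (n::nat)"
 shows "(\<Sum>a<n. \<Sum>b<n. sc (if a = i \<and> b = j then 1 else 0) * f a b) = (f i j :: ('v, 'k) endo)"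
proof -
 have "(\<Sum>a<n. \<Sum>b<n. sc (if a = i \<and> b = j then 1 else 0) * f a b) = (\<Sum>a<n. \<Sum>b<n. if b = j then (if a = i then f i j else 0) else 0)"
  by (intro sum.cong refl) auto
 thus ?thesis using assms by simp
qed

text \<open>The values on generators and brackets are read off, and they match exactly except for
  two elements of W: these commute in L, while the commutator of c_w and c_w' need not vanish. This
  is the source of the central operators.\<close>

lemma spin_map_so:
 fixes N :: "('k, nat + 'w, 'v) rep"
 assumes N: "cliff_module (m - 1) W N"
 shows "spin_map (m - 1) W LL soP N (so_spin N)"
proof -
 interpret cliff_lie "m - 1" W LL soP by (rule cliff_lie_so)
 let ?r = "m - 1" and ?d = "\<lambda>j. cop N (Inl j)" and ?c = "\<lambda>w. cop N (Inr w)"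
 note n = cop_simps[OF N]
 have lt: "Suc j < m" if "j < ?r" for j using that by simp
 have z: "0 < m" using m by simp
 have gi: "Inl j \<in> gens ?r W" if "j < ?r" for j using that by (auto simp: gens_def)
 have gw: "Inr w \<in> gens ?r W" if "w \<in> carrier W" for w using that by (auto simp: gens_def)
 have c0: "?c \<zero>\<^bsub>W\<^esub> = 0" using n(6)[OF vWs(1), of 0] vWs(11)[OF vWs(1)] by simp
 have sl: "S * (sc a * T) = sc a * (S * T)" for a and S T :: "('v, 'k) endo" by (rule sc_left_commute)
 have add: "so_spin N (x \<oplus>\<^bsub>LL\<^esub> y) = so_spin N x + so_spin N y" if x: "x \<in> carrier LL" and y: "y \<in> carrier LL" for x y
 proof -
  note co = so_coord(1,3)[OF x y]
  have cw: "?c (snd (x \<oplus>\<^bsub>LL\<^esub> y) a) = ?c (snd x a) + ?c (snd y a)" if "a < m" for a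
   using co(2)[OF that] n(5) so_mem(4)[OF x that] so_mem(4)[OF y that] by simp
  have s1: "(\<Sum>j<?r. sc (ca (x \<oplus>\<^bsub>LL\<^esub> y) 0 (Suc j)) * ?d j) = (\<Sum>j<?r. sc (ca x 0 (Suc j)) * ?d j) + (\<Sum>j<?r. sc (ca y 0 (Suc j)) * ?d j)"
   unfolding sum.distrib[symmetric] using lt z by (intro sum.cong refl) (simp add: co(1) sc_add distrib_right)
  have s2: "(\<Sum>i<?r. \<Sum>j<?r. sc (ca (x \<oplus>\<^bsub>LL\<^esub> y) (Suc i) (Suc j)) * (?d i * ?d j)) =
    (\<Sum>i<?r. \<Sum>j<?r. sc (ca x (Suc i) (Suc j)) * (?d i * ?d j)) + (\<Sum>i<?r. \<Sum>j<?r. sc (ca y (Suc i) (Suc j)) * (?d i * ?d j))"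
   unfolding sum.distrib[symmetric] using lt by (intro sum.cong refl) (simp add: co(1) sc_add distrib_right)
  have s3: "(\<Sum>j<?r. ?d j * ?c (snd (x \<oplus>\<^bsub>LL\<^esub> y) (Suc j))) = (\<Sum>j<?r. ?d j * ?c (snd x (Suc j))) + (\<Sum>j<?r. ?d j * ?c (snd y (Suc j)))"
   unfolding sum.distrib[symmetric] using lt by (intro sum.cong refl) (simp add: cw distrib_left)
  show ?thesis unfolding so_spin_def s1 s2 s3 cw[OF z] by (simp add: distrib_left)
 qed
 have smult: "so_spin N (c \<odot>\<^bsub>LL\<^esub> x) = sc c * so_spin N x" if x: "x \<in> carrier LL" for c x
 proof -
  note co = so_smult(1,3)[OF x]
  have cw: "?c (snd (c \<odot>\<^bsub>LL\<^esub> x) a) = sc c * ?c (snd x a)" if "a < m" for a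
   using co(2)[OF that] n(6) so_mem(4)[OF x that] by simp
  have s1: "(\<Sum>j<?r. sc (ca (c \<odot>\<^bsub>LL\<^esub> x) 0 (Suc j)) * ?d j) = sc c * (\<Sum>j<?r. sc (ca x 0 (Suc j)) * ?d j)"
   unfolding sum_distrib_left using lt z by (intro sum.cong refl) (simp add: co(1) sc_mult mult.assoc)
  have s2: "(\<Sum>i<?r. \<Sum>j<?r. sc (ca (c \<odot>\<^bsub>LL\<^esub> x) (Suc i) (Suc j)) * (?d i * ?d j)) =
    sc c * (\<Sum>i<?r. \<Sum>j<?r. sc (ca x (Suc i) (Suc j)) * (?d i * ?d j))"
   unfolding sum_distrib_left using lt by (intro sum.cong refl) (simp add: co(1) sc_mult mult.assoc)
  have s3: "(\<Sum>j<?r. ?d j * ?c (snd (c \<odot>\<^bsub>LL\<^esub> x) (Suc j))) = sc c * (\<Sum>j<?r. ?d j * ?c (snd x (Suc j)))"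
   unfolding sum_distrib_left using lt by (intro sum.cong refl) (simp add: cw, rule sl)
  show ?thesis unfolding so_spin_def s1 s2 s3 cw[OF z] distrib_left right_diff_distrib sl[of "sc (1 / 2)"] sl[of "sc (1 / 4)"] sc_sc
   by (simp add: mult.commute)
 qed
 have sLe0: "so_spin N (Le 0 (Suc k)) = sc (1 / 2) * ?d k" if k: "k < ?r" for k
 proof -
  have s1: "(\<Sum>j<?r. sc (ca (Le 0 (Suc k)) 0 (Suc j)) * ?d j) = (\<Sum>j<?r. if j = k then ?d k else 0)"
   using lt z by (intro sum.cong refl) (simp add: Le_coord)
  have s2: "(\<Sum>i<?r. \<Sum>j<?r. sc (ca (Le 0 (Suc k)) (Suc i) (Suc j)) * (?d i * ?d j)) = 0"
   using lt by (intro sum.neutral ballI) (simp add: Le_coord)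
  have s3: "(\<Sum>j<?r. ?d j * ?c (snd (Le 0 (Suc k)) (Suc j))) = 0"
   using lt by (intro sum.neutral ballI) (simp add: Le_coord Le_snd c0)
  show ?thesis unfolding so_spin_def s1 s2 s3 using k z by (simp add: Le_coord Le_snd c0)
 qed
 have sLe: "so_spin N (Le (Suc k) (Suc l)) = - (sc (1 / 4) * cm (?d k) (?d l))" if k: "k < ?r" "l < ?r" for k l
 proof -
  have s1: "(\<Sum>j<?r. sc (ca (Le (Suc k) (Suc l)) 0 (Suc j)) * ?d j) = 0"
   using lt z by (intro sum.neutral ballI) (simp add: Le_coord)
  have s2: "(\<Sum>i<?r. \<Sum>j<?r. sc (ca (Le (Suc k) (Suc l)) (Suc i) (Suc j)) * (?d i * ?d j)) = cm (?d k) (?d l)"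
  proof -
   have "(\<Sum>i<?r. \<Sum>j<?r. sc (ca (Le (Suc k) (Suc l)) (Suc i) (Suc j)) * (?d i * ?d j)) =
    (\<Sum>i<?r. \<Sum>j<?r. sc (if i = k \<and> j = l then 1 else 0) * (?d i * ?d j) - sc (if i = l \<and> j = k then 1 else 0) * (?d i * ?d j))"
    using lt by (intro sum.cong refl) (simp only: Le_coord nat.inject sc_diff left_diff_distrib lessThan_iff)
   thus ?thesis unfolding sum_subtractf sum_delta2[OF k] sum_delta2[OF k(2,1)] .
  qed
  have s3: "(\<Sum>j<?r. ?d j * ?c (snd (Le (Suc k) (Suc l)) (Suc j))) = 0"
   using lt by (intro sum.neutral ballI) (simp add: Le_coord Le_snd c0)
  show ?thesis unfolding so_spin_def s1 s2 s3 using k z by (simp add: Le_coord Le_snd c0)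
 qed
 have ca0: "(\<Sum>j<?r. sc (ca (Lt k w) 0 (Suc j)) * ?d j) = 0" "(\<Sum>i<?r. \<Sum>j<?r. sc (ca (Lt k w) (Suc i) (Suc j)) * (?d i * ?d j)) = 0" for k w
  using lt z by (intro sum.neutral ballI; simp add: Lt_coord)+
 have sLt0: "so_spin N (Lt 0 w) = sc (1 / 2) * ?c w" for w
 proof -
  have s3: "(\<Sum>j<?r. ?d j * ?c (snd (Lt 0 w) (Suc j))) = 0"
   using lt by (intro sum.neutral ballI) (simp add: Lt_coord Lt_snd c0)
  show ?thesis unfolding so_spin_def ca0 s3 using z by (simp add: Lt_snd)
 qed
 have sLt: "so_spin N (Lt (Suc k) w) = - (sc (1 / 2) * (?d k * ?c w))" if k: "k < ?r" for k w
 proof -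
  have s3: "(\<Sum>j<?r. ?d j * ?c (snd (Lt (Suc k) w) (Suc j))) = (\<Sum>j<?r. if j = k then ?d k * ?c w else 0)"
   using lt by (intro sum.cong refl) (simp add: Lt_coord Lt_snd c0)
  show ?thesis unfolding so_spin_def ca0 s3 using z k by (simp add: Lt_coord Lt_snd c0)
 qed
 have anti: "cop N s * ?c w = - (?c w * cop N s)" if "s \<in> gens ?r W" "w \<in> carrier W" for s w
 proof -
  have "cform s (Inr w) = (0::'k)" by (cases s) simp_all
  thus ?thesis using n(4)[OF that(1) gw[OF that(2)]] by (simp add: eq_neg_iff_add_eq_0)
 qed
 have half: "sc (1 / 4) * (x + x) = sc (1 / 2) * x" for x :: "('v, 'k) endo"
 proof -
  have "x + x = sc 2 * x" by (simp add: mult_2)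
  thus ?thesis by (simp only: sc_sc) simp
 qed
 \<comment> \<open>A product of two operators from W passes every generator with two sign changes,
   hence commutes with it; and it commutes with whatever commutes with the generators.\<close>
 have ww: "?c w * ?c w' \<in> ccenter ?r W N" if w: "w \<in> carrier W" "w' \<in> carrier W" for w w'
  unfolding ccenter_def mem_Collect_eq
 proof (intro conjI allI impI ballI)
  show "Pr N * (?c w * ?c w') = ?c w * ?c w'" "?c w * ?c w' * Pr N = ?c w * ?c w'"
   using n(1)[OF gw[OF w(1)]] n(2)[OF gw[OF w(2)]] by (simp_all add: mult.assoc[symmetric]) (simp add: mult.assoc)
  fix s assume s: "s \<in> gens ?r W"
  have "?c w * ?c w' * cop N s = ?c w * (?c w' * cop N s)" by (rule mult.assoc)
  also have "?c w' * cop N s = - (cop N s * ?c w')" using anti[OF s w(2)] by simp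
  also have "?c w * (- (cop N s * ?c w')) = - ((?c w * cop N s) * ?c w')" by (simp add: mult.assoc)
  also have "?c w * cop N s = - (cop N s * ?c w)" using anti[OF s w(1)] by simp
  finally show "?c w * ?c w' * cop N s = cop N s * (?c w * ?c w')" by (simp add: mult.assoc)
 next
  fix S assume S: "\<forall>s\<in>gens ?r W. S * cop N s = cop N s * S"
  have "?c w * ?c w' * S = ?c w * (S * ?c w')" using S gw[OF w(2)] by (simp add: mult.assoc)
  also have "\<dots> = (S * ?c w) * ?c w'" using S gw[OF w(1)] by (simp add: mult.assoc[symmetric])
  finally show "?c w * ?c w' * S = S * (?c w * ?c w')" by (simp add: mult.assoc)
 qed
 note zc = ccenter_closed[where r = ?r and W = W and N = N]
 show ?thesis
 proof
  show "cliff_module ?r W N" by (rule N)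
  show "so_spin N (soP s) = sc (1 / 2) * cop N s" if "s \<in> gens ?r W" for s
   using that by (cases rule: so_gens_cases) (simp_all add: soP_simps sLe0 sLt0)
  fix s t assume s: "s \<in> gens ?r W" and t: "t \<in> gens ?r W"
  show "sc (1 / 4) * cm (cop N s) (cop N t) - so_spin N (bracket LL (soP s) (soP t)) \<in> ccenter ?r W N"
   using s
  proof (cases rule: so_gens_cases)
   case s: (1 i)
   show ?thesis using t
   proof (cases rule: so_gens_cases)
    case t: (1 j)
    thus ?thesis using s zc(1) by (simp add: soP_brackets smult[OF Le_mem] sLe)
   next
    case t: (2 w)
    have "sc (1 / 4) * cm (?d i) (?c w) = sc (1 / 2) * (?d i * ?c w)"
     using anti[OF gi t(2), of i] s half[of "?d i * ?c w"] by simp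
    thus ?thesis using s t zc(1) by (simp add: soP_brackets smult[OF Lt_mem] sLt)
   qed
  next
   case s: (2 w)
   show ?thesis using t
   proof (cases rule: so_gens_cases)
    case t: (1 j)
    have "sc (1 / 4) * cm (?c w) (?d j) = - (sc (1 / 2) * (?d j * ?c w))"
    proof -
     have e: "cm (?c w) (?d j) = - (?d j * ?c w + ?d j * ?c w)" using anti[OF gi s(2), of j] t by simp
     show ?thesis unfolding e mult_minus_right half ..
    qed
    thus ?thesis using s t zc(1) by (simp add: soP_brackets sLt)
   next
    case t: (2 w')
    have "so_spin N \<zero>\<^bsub>LL\<^esub> = 0" using smult[OF vL(1), of 0] vL(11)[OF vL(1)] by simp
    thus ?thesis using s t zc(4)[OF zc(3)[OF ww[OF s(2) t(2)] ww[OF t(2) s(2)]], of "1 / 4"] by (simp add: soP_brackets)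
   qed
  qed
 qed (use add smult in auto)
qed

theorem S_half_std_equiv_cliff_modules:
 fixes G :: "('k, 'e) lie"
 assumes G: "universal_central_extension G \<pi> LL"
 shows "equivalent_categories
  (S_half G \<pi> (std_e m, \<zero>\<^bsub>tensor_std m W\<^esub>) (std_h m, \<zero>\<^bsub>tensor_std m W\<^esub>) (std_f m, \<zero>\<^bsub>tensor_std m W\<^esub>)
   :: (('k, 'e, 'v) rep, 'v => 'v) category)
  (cliff_modules (m - 1) W :: (('k, nat + 'w, 'v) rep, 'v => 'v) category)"
proof -
 interpret A: cliff_lie "m - 1" W LL soP by (rule cliff_lie_so)
 have ce: "central_extension G \<pi> LL" using G by (simp add: universal_central_extension_def)
 interpret cliff_ext G \<pi> LL "m - 1" W soP by unfold_locales (rule ce)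
 show ?thesis
  using S_half_equiv_cliff_modules[OF G soP_nonzero] spin_map_so unfolding std3_so by blast
qed

end

theorem lemma4p17:
  fixes m :: nat
    and W :: "('k::{alg_closed_field, field_char_0}, 'w) module"
    and e h f :: "'k mat"
    and G :: "('k, 'e) lie"
    and \<pi> :: "'e \<Rightarrow> 'k mat \<times> (nat \<Rightarrow> 'w)"
  assumes "3 \<le> m"
    and "fd_vectorspace W"
    and "second_short_triple m e h f"
    and "universal_central_extension G \<pi> (so_semidirect m W)"
  defines "S \<equiv> S_half G \<pi> (e, \<zero>\<^bsub>tensor_std m W\<^esub>) (h, \<zero>\<^bsub>tensor_std m W\<^esub>) (f, \<zero>\<^bsub>tensor_std m W\<^esub>)
                 :: (('k, 'e, 'v) rep, 'v \<Rightarrow> 'v) category"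
  shows "(\<forall>n. m = 2 * n \<longrightarrow>
            equivalent_categories S
              (graded_ext_modules W :: (('k, ('w list \<Rightarrow> 'k) set, 'v) graded_rep, 'v \<Rightarrow> 'v) category)) \<and>
         (\<forall>n. m = 2 * n + 1 \<longrightarrow>
            equivalent_categories S
              (ext_modules W :: (('k, ('w list \<Rightarrow> 'k) set, 'v) rep, 'v \<Rightarrow> 'v) category))"
proof -
  let ?L = "so_semidirect m W" and ?z = "\<zero>\<^bsub>tensor_std m W\<^esub>"
  let ?C = "\<lambda>r. cliff_modules r W :: (('k, nat + 'w, 'v) rep, 'v \<Rightarrow> 'v) category"
  have vW: "vsp W" using fdD(1)[OF assms(2)] .
  have ce: "central_extension G \<pi> ?L" using assms(4) by (simp add: universal_central_extension_def)
  have L: "lie_algebra ?L" using ce by (simp add: central_extension_def)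
  obtain Q where Q: "Q \<in> carrier_mat m m" "transpose_mat Q * Q = 1\<^sub>m m" "Q * transpose_mat Q = 1\<^sub>m m"
    "transpose_mat Q * e * Q = std_e m" "transpose_mat Q * h * Q = std_h m" "transpose_mat Q * f * Q = std_f m"
    by (rule second_short_triple_normal_form[OF assms(1,3)])
  \<comment> \<open>The automorphism that carries the given triple to the standard one. Composing
    \<pi> with it preserves both universality and the category, so the case of the standard triple
    suffices.\<close>
  let ?\<theta> = "conj_map m W Q" and ?\<theta>' = "conj_map m W (transpose_mat Q)"
  have Qt: "transpose_mat Q \<in> carrier_mat m m" "transpose_mat (transpose_mat Q) = Q" using Q(1) by simp_all
  have hom: "lie_hom ?L ?L ?\<theta>" "lie_hom ?L ?L ?\<theta>'"
    using lie_hom_conj_map[OF assms(2) L Q(1,3)] lie_hom_conj_map[OF assms(2) L Qt(1)] Q(2) Qt(2) by auto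
  have inv: "?\<theta> (?\<theta>' x) = x" "?\<theta>' (?\<theta> x) = x" if "x \<in> carrier ?L" for x
    using conj_map_inverse[OF assms(2) Q(1-3) that] conj_map_inverse[OF assms(2) Qt(1) _ _ that] Q(2,3) Qt(2) by simp_all
  have inj: "inj_on ?\<theta> (carrier ?L)" using inv(2) by (rule inj_on_inverseI)
  have sl: "sl2_relations (so_lie m) e h f" using assms(3) by (simp add: second_short_triple_def short_triple_def)
  have z: "?z \<in> carrier (tensor_std m W)" by (rule tensor_std_closed(4)[OF assms(2)])
  have mem: "(e, ?z) \<in> carrier ?L" "(h, ?z) \<in> carrier ?L" "(f, ?z) \<in> carrier ?L"
    using sl z by (simp_all add: sl2_relations_def so_semidirect_simps(1) tensor_std_simps(1))
  have \<theta>: "?\<theta> (A, ?z) = (transpose_mat Q * A * Q, ?z)" for A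
    by (simp add: conj_map_def[OF assms(2)] tensor_std_act_linear(4)[OF assms(2) z z])
  have S: "S = S_half G (\<lambda>x. ?\<theta> (\<pi> x)) (std_e m, ?z) (std_h m, ?z) (std_f m, ?z)"
    unfolding S_def using S_half_automorphism[OF ce inj mem] unfolding \<theta> Q(4-6) by (rule sym)
  have G: "universal_central_extension G (\<lambda>x. ?\<theta> (\<pi> x)) ?L"
    by (rule universal_central_extension_automorphism[OF assms(4) hom inv])
  have SC: "equivalent_categories S (?C (m - 1))"
    unfolding S by (rule S_half_std_equiv_cliff_modules[OF assms(1,2) L G])
  show ?thesis
  proof (intro conjI allI impI)
    fix n assume "m = 2 * n"
    \<comment> \<open>Removing hyperbolic planes from the odd rank 2 n - 1 ends at rank 1, that is,
      at graded modules; m >= 3 makes the subtraction n - 1 a genuine one.\<close>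
    then have m: "m - 1 = 2 * (n - 1) + 1" using assms(1) by simp
    show "equivalent_categories S (graded_ext_modules W :: (('k, ('w list \<Rightarrow> 'k) set, 'v) graded_rep, 'v \<Rightarrow> 'v) category)"
      using equivalent_categories_trans[OF equivalent_categories_trans[OF SC[unfolded m] cliff_modules_equiv] cliff1_equiv_graded_ext_modules[OF vW]] .
  next
    fix n assume "m = 2 * n + 1"
    then have m: "m - 1 = 2 * n + 0" by simp
    show "equivalent_categories S (ext_modules W :: (('k, ('w list \<Rightarrow> 'k) set, 'v) rep, 'v \<Rightarrow> 'v) category)"
      using equivalent_categories_trans[OF equivalent_categories_trans[OF SC[unfolded m] cliff_modules_equiv] cliff0_equiv_ext_modules[OF vW]] .
  qed
qed

end
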